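(* Let $m:\mathbf R\to\mathbf R$ and consider, for integers $p\ge2$, the initial value problem $$\partial_t u+\frac1p\partial_x[u^p]+\mathcal F^{-1}[i\,m(\xi)\widehat u\,]=0,\quad (t,x)\in\mathbf R_+\times\mathbf R,\qquad u(0,x)=u_0(x).$$ Let $T(t)u_0=\mathcal F^{-1}[e^{-itm(\xi)}\widehat{u_0}]$. Assume that, for some $n\in\mathbf N$ and $\gamma>0$ (and a constant $C$), for all $t>0$ and all $u_0$, $$\|T(t)u_0\|_{L^2}=\|u_0\|_{L^2},\qquad \|T(t)u_0\|_{L^r}\le C\,t^{-\frac1n(1-\frac2r)}\|u_0\|_{W^{\gamma(1-\frac2r),r'}}\quad(2<r<\infty).$$ Put $\sigma=\frac52+\max\{\frac12,\gamma\}$. Assume also that the initial value problem is locally well-posed in $H^{\sigma}$, with existence time $T=T(u_0)$ of the local solution depending only on $\|u_0\|_{H^\sigma}$ and satisfying $\liminf_{\|u_0\|_{H^\sigma}\to0}T(u_0)>0$. Let $p^*=\left[\frac{n+\sqrt{n^2+4n}}{2}+2\right]$. Then for every integer $p\ge p^*$ there exists $\epsilon=\epsilon(p)>0$ such that if $$\|u_0\|_{H^{\sigma}}+\|u_0\|_{W^{\frac32+\gamma,1}}<\epsilon,$$ the initial value problem has a global solution. In addition, $$\sup_{0<t<\infty}\|u(t)\|_{H^{\sigma}}\le 4\epsilon.$$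
   Context: $[\,\cdot\,]$ applied to the number defining $p^*$ is the Gauss symbol (integer part). $r'$ is the conjugate exponent, $\frac1r+\frac1{r'}=1$. $\widehat{\ }$ and $\mathcal F^{-1}$ denote the Fourier transform in $x\in\mathbf R$ and its inverse. $\|f\|_{W^{s,q}}=\|\mathcal F^{-1}[(1+|\xi|^2)^{s/2}\widehat f\,]\|_{L^q(\mathbf R)}$ and $H^s=W^{s,2}$. A global solution is one existing for all $t\ge0$ in $H^\sigma$. *)

theory Defs
  imports "HOL-Analysis.Analysis"
begin

definition Lp :: "real \<Rightarrow> (real \<Rightarrow> complex) \<Rightarrow> bool" where
  "Lp q f \<longleftrightarrow> f \<in> borel_measurable lebesgue \<and> integrable lebesgue (\<lambda>x. norm (f x) powr q)"

definition Lp_norm :: "real \<Rightarrow> (real \<Rightarrow> complex) \<Rightarrow> real" where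
  "Lp_norm q f = (LINT x|lebesgue. norm (f x) powr q) powr (1 / q)"

definition schwartz :: "(real \<Rightarrow> complex) \<Rightarrow> bool" where
  "schwartz \<phi> \<longleftrightarrow> (\<exists>D :: nat \<Rightarrow> real \<Rightarrow> complex. D 0 = \<phi>
     \<and> (\<forall>k x. (D k has_vector_derivative D (Suc k) x) (at x))
     \<and> (\<forall>j k. bounded (range (\<lambda>x. x ^ j *\<^sub>R D k x))))"

definition fourier_integral :: "(real \<Rightarrow> complex) \<Rightarrow> real \<Rightarrow> complex" where
  "fourier_integral \<phi> \<xi> = (LINT x|lebesgue. cis (- (x * \<xi>)) * \<phi> x)"

text \<open>
  \<open>is_fourier f g\<close>: the Fourier transform of \<open>f\<close>, in the sense of tempered distributions, is
  the function \<open>g\<close>. By Plancherel and Hausdorff-Young such a \<open>g\<close> exists for every \<open>f\<close> in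
  \<open>L\<^sup>q\<close>, \<open>1 \<le> q \<le> 2\<close>; it is unique up to null sets. Only Fourier multipliers enter below,
  so the normalising constant of the transform plays no role.
\<close>

definition is_fourier :: "(real \<Rightarrow> complex) \<Rightarrow> (real \<Rightarrow> complex) \<Rightarrow> bool" where
  "is_fourier f g \<longleftrightarrow>
     f \<in> borel_measurable lebesgue \<and> g \<in> borel_measurable lebesgue \<and>
     (\<forall>\<phi>. schwartz \<phi> \<longrightarrow>
        integrable lebesgue (\<lambda>x. f x * fourier_integral \<phi> x) \<and>
        integrable lebesgue (\<lambda>\<xi>. g \<xi> * \<phi> \<xi>) \<and>
        (LINT \<xi>|lebesgue. g \<xi> * \<phi> \<xi>) = (LINT x|lebesgue. f x * fourier_integral \<phi> x))"

definition fourier :: "(real \<Rightarrow> complex) \<Rightarrow> real \<Rightarrow> complex" where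
  "fourier f = (SOME g. is_fourier f g)"

text \<open>
  \<open>is_multiplier a f h\<close> says that \<open>h\<close> is the inverse Fourier transform of \<open>a\<close> times the
  Fourier transform of \<open>f\<close>. The symbol \<open>a\<close> need not be smooth or even bounded.
\<close>

definition is_multiplier ::
    "(real \<Rightarrow> complex) \<Rightarrow> (real \<Rightarrow> complex) \<Rightarrow> (real \<Rightarrow> complex) \<Rightarrow> bool" where
  "is_multiplier a f h \<longleftrightarrow> (\<exists>g. is_fourier f g \<and> is_fourier h (\<lambda>\<xi>. a \<xi> * g \<xi>))"

definition multiplier :: "(real \<Rightarrow> complex) \<Rightarrow> (real \<Rightarrow> complex) \<Rightarrow> real \<Rightarrow> complex" where
  "multiplier a f = (SOME h. is_multiplier a f h)"

definition bessel_symbol :: "real \<Rightarrow> real \<Rightarrow> complex" where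
  "bessel_symbol s \<xi> = complex_of_real ((1 + \<xi>\<^sup>2) powr (s / 2))"

text \<open>
  Membership in \<open>W\<^sup>s\<^sup>,\<^sup>q\<close>. Since \<open>is_fourier\<close> only covers transforms that are functions, this is
  the full space for \<open>1 \<le> q \<le> 2\<close>; no other exponent is used with \<open>sobolev\<close>.
\<close>

definition sobolev :: "real \<Rightarrow> real \<Rightarrow> (real \<Rightarrow> complex) \<Rightarrow> bool" where
  "sobolev s q f \<longleftrightarrow> (\<exists>h. is_multiplier (bessel_symbol s) f h \<and> Lp q h)"

definition sobolev_norm :: "real \<Rightarrow> real \<Rightarrow> (real \<Rightarrow> complex) \<Rightarrow> real" where
  "sobolev_norm s q f = Lp_norm q (multiplier (bessel_symbol s) f)"

abbreviation cplx :: "(real \<Rightarrow> real) \<Rightarrow> real \<Rightarrow> complex" where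
  "cplx f \<equiv> (\<lambda>x. complex_of_real (f x))"

abbreviation H_space :: "real \<Rightarrow> (real \<Rightarrow> real) \<Rightarrow> bool" where
  "H_space s f \<equiv> sobolev s 2 (cplx f)"

abbreviation H_norm :: "real \<Rightarrow> (real \<Rightarrow> real) \<Rightarrow> real" where
  "H_norm s f \<equiv> sobolev_norm s 2 (cplx f)"

definition propagator :: "(real \<Rightarrow> real) \<Rightarrow> real \<Rightarrow> (real \<Rightarrow> complex) \<Rightarrow> real \<Rightarrow> complex" where
  "propagator m t f = multiplier (\<lambda>\<xi>. cis (- (t * m \<xi>))) f"

text \<open>
  \<open>pde_defect m p u s t \<xi>\<close> is the Fourier transform at \<open>\<xi>\<close> of
  \<open>(u(s) - u(t)) / (s - t) + (1/p) \<partial>\<^sub>x[u(t)\<^sup>p] + F\<^sup>-\<^sup>1[i m F u(t)]\<close>.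
\<close>

definition pde_defect ::
    "(real \<Rightarrow> real) \<Rightarrow> nat \<Rightarrow> (real \<Rightarrow> real \<Rightarrow> real) \<Rightarrow> real \<Rightarrow> real \<Rightarrow> real \<Rightarrow> complex" where
  "pde_defect m p u s t \<xi> =
     (fourier (cplx (u s)) \<xi> - fourier (cplx (u t)) \<xi>) / complex_of_real (s - t)
     + (1 / of_nat p) * (\<i> * complex_of_real \<xi> * fourier (cplx (\<lambda>x. u t x ^ p)) \<xi>)
     + \<i> * complex_of_real (m \<xi>) * fourier (cplx (u t)) \<xi>"

text \<open>
  A (real-valued) solution on the time interval \<open>I\<close> (containing \<open>0\<close>) is a continuous curve in
  \<open>H\<^sup>s\<close> with the given initial value, along which the equation holds at every time. The time
  derivative is the limit of the difference quotients in the weighted space with norm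
  \<open>\<parallel>F v / (1 + |\<xi>| + |m|)\<parallel>\<close> in \<open>L\<^sup>2\<close>, in which all three terms of the equation lie whatever the
  size of \<open>m\<close>. The weight is needed because \<open>m\<close> may be singular (say \<open>m(\<xi>) = 1/\<xi>\<close>), in which
  case the last term of the equation need not be a tempered distribution.
\<close>

definition is_solution ::
    "(real \<Rightarrow> real) \<Rightarrow> nat \<Rightarrow> real \<Rightarrow> (real \<Rightarrow> real) \<Rightarrow> real set \<Rightarrow> (real \<Rightarrow> real \<Rightarrow> real) \<Rightarrow> bool" where
  "is_solution m p s u0 I u \<longleftrightarrow>
     (\<forall>t\<in>I. H_space s (u t)) \<and>
     (\<forall>t\<in>I. ((\<lambda>t'. H_norm s (\<lambda>x. u t' x - u t x)) \<longlongrightarrow> 0) (at t within I)) \<and>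
     (AE x in lebesgue. u 0 x = u0 x) \<and>
     (\<forall>t\<in>I. ((\<lambda>t'. Lp_norm 2 (\<lambda>\<xi>. pde_defect m p u t' t \<xi>
                / complex_of_real (1 + \<bar>\<xi>\<bar> + \<bar>m \<xi>\<bar>))) \<longlongrightarrow> 0) (at t within I))"

text \<open>
  Local well-posedness in \<open>H\<^sup>s\<close> with existence time \<open>\<tau> r\<close> for data of norm \<open>r\<close>: existence,
  uniqueness, and continuous dependence on the data (on the common interval of existence).
\<close>

definition locally_well_posed ::
    "(real \<Rightarrow> real) \<Rightarrow> nat \<Rightarrow> real \<Rightarrow> (real \<Rightarrow> real) \<Rightarrow> bool" where
  "locally_well_posed m p s \<tau> \<longleftrightarrow>
     (\<forall>r\<ge>0. 0 < \<tau> r) \<and>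
     (\<forall>u0. H_space s u0 \<longrightarrow> (\<exists>u. is_solution m p s u0 {0..\<tau> (H_norm s u0)} u)) \<and>
     (\<forall>u0 u v. H_space s u0
        \<longrightarrow> is_solution m p s u0 {0..\<tau> (H_norm s u0)} u
        \<longrightarrow> is_solution m p s u0 {0..\<tau> (H_norm s u0)} v
        \<longrightarrow> (\<forall>t\<in>{0..\<tau> (H_norm s u0)}. AE x in lebesgue. u t x = v t x)) \<and>
     (\<forall>u0 u. H_space s u0 \<longrightarrow> is_solution m p s u0 {0..\<tau> (H_norm s u0)} u
        \<longrightarrow> (\<forall>\<eta>>0. \<exists>\<delta>>0. \<forall>v0 v. H_space s v0
               \<longrightarrow> H_norm s (\<lambda>x. v0 x - u0 x) < \<delta>
               \<longrightarrow> is_solution m p s v0 {0..\<tau> (H_norm s v0)} v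
               \<longrightarrow> (\<forall>t\<in>{0..min (\<tau> (H_norm s u0)) (\<tau> (H_norm s v0))}.
                      H_norm s (\<lambda>x. v t x - u t x) < \<eta>)))"

definition p_star :: "nat \<Rightarrow> int" where
  "p_star n = \<lfloor>(real n + sqrt ((real n)\<^sup>2 + 4 * real n)) / 2 + 2\<rfloor>"

end

theory Submission
  imports Defs "HOL-Probability.Probability" "HOL-Computational_Algebra.Polynomial"
begin

text \<open>
  Since \<open>p* = n + 2\<close>, the choice \<open>r = 2p\<close> makes the dispersive decay rate \<open>d = (1/n)(1 - 1/p)\<close>
  satisfy \<open>d(p - 1) > 1\<close>. A continuity argument controls the \<open>H\<^sup>\<sigma>\<close> norm \<open>X(t)\<close> and the norm
  \<open>N(t)\<close> of the solution in the Besov space with exponents \<open>(3/2, r, \<infinity>)\<close>, expecting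
  \<open>X \<lesssim> \<epsilon>\<close> and \<open>N \<lesssim> \<epsilon>(1 + t)\<^sup>-\<^sup>d\<close>. The energy identity and a commutator estimate give
  \<open>(X\<^sup>2)' \<lesssim> N\<^sup>p\<^sup>-\<^sup>1X\<^sup>2\<close>, which is integrable in time. Duhamel's formula and the dispersive estimate,
  applied to each Littlewood-Paley piece, give the decay of \<open>N\<close>, the piece of frequency \<open>2\<^sup>k\<close> of
  \<open>\<partial>\<^sub>xu\<^sup>p\<close> being bounded by \<open>2\<^sup>-\<^sup>3\<^sup>k\<^sup>/\<^sup>2XN\<^sup>p\<^sup>-\<^sup>1\<close> in the dual norm. Both nonlinear estimates
  rest on the splitting \<open>u = U + g\<close> in which \<open>U\<close> collects the frequencies well below
  \<open>2\<^sup>k/p\<close>, so that \<open>U\<^sup>p\<close> has no frequency near \<open>2\<^sup>k\<close>. The uniform bound and the uniform existence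
  time for small data continue the local solutions for ever.

  Hypotheses on \<open>m\<close> are too weak for the equation to hold in \<open>L\<^sup>2\<close>; time derivatives are taken after
  restriction to the frequencies with \<open>|\<xi>|, |m(\<xi>)| \<le> R\<close>, and then \<open>R \<rightarrow> \<infinity>\<close>.
\<close>

text \<open>The exponent r = 2p comes from Hoelder's inequality: 1/r' = 1/2 + (p - 1)/r, so in u^p
  one factor is placed in L^2, where it can carry all \<sigma> derivatives, and the p - 1 others in
  L^r, where they decay. The regularity 3/2 of N is fixed from two sides. It exceeds 1 + 1/r, so
  that N bounds the Lipschitz norm, as the energy estimate demands; and it is left of X after the
  nonlinearity has used one derivative and the dispersive estimate at most \<gamma>, as \<sigma> - 1
  - \<gamma> \<ge> 3/2. A supremum over k instead of a sum lets each block be estimated by itself.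
  The derivative in the nonlinearity is the obstacle in the energy: where it falls on the highest
  frequency only the antisymmetry of its symbol helps. Multipliers are bounded in L^q by means of
  kernels below a rescaled 1/(1 + x^2), so a cut-off with three derivatives is smooth enough. A norm
  known only through dual pairings avoids assuming in advance that the pieces of a solution lie in
  L^r. Fourier transforms of L^2 functions are identified by their pairings with Gaussians, which
  the transform maps to Gaussians.\<close>

abbreviation (input) cr :: "real \<Rightarrow> complex" where "cr \<equiv> complex_of_real"

abbreviation (input) lmeas :: "(real \<Rightarrow> 'a::topological_space) set" where "lmeas \<equiv> borel_measurable lebesgue"

abbreviation (input) integ :: "(real \<Rightarrow> 'a::{banach, second_countable_topology}) \<Rightarrow> bool" where
  "integ \<equiv> integrable lebesgue"

abbreviation (input) lebesgue_lint :: "(real \<Rightarrow> 'a::{banach, second_countable_topology}) \<Rightarrow> 'a" (binder "LI " 60) where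
  "lebesgue_lint \<equiv> integral\<^sup>L lebesgue"

abbreviation (input) lebesgue_AE :: "(real \<Rightarrow> bool) \<Rightarrow> bool" (binder "AEL " 10) where
  "lebesgue_AE P \<equiv> almost_everywhere lebesgue P"

abbreviation (input) N2 :: "(real \<Rightarrow> complex) \<Rightarrow> real" where "N2 \<equiv> Lp_norm 2"

lemmas B_integrable_add = Bochner_Integration.integrable_add
lemmas B_integrable_diff = Bochner_Integration.integrable_diff
lemmas B_integrable_bound = Bochner_Integration.integrable_bound
lemmas B_integral_add = Bochner_Integration.integral_add
lemmas B_integral_diff = Bochner_Integration.integral_diff
lemmas B_integral_cong = Bochner_Integration.integral_cong

lemma measurable_cnj [measurable]: "cnj \<in> borel_measurable borel"
  by (intro borel_measurable_continuous_onI continuous_intros)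

section \<open>Lebesgue spaces: Hoelder's inequality and duality\<close>

lemma Lp_measurable [measurable_dest]: "Lp q f \<Longrightarrow> f \<in> lmeas"
  by (simp add: Lp_def)

lemma Lp_integrable: "Lp q f \<Longrightarrow> integ (\<lambda>x. cmod (f x) powr q)"
  by (simp add: Lp_def)

lemma Lp2_iff: "Lp 2 f \<longleftrightarrow> f \<in> lmeas \<and> integ (\<lambda>x. (cmod (f x))\<^sup>2)"
  by (simp add: Lp_def)

lemma Lp2_integrable: "Lp 2 f \<Longrightarrow> integ (\<lambda>x. (cmod (f x))\<^sup>2)"
  by (simp add: Lp2_iff)

lemma Lp_norm2: "N2 f = sqrt (LI x. (cmod (f x))\<^sup>2)"
  unfolding Lp_norm_def by (simp add: powr_half_sqrt)

lemma Lp_norm2_sq: "(N2 f)\<^sup>2 = (LI x. (cmod (f x))\<^sup>2)"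
  by (simp add: Lp_norm2)

lemma Lp_norm_nonneg [simp]: "0 \<le> Lp_norm q f"
  by (simp add: Lp_norm_def)

lemma Lp_norm_powr: "q > 0 \<Longrightarrow> Lp_norm q f powr q = (LI x. cmod (f x) powr q)"
  by (simp add: Lp_norm_def powr_powr)

lemma AE_measurable_lebesgue:
  fixes f g :: "real \<Rightarrow> complex"
  assumes "f \<in> lmeas" "AEL x. f x = g x"
  shows "g \<in> lmeas"
  using assms by (metis borel_measurable_AE)

lemma Lp_cong_AE:
  assumes "AEL x. f x = g x" "Lp q f"
  shows "Lp q g"
proof -
  have [measurable]: "f \<in> lmeas" "g \<in> lmeas"
    using assms(2) AE_measurable_lebesgue[OF _ assms(1)] by (simp_all add: Lp_def)
  have "integ (\<lambda>x. cmod (f x) powr q) = integ (\<lambda>x. cmod (g x) powr q)"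
    by (rule integrable_cong_AE) (use assms in auto)
  then show ?thesis using assms by (simp add: Lp_def)
qed

lemma Lp_norm_cong_AE:
  assumes "AEL x. f x = g x" "f \<in> lmeas"
  shows "Lp_norm q f = Lp_norm q g"
proof -
  have [measurable]: "f \<in> lmeas" "g \<in> lmeas"
    using assms(2) AE_measurable_lebesgue[OF assms(2,1)] by simp_all
  have "(LI x. cmod (f x) powr q) = (LI x. cmod (g x) powr q)"
    by (rule integral_cong_AE) (use assms in auto)
  then show ?thesis by (simp add: Lp_norm_def)
qed

lemma Lp_bound:
  assumes "g \<in> lmeas" "Lp q f" "0 \<le> c" "q \<ge> 0"
    "AEL x. cmod (g x) \<le> c * cmod (f x)"
  shows "Lp q g"
  unfolding Lp_def
proof
  note [measurable] = assms(1) Lp_measurable[OF assms(2)]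
  show "g \<in> lmeas" by fact
  have "integ (\<lambda>x. c powr q * cmod (f x) powr q)"
    using assms(2) by (simp add: Lp_def)
  then show "integ (\<lambda>x. cmod (g x) powr q)"
  proof (rule B_integrable_bound)
    show "AEL x. norm (cmod (g x) powr q) \<le> norm (c powr q * cmod (f x) powr q)"
      using assms(5)
    proof eventually_elim
      case (elim x)
      then have "cmod (g x) powr q \<le> (c * cmod (f x)) powr q"
        using assms by (intro powr_mono2) auto
      then show ?case using assms by (simp add: powr_mult)
    qed
  qed measurable
qed

lemma Lp_norm_bound:
  assumes "g \<in> lmeas" "Lp q f" "0 \<le> c" "q > 0"
    "AEL x. cmod (g x) \<le> c * cmod (f x)"
  shows "Lp_norm q g \<le> c * Lp_norm q f"
proof -
  have g: "Lp q g" by (rule Lp_bound[OF assms(1,2,3) _ assms(5)]) (use assms in auto)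
  have "(LI x. cmod (g x) powr q) \<le> (LI x. c powr q * cmod (f x) powr q)"
  proof (rule integral_mono_AE)
    show "AEL x. cmod (g x) powr q \<le> c powr q * cmod (f x) powr q"
      using assms(5)
    proof eventually_elim
      case (elim x)
      then have "cmod (g x) powr q \<le> (c * cmod (f x)) powr q"
        using assms by (intro powr_mono2) auto
      then show ?case using assms by (simp add: powr_mult)
    qed
  qed (use g assms(2) in \<open>auto simp: Lp_def\<close>)
  then have "Lp_norm q g \<le> (c powr q * (LI x. cmod (f x) powr q)) powr (1/q)"
    unfolding Lp_norm_def using assms by (intro powr_mono2) auto
  also have "... = c * Lp_norm q f"
    using assms by (simp add: Lp_norm_def powr_mult powr_powr)
  finally show ?thesis .
qed

lemma Lp_scale: "Lp q f \<Longrightarrow> q \<ge> 0 \<Longrightarrow> Lp q (\<lambda>x. c * f x)"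
  by (rule Lp_bound[where c = "cmod c" and f = f]) (auto simp: Lp_def norm_mult)

lemma Lp_cnj [simp]: "Lp q f \<Longrightarrow> Lp q (\<lambda>x. cnj (f x))"
  by (auto simp: Lp_def)

lemma Lp_norm_cnj [simp]: "Lp_norm q (\<lambda>x. cnj (f x)) = Lp_norm q f"
  by (auto simp: Lp_norm_def)

lemma Lp_norm_scale: "q > 0 \<Longrightarrow> Lp_norm q (\<lambda>x. c * f x) = cmod c * Lp_norm q f"
  by (simp add: Lp_norm_def norm_mult powr_mult powr_powr)

lemma Lp_norm_minus [simp]: "Lp_norm q (\<lambda>x. - f x) = Lp_norm q f"
  by (simp add: Lp_norm_def)

lemma Lp_add:
  assumes "Lp q f" "Lp q g" "q \<ge> 0"
  shows "Lp q (\<lambda>x. f x + g x)"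
  unfolding Lp_def
proof
  note [measurable] = Lp_measurable[OF assms(1)] Lp_measurable[OF assms(2)]
  show "(\<lambda>x. f x + g x) \<in> lmeas" by measurable
  have "integ (\<lambda>x. 2 powr q * (cmod (f x) powr q + cmod (g x) powr q))"
    using assms by (simp add: Lp_def)
  then show "integ (\<lambda>x. cmod (f x + g x) powr q)"
  proof (rule B_integrable_bound)
    show "AEL x. norm (cmod (f x + g x) powr q) \<le> norm (2 powr q * (cmod (f x) powr q + cmod (g x) powr q))"
    proof (rule AE_I2)
      fix x
      have "cmod (f x + g x) \<le> 2 * max (cmod (f x)) (cmod (g x))"
        using norm_triangle_ineq[of "f x" "g x"] by linarith
      then have "cmod (f x + g x) powr q \<le> (2 * max (cmod (f x)) (cmod (g x))) powr q"
        using assms by (intro powr_mono2) auto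
      also have "... = 2 powr q * (max (cmod (f x)) (cmod (g x))) powr q"
        by (simp add: powr_mult max_def)
      also have "... \<le> 2 powr q * (cmod (f x) powr q + cmod (g x) powr q)"
        by (auto simp: max_def)
      finally show "norm (cmod (f x + g x) powr q) \<le> norm (2 powr q * (cmod (f x) powr q + cmod (g x) powr q))"
        by simp
    qed
  qed measurable
qed

lemma Lp_diff: "Lp q f \<Longrightarrow> Lp q g \<Longrightarrow> q \<ge> 0 \<Longrightarrow> Lp q (\<lambda>x. f x - g x)"
  using Lp_add[of q f "\<lambda>x. - g x"] Lp_scale[of q g "-1"] by simp

lemma Lp_zero [simp]: "Lp q (\<lambda>x. 0)"
  by (simp add: Lp_def)

lemma Lp_norm_zero [simp]: "Lp_norm q (\<lambda>x. 0) = 0"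
  by (simp add: Lp_norm_def)

lemma Lp_norm_eq_0:
  assumes "Lp q f" "Lp_norm q f = 0"
  shows "AEL x. f x = 0"
proof -
  have "(LI x. cmod (f x) powr q) = 0"
    using assms(2) by (auto simp: Lp_norm_def)
  then have "AEL x. cmod (f x) powr q = 0"
    using assms by (subst integral_nonneg_eq_0_iff_AE[symmetric]) (auto simp: Lp_def)
  then show ?thesis by eventually_elim auto
qed

text \<open>Young's inequality for numbers gives an integrable majorant. Applied to the functions
  divided by their norms, its two terms integrate to 1/p and 1/q, which add to 1. A factor of norm 0
  vanishes almost everywhere and is treated apart.\<close>

lemma Holder_aux:
  assumes pq: "p > 1" "q > 1" "1/p + 1/q = (1::real)" and f: "Lp p f" and g: "Lp q g"
  shows "integ (\<lambda>x. f x * g x)"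
    and "(LI x. cmod (f x) * cmod (g x)) \<le> Lp_norm p f * Lp_norm q g"
proof -
  note [measurable] = Lp_measurable[OF f] Lp_measurable[OF g]
  have b: "cmod (f x) * cmod (g x) \<le> cmod (f x) powr p / p + cmod (g x) powr q / q" for x
    by (rule Youngs_inequality) (use pq in auto)
  have i1: "integ (\<lambda>x. cmod (f x) powr p / p + cmod (g x) powr q / q)"
    using f g by (simp add: Lp_def)
  show i: "integ (\<lambda>x. f x * g x)"
    by (rule B_integrable_bound[OF i1]) (use b in \<open>auto simp: norm_mult intro!: AE_I2 order_trans[OF _ abs_ge_self]\<close>)
  have i2: "integ (\<lambda>x. cmod (f x) * cmod (g x))"
    using integrable_norm[OF i] by (simp add: norm_mult)
  show "(LI x. cmod (f x) * cmod (g x)) \<le> Lp_norm p f * Lp_norm q g"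
  proof (cases "Lp_norm p f = 0 \<or> Lp_norm q g = 0")
    case True
    then have "AEL x. f x = 0 \<or> g x = 0"
    proof
      assume "Lp_norm p f = 0"
      from Lp_norm_eq_0[OF f this] show ?thesis by eventually_elim simp
    next
      assume "Lp_norm q g = 0"
      from Lp_norm_eq_0[OF g this] show ?thesis by eventually_elim simp
    qed
    then have "AEL x. cmod (f x) * cmod (g x) = 0" by eventually_elim auto
    then have "(LI x. cmod (f x) * cmod (g x)) = (LINT x|(lebesgue::real measure). 0)"
      by (intro integral_cong_AE) auto
    then show ?thesis by simp
  next
    case False
    define A where "A = Lp_norm p f"
    define B where "B = Lp_norm q g"
    have A: "A > 0" and B: "B > 0" using False Lp_norm_nonneg[of p f] Lp_norm_nonneg[of q g]
      unfolding A_def B_def by linarith+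
    have "(LI x. cmod (f x) * cmod (g x)) / (A * B) = (LI x. (cmod (f x) / A) * (cmod (g x) / B))"
      by simp
    also have "... \<le> (LI x. cmod (f x) powr p / (p * A powr p) + cmod (g x) powr q / (q * B powr q))"
    proof (rule integral_mono)
      show "integ (\<lambda>x. cmod (f x) / A * (cmod (g x) / B))"
        using i2 by simp
      show "integ (\<lambda>x. cmod (f x) powr p / (p * A powr p) + cmod (g x) powr q / (q * B powr q))"
        using f g by (auto simp: Lp_def)
      fix x
      have "cmod (f x) / A * (cmod (g x) / B) \<le> (cmod (f x) / A) powr p / p + (cmod (g x) / B) powr q / q"
        by (rule Youngs_inequality) (use pq A B in auto)
      then show "cmod (f x) / A * (cmod (g x) / B) \<le> cmod (f x) powr p / (p * A powr p) + cmod (g x) powr q / (q * B powr q)"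
        using A B by (simp add: powr_divide field_simps)
    qed
    also have "... = A powr p / (p * A powr p) + B powr q / (q * B powr q)"
      using f g pq by (simp add: Lp_def A_def B_def Lp_norm_powr)
    also have "... = 1" using pq A B by simp
    finally show ?thesis using A B unfolding A_def[symmetric] B_def[symmetric] by (simp add: field_simps)
  qed
qed

lemma Holder:
  assumes pq: "p > 1" "q > 1" "1/p + 1/q = (1::real)" and f: "Lp p f" and g: "Lp q g"
  shows "cmod (LI x. f x * g x) \<le> Lp_norm p f * Lp_norm q g"
proof -
  have "cmod (LI x. f x * g x) \<le> (LI x. cmod (f x * g x))"
    by (rule integral_norm_bound)
  then show ?thesis using Holder_aux(2)[OF assms] by (simp add: norm_mult)
qed

lemma CS_integrable: "Lp 2 f \<Longrightarrow> Lp 2 g \<Longrightarrow> integ (\<lambda>x. f x * g x)"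
  by (rule Holder_aux(1)[of 2 2]) auto

lemma CS: "Lp 2 f \<Longrightarrow> Lp 2 g \<Longrightarrow> cmod (LI x. f x * g x) \<le> N2 f * N2 g"
  by (rule Holder[of 2 2]) auto

lemma CS_norm: "Lp 2 f \<Longrightarrow> Lp 2 g \<Longrightarrow> (LI x. cmod (f x) * cmod (g x)) \<le> N2 f * N2 g"
  by (rule Holder_aux(2)[of 2 2]) auto

lemma Lp_norm2_triangle:
  assumes f: "Lp 2 f" and g: "Lp 2 g"
  shows "N2 (\<lambda>x. f x + g x) \<le> N2 f + N2 g"
proof (rule power2_le_imp_le)
  note [measurable] = Lp_measurable[OF f] Lp_measurable[OF g]
  have i2: "integ (\<lambda>x. cmod (f x) * cmod (g x))"
    using integrable_norm[OF CS_integrable[OF f g]] by (simp add: norm_mult)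
  have "(N2 (\<lambda>x. f x + g x))\<^sup>2 = (LI x. (cmod (f x + g x))\<^sup>2)"
    by (rule Lp_norm2_sq)
  also have "... \<le> (LI x. (cmod (f x))\<^sup>2 + 2 * (cmod (f x) * cmod (g x)) + (cmod (g x))\<^sup>2)"
  proof (rule integral_mono)
    show "integ (\<lambda>x. (cmod (f x + g x))\<^sup>2)"
      using Lp_add[OF f g] by (simp add: Lp2_iff)
    show "integ (\<lambda>x. (cmod (f x))\<^sup>2 + 2 * (cmod (f x) * cmod (g x)) + (cmod (g x))\<^sup>2)"
      using i2 f g by (simp add: Lp2_iff)
    fix x
    have "(cmod (f x + g x))\<^sup>2 \<le> (cmod (f x) + cmod (g x))\<^sup>2"
      by (intro power_mono norm_triangle_ineq) auto
    then show "(cmod (f x + g x))\<^sup>2 \<le> (cmod (f x))\<^sup>2 + 2 * (cmod (f x) * cmod (g x)) + (cmod (g x))\<^sup>2"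
      by (simp add: power2_sum)
  qed
  also have "... = (N2 f)\<^sup>2 + 2 * (LI x. cmod (f x) * cmod (g x)) + (N2 g)\<^sup>2"
    using i2 f g by (simp add: Lp2_iff Lp_norm2_sq)
  also have "... \<le> (N2 f)\<^sup>2 + 2 * (N2 f * N2 g) + (N2 g)\<^sup>2"
    using CS_norm[OF f g] by simp
  also have "... = (N2 f + N2 g)\<^sup>2" by (simp add: power2_sum)
  finally show "(N2 (\<lambda>x. f x + g x))\<^sup>2 \<le> (N2 f + N2 g)\<^sup>2" .
qed simp

text \<open>The extremal test function for the L^q norm is |f|^(q-2) times the conjugate of f.
  Cutting it off where |f| > k keeps it in L^2 and makes the integral J of |f|^q over the remaining
  set finite beforehand, so that J \<le> A J^(1/q') can be divided by J^(1/q'); then k tends to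
  infinity. Membership in L^q is a conclusion, because the decaying norm of a solution is available
  in this dual form only.\<close>

lemma Lp_by_duality:
  assumes q: "q > 2" and f: "Lp 2 f" and A: "A \<ge> 0"
    and dual: "\<And>G. Lp 2 G \<Longrightarrow> Lp (q / (q - 1)) G \<Longrightarrow>
       cmod (LI x. f x * G x) \<le> A * Lp_norm (q / (q - 1)) G"
  shows "Lp q f" and "Lp_norm q f \<le> A"
proof -
  note [measurable] = Lp_measurable[OF f]
  define q' where "q' = q / (q - 1)"
  have q': "q' > 1" "(q - 1) * q' = q" "q' \<noteq> 0" using q by (auto simp: q'_def field_simps)
  define I where "I k x = (if cmod (f x) \<le> real k then cmod (f x) powr q else 0)" for k :: nat and x
  have [measurable]: "I k \<in> lmeas" for k
    unfolding I_def by measurable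
  have int: "integ (I k)" for k
  proof (rule B_integrable_bound)
    show "integ (\<lambda>x. (real k powr (q - 2)) * (cmod (f x))\<^sup>2)"
      using f by (simp add: Lp2_iff)
    show "AEL x. norm (I k x) \<le> norm (real k powr (q - 2) * (cmod (f x))\<^sup>2)"
    proof (rule AE_I2)
      fix x
      show "norm (I k x) \<le> norm (real k powr (q - 2) * (cmod (f x))\<^sup>2)"
      proof (cases "cmod (f x) \<le> real k")
        case True
        have "cmod (f x) powr q = cmod (f x) powr (q - 2) * cmod (f x) powr 2"
          unfolding powr_add[symmetric] by (rule arg_cong[where f = "(powr) (cmod (f x))"]) simp
        also have "... \<le> real k powr (q - 2) * cmod (f x) powr 2"
          using True q by (intro mult_right_mono powr_mono2) auto
        finally show ?thesis using True by (simp add: I_def)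
      qed (simp add: I_def)
    qed
  qed measurable
  have bound: "(LI x. I k x) \<le> A powr q" for k
  proof -
    define G where "G x = (if cmod (f x) \<le> real k then cr (cmod (f x) powr (q - 2)) * cnj (f x) else 0)" for x
    have [measurable]: "G \<in> lmeas"
      unfolding G_def by measurable
    have "Lp 2 G"
    proof (rule Lp_bound[OF _ f, where c = "real k powr (q - 2)"])
      show "AEL x. cmod (G x) \<le> real k powr (q - 2) * cmod (f x)"
        using q by (auto simp: G_def norm_mult intro!: AE_I2 mult_right_mono powr_mono2)
    qed auto
    have *: "cmod (G x) powr q' = I k x" for x
    proof -
      have "(cmod (f x) powr (q - 2) * cmod (f x)) = cmod (f x) powr (q - 1)"
        using powr_add[of "cmod (f x)" "q-2" 1] by (cases "f x = 0") auto
      then have "(cmod (f x) powr (q - 2) * cmod (f x)) powr q' = cmod (f x) powr q"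
        using q' by (simp add: powr_powr)
      then show ?thesis by (simp add: G_def I_def norm_mult)
    qed
    have G2: "Lp q' G" unfolding Lp_def * using int by auto
    have fG: "f x * G x = cr (I k x)" for x
    proof (cases "cmod (f x) \<le> real k")
      case True
      have "cmod (f x) powr (q - 2) * (cmod (f x))\<^sup>2 = cmod (f x) powr q"
      proof -
        have "cmod (f x) powr q = cmod (f x) powr ((q - 2) + 2)" by simp
        also have "... = cmod (f x) powr (q - 2) * cmod (f x) powr 2" by (rule powr_add)
        finally show ?thesis by simp
      qed
      moreover have "f x * G x = cr (cmod (f x) powr (q - 2)) * cr ((cmod (f x))\<^sup>2)"
        using True unfolding complex_norm_square by (simp add: G_def)
      ultimately show ?thesis using True by (simp add: I_def flip: of_real_mult of_real_power)
    qed (auto simp: G_def I_def)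
    define J where "J = (LI x. I k x)"
    have J0: "J \<ge> 0" unfolding J_def I_def by (intro integral_nonneg_AE) auto
    have "J = cmod (LI x. f x * G x)"
      using J0 by (simp add: fG J_def)
    also have "... \<le> A * J powr (1 / q')"
      using dual[OF \<open>Lp 2 G\<close> G2[unfolded q'_def]] by (simp add: Lp_norm_def q'_def[symmetric] * J_def)
    finally have J: "J \<le> A * J powr (1 / q')" .
    have "J \<le> A powr q"
    proof (cases "J = 0")
      case False
      then have "J > 0" using J0 by simp
      have "J = J powr (1/q) * J powr (1/q')"
        using \<open>J > 0\<close> q by (simp add: q'_def field_simps flip: powr_add)
      then have "J powr (1/q) * J powr (1/q') \<le> A * J powr (1/q')" using J by simp
      then have "J powr (1/q) \<le> A" using \<open>J > 0\<close> by (simp add: mult_le_cancel_right)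
      then have "(J powr (1/q)) powr q \<le> A powr q" using q by (intro powr_mono2) auto
      then show ?thesis using q \<open>J > 0\<close> by (simp add: powr_powr)
    qed auto
    then show ?thesis by (simp add: J_def)
  qed
  have lim: "(\<lambda>k. I k x) \<longlonglongrightarrow> cmod (f x) powr q" for x
  proof (rule tendsto_eventually)
    have "\<forall>\<^sub>F k in sequentially. cmod (f x) \<le> real k"
      by (meson eventually_sequentiallyI of_nat_ceiling order_trans of_nat_le_iff)
    then show "\<forall>\<^sub>F k in sequentially. I k x = cmod (f x) powr q"
      by eventually_elim (simp add: I_def)
  qed
  have mono: "mono (\<lambda>k. I k x)" for x
    by (auto simp: mono_def I_def)
  have "\<exists>l. (\<lambda>k. LI x. I k x) \<longlonglongrightarrow> l \<and> l \<le> A powr q"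
  proof -
    have inc: "incseq (\<lambda>k. LI x. I k x)"
      using mono by (auto simp: incseq_def mono_def intro!: integral_mono int)
    obtain l where l: "(\<lambda>k. LI x. I k x) \<longlonglongrightarrow> l"
      using incseq_convergent[OF inc, of "A powr q"] bound by blast
    then have "l \<le> A powr q" by (rule LIMSEQ_le_const2) (use bound in auto)
    then show ?thesis using l by auto
  qed
  then obtain l where l: "(\<lambda>k. LI x. I k x) \<longlonglongrightarrow> l" "l \<le> A powr q" by auto
  have *: "integ (\<lambda>x. cmod (f x) powr q)" "(LI x. cmod (f x) powr q) = l"
    by (rule integrable_monotone_convergence[OF int _ _ l(1)], use mono lim in simp_all)
      (rule integral_monotone_convergence[OF int _ _ l(1)], use mono lim in simp_all)
  then show "Lp q f" by (simp add: Lp_def)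
  have "l \<ge> 0" unfolding *(2)[symmetric] by (rule integral_nonneg_AE) simp
  then show "Lp_norm q f \<le> A"
    using l(2) A q powr_mono2[of "1/q" l "A powr q"] by (simp add: Lp_norm_def * powr_powr)
qed

section \<open>Null sets, Borel representatives and Fubini's theorem\<close>

lemma integral_lebesgue_lborel:
  fixes f :: "real \<Rightarrow> 'a::{banach, second_countable_topology}"
  assumes "f \<in> borel_measurable borel"
  shows "(LI x. f x) = (LINT x|lborel. f x)"
  by (rule integral_completion) (use assms in simp)

lemma integrable_lebesgue_lborel:
  fixes f :: "real \<Rightarrow> 'a::{banach, second_countable_topology}"
  assumes "f \<in> borel_measurable borel"
  shows "integ f \<longleftrightarrow> integrable lborel f"
  by (rule integrable_completion) (use assms in simp)

lemma borel_representative: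
  fixes f :: "real \<Rightarrow> complex"
  assumes "f \<in> lmeas"
  obtains f' where "f' \<in> borel_measurable borel" "AEL x. f x = f' x"
proof -
  have "(\<lambda>x. Re (f x)) \<in> lmeas" "(\<lambda>x. Im (f x)) \<in> lmeas"
    using assms by measurable
  then obtain r i where r: "r \<in> borel_measurable lborel" "AE x in lborel. Re (f x) = r x"
    and i: "i \<in> borel_measurable lborel" "AE x in lborel. Im (f x) = i x"
    using completion_ex_borel_measurable_real[of "\<lambda>x. Re (f x)" lborel]
      completion_ex_borel_measurable_real[of "\<lambda>x. Im (f x)" lborel] by blast
  have [measurable]: "r \<in> borel_measurable borel" "i \<in> borel_measurable borel" using r i by auto
  show thesis
  proof
    show "(\<lambda>x. Complex (r x) (i x)) \<in> borel_measurable borel"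
      unfolding Complex_eq by measurable
    have "AE x in lborel. f x = Complex (r x) (i x)"
      using r(2) i(2) by eventually_elim (simp add: complex_eq_iff)
    then show "AEL x. f x = Complex (r x) (i x)" by (rule AE_completion)
  qed
qed

text \<open>Lebesgue measure is complete, so either both functions are measurable or neither is; in
  the second case both integrals have the default value 0.\<close>

lemma integral_cong_AE_gen:
  fixes f g :: "real \<Rightarrow> complex"
  assumes "AEL x. f x = g x"
  shows "(LI x. f x) = (LI x. g x)"
proof (cases "f \<in> lmeas")
  case True
  then show ?thesis using AE_measurable_lebesgue[OF True assms] assms by (intro integral_cong_AE)
next
  case False
  moreover have "g \<notin> lmeas"
  proof
    assume g: "g \<in> lmeas"
    have "AEL x. g x = f x" using assms by eventually_elim simp
    from AE_measurable_lebesgue[OF g this] False show False by simp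
  qed
  ultimately show ?thesis
    by (metis borel_measurable_integrable not_integrable_integral_eq)
qed

lemma integrable_cong_AE_gen:
  fixes f g :: "real \<Rightarrow> complex"
  assumes "AEL x. f x = g x" "integ f"
  shows "integ g"
  using integrable_cong_AE_imp[OF assms(2) AE_measurable_lebesgue[OF borel_measurable_integrable[OF assms(2)] assms(1)]] assms(1)
  by (simp add: eq_commute)

lemma measurable_id_lebesgue [measurable]: "(\<lambda>x::real. x) \<in> lmeas"
  by (rule measurable_completion) simp

lemma borel_imp_lebesgue [simp]: "f \<in> borel_measurable borel \<Longrightarrow> f \<in> lmeas"
  for f :: "real \<Rightarrow> complex"
  by (rule measurable_completion) simp

lemma integrable_cmult_iff:
  fixes f :: "real \<Rightarrow> complex"
  assumes "c \<noteq> 0"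
  shows "integrable M (\<lambda>x. c * f x) \<longleftrightarrow> integrable M f"
  using assms Bochner_Integration.integrable_mult_right[of "1 / c" M "\<lambda>x. c * f x"] by auto

text \<open>The form of Fubini's theorem behind the exchanges of integrals below: an integral
  operator is moved from \<open>g\<close> to \<open>f\<close>. The functions \<open>f\<close> and
  \<open>g\<close> are replaced by Borel functions equal to them almost everywhere, because the
  product is formed from the Borel measure and not from its completion.\<close>

lemma Fubini_kernel:
  fixes f g :: "real \<Rightarrow> complex" and k :: "real \<Rightarrow> real \<Rightarrow> complex"
  assumes f: "f \<in> lmeas" and g: "g \<in> lmeas"
    and k [measurable]: "case_prod k \<in> borel_measurable (borel \<Otimes>\<^sub>M borel)"
    and kg: "\<And>x. integ (\<lambda>y. k x y * g y)"
    and fkg: "integ (\<lambda>x. cmod (f x) * (LI y. cmod (k x y) * cmod (g y)))"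
  shows "(LI x. f x * (LI y. k x y * g y)) = (LI y. g y * (LI x. k x y * f x))"
    and "integ (\<lambda>y. g y * (LI x. k x y * f x))"
proof -
  obtain f' where f'[measurable]: "f' \<in> borel_measurable borel" and ff: "AEL x. f x = f' x"
    using borel_representative[OF f] by auto
  obtain g' where g'[measurable]: "g' \<in> borel_measurable borel" and gg: "AEL x. g x = g' x"
    using borel_representative[OF g] by auto
  note [measurable] = f g
  have eqg: "AEL y. k x y * g y = k x y * g' y" for x
    using gg by eventually_elim simp
  have kg': "integ (\<lambda>y. k x y * g' y)" for x
    by (rule integrable_cong_AE_gen[OF eqg kg])
  have Ig: "(LI y. k x y * g y) = (LINT y|lborel. k x y * g' y)" for x
    by (subst integral_cong_AE_gen[OF eqg]) (simp add: integral_lebesgue_lborel)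
  have If: "(LI x. k x y * f x) = (LINT x|lborel. k x y * f' x)" for y
  proof -
    have "AEL x. k x y * f x = k x y * f' x" using ff by eventually_elim simp
    from integral_cong_AE_gen[OF this] show ?thesis by (simp add: integral_lebesgue_lborel)
  qed
  have Ig2: "(LI y. cmod (k x y) * cmod (g y)) = (LINT y|lborel. cmod (k x y) * cmod (g' y))" for x
  proof -
    have "(LI y. cmod (k x y) * cmod (g y)) = (LI y. cmod (k x y) * cmod (g' y))"
    proof (rule integral_cong_AE)
      have kx: "(\<lambda>y. k x y) \<in> lmeas"
        by (rule borel_imp_lebesgue) measurable
      have g'': "g' \<in> lmeas"
        by (rule borel_imp_lebesgue) measurable
      show "(\<lambda>y. cmod (k x y) * cmod (g y)) \<in> lmeas"
        "(\<lambda>y. cmod (k x y) * cmod (g' y)) \<in> lmeas"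
        by (intro borel_measurable_times measurable_compose[OF _ borel_measurable_norm] kx g'' g)+
      show "AEL y. cmod (k x y) * cmod (g y) = cmod (k x y) * cmod (g' y)"
        using gg by eventually_elim simp
    qed
    then show ?thesis by (simp add: integral_lebesgue_lborel)
  qed
  define F where "F x y = f' x * (k x y * g' y)" for x y
  have [measurable]: "case_prod F \<in> borel_measurable (lborel \<Otimes>\<^sub>M lborel)"
    unfolding F_def by measurable
  have i1: "integrable lborel (\<lambda>x. LINT y|lborel. norm (case_prod F (x, y)))"
  proof -
    have "integ (\<lambda>x. cmod (f' x) * (LI y. cmod (k x y) * cmod (g y)))"
    proof (rule integrable_cong_AE_imp[OF fkg])
      show "(\<lambda>x. cmod (f' x) * (LI y. cmod (k x y) * cmod (g y))) \<in> lmeas"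
        unfolding Ig2 by measurable
      show "AEL x. cmod (f x) * (LI y. cmod (k x y) * cmod (g y)) =
          cmod (f' x) * (LI y. cmod (k x y) * cmod (g y))"
        using ff by eventually_elim simp
    qed
    then have "integrable lborel (\<lambda>x. cmod (f' x) * (LINT y|lborel. cmod (k x y) * cmod (g' y)))"
      unfolding Ig2 using integrable_lebesgue_lborel[of "\<lambda>x. cmod (f' x) * (LINT y|lborel. cmod (k x y) * cmod (g' y))"]
      by simp
    then show ?thesis by (simp add: F_def norm_mult)
  qed
  have kgl: "integrable lborel (\<lambda>y. k x y * g' y)" for x
    using kg'[of x] by (subst (asm) integrable_lebesgue_lborel) auto
  have i2: "AE x in lborel. integrable lborel (\<lambda>y. case_prod F (x, y))"
    using kgl by (auto simp: F_def)
  have FI: "integrable (lborel \<Otimes>\<^sub>M lborel) (case_prod F)"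
    by (rule lborel_pair.Fubini_integrable[OF _ i1 i2]) measurable
  have "(LI x. f x * (LI y. k x y * g y)) = (LI x. f' x * (LINT y|lborel. k x y * g' y))"
    unfolding Ig by (rule integral_cong_AE_gen) (use ff in eventually_elim, simp)
  also have "... = (LINT x|lborel. LINT y|lborel. F x y)"
    unfolding F_def by (subst integral_lebesgue_lborel) auto
  also have "... = (LINT y|lborel. LINT x|lborel. F x y)"
    by (rule lborel_pair.Fubini_integral[OF FI, symmetric])
  also have "... = (LINT y|lborel. g' y * (LINT x|lborel. k x y * f' x))"
  proof -
    have "F x y = g' y * (k x y * f' x)" for x y by (simp add: F_def)
    then show ?thesis by simp
  qed
  also have "... = (LI y. g' y * (LINT x|lborel. k x y * f' x))"
    by (rule integral_lebesgue_lborel[symmetric]) measurable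
  also have "... = (LI y. g y * (LI x. k x y * f x))"
    unfolding If by (rule integral_cong_AE_gen) (use gg in eventually_elim, simp)
  finally show "(LI x. f x * (LI y. k x y * g y)) = (LI y. g y * (LI x. k x y * f x))" .
  have "integrable lborel (\<lambda>y. LINT x|lborel. F x y)"
    using lborel_pair.integrable_snd[OF FI] by simp
  moreover have "(LINT x|lborel. F x y) = g' y * (LINT x|lborel. k x y * f' x)" for y
  proof -
    have "F x y = g' y * (k x y * f' x)" for x by (simp add: F_def)
    then show ?thesis by simp
  qed
  ultimately have "integrable lborel (\<lambda>y. g' y * (LINT x|lborel. k x y * f' x))" by simp
  then have i: "integ (\<lambda>y. g' y * (LINT x|lborel. k x y * f' x))"
    by (subst integrable_lebesgue_lborel) auto
  show "integ (\<lambda>y. g y * (LI x. k x y * f x))"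
    unfolding If by (rule integrable_cong_AE_gen[OF _ i]) (use gg in eventually_elim, simp)
qed

lemma kernel_integral_measurable:
  fixes g :: "real \<Rightarrow> complex" and k :: "real \<Rightarrow> real \<Rightarrow> complex"
  assumes g: "g \<in> lmeas"
    and k [measurable]: "case_prod k \<in> borel_measurable (borel \<Otimes>\<^sub>M borel)"
  shows "(\<lambda>x. LI y. k x y * g y) \<in> borel_measurable borel"
proof -
  obtain g' where g'[measurable]: "g' \<in> borel_measurable borel" and gg: "AEL x. g x = g' x"
    using borel_representative[OF g] by auto
  have eqg: "AEL y. k x y * g y = k x y * g' y" for x
    using gg by eventually_elim simp
  have Ig: "(LI y. k x y * g y) = (LINT y|lborel. k x y * g' y)" for x
    by (subst integral_cong_AE_gen[OF eqg]) (simp add: integral_lebesgue_lborel)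
  show ?thesis unfolding Ig by measurable
qed

section \<open>The Fourier integral of an integrable function\<close>

lemma measurable_cis [measurable]: "cis \<in> borel_measurable borel"
  by (intro borel_measurable_continuous_onI continuous_intros)

lemma integrable_bounded_mult:
  fixes f b :: "real \<Rightarrow> complex"
  assumes "integ f" "b \<in> lmeas" "\<And>x. cmod (b x) \<le> B"
  shows "integ (\<lambda>x. b x * f x)"
proof (rule B_integrable_bound)
  show "integ (\<lambda>x. B * cmod (f x))" using assms(1) by (intro integrable_mult_right integrable_norm)
  show "(\<lambda>x. b x * f x) \<in> lmeas" using assms by auto
  have "B \<ge> 0" using assms(3)[of 0] norm_ge_zero order_trans by blast
  then show "AEL x. norm (b x * f x) \<le> norm (B * cmod (f x))"
    using assms(3) by (auto simp: norm_mult intro!: AE_I2 mult_right_mono)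
qed

lemma integrable_cis_mult:
  fixes f :: "real \<Rightarrow> complex"
  assumes "integ f"
  shows "integ (\<lambda>x. cis (a * x + b) * f x)"
  by (rule integrable_bounded_mult[OF assms, of _ 1]) auto

lemma integrable_cis_mult':
  fixes f :: "real \<Rightarrow> complex"
  assumes "integ f"
  shows "integ (\<lambda>x. cis (- (x * a)) * f x)" "integ (\<lambda>x. cis (- (a * x)) * f x)"
    "integ (\<lambda>x. cis (a * x) * f x)" "integ (\<lambda>x. cis (x * a) * f x)"
  using integrable_cis_mult[OF assms, of "- a" 0] integrable_cis_mult[OF assms, of a 0]
  by (simp_all add: mult.commute[of a])

lemma fourier_integral_measurable [measurable]:
  assumes "f \<in> lmeas"
  shows "fourier_integral f \<in> borel_measurable borel"
proof -
  have "(\<lambda>xi. LI x. cis (- (x * xi)) * f x) \<in> borel_measurable borel"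
    by (rule kernel_integral_measurable[OF assms]) measurable
  then show ?thesis by (simp add: fourier_integral_def[abs_def])
qed

lemma fourier_integral_bound:
  "cmod (fourier_integral f xi) \<le> (LI x. cmod (f x))"
proof -
  have "cmod (fourier_integral f xi) \<le> (LI x. cmod (cis (- (x * xi)) * f x))"
    unfolding fourier_integral_def by (rule integral_norm_bound)
  then show ?thesis by (simp add: norm_mult)
qed

text \<open>The kernel of the Fourier integral is symmetric and bounded, so Fubini applies.
  Plancherel's theorem and the agreement of \<open>fourier_integral\<close> with
  \<open>is_fourier\<close> rest on this identity.\<close>

lemma multiplication_formula:
  assumes f: "integ f" and h: "integ h"
  shows "(LI x. f x * fourier_integral h x) = (LI x. h x * fourier_integral f x)"
proof -
  note [measurable] = borel_measurable_integrable[OF f] borel_measurable_integrable[OF h]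
  have [measurable]: "case_prod (\<lambda>x y. cis (- (y * x))) \<in> borel_measurable (borel \<Otimes>\<^sub>M borel)" by measurable
  have "(LI x. f x * (LI y. cis (- (y * x)) * h y)) = (LI y. h y * (LI x. cis (- (y * x)) * f x))"
  proof (rule Fubini_kernel(1))
    show "integ (\<lambda>y. cis (- (y * x)) * h y)" for x
      by (rule integrable_cis_mult'[OF h])
    show "integ (\<lambda>x. cmod (f x) * (LI y. cmod (cis (- (y * x))) * cmod (h y)))"
      using f by simp
  qed measurable
  then show ?thesis by (simp add: fourier_integral_def mult.commute)
qed

section \<open>Gaussians\<close>

text \<open>Centre s and frequency t. Up to constants the Fourier transform produces the Gaussian of
  centre t and frequency -s, so that the family is closed under the transform and serves as a supply
  of test functions on both sides.\<close>

definition gauss :: "real \<Rightarrow> real \<Rightarrow> real \<Rightarrow> complex" where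
  "gauss s t x = cr (exp (- (x - s)\<^sup>2 / 2)) * cis (t * x)"

lemma gauss_measurable [measurable]: "gauss s t \<in> borel_measurable borel"
  unfolding gauss_def by measurable

lemma cmod_gauss: "cmod (gauss s t x) = exp (- (x - s)\<^sup>2 / 2)"
  by (simp add: gauss_def norm_mult)

lemma integrable_gauss0: "integ (\<lambda>x::real. exp (- x\<^sup>2 / 2))"
proof -
  have "integrable lborel (\<lambda>x. sqrt (2 * pi) * std_normal_density x)"
    by (intro integrable_mult_right) auto
  then have "integrable lborel (\<lambda>x::real. exp (- x\<^sup>2 / 2))"
    by (simp add: std_normal_density_def)
  then show ?thesis by (subst integrable_lebesgue_lborel) auto
qed

lemma integrable_gauss_norm: "integ (\<lambda>x::real. exp (- (x - s)\<^sup>2 / 2))"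
  using lebesgue_integrable_real_affine[OF integrable_gauss0, of 1 "-s"] by simp

lemma integrable_gauss: "integ (gauss s t)"
  by (rule B_integrable_bound[OF integrable_gauss_norm[of s]]) (auto simp: cmod_gauss)

text \<open>The integral is the characteristic function of the standard normal law, apart from the
  factor sqrt (2 pi) of its density.\<close>

lemma fourier_gauss0: "(LI x. cis (t * x) * cr (exp (- x\<^sup>2 / 2))) =
    cr (sqrt (2 * pi) * exp (- t\<^sup>2 / 2))"
proof -
  have "cr (exp (- (t^2) / 2)) = char std_normal_distribution t"
    by (simp add: char_std_normal_distribution)
  also have "... = (LINT x|lborel. std_normal_density x *\<^sub>R cis (t * x))"
    unfolding char_def by (subst integral_density) (auto simp: cis_conv_exp)
  also have "... = (LINT x|lborel. cr (1 / sqrt (2 * pi)) * (cis (t * x) * cr (exp (- x\<^sup>2 / 2))))"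
    by (simp add: std_normal_density_def scaleR_conv_of_real mult_ac)
  also have "... = cr (1 / sqrt (2 * pi)) * (LINT x|lborel. cis (t * x) * cr (exp (- x\<^sup>2 / 2)))"
    by (rule integral_mult_right_zero)
  also have "(LINT x|lborel. cis (t * x) * cr (exp (- x\<^sup>2 / 2))) = (LI x. cis (t * x) * cr (exp (- x\<^sup>2 / 2)))"
    by (rule integral_lebesgue_lborel[symmetric]) measurable
  finally show ?thesis by (simp add: field_simps)
qed

lemma fourier_integral_gauss:
  "fourier_integral (gauss s t) x = cr (sqrt (2 * pi)) * gauss t (- s) x * cis (s * t)"
proof -
  have "fourier_integral (gauss s t) x = (LI xi. cis (- (xi * x)) * gauss s t xi)"
    by (simp add: fourier_integral_def)
  also have "... = (LI xi. cis (- ((s + xi) * x)) * gauss s t (s + xi))"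
    using lebesgue_integral_real_affine[of 1 "\<lambda>xi. cis (- (xi * x)) * gauss s t xi" s] by simp
  also have "... = (LI xi. cis (s * (t - x)) * (cis ((t - x) * xi) * cr (exp (- xi\<^sup>2 / 2))))"
    by (rule B_integral_cong[OF refl]) (simp add: gauss_def cis_mult algebra_simps)
  also have "... = cis (s * (t - x)) * cr (sqrt (2 * pi) * exp (- (t - x)\<^sup>2 / 2))"
    by (subst integral_mult_right_zero, subst fourier_gauss0) (rule refl)
  also have "... = cr (sqrt (2 * pi)) * gauss t (- s) x * cis (s * t)"
    by (simp add: gauss_def cis_mult algebra_simps power2_commute)
  finally show ?thesis .
qed

text \<open>An exponential majorant survives multiplication by x, which the induction needs, and
  against a Gaussian it disappears by completing the square.\<close>

lemma poly_exp_bound: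
  fixes Q :: "complex poly"
  shows "\<exists>C n::nat. \<forall>x::real. cmod (poly Q (of_real x)) \<le> C * exp (real n * \<bar>x\<bar>)"
proof (induction Q)
  case 0
  show ?case by (intro exI[of _ 0]) auto
next
  case (pCons a p)
  then obtain C n where C: "\<And>x::real. cmod (poly p (of_real x)) \<le> C * exp (real n * \<bar>x\<bar>)" by auto
  have "cmod (poly (pCons a p) (of_real x)) \<le> (cmod a + C) * exp (real (Suc n) * \<bar>x\<bar>)" for x :: real
  proof -
    have C0: "C \<ge> 0" using order_trans[OF norm_ge_zero C[of 0]] by simp
    have "cmod (poly (pCons a p) (of_real x)) \<le> cmod a + \<bar>x\<bar> * cmod (poly p (of_real x))"
      using norm_triangle_ineq[of a "of_real x * poly p (of_real x)"] by (simp add: norm_mult)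
    also have "... \<le> cmod a + exp \<bar>x\<bar> * (C * exp (real n * \<bar>x\<bar>))"
      using C[of x] exp_ge_add_one_self[of "\<bar>x\<bar>"] by (intro add_left_mono mult_mono) (linarith | simp)+
    also have "... = cmod a + C * exp (real (Suc n) * \<bar>x\<bar>)"
      by (simp add: algebra_simps exp_add)
    also have "... \<le> (cmod a + C) * exp (real (Suc n) * \<bar>x\<bar>)"
      using mult_left_mono[of 1 "exp (real (Suc n) * \<bar>x\<bar>)" "cmod a"] by (simp add: distrib_right)
    finally show ?thesis .
  qed
  then show ?case by blast
qed

lemma poly_gauss_bounded: "bounded (range (\<lambda>x::real. poly Q (of_real x) * gauss s t x))"
proof -
  obtain C and n :: nat where C: "\<And>x::real. cmod (poly Q (of_real x)) \<le> C * exp (real n * \<bar>x\<bar>)"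
    using poly_exp_bound by blast
  have C0: "C \<ge> 0" using order_trans[OF norm_ge_zero C[of 0]] by simp
  have "cmod (poly Q (of_real x) * gauss s t x) \<le> C * exp (real n * \<bar>s\<bar> + (real n)\<^sup>2 / 2)" for x :: real
  proof -
    have "cmod (poly Q (of_real x) * gauss s t x) \<le> C * exp (real n * \<bar>x\<bar>) * exp (- (x - s)\<^sup>2 / 2)"
      by (simp add: norm_mult cmod_gauss C)
    also have "... = C * exp (real n * \<bar>x\<bar> - (x - s)\<^sup>2 / 2)"
      by (simp add: mult.assoc exp_add[symmetric])
    also have "real n * \<bar>x\<bar> - (x - s)\<^sup>2 / 2 \<le> real n * \<bar>s\<bar> + (real n)\<^sup>2 / 2"
    proof -
      have "real n * \<bar>x\<bar> \<le> real n * (\<bar>x - s\<bar> + \<bar>s\<bar>)" by (intro mult_left_mono) auto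
      moreover have "real n * \<bar>x - s\<bar> \<le> (real n)\<^sup>2 / 2 + (x - s)\<^sup>2 / 2"
        using zero_le_power2[of "real n - \<bar>x - s\<bar>"] unfolding power2_diff[of "real n"] power2_abs by linarith
      ultimately show ?thesis by (simp add: algebra_simps)
    qed
    finally show ?thesis using C0 by (simp add: mult_left_mono)
  qed
  then show ?thesis unfolding bounded_iff by blast
qed

lemma schwartz_gauss: "schwartz (gauss s t)"
proof -
  \<comment> \<open>Differentiating a polynomial times the Gaussian gives another polynomial times
    the same Gaussian, whose logarithmic derivative is s + i t - x; the recursion records the
    polynomials.\<close>
  define P :: "nat \<Rightarrow> complex poly" where
    "P = rec_nat 1 (\<lambda>k Q. pderiv Q + [: of_real s + \<i> * of_real t, - 1 :] * Q)"
  have P: "P 0 = 1" "P (Suc k) = pderiv (P k) + [: of_real s + \<i> * of_real t, - 1 :] * P k" for k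
    by (simp_all add: P_def)
  have d: "((\<lambda>x::real. poly Q (of_real x) * gauss s t x) has_vector_derivative
      poly (pderiv Q + [: of_real s + \<i> * of_real t, - 1 :] * Q) (of_real x) * gauss s t x) (at x)" for Q x
  proof -
    have g: "gauss s t = (\<lambda>x::real. exp (- (of_real x - of_real s)\<^sup>2 / 2 + \<i> * (of_real t * of_real x)))"
      unfolding gauss_def cis_conv_exp exp_add by (simp flip: exp_of_real)
    have "((\<lambda>z. poly Q z * exp (- (z - of_real s)\<^sup>2 / 2 + \<i> * (of_real t * z))) has_field_derivative
      poly (pderiv Q) z * exp (- (z - of_real s)\<^sup>2 / 2 + \<i> * (of_real t * z)) +
      (exp (- (z - of_real s)\<^sup>2 / 2 + \<i> * (of_real t * z)) * (- (z - of_real s) + \<i> * of_real t)) * poly Q z) (at z)" for z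
      by (rule DERIV_mult[OF poly_DERIV]) (auto intro!: derivative_eq_intros simp: power2_eq_square field_simps)
    from has_vector_derivative_real_field[OF this, of x UNIV] show ?thesis unfolding g
      by (rule has_vector_derivative_eq_rhs) (simp add: algebra_simps)
  qed
  show ?thesis unfolding schwartz_def
  proof (intro exI[of _ "\<lambda>k x. poly (P k) (of_real x) * gauss s t x"] conjI allI)
    show "(\<lambda>x. poly (P 0) (cr x) * gauss s t x) = gauss s t" by (simp add: P)
    show "((\<lambda>x. poly (P k) (cr x) * gauss s t x) has_vector_derivative
         poly (P (Suc k)) (cr x) * gauss s t x) (at x)" for k x
      unfolding P by (rule d)
    show "bounded (range (\<lambda>x. x ^ j *\<^sub>R (poly (P k) (cr x) * gauss s t x)))" for j k
      using poly_gauss_bounded[of "[:0,1:]^j * P k" s t] by (simp add: scaleR_conv_of_real mult_ac)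
  qed
qed

section \<open>Uniqueness of the Fourier transform\<close>

text \<open>Divided by their common total mass, which is read off at t = 0, the functions become
  densities of probability measures with the same characteristic function, and Levy's uniqueness
  theorem applies. If the mass is 0, both vanish almost everywhere.\<close>

lemma nonneg_fourier_inj:
  fixes a b :: "real \<Rightarrow> real"
  assumes a: "integrable lborel a" "\<And>x. a x \<ge> 0" and b: "integrable lborel b" "\<And>x. b x \<ge> 0"
    and eq: "\<And>t. (LINT x|lborel. a x *\<^sub>R cis (t * x)) = (LINT x|lborel. b x *\<^sub>R cis (t * x))"
  shows "AE x in lborel. a x = b x"
proof -
  note [measurable] = borel_measurable_integrable[OF a(1)] borel_measurable_integrable[OF b(1)]
  define c where "c = (LINT x|lborel. a x)"
  have c: "c = (LINT x|lborel. b x)"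
    using eq[of 0] a(1) b(1) by (simp add: c_def scaleR_conv_of_real of_real_eq_iff)
  have c0: "c \<ge> 0" unfolding c_def using a by (intro integral_nonneg_AE) auto
  show ?thesis
  proof (cases "c = 0")
    case True
    have "AE x in lborel. a x = 0" using True a integral_nonneg_eq_0_iff_AE[OF a(1)] by (simp add: c_def)
    moreover have "AE x in lborel. b x = 0" using True b integral_nonneg_eq_0_iff_AE[OF b(1)] by (simp add: c)
    ultimately show ?thesis by eventually_elim simp
  next
    case False
    with c0 have c_pos: "c > 0" by simp
    define M where "M f = density lborel (\<lambda>x. ennreal (f x / c))" for f :: "real \<Rightarrow> real"
    have rd: "real_distribution (M f)" if f: "integrable lborel f" "\<And>x. f x \<ge> 0" "(LINT x|lborel. f x) = c" for f
    proof -
      note [measurable] = borel_measurable_integrable[OF f(1)]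
      have "emeasure (M f) (space (M f)) = (\<integral>\<^sup>+x. ennreal (f x / c) \<partial>lborel)"
        unfolding M_def by (subst emeasure_density) (auto intro!: nn_integral_cong)
      also have "... = ennreal (LINT x|lborel. f x / c)"
        by (rule nn_integral_eq_integral) (use f c_pos in auto)
      also have "... = 1" using f c_pos by simp
      finally have "prob_space (M f)" by (rule prob_spaceI)
      then show ?thesis
        by (auto simp: real_distribution_def real_distribution_axioms_def M_def)
    qed
    have ch: "char (M f) t = (LINT x|lborel. f x *\<^sub>R cis (t * x)) / of_real c"
      if f: "integrable lborel f" "\<And>x. f x \<ge> 0" for f t
    proof -
      note [measurable] = borel_measurable_integrable[OF f(1)]
      have "char (M f) t = (LINT x|lborel. (f x / c) *\<^sub>R cis (t * x))"
        unfolding char_def M_def using f c_pos by (subst integral_density) (auto simp: cis_conv_exp)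
      also have "... = (LINT x|lborel. (f x *\<^sub>R cis (t * x)) / of_real c)"
        by (simp add: scaleR_conv_of_real)
      finally show ?thesis by simp
    qed
    have "M a = M b"
      by (rule Levy_uniqueness) (use a b c rd ch eq in \<open>auto simp: c_def fun_eq_iff\<close>)
    then have "AE x in lborel. ennreal (a x / c) = ennreal (b x / c)"
      unfolding M_def by (intro sigma_finite_measure.density_unique[OF sigma_finite_lborel]) auto
    then show ?thesis
      by eventually_elim (use a b c_pos in \<open>simp add: ennreal_inj\<close>)
  qed
qed

text \<open>The hypothesis means that the positive and the negative part have the same transform.
  Two such parts can agree only where both are 0.\<close>

lemma real_fourier_inj:
  fixes v :: "real \<Rightarrow> real"
  assumes v: "integrable lborel v" and 0: "\<And>t. (LINT x|lborel. v x *\<^sub>R cis (t * x)) = 0"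
  shows "AE x in lborel. v x = 0"
proof -
  note [measurable] = borel_measurable_integrable[OF v]
  have i: "integrable lborel (\<lambda>x. max (v x) 0)" "integrable lborel (\<lambda>x. max (- v x) 0)"
    using v by auto
  have ic: "integrable lborel (\<lambda>x. w x *\<^sub>R cis (t * x))" if w: "integrable lborel w" for w :: "real \<Rightarrow> real" and t
    by (rule B_integrable_bound[OF w]) (use w in \<open>auto\<close>)
  have "AE x in lborel. max (v x) 0 = max (- v x) 0"
  proof (rule nonneg_fourier_inj)
    fix t
    have "(LINT x|lborel. max (v x) 0 *\<^sub>R cis (t * x)) - (LINT x|lborel. max (- v x) 0 *\<^sub>R cis (t * x))
      = (LINT x|lborel. max (v x) 0 *\<^sub>R cis (t * x) - max (- v x) 0 *\<^sub>R cis (t * x))"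
      by (rule B_integral_diff[symmetric]) (intro ic i)+
    also have "... = (LINT x|lborel. v x *\<^sub>R cis (t * x))"
      by (rule B_integral_cong) (auto simp: max_def)
    finally show "(LINT x|lborel. max (v x) 0 *\<^sub>R cis (t * x)) = (LINT x|lborel. max (- v x) 0 *\<^sub>R cis (t * x))"
      using 0 by simp
  qed (use i in auto)
  then show ?thesis by eventually_elim (auto simp: max_def split: if_splits)
qed

text \<open>Replacing t by -t and conjugating shows that the conjugate of w has vanishing transform
  too; hence so have the real and the imaginary part, to which the real case applies.\<close>

lemma fourier_L1_inj:
  fixes w :: "real \<Rightarrow> complex"
  assumes w: "integ w" and 0: "\<And>t. (LI x. w x * cis (t * x)) = 0"
  shows "AEL x. w x = 0"
proof -
  obtain w' where [measurable]: "w' \<in> borel_measurable borel" and ww: "AEL x. w x = w' x"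
    using borel_representative[OF borel_measurable_integrable[OF w]] by auto
  have w': "integrable lborel w'"
    using integrable_cong_AE_gen[OF ww w] by (subst (asm) integrable_lebesgue_lborel) auto
  have ic: "integrable lborel (\<lambda>x. v x * cis (t * x))" if v: "integrable lborel v" for v :: "real \<Rightarrow> complex" and t
    by (rule B_integrable_bound[OF v]) (use v in \<open>auto simp: norm_mult\<close>)
  have z: "(LINT x|lborel. w' x * cis (t * x)) = 0" for t
  proof -
    have "(LI x. w x * cis (t * x)) = (LI x. w' x * cis (t * x))"
      by (rule integral_cong_AE_gen) (use ww in eventually_elim, simp)
    then show ?thesis using 0[of t] by (simp add: integral_lebesgue_lborel)
  qed
  have zc: "(LINT x|lborel. cnj (w' x) * cis (t * x)) = 0" for t
  proof -
    have "(LINT x|lborel. cnj (w' x) * cis (t * x)) = (LINT x|lborel. cnj (w' x * cis (- t * x)))"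
      by (simp add: cis_cnj)
    also have "... = cnj (LINT x|lborel. w' x * cis (- t * x))"
      by (simp del: complex_cnj_mult)
    finally show ?thesis using z[of "- t"] by simp
  qed
  have re: "(LINT x|lborel. Re (w' x) *\<^sub>R cis (t * x)) = 0" for t
  proof -
    have "Re (w' x) *\<^sub>R cis (t * x) = (w' x * cis (t * x) + cnj (w' x) * cis (t * x)) / 2" for x
      by (simp add: complex_eq_iff)
    then have "(LINT x|lborel. Re (w' x) *\<^sub>R cis (t * x)) = (LINT x|lborel. w' x * cis (t * x) + cnj (w' x) * cis (t * x)) / 2"
      by (simp only: integral_divide_zero)
    also have "(LINT x|lborel. w' x * cis (t * x) + cnj (w' x) * cis (t * x)) = 0"
      by (subst B_integral_add) (use ic w' z zc in \<open>auto\<close>)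
    finally show ?thesis by simp
  qed
  have im: "(LINT x|lborel. Im (w' x) *\<^sub>R cis (t * x)) = 0" for t
  proof -
    have "Im (w' x) *\<^sub>R cis (t * x) = (w' x * cis (t * x) - cnj (w' x) * cis (t * x)) / (2 * \<i>)" for x
    proof -
      have "2 * \<i> * cr (Im (w' x)) = w' x - cnj (w' x)" by (simp add: complex_eq_iff)
      then have "2 * \<i> * (Im (w' x) *\<^sub>R cis (t * x)) = (w' x - cnj (w' x)) * cis (t * x)"
        by (simp only: scaleR_conv_of_real mult.assoc[symmetric])
      then show ?thesis by (simp add: field_simps)
    qed
    then have "(LINT x|lborel. Im (w' x) *\<^sub>R cis (t * x)) = (LINT x|lborel. w' x * cis (t * x) - cnj (w' x) * cis (t * x)) / (2 * \<i>)"
      by (simp only: integral_divide_zero)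
    also have "(LINT x|lborel. w' x * cis (t * x) - cnj (w' x) * cis (t * x)) = 0"
      by (subst B_integral_diff) (use ic w' z zc in \<open>auto\<close>)
    finally show ?thesis by simp
  qed
  have "AE x in lborel. Re (w' x) = 0" "AE x in lborel. Im (w' x) = 0"
    using real_fourier_inj[OF _ re] real_fourier_inj[OF _ im] w' by auto
  then have "AE x in lborel. w' x = 0" by eventually_elim (simp add: complex_eq_iff)
  then have "AEL x. w' x = 0" by (rule AE_completion)
  with ww show ?thesis by eventually_elim simp
qed

text \<open>Multiplication by the fixed Gaussian makes g integrable, and the modulations of the test
  functions turn the second hypothesis into the vanishing of the Fourier integral of that product. A
  Gaussian has no zeros, so g itself vanishes.\<close>

lemma gauss_test_unique:
  assumes g: "g \<in> lmeas"
    and i: "\<And>t. integ (\<lambda>x. g x * gauss 0 t x)"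
    and 0: "\<And>t. (LI x. g x * gauss 0 t x) = 0"
  shows "AEL x. g x = 0"
proof -
  have "AEL x. g x * cr (exp (- x\<^sup>2 / 2)) = 0"
  proof (rule fourier_L1_inj)
    show "integ (\<lambda>x. g x * cr (exp (- x\<^sup>2 / 2)))"
      using i[of 0] by (simp add: gauss_def)
    show "(LI x. g x * cr (exp (- x\<^sup>2 / 2)) * cis (t * x)) = 0" for t
      using 0[of t] by (simp add: gauss_def mult.assoc)
  qed
  then show ?thesis by eventually_elim simp
qed

lemma is_fourier_unique:
  assumes "is_fourier f g" "is_fourier f g'"
  shows "AEL x. g x = g' x"
proof -
  have "AEL x. g x - g' x = 0"
  proof (rule gauss_test_unique)
    show "(\<lambda>x. g x - g' x) \<in> lmeas" using assms by (auto simp: is_fourier_def)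
    fix t
    have *: "integ (\<lambda>x. g x * gauss 0 t x)" "integ (\<lambda>x. g' x * gauss 0 t x)"
      "(LI x. g x * gauss 0 t x) = (LI x. g' x * gauss 0 t x)"
      using assms schwartz_gauss[of 0 t] by (auto simp: is_fourier_def)
    then show "integ (\<lambda>x. (g x - g' x) * gauss 0 t x)" by (simp add: left_diff_distrib)
    show "(LI x. (g x - g' x) * gauss 0 t x) = 0"
      using * by (simp add: left_diff_distrib)
  qed
  then show ?thesis by eventually_elim simp
qed

text \<open>Here f is tested against transforms. The transform of the Gaussian centred at -t is a
  multiple of \<open>gauss 0 t\<close>, so the same uniqueness argument applies.\<close>

lemma is_fourier_inj:
  assumes "is_fourier f g" "is_fourier f' g"
  shows "AEL x. f x = f' x"
proof -
  have "AEL x. f x - f' x = 0"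
  proof (rule gauss_test_unique)
    show "(\<lambda>x. f x - f' x) \<in> lmeas" using assms by (auto simp: is_fourier_def)
    fix t
    have fg: "fourier_integral (gauss (-t) 0) x = cr (sqrt (2 * pi)) * gauss 0 t x" for x
      by (simp add: fourier_integral_gauss)
    have *: "integ (\<lambda>x. f x * fourier_integral (gauss (-t) 0) x)" "integ (\<lambda>x. f' x * fourier_integral (gauss (-t) 0) x)"
      "(LI x. f x * fourier_integral (gauss (-t) 0) x) = (LI x. f' x * fourier_integral (gauss (-t) 0) x)"
      using assms schwartz_gauss[of "-t" 0] unfolding is_fourier_def by metis+
    have i: "integ (\<lambda>x. f x * gauss 0 t x)" "integ (\<lambda>x. f' x * gauss 0 t x)"
      using *(1,2) unfolding fg mult.left_commute[of _ "cr (sqrt (2*pi))"]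
      by (simp_all add: integrable_cmult_iff)
    have "(LI x. f x * gauss 0 t x) = (LI x. f' x * gauss 0 t x)"
      using *(3) unfolding fg mult.left_commute[of _ "cr (sqrt (2*pi))"] by simp
    then show "(LI x. (f x - f' x) * gauss 0 t x) = 0"
      using i by (simp add: left_diff_distrib)
    show "integ (\<lambda>x. (f x - f' x) * gauss 0 t x)" using i by (simp add: left_diff_distrib)
  qed
  then show ?thesis by eventually_elim simp
qed

lemma is_fourier_cong_AE:
  assumes "is_fourier f g" "AEL x. f x = f' x" "AEL x. g x = g' x"
  shows "is_fourier f' g'"
  unfolding is_fourier_def
proof (intro conjI allI impI)
  have m: "f \<in> lmeas" "g \<in> lmeas"
    using assms(1) by (auto simp: is_fourier_def)
  show "f' \<in> lmeas" "g' \<in> lmeas"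
    using AE_measurable_lebesgue[OF m(1) assms(2)] AE_measurable_lebesgue[OF m(2) assms(3)] by auto
  fix \<phi> assume "schwartz \<phi>"
  then have *: "integ (\<lambda>x. f x * fourier_integral \<phi> x)" "integ (\<lambda>xi. g xi * \<phi> xi)"
        "(LI xi. g xi * \<phi> xi) = (LI x. f x * fourier_integral \<phi> x)"
    using assms(1) by (auto simp: is_fourier_def)
  have e1: "AEL x. f x * fourier_integral \<phi> x = f' x * fourier_integral \<phi> x"
    using assms(2) by eventually_elim simp
  have e2: "AEL x. g x * \<phi> x = g' x * \<phi> x"
    using assms(3) by eventually_elim simp
  show "integ (\<lambda>x. f' x * fourier_integral \<phi> x)" by (rule integrable_cong_AE_gen[OF e1 *(1)])
  show "integ (\<lambda>x. g' x * \<phi> x)" by (rule integrable_cong_AE_gen[OF e2 *(2)])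
  show "(LI xi. g' xi * \<phi> xi) = (LI x. f' x * fourier_integral \<phi> x)"
    using *(3) integral_cong_AE_gen[OF e1] integral_cong_AE_gen[OF e2] by simp
qed

lemma is_fourier_add:
  assumes "is_fourier f g" "is_fourier f' g'"
  shows "is_fourier (\<lambda>x. f x + f' x) (\<lambda>x. g x + g' x)"
  using assms unfolding is_fourier_def by (auto simp: distrib_right)

lemma is_fourier_scale:
  assumes "is_fourier f g"
  shows "is_fourier (\<lambda>x. c * f x) (\<lambda>x. c * g x)"
  using assms unfolding is_fourier_def by (auto simp: mult.assoc)

lemma is_fourier_diff:
  assumes "is_fourier f g" "is_fourier f' g'"
  shows "is_fourier (\<lambda>x. f x - f' x) (\<lambda>x. g x - g' x)"
  using is_fourier_add[OF assms(1) is_fourier_scale[OF assms(2), of "-1"]] by simp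

lemma mono_bounded_integrable:
  fixes F :: "nat \<Rightarrow> real \<Rightarrow> real"
  assumes int: "\<And>n. integ (F n)" and mono: "\<And>x. mono (\<lambda>n. F n x)"
    and lim: "\<And>x. (\<lambda>n. F n x) \<longlonglongrightarrow> u x" and bd: "\<And>n. (LI x. F n x) \<le> A"
    and u: "u \<in> lmeas"
  shows "integ u" "(LI x. u x) \<le> A"
proof -
  have inc: "incseq (\<lambda>k. LI x. F k x)"
    using mono by (auto simp: incseq_def mono_def intro!: integral_mono int)
  obtain l where l: "(\<lambda>k. LI x. F k x) \<longlonglongrightarrow> l"
    using incseq_convergent[OF inc, of A] bd by blast
  then have le: "l \<le> A" by (rule LIMSEQ_le_const2) (use bd in auto)
  show "integ u"
    by (rule integrable_monotone_convergence[OF int _ _ l u]) (use mono lim in simp_all)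
  have "(LI x. u x) = l"
    by (rule integral_monotone_convergence[OF int _ _ l u]) (use mono lim in simp_all)
  then show "(LI x. u x) \<le> A" using le by simp
qed

section \<open>Convolution with bounded integrable kernels\<close>

definition conv :: "(real \<Rightarrow> complex) \<Rightarrow> (real \<Rightarrow> complex) \<Rightarrow> real \<Rightarrow> complex" where
  "conv K f x = (LI y. K (x - y) * f y)"

text \<open>Boundedness puts an integrable kernel into every L^q with q \<ge> 1, so that
  convolutions with L^2 functions converge at each point. Borel measurability is inherited by
  \<open>K (x - y)\<close> as a function on the product space.\<close>

definition conv_kernel :: "(real \<Rightarrow> complex) \<Rightarrow> bool" where
  "conv_kernel K \<longleftrightarrow> K \<in> borel_measurable borel \<and> integ K \<and> (\<exists>B. \<forall>z. cmod (K z) \<le> B)"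

lemma kernel_measurable [measurable_dest]: "conv_kernel K \<Longrightarrow> K \<in> borel_measurable borel"
  by (simp add: conv_kernel_def)

lemma kernel_integrable: "conv_kernel K \<Longrightarrow> integ K"
  by (simp add: conv_kernel_def)

lemma kernel_norm: "conv_kernel K \<Longrightarrow> conv_kernel (\<lambda>z. cr (cmod (K z)))"
  unfolding conv_kernel_def by (auto intro: integrable_norm)

lemma kernel_shift_measurable:
  assumes "conv_kernel K"
  shows "case_prod (\<lambda>x y. K (x - y)) \<in> borel_measurable (borel \<Otimes>\<^sub>M borel)" "(\<lambda>y. K (x - y)) \<in> borel_measurable borel"
  using kernel_measurable[OF assms] by measurable

lemma integrable_reflect:
  fixes f :: "real \<Rightarrow> 'a::euclidean_space"
  shows "integ f \<Longrightarrow> integ (\<lambda>y. f (x - y))"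
  using lebesgue_integrable_real_affine[of f "-1" x] by simp

lemma integral_reflect:
  fixes f :: "real \<Rightarrow> 'a::euclidean_space"
  shows "(LI y. f (x - y)) = (LI y. f y)"
  using lebesgue_integral_real_affine[of "-1" f x] by simp

lemma integrable_shift:
  fixes f :: "real \<Rightarrow> 'a::euclidean_space"
  shows "integ f \<Longrightarrow> integ (\<lambda>y. f (y - x))"
  using lebesgue_integrable_real_affine[of f 1 "-x"] by simp

lemma integral_shift:
  fixes f :: "real \<Rightarrow> 'a::euclidean_space"
  shows "(LI y. f (y - x)) = (LI y. f y)"
  using lebesgue_integral_real_affine[of 1 f "-x"] by simp

lemma kernel_Lp:
  assumes "conv_kernel K" "q \<ge> 1"
  shows "Lp q K"
  unfolding Lp_def
proof
  show "K \<in> lmeas" using assms by (auto dest: kernel_measurable)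
  obtain B where B: "\<And>z. cmod (K z) \<le> B" using assms by (auto simp: conv_kernel_def)
  have B0: "B \<ge> 0" using B[of 0] norm_ge_zero order_trans by blast
  have "integ (\<lambda>x. B powr (q - 1) * cmod (K x))"
    using assms by (intro integrable_mult_right integrable_norm kernel_integrable)
  then show "integ (\<lambda>x. cmod (K x) powr q)"
  proof (rule B_integrable_bound)
    show "AEL x. norm (cmod (K x) powr q) \<le> norm (B powr (q - 1) * cmod (K x))"
    proof (rule AE_I2)
      fix x
      have "cmod (K x) powr q = cmod (K x) powr (q - 1) * cmod (K x)"
        using powr_add[of "cmod (K x)" "q - 1" 1] by (cases "K x = 0") auto
      also have "... \<le> B powr (q - 1) * cmod (K x)"
        using B assms by (intro mult_right_mono powr_mono2) auto
      finally show "norm (cmod (K x) powr q) \<le> norm (B powr (q - 1) * cmod (K x))" using B0 by simp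
    qed
    have [measurable]: "K \<in> lmeas" by fact
    show "(\<lambda>x. cmod (K x) powr q) \<in> lmeas" by measurable
  qed
qed

lemma Lp_reflect: "Lp q K \<Longrightarrow> Lp q (\<lambda>y. K (x - y))"
proof -
  assume K: "Lp q K"
  have "(\<lambda>y. K (x + (-1) *\<^sub>R y)) \<in> lmeas"
    by (rule borel_measurable_affine) (use K in \<open>auto simp: Lp_def\<close>)
  then show ?thesis
    using integrable_reflect[of "\<lambda>z. cmod (K z) powr q" x] K by (simp add: Lp_def)
qed

lemma Lp_norm_reflect: "Lp_norm q (\<lambda>y. K (x - y)) = Lp_norm q K"
  using integral_reflect[of "\<lambda>z. cmod (K z) powr q" x] by (simp add: Lp_norm_def)

lemma Lp_shift: "Lp q K \<Longrightarrow> Lp q (\<lambda>y. K (y - x))"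
proof -
  assume K: "Lp q K"
  have "(\<lambda>y. K (- x + 1 *\<^sub>R y)) \<in> lmeas"
    by (rule borel_measurable_affine) (use K in \<open>auto simp: Lp_def\<close>)
  then show ?thesis
    using integrable_shift[of "\<lambda>z. cmod (K z) powr q" x] K by (simp add: Lp_def)
qed

lemma conv_integrable:
  assumes "conv_kernel K" "Lp 2 f"
  shows "integ (\<lambda>y. K (x - y) * f y)"
  using CS_integrable[OF Lp_reflect[OF kernel_Lp[OF assms(1)]] assms(2)] by simp

lemma conv_measurable [measurable]:
  assumes "conv_kernel K" "f \<in> lmeas"
  shows "conv K f \<in> borel_measurable borel"
proof -
  have "(\<lambda>x. LI y. K (x - y) * f y) \<in> borel_measurable borel"
    by (rule kernel_integral_measurable[OF assms(2)]) (rule kernel_shift_measurable[OF assms(1)])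
  then show ?thesis by (simp add: conv_def[abs_def])
qed

lemma conv_norm_bound:
  "cmod (conv K f x) \<le> (LI y. cmod (K (x - y)) * cmod (f y))"
proof -
  have "cmod (conv K f x) \<le> (LI y. cmod (K (x - y) * f y))"
    unfolding conv_def by (rule integral_norm_bound)
  then show ?thesis by (simp add: norm_mult)
qed

lemma conv_abs_eq:
  "conv (\<lambda>z. cr (cmod (K z))) (\<lambda>z. cr (cmod (f z))) x
    = cr (LI y. cmod (K (x - y)) * cmod (f y))"
  unfolding conv_def by (simp flip: of_real_mult)

text \<open>Tonelli's theorem, obtained from \<open>Fubini_kernel\<close> with the constant 1 for
  one of the two functions; the inner integral is then the mass of the shifted kernel, which does
  not depend on the shift.\<close>

lemma Young_integral:
  fixes w :: "real \<Rightarrow> real"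
  assumes K: "conv_kernel K" and w: "integ w" "\<And>y. w y \<ge> 0"
  shows "integ (\<lambda>x. LI y. cmod (K (x - y)) * w y)"
    and "(LI x. LI y. cmod (K (x - y)) * w y) = (LI x. cmod (K x)) * (LI y. w y)"
    and "integ (\<lambda>y. cmod (K (x - y)) * w y)"
proof -
  let ?W = "\<lambda>y. cr (w y)"
  let ?k = "\<lambda>x y. cr (cmod (K (y - x)))"
  note [measurable] = kernel_measurable[OF K] kernel_shift_measurable[OF K] borel_measurable_integrable[OF w(1)]
  obtain B where B: "\<And>z. cmod (K z) \<le> B" using K by (auto simp: conv_kernel_def)
  have iK: "integ (\<lambda>y. cr (cmod (K (y - x))))" for x
    using integrable_shift[OF integrable_norm[OF kernel_integrable[OF K]], of x] by simp
  have IK: "(LI y. cr (cmod (K (y - x)))) = cr (LI z. cmod (K z))" for x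
    using integral_shift[of "\<lambda>z. cmod (K z)" x] by simp
  show i3: "integ (\<lambda>y. cmod (K (x - y)) * w y)" for x
  proof (rule B_integrable_bound)
    show "integ (\<lambda>y. B * w y)" using w by simp
    have "(\<lambda>y. cmod (K (x - y))) \<in> lmeas"
      by (rule measurable_completion) (use measurable_compose[OF kernel_shift_measurable(2)[OF K] borel_measurable_norm] in simp)
    then show "(\<lambda>y. cmod (K (x - y)) * w y) \<in> lmeas" by measurable
    show "AEL y. norm (cmod (K (x - y)) * w y) \<le> norm (B * w y)"
      using B w(2) by (auto simp: abs_mult intro!: mult_right_mono order_trans[OF B abs_ge_self])
  qed
  have km: "case_prod ?k \<in> borel_measurable (borel \<Otimes>\<^sub>M borel)" by measurable
  have fkg: "integ (\<lambda>x. cmod (?W x) * (LI y. cmod (?k x y) * cmod (1::complex)))"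
    using w integral_shift[of "\<lambda>z. cmod (K z)"] by (simp add: abs_of_nonneg)
  note F = Fubini_kernel[where f = ?W and g = "\<lambda>_. 1" and k = ?k, OF _ _ km _ fkg]
  have e: "(LI y. ?k y x * ?W y) = cr (LI y. cmod (K (x - y)) * w y)" for x
    by (simp flip: of_real_mult)
  have "integ (\<lambda>x. cr (LI y. cmod (K (x - y)) * w y))"
    using F(2) iK unfolding e by simp
  then show "integ (\<lambda>x. LI y. cmod (K (x - y)) * w y)"
    by (rule complex_of_real_integrable_eq[THEN iffD1])
  have "cr (LI x. LI y. cmod (K (x - y)) * w y)
     = (LI x. cr (LI y. cmod (K (x - y)) * w y))"
    by simp
  also have "... = (LI x. ?W x * cr (LI z. cmod (K z)))"
    using F(1) iK IK unfolding e by simp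
  also have "... = cr ((LI x. cmod (K x)) * (LI y. w y))"
    by simp
  finally show "(LI x. LI y. cmod (K (x - y)) * w y) = (LI x. cmod (K x)) * (LI y. w y)"
    unfolding of_real_eq_iff .
qed

text \<open>Hoelder's inequality with |K| split as |K|^(1/q) |K|^(1/q'): the first factor stays with
  f, the second integrates to the mass of K.\<close>

lemma Young_pointwise:
  assumes K: "conv_kernel K" and f: "Lp q f" and q: "q > 1"
  shows "(LI y. cmod (K (x - y)) * cmod (f y)) powr q
     \<le> (LI z. cmod (K z)) powr (q - 1) * (LI y. cmod (K (x - y)) * cmod (f y) powr q)"
proof -
  define q' where "q' = q / (q - 1)"
  have q': "q' > 1" "1 / q + 1 / q' = 1" "q' \<noteq> 0" "1 / q' * q = q - 1" using q by (auto simp: q'_def field_simps)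
  note [measurable] = kernel_measurable[OF K] kernel_shift_measurable[OF K] Lp_measurable[OF f]
  have [measurable]: "(\<lambda>y. K (x - y)) \<in> lmeas"
    by (rule borel_imp_lebesgue) measurable
  let ?F = "\<lambda>y. cr (cmod (K (x - y)) powr (1 / q) * cmod (f y))"
  let ?G = "\<lambda>y. cr (cmod (K (x - y)) powr (1 / q'))"
  have pF: "cmod (?F y) powr q = cmod (K (x - y)) * cmod (f y) powr q" for y
    using q by (simp add: norm_mult powr_mult powr_powr)
  have pG: "cmod (?G y) powr q' = cmod (K (x - y))" for y
    using q' by (simp add: powr_powr)
  have LF: "Lp q ?F"
    unfolding Lp_def pF using f Young_integral(3)[OF K Lp_integrable[OF f]] by simp
  have LG: "Lp q' ?G"
    unfolding Lp_def pG using integrable_reflect[OF integrable_norm[OF kernel_integrable[OF K]], of x] by simp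
  have "(LI y. cmod (K (x - y)) * cmod (f y)) = (LI y. cmod (?F y) * cmod (?G y))"
  proof (rule B_integral_cong[OF refl])
    fix y
    have "cmod (K (x - y)) powr (1 / q) * cmod (K (x - y)) powr (1 / q') = cmod (K (x - y)) powr 1"
      using q'(2) by (simp only: powr_add[symmetric])
    then show "cmod (K (x - y)) * cmod (f y) = cmod (?F y) * cmod (?G y)"
      by (simp add: norm_mult mult_ac)
  qed
  also have "... \<le> Lp_norm q ?F * Lp_norm q' ?G"
    by (rule Holder_aux(2)[OF q q'(1,2) LF LG])
  also have "... = (LI y. cmod (K (x - y)) * cmod (f y) powr q) powr (1/q) * (LI z. cmod (K z)) powr (1/q')"
    unfolding Lp_norm_def pF pG using integral_reflect[of "\<lambda>z. cmod (K z)" x] by simp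
  finally have "(LI y. cmod (K (x - y)) * cmod (f y)) powr q \<le>
     ((LI y. cmod (K (x - y)) * cmod (f y) powr q) powr (1/q) * (LI z. cmod (K z)) powr (1/q')) powr q"
    using q by (intro powr_mono2) auto
  also have "... = (LI z. cmod (K z)) powr (q - 1) * (LI y. cmod (K (x - y)) * cmod (f y) powr q)"
    using q q' by (simp add: powr_mult powr_powr)
  finally show ?thesis .
qed

lemma Young_abs:
  assumes K: "conv_kernel K" and f: "Lp q f" and q: "q \<ge> 1"
  shows "integ (\<lambda>x. (LI y. cmod (K (x - y)) * cmod (f y)) powr q)" (is "integrable _ (\<lambda>x. ?a x powr q)")
    and "(LI x. (LI y. cmod (K (x - y)) * cmod (f y)) powr q) powr (1/q)
         \<le> (LI z. cmod (K z)) * Lp_norm q f"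
proof -
  define M where "M = (LI z. cmod (K z))"
  have M: "M \<ge> 0" unfolding M_def by (rule integral_nonneg_AE) simp
  note [measurable] = kernel_measurable[OF K] kernel_shift_measurable[OF K] Lp_measurable[OF f]
  have pw: "?a x powr q \<le> M powr (q - 1) * (LI y. cmod (K (x - y)) * cmod (f y) powr q)" for x
  proof (cases "q = 1")
    case True
    have a0: "?a x \<ge> 0" by (rule integral_nonneg_AE) simp
    show ?thesis
    \<comment> \<open>For q = 1 the factor \<open>M powr (q - 1)\<close> is 1 only if M \<noteq> 0;
      for M = 0 it is 0 by convention, and the left side has to be shown to vanish.\<close>
    proof (cases "M = 0")
      case True
      have "AEL z. cmod (K z) = 0"
        using True integral_nonneg_eq_0_iff_AE[OF integrable_norm[OF kernel_integrable[OF K]]] by (simp add: M_def)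
      have "(LI y. cmod (K (x - y))) = 0" using True integral_reflect[of "\<lambda>z. cmod (K z)" x] by (simp add: M_def)
      then have "AEL y. cmod (K (x - y)) = 0"
        using integral_nonneg_eq_0_iff_AE[OF integrable_reflect[OF integrable_norm[OF kernel_integrable[OF K]], of x]] by simp
      then have "AEL y. cr (cmod (K (x - y)) * cmod (f y)) = 0" by eventually_elim simp
      then have "cr (?a x) = 0" using integral_cong_AE_gen[of _ "\<lambda>_. 0"] by (simp flip: integral_complex_of_real del: of_real_mult)
      then have "?a x = 0" by simp
      then show ?thesis by (simp add: True)
    next
      case False
      then show ?thesis using \<open>q = 1\<close> M a0 by simp
    qed
  next
    case False
    then show ?thesis using Young_pointwise[OF K f, of x] q by (simp add: M_def)
  qed
  note Y = Young_integral(1,2)[OF K Lp_integrable[OF f]]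
  have am: "?a \<in> lmeas"
  proof -
    have "conv (\<lambda>z. cr (cmod (K z))) (\<lambda>z. cr (cmod (f z))) \<in> borel_measurable borel"
      by (rule conv_measurable[OF kernel_norm[OF K]]) measurable
    then have "(\<lambda>x. cr (?a x)) \<in> borel_measurable borel" by (simp add: conv_abs_eq[abs_def])
    then have "(\<lambda>x. Re (cr (?a x))) \<in> borel_measurable borel" by measurable
    then have "?a \<in> borel_measurable borel" by simp
    then show ?thesis by (intro measurable_completion) simp
  qed
  show i: "integ (\<lambda>x. ?a x powr q)"
  proof (rule B_integrable_bound)
    show "integ (\<lambda>x. M powr (q - 1) * (LI y. cmod (K (x - y)) * cmod (f y) powr q))"
      using Y(1) by simp
    show "(\<lambda>x. ?a x powr q) \<in> lmeas" using am by measurable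
    show "AEL x. norm (?a x powr q) \<le> norm (M powr (q - 1) * (LI y. cmod (K (x - y)) * cmod (f y) powr q))"
      using pw by (auto intro!: order_trans[OF _ abs_ge_self])
  qed
  have "(LI x. ?a x powr q) \<le> (LI x. M powr (q - 1) * (LI y. cmod (K (x - y)) * cmod (f y) powr q))"
    by (rule integral_mono[OF i]) (use Y(1) pw in auto)
  also have "... = M powr (q - 1) * (M * (LI y. cmod (f y) powr q))"
    using Y(2) by (simp add: M_def)
  also have "... = M powr q * (LI y. cmod (f y) powr q)"
    using powr_add[of M "q - 1" 1] M by (cases "M = 0") auto
  finally have "(LI x. ?a x powr q) powr (1/q) \<le> (M powr q * (LI y. cmod (f y) powr q)) powr (1/q)"
    using q by (intro powr_mono2) auto
  also have "... = M * Lp_norm q f"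
    using q M by (simp add: powr_mult powr_powr Lp_norm_def)
  finally show "(LI x. ?a x powr q) powr (1/q) \<le> (LI z. cmod (K z)) * Lp_norm q f"
    by (simp add: M_def)
qed

lemma Young:
  assumes K: "conv_kernel K" and f: "Lp q f" and q: "q \<ge> 1"
  shows "Lp q (conv K f)" and "Lp_norm q (conv K f) \<le> (LI z. cmod (K z)) * Lp_norm q f"
proof -
  note [measurable] = Lp_measurable[OF f]
  have [measurable]: "conv K f \<in> lmeas"
    by (rule borel_imp_lebesgue) (use K in measurable)
  have le: "cmod (conv K f x) powr q \<le> (LI y. cmod (K (x - y)) * cmod (f y)) powr q" for x
    using conv_norm_bound q by (intro powr_mono2) auto
  note Y = Young_abs[OF assms]
  have i: "integ (\<lambda>x. cmod (conv K f x) powr q)"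
    by (rule B_integrable_bound[OF Y(1)]) (use le in \<open>auto\<close>)
  then show "Lp q (conv K f)" by (simp add: Lp_def)
  have "(LI x. cmod (conv K f x) powr q) \<le> (LI x. (LI y. cmod (K (x - y)) * cmod (f y)) powr q)"
    by (rule integral_mono[OF i Y(1) le])
  then have "Lp_norm q (conv K f) \<le> (LI x. (LI y. cmod (K (x - y)) * cmod (f y)) powr q) powr (1/q)"
    unfolding Lp_norm_def using q by (intro powr_mono2) auto
  then show "Lp_norm q (conv K f) \<le> (LI z. cmod (K z)) * Lp_norm q f"
    using Y(2) by simp
qed

text \<open>Young's inequality for the absolute values, followed by Cauchy-Schwarz. It supplies the
  absolute integrability that Fubini asks for when both functions are merely square integrable, and
  the bound by which a commutator is finally estimated.\<close>

lemma Schur: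
  assumes K: "conv_kernel K" and f: "Lp 2 f" and g: "Lp 2 g"
  shows "integ (\<lambda>x. cmod (f x) * (LI y. cmod (K (x - y)) * cmod (g y)))"
    and "(LI x. cmod (f x) * (LI y. cmod (K (x - y)) * cmod (g y)))
      \<le> (LI z. cmod (K z)) * N2 f * N2 g"
proof -
  let ?b = "conv (\<lambda>z. cr (cmod (K z))) (\<lambda>z. cr (cmod (g z)))"
  have g': "Lp 2 (\<lambda>z. cr (cmod (g z)))" "N2 (\<lambda>z. cr (cmod (g z))) = N2 g"
    using g by (auto simp: Lp_def Lp_norm_def)
  have b: "Lp 2 ?b" "N2 ?b \<le> (LI z. cmod (K z)) * N2 g"
    using Young[OF kernel_norm[OF K] g'(1)] g'(2) by auto
  have e: "cmod (?b x) = (LI y. cmod (K (x - y)) * cmod (g y))" for x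
    unfolding conv_abs_eq by (simp add: abs_of_nonneg integral_nonneg_AE)
  show "integ (\<lambda>x. cmod (f x) * (LI y. cmod (K (x - y)) * cmod (g y)))"
    using integrable_norm[OF CS_integrable[OF f b(1)]] by (simp add: norm_mult e)
  have "(LI x. cmod (f x) * (LI y. cmod (K (x - y)) * cmod (g y))) \<le> N2 f * N2 ?b"
    using CS_norm[OF f b(1)] by (simp add: e)
  also have "... \<le> N2 f * ((LI z. cmod (K z)) * N2 g)"
    using b(2) by (intro mult_left_mono) auto
  finally show "(LI x. cmod (f x) * (LI y. cmod (K (x - y)) * cmod (g y)))
      \<le> (LI z. cmod (K z)) * N2 f * N2 g" by (simp add: mult_ac)
qed

section \<open>Schwartz functions and their transforms\<close>

lemma integrable_cauchy: "integ (\<lambda>x::real. inverse (1 + x\<^sup>2))"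
proof -
  have "integrable lborel (\<lambda>x::real. inverse (1 + x\<^sup>2))"
    using integrable_inverse_1_plus_square by (simp add: set_integrable_def)
  then show ?thesis by (subst integrable_lebesgue_lborel) auto
qed

lemma integrable_cauchy_bound:
  fixes f :: "real \<Rightarrow> 'a::{banach, second_countable_topology}"
  assumes "f \<in> lmeas" "\<And>x. norm (f x) \<le> B * inverse (1 + x\<^sup>2)"
  shows "integ f"
proof (rule B_integrable_bound)
  show "integ (\<lambda>x::real. B * inverse (1 + x\<^sup>2))" using integrable_cauchy by simp
  show "AEL x. norm (f x) \<le> norm (B * inverse (1 + x\<^sup>2))"
    using assms(2) by (auto intro!: order_trans[OF assms(2)])
qed fact

lemma integral_vector_derivative_zero:
  fixes h h' :: "real \<Rightarrow> complex"
  assumes d: "\<And>x. (h has_vector_derivative h' x) (at x)" and c: "continuous_on UNIV h'"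
    and i: "integ h'" and l1: "(h \<longlongrightarrow> 0) at_top" and l2: "(h \<longlongrightarrow> 0) at_bot"
  shows "(LI x. h' x) = 0"
proof -
  have m: "h' \<in> borel_measurable borel" by (rule borel_measurable_continuous_onI[OF c])
  have "integrable lborel h'" using i integrable_lebesgue_lborel[OF m] by simp
  then have si: "set_integrable lborel (einterval (-\<infinity>) \<infinity>) h'"
    by (simp add: set_integrable_def)
  have "(LBINT x=-\<infinity>..\<infinity>. h' x) = 0 - 0"
  proof (rule interval_integral_FTC_integrable[OF _ d _ si])
    show "isCont h' x" for x using c by (simp add: continuous_on_eq_continuous_at)
    show "((h \<circ> real_of_ereal) \<longlongrightarrow> 0) (at_right (-\<infinity>))" "((h \<circ> real_of_ereal) \<longlongrightarrow> 0) (at_left \<infinity>)"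
      using l1 l2 by (simp_all add: ereal_tendsto_simps)
  qed auto
  then show ?thesis
    by (simp add: interval_lebesgue_integral_def set_lebesgue_integral_def integral_lebesgue_lborel[OF m])
qed

text \<open>All derivatives decay at least like 1/(1 + x^2) and are integrable. Two integrations by
  parts carry this decay over to the transform, which is therefore bounded and integrable, hence
  square integrable.\<close>

lemma schwartz_facts:
  assumes "schwartz \<phi>"
  shows "\<phi> \<in> borel_measurable borel" "integ \<phi>" "Lp 2 \<phi>" "\<exists>B. \<forall>x. cmod (\<phi> x) \<le> B"
    and "Lp 2 (fourier_integral \<phi>)"
proof -
  obtain D where D0: "D 0 = \<phi>" and D: "\<And>k x. (D k has_vector_derivative D (Suc k) x) (at x)"
    and Db: "\<And>j k. bounded (range (\<lambda>x. x ^ j *\<^sub>R D k x))"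
    using assms unfolding schwartz_def by auto
  have cD: "continuous_on UNIV (D k)" for k
    using D by (meson continuous_at_imp_continuous_on has_vector_derivative_continuous)
  have mD [measurable]: "D k \<in> borel_measurable borel" for k
    by (rule borel_measurable_continuous_onI[OF cD])
  have mD' [measurable]: "D k \<in> lmeas" for k by simp
  have B: "\<exists>B. \<forall>x. cmod (D k x) \<le> B * inverse (1 + x\<^sup>2)" for k
  proof -
    obtain B0 where B0: "\<And>x. cmod (D k x) \<le> B0"
      using Db[of 0 k] by (auto simp: bounded_iff)
    obtain B2 where B2: "\<And>x. x\<^sup>2 * cmod (D k x) \<le> B2"
      using Db[of 2 k] by (auto simp: bounded_iff)
    have "cmod (D k x) * (1 + x\<^sup>2) \<le> B0 + B2" for x
      using B0[of x] B2[of x] by (simp add: algebra_simps)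
    then have "cmod (D k x) \<le> (B0 + B2) * inverse (1 + x\<^sup>2)" for x
      by (simp add: inverse_eq_divide pos_le_divide_eq add_pos_nonneg)
    then show ?thesis by blast
  qed
  then obtain BB where BB: "\<And>k x. cmod (D k x) \<le> BB k * inverse (1 + x\<^sup>2)" by metis
  have iD: "integ (D k)" for k
    by (rule integrable_cauchy_bound[OF mD' BB])
  have lim: "(D k \<longlongrightarrow> 0) at_top" "(D k \<longlongrightarrow> 0) at_bot" for k
  proof -
    have "((\<lambda>x. BB k * inverse (1 + x\<^sup>2)) \<longlongrightarrow> 0) at_top" by real_asymp
    then show "(D k \<longlongrightarrow> 0) at_top"
      by (rule Lim_null_comparison[rotated]) (use BB in auto)
    have "((\<lambda>x. BB k * inverse (1 + x\<^sup>2)) \<longlongrightarrow> 0) at_bot" by real_asymp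
    then show "(D k \<longlongrightarrow> 0) at_bot"
      by (rule Lim_null_comparison[rotated]) (use BB in auto)
  qed
  show "\<phi> \<in> borel_measurable borel" "integ \<phi>" using mD[of 0] iD[of 0] by (simp_all add: D0)
  have bd: "cmod (D k x) \<le> BB k" for k x
  proof -
    have "BB k \<ge> 0" using order_trans[OF norm_ge_zero BB[of k 0]] by simp
    then have "BB k * inverse (1 + x\<^sup>2) \<le> BB k"
      by (intro mult_left_le) (auto simp: inverse_eq_divide divide_le_eq_1 intro: add_pos_nonneg)
    then show ?thesis using BB[of k x] by simp
  qed
  then show "\<exists>B. \<forall>x. cmod (\<phi> x) \<le> B" using D0 by blast
  have "conv_kernel (D 0)" unfolding conv_kernel_def using mD iD bd by blast
  then show "Lp 2 \<phi>" using kernel_Lp[of "D 0" 2] D0 by simp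
  have step: "fourier_integral (D (Suc k)) x = \<i> * x * fourier_integral (D k) x" for k and x :: real
  proof -
    have d: "((\<lambda>y. cis (- (y * x)) * D k y) has_vector_derivative
        cis (- (y * x)) * D (Suc k) y - \<i> * x * (cis (- (y * x)) * D k y)) (at y)" for y
    proof -
      have "((\<lambda>y. cis (- (y * x))) has_vector_derivative - \<i> * x * cis (- (y * x))) (at y)"
      proof -
        have "((\<lambda>z. exp (- \<i> * of_real x * z)) has_field_derivative - \<i> * of_real x * exp (- \<i> * of_real x * of_real y)) (at (of_real y))"
          by (auto intro!: derivative_eq_intros)
        from has_vector_derivative_real_field[OF this, of UNIV] show ?thesis
          by (simp add: cis_conv_exp mult_ac)
      qed
      from has_vector_derivative_mult[OF this D[of k y]] show ?thesis
        by (simp add: algebra_simps)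
    qed
    have i1: "integ (\<lambda>y. cis (- (y * x)) * D k y)" for k
      by (rule integrable_cis_mult'[OF iD])
    have "(LI y. cis (- (y * x)) * D (Suc k) y - \<i> * x * (cis (- (y * x)) * D k y)) = 0"
    proof (rule integral_vector_derivative_zero[OF d])
      show "continuous_on UNIV (\<lambda>y. cis (- (y * x)) * D (Suc k) y - \<i> * x * (cis (- (y * x)) * D k y))"
        by (intro continuous_intros cD)
      show "integ (\<lambda>y. cis (- (y * x)) * D (Suc k) y - \<i> * x * (cis (- (y * x)) * D k y))"
        using i1 by auto
      show "((\<lambda>y. cis (- (y * x)) * D k y) \<longlongrightarrow> 0) at_top" "((\<lambda>y. cis (- (y * x)) * D k y) \<longlongrightarrow> 0) at_bot"
        by (rule Lim_null_comparison[OF _ tendsto_norm_zero[OF lim(1)[of k]]], simp add: norm_mult)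
          (rule Lim_null_comparison[OF _ tendsto_norm_zero[OF lim(2)[of k]]], simp add: norm_mult)
    qed
    then have "fourier_integral (D (Suc k)) x - \<i> * x * fourier_integral (D k) x = 0"
      unfolding fourier_integral_def using i1 by (subst (asm) B_integral_diff) auto
    then show ?thesis by simp
  qed
  define A where "A = (LI x. cmod (D 0 x)) + (LI x. cmod (D 2 x))"
  have "cmod (fourier_integral \<phi> x) \<le> A * inverse (1 + x\<^sup>2)" for x
  proof -
    have "fourier_integral (D 2) x = - (of_real x)\<^sup>2 * fourier_integral \<phi> x"
      using step[of 1 x] step[of 0 x] by (simp add: D0 numeral_2_eq_2 power2_eq_square algebra_simps)
    then have "x\<^sup>2 * cmod (fourier_integral \<phi> x) = cmod (fourier_integral (D 2) x)"
      by (simp add: norm_mult norm_power)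
    then have "cmod (fourier_integral \<phi> x) * (1 + x\<^sup>2) \<le> A"
      using fourier_integral_bound[of "D 0" x] fourier_integral_bound[of "D 2" x]
      by (simp add: A_def D0 algebra_simps)
    then show ?thesis
      by (simp add: inverse_eq_divide pos_le_divide_eq add_pos_nonneg)
  qed
  note fb = this
  have fm: "fourier_integral \<phi> \<in> borel_measurable borel"
    using fourier_integral_measurable[OF mD'[of 0]] D0 by simp
  have "conv_kernel (fourier_integral \<phi>)"
    unfolding conv_kernel_def
  proof (intro conjI exI allI)
    show "integ (fourier_integral \<phi>)"
      by (rule integrable_cauchy_bound[OF _ fb]) (use fm in simp)
    show "cmod (fourier_integral \<phi> z) \<le> (LI x. cmod (\<phi> x))" for z
      by (rule fourier_integral_bound)
  qed (rule fm)
  then show "Lp 2 (fourier_integral \<phi>)" by (rule kernel_Lp) simp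
qed

lemma is_fourier_L1:
  assumes f: "integ f" and f2: "Lp 2 f"
  shows "is_fourier f (fourier_integral f)"
  unfolding is_fourier_def
proof (intro conjI allI impI)
  note [measurable] = borel_measurable_integrable[OF f]
  show "f \<in> lmeas" "fourier_integral f \<in> lmeas"
    using borel_imp_lebesgue[OF fourier_integral_measurable] by auto
  fix \<phi> assume \<phi>: "schwartz \<phi>"
  note s = schwartz_facts[OF \<phi>]
  show "integ (\<lambda>x. f x * fourier_integral \<phi> x)"
    by (rule CS_integrable[OF f2 s(5)])
  show "integ (\<lambda>xi. fourier_integral f xi * \<phi> xi)"
    by (rule integrable_bounded_mult[OF s(2) _ fourier_integral_bound])
      (rule borel_imp_lebesgue, measurable)
  show "(LI xi. fourier_integral f xi * \<phi> xi) = (LI x. f x * fourier_integral \<phi> x)"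
    using multiplication_formula[OF f s(2)] by (simp add: mult.commute)
qed

section \<open>Plancherel\<close>

lemma gauss_scaled_integrable:
  assumes "d > (0::real)"
  shows "integ (\<lambda>x::real. exp (- (d * x)\<^sup>2 / 2))"
  using lebesgue_integrable_real_affine[OF integrable_gauss0, of d 0] assms by simp

lemma fourier_gauss_scaled:
  assumes d: "d > (0::real)"
  shows "(LI x. cis (t * x) * cr (exp (- (d * x)\<^sup>2 / 2))) =
     cr (sqrt (2 * pi) / d * exp (- (t / d)\<^sup>2 / 2))"
proof -
  have "cr (sqrt (2 * pi) * exp (- (t / d)\<^sup>2 / 2)) = (LI x. cis (t / d * x) * cr (exp (- x\<^sup>2 / 2)))"
    by (rule fourier_gauss0[symmetric])
  also have "... = d *\<^sub>R (LI x. cis (t / d * (0 + d * x)) * cr (exp (- (0 + d * x)\<^sup>2 / 2)))"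
    using d lebesgue_integral_real_affine[of d "\<lambda>x. cis (t / d * x) * cr (exp (- x\<^sup>2 / 2))" 0] by simp
  also have "... = d *\<^sub>R (LI x. cis (t * x) * cr (exp (- (d * x)\<^sup>2 / 2)))"
    using d by simp
  finally show ?thesis using d by (simp add: scaleR_conv_of_real field_simps)
qed

lemma gauss_total: "d > 0 \<Longrightarrow> (LI x. exp (- (d * x)\<^sup>2 / 2)) = sqrt (2 * pi) / d"
  using fourier_gauss_scaled[of d 0] by (simp flip: of_real_mult of_real_divide add: of_real_eq_iff)

text \<open>Damping |F|^2 by a wide Gaussian makes all integrals absolutely convergent. The damped
  integral is the pairing of f with the conjugate of f convolved with a Gaussian of mass 2 pi, so
  Young's inequality bounds it uniformly in the damping, which is then removed by monotone
  convergence. That the inequality is an equality follows later from inversion.\<close>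

lemma Plancherel_L1:
  assumes f: "integ f" and f2: "Lp 2 f"
  shows "Lp 2 (fourier_integral f)" and "(N2 (fourier_integral f))\<^sup>2 \<le> 2 * pi * (N2 f)\<^sup>2"
proof -
  note [measurable] = borel_measurable_integrable[OF f]
  let ?F = "fourier_integral f"
  have mF [measurable]: "?F \<in> borel_measurable borel" by measurable
  have mF' [measurable]: "?F \<in> lmeas" by simp
  define d where "d n = 1 / real (Suc n)" for n
  have d: "d n > 0" for n by (simp add: d_def)
  define e where "e n xi = exp (- (d n * xi)\<^sup>2 / 2)" for n and xi :: real
  have e_meas [measurable]: "e n \<in> borel_measurable borel" for n unfolding e_def by measurable
  have e_int: "integ (e n)" for n
    unfolding e_def by (rule gauss_scaled_integrable[OF d])
  have main: "integ (\<lambda>xi. (cmod (?F xi))\<^sup>2 * e n xi)"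
    "(LI xi. (cmod (?F xi))\<^sup>2 * e n xi) \<le> 2 * pi * (N2 f)\<^sup>2" for n
  proof -
    have ec: "integ (\<lambda>xi. cr (e n xi))" using e_int by simp
    define h where "h xi = cnj (?F xi) * cr (e n xi)" for xi
    have h: "integ h" unfolding h_def
    proof (rule integrable_bounded_mult[OF ec])
      show "(\<lambda>x. cnj (?F x)) \<in> lmeas" by measurable
      show "cmod (cnj (?F x)) \<le> (LI x. cmod (f x))" for x
        using fourier_integral_bound[of f x] by simp
    qed
    have Fh: "?F xi * h xi = cr ((cmod (?F xi))\<^sup>2 * e n xi)" for xi
      unfolding h_def of_real_mult complex_norm_square by (simp add: mult.assoc)
    have i: "integ (\<lambda>xi. ?F xi * h xi)"
      by (rule integrable_bounded_mult[OF h mF' fourier_integral_bound])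
    then show int: "integ (\<lambda>xi. (cmod (?F xi))\<^sup>2 * e n xi)"
      unfolding Fh by (rule complex_of_real_integrable_eq[THEN iffD1])
    define G where "G z = cr (sqrt (2 * pi) / d n * exp (- (z / d n)\<^sup>2 / 2))" for z
    have G_meas [measurable]: "G \<in> borel_measurable borel" unfolding G_def by measurable
    \<comment> \<open>The multiplication formula for f and the modulated damping factor: the
      transform of the latter is the Gaussian \<open>G\<close> centred at x, so a convolution
      appears.\<close>
    have hh: "fourier_integral h x = cnj (conv G f x)" for x
    proof -
      have ie: "integ (\<lambda>xi. cis (xi * x) * cr (e n xi))"
        by (rule integrable_cis_mult'[OF ec])
      have "fourier_integral h x = (LI xi. cnj (?F xi * (cis (xi * x) * cr (e n xi))))"
        unfolding fourier_integral_def[of h] h_def by (simp add: cis_cnj mult_ac)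
      also have "... = cnj (LI xi. ?F xi * (cis (xi * x) * cr (e n xi)))"
        by (simp del: complex_cnj_mult)
      also have "(LI xi. ?F xi * (cis (xi * x) * cr (e n xi))) =
         (LI y. f y * fourier_integral (\<lambda>xi. cis (xi * x) * cr (e n xi)) y)"
        using multiplication_formula[OF f ie] by (simp add: mult.commute mult.left_commute)
      also have "... = conv G f x"
      proof -
        have "fourier_integral (\<lambda>xi. cis (xi * x) * cr (e n xi)) y = G (x - y)" for y
        proof -
          have "fourier_integral (\<lambda>xi. cis (xi * x) * cr (e n xi)) y
            = (LI xi. cis ((x - y) * xi) * cr (exp (- (d n * xi)\<^sup>2 / 2)))"
            unfolding fourier_integral_def e_def mult.assoc[symmetric] cis_mult by (simp add: algebra_simps)
          then show ?thesis unfolding fourier_gauss_scaled[OF d] G_def by simp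
        qed
        then show ?thesis by (simp add: conv_def mult.commute)
      qed
      finally show ?thesis .
    qed
    have nG: "cmod (G z) = sqrt (2 * pi) / d n * exp (- (1 / d n * z)\<^sup>2 / 2)" for z
      unfolding G_def norm_of_real using d[of n] by (simp add: abs_mult)
    have GI: "integ (\<lambda>z. cmod (G z))"
      unfolding nG using gauss_scaled_integrable[of "1 / d n"] d[of n] by simp
    have G_norm: "(LI z. cmod (G z)) = 2 * pi"
      unfolding nG using gauss_total[of "1 / d n"] d[of n] by simp
    have K: "conv_kernel G" unfolding conv_kernel_def
    proof (intro conjI exI allI)
      show "integ G" using GI by (subst integrable_norm_iff[symmetric]) auto
      show "cmod (G z) \<le> sqrt (2 * pi) / d n" for z
        unfolding nG using d[of n] by (intro mult_left_le) auto
    qed measurable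
    have "cr (LI xi. (cmod (?F xi))\<^sup>2 * e n xi) = (LI xi. ?F xi * h xi)"
      unfolding Fh by (rule integral_complex_of_real[symmetric])
    also have "... = (LI xi. h xi * ?F xi)" by (simp only: mult.commute)
    also have "... = (LI x. f x * fourier_integral h x)"
      by (rule multiplication_formula[OF f h, symmetric])
    also have "... = (LI x. f x * cnj (conv G f x))" by (simp add: hh)
    finally have eq: "cr (LI xi. (cmod (?F xi))\<^sup>2 * e n xi) = (LI x. f x * cnj (conv G f x))" .
    have "(LI xi. (cmod (?F xi))\<^sup>2 * e n xi) \<le> cmod (LI x. f x * cnj (conv G f x))"
      unfolding eq[symmetric] norm_of_real by (rule abs_ge_self)
    also have "... \<le> N2 f * N2 (\<lambda>x. cnj (conv G f x))"
      by (rule CS[OF f2]) (rule Lp_cnj[OF Young(1)[OF K f2]], simp)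
    also have "... \<le> N2 f * (2 * pi * N2 f)"
      using Young(2)[OF K f2] by (intro mult_left_mono) (simp_all add: G_norm)
    finally show "(LI xi. (cmod (?F xi))\<^sup>2 * e n xi) \<le> 2 * pi * (N2 f)\<^sup>2"
      by (simp add: power2_eq_square mult_ac)
  qed
  have mono: "mono (\<lambda>n. (cmod (?F xi))\<^sup>2 * e n xi)" for xi
  proof (rule monoI)
    fix m n :: nat assume "m \<le> n"
    then have "d n \<le> d m" by (simp add: d_def frac_le)
    then have "(d n * \<bar>xi\<bar>)\<^sup>2 \<le> (d m * \<bar>xi\<bar>)\<^sup>2"
      using d[of n] by (intro power_mono mult_right_mono) auto
    then show "(cmod (?F xi))\<^sup>2 * e m xi \<le> (cmod (?F xi))\<^sup>2 * e n xi"
      by (intro mult_left_mono) (auto simp: e_def power_mult_distrib)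
  qed
  have lim: "(\<lambda>n. (cmod (?F xi))\<^sup>2 * e n xi) \<longlonglongrightarrow> (cmod (?F xi))\<^sup>2" for xi
  proof -
    have "(\<lambda>n. e n xi) \<longlonglongrightarrow> 1" proof -
      have "(\<lambda>n. exp (- (1 / real (Suc n) * xi)\<^sup>2 / 2)) \<longlonglongrightarrow> exp (- (0 * xi)\<^sup>2 / 2)"
        by (intro tendsto_intros LIMSEQ_Suc[OF lim_1_over_n]) auto
      then show ?thesis by (simp add: e_def d_def)
    qed
    from tendsto_mult[OF tendsto_const this] show ?thesis by simp
  qed
  have "(\<lambda>xi. (cmod (?F xi))\<^sup>2) \<in> lmeas" by measurable
  note M = mono_bounded_integrable[OF main(1) mono lim main(2) this]
  show "Lp 2 ?F" unfolding Lp2_iff using M(1) mF' by simp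
  show "(N2 ?F)\<^sup>2 \<le> 2 * pi * (N2 f)\<^sup>2"
    using M(2) by (simp add: Lp_norm2_sq)
qed

text \<open>Fatou's lemma gives the integrability of the limit together with the bound. Convergence
  almost everywhere is all that the selection of a subsequence provides.\<close>

lemma L2_Fatou:
  assumes F: "\<And>n. Lp 2 (F n)" and lim: "AEL x. (\<lambda>n. F n x) \<longlonglongrightarrow> G x"
    and G: "G \<in> lmeas" and A: "\<And>n. (N2 (F n))\<^sup>2 \<le> A"
  shows "Lp 2 G" and "(N2 G)\<^sup>2 \<le> A"
proof -
  note [measurable] = Lp_measurable[OF F] G
  have A0: "A \<ge> 0" using A[of 0] zero_le_power2 order_trans by blast
  have "(\<integral>\<^sup>+x. ennreal ((cmod (G x))\<^sup>2) \<partial>lebesgue) = (\<integral>\<^sup>+x. liminf (\<lambda>n. ennreal ((cmod (F n x))\<^sup>2)) \<partial>lebesgue)"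
  proof (rule nn_integral_cong_AE)
    show "AEL x. ennreal ((cmod (G x))\<^sup>2) = liminf (\<lambda>n. ennreal ((cmod (F n x))\<^sup>2))"
      using lim
    proof eventually_elim
      case (elim x)
      then have "(\<lambda>n. ennreal ((cmod (F n x))\<^sup>2)) \<longlonglongrightarrow> ennreal ((cmod (G x))\<^sup>2)"
        by (intro tendsto_intros) auto
      from lim_imp_Liminf[OF sequentially_bot this] show ?case by (rule sym)
    qed
  qed
  also have "... \<le> liminf (\<lambda>n. \<integral>\<^sup>+x. ennreal ((cmod (F n x))\<^sup>2) \<partial>lebesgue)"
    by (rule nn_integral_liminf) measurable
  also have "... \<le> liminf (\<lambda>n::nat. ennreal A)"
  proof (rule Liminf_mono, rule always_eventually, rule allI)
    fix n
    have "(\<integral>\<^sup>+x. ennreal ((cmod (F n x))\<^sup>2) \<partial>lebesgue) = ennreal ((N2 (F n))\<^sup>2)"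
      unfolding Lp_norm2_sq by (rule nn_integral_eq_integral) (use F in \<open>auto simp: Lp2_iff\<close>)
    then show "(\<integral>\<^sup>+x. ennreal ((cmod (F n x))\<^sup>2) \<partial>lebesgue) \<le> ennreal A"
      using A[of n] by (simp add: ennreal_leI)
  qed
  also have "... = ennreal A" by (simp add: Liminf_const)
  finally have le: "(\<integral>\<^sup>+x. ennreal ((cmod (G x))\<^sup>2) \<partial>lebesgue) \<le> ennreal A" .
  have i: "integ (\<lambda>x. (cmod (G x))\<^sup>2)"
    by (rule integrableI_bounded) (use le in \<open>auto simp: order_le_less_trans\<close>)
  then show "Lp 2 G" using G by (simp add: Lp2_iff)
  have "ennreal ((N2 G)\<^sup>2) \<le> ennreal A"
    using le nn_integral_eq_integral[OF i] by (simp add: Lp_norm2_sq)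
  then show "(N2 G)\<^sup>2 \<le> A" using A0 by (simp add: ennreal_le_iff)
qed

lemma Lp2_truncation:
  assumes f: "Lp 2 f"
  defines "g n x \<equiv> indicator {- real n..real n} x * f x"
  shows "Lp 2 (g n)" "integ (g n)"
    and "(\<lambda>n. N2 (\<lambda>x. f x - g n x)) \<longlonglongrightarrow> 0"
    and "m \<le> n \<Longrightarrow> N2 (\<lambda>x. g n x - g m x) \<le> N2 (\<lambda>x. f x - g m x)"
proof -
  note [measurable] = Lp_measurable[OF f]
  have [measurable]: "g n \<in> lmeas" for n unfolding g_def by measurable
  have g2: "Lp 2 (g n)" for n
    by (rule Lp_bound[OF _ f, where c = 1]) (auto simp: g_def indicator_def)
  then show "Lp 2 (g n)" .
  have "Lp 2 (indicator {- real n..real n} :: real \<Rightarrow> complex)"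
  proof -
    have "(\<lambda>x. (cmod (indicator {- real n..real n} x))\<^sup>2) = (indicator {- real n..real n} :: real \<Rightarrow> real)"
      by (auto simp: indicator_def)
    then show ?thesis by (simp add: Lp2_iff)
  qed
  from CS_integrable[OF this f] show "integ (g n)" unfolding g_def .
  have d: "cmod (f x - g n x) = (if x \<in> {- real n..real n} then 0 else cmod (f x))" for x n
    by (auto simp: g_def)
  have "(\<lambda>n. LI x. (cmod (f x - g n x))\<^sup>2) \<longlonglongrightarrow> (LI x. (0::real))"
  proof (rule Bochner_Integration.integral_dominated_convergence)
    show "integ (\<lambda>x. (cmod (f x))\<^sup>2)" using f by (simp add: Lp2_iff)
    show "AEL x. norm ((cmod (f x - g n x))\<^sup>2) \<le> (cmod (f x))\<^sup>2" for n
      by (auto simp: d)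
    show "AEL x. (\<lambda>n. (cmod (f x - g n x))\<^sup>2) \<longlonglongrightarrow> 0"
    proof (rule AE_I2, rule tendsto_eventually)
      fix x
      show "\<forall>\<^sub>F n in sequentially. (cmod (f x - g n x))\<^sup>2 = 0"
        using eventually_ge_at_top[of "nat \<lceil>\<bar>x\<bar>\<rceil>"]
      proof eventually_elim
        case (elim n)
        then have "\<bar>x\<bar> \<le> real n" by linarith
        then show ?case by (simp add: d abs_le_iff)
      qed
    qed
  qed auto
  then have "(\<lambda>n. sqrt (LI x. (cmod (f x - g n x))\<^sup>2)) \<longlonglongrightarrow> sqrt 0"
    by (intro tendsto_real_sqrt) simp
  then show "(\<lambda>n. N2 (\<lambda>x. f x - g n x)) \<longlonglongrightarrow> 0"
    by (simp add: Lp_norm2)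
  assume "m \<le> n"
  then show "N2 (\<lambda>x. g n x - g m x) \<le> N2 (\<lambda>x. f x - g m x)"
    using Lp_norm_bound[of "\<lambda>x. g n x - g m x" 2 "\<lambda>x. f x - g m x" 1] Lp_diff[OF f g2[of m]]
    by (auto simp: g_def indicator_def)
qed

lemma integral_L2_tendsto:
  assumes "\<And>n. Lp 2 (F n)" "Lp 2 G" "Lp 2 h" "(\<lambda>n. N2 (\<lambda>x. G x - F n x)) \<longlonglongrightarrow> 0"
  shows "(\<lambda>n. LI x. F n x * h x) \<longlonglongrightarrow> (LI x. G x * h x)"
proof -
  have "(\<lambda>n. (LI x. F n x * h x) - (LI x. G x * h x)) \<longlonglongrightarrow> 0"
  proof (rule Lim_null_comparison)
    show "(\<lambda>n. N2 (\<lambda>x. G x - F n x) * N2 h) \<longlonglongrightarrow> 0"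
      using tendsto_mult_right[OF assms(4), of "N2 h"] by simp
    show "\<forall>\<^sub>F n in sequentially. norm ((LI x. F n x * h x) - (LI x. G x * h x)) \<le>
        N2 (\<lambda>x. G x - F n x) * N2 h"
    proof (rule always_eventually, rule allI)
      fix n
      have "(LI x. G x * h x) - (LI x. F n x * h x) = (LI x. (G x - F n x) * h x)"
        using CS_integrable[OF assms(2,3)] CS_integrable[OF assms(1,3)] by (simp add: left_diff_distrib)
      then show "norm ((LI x. F n x * h x) - (LI x. G x * h x)) \<le>
        N2 (\<lambda>x. G x - F n x) * N2 h"
        using CS[OF Lp_diff[OF assms(2) assms(1)[of n]] assms(3)]
        by (subst norm_minus_commute) simp
    qed
  qed
  then show ?thesis by (simp add: LIM_zero_iff)
qed

text \<open>The transforms of the truncations to [-n, n] form a Cauchy sequence in L^2. A candidate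
  for the limit is found along a subsequence converging almost everywhere; Fatou's lemma carries the
  Cauchy estimate over to it, and thus the full sequence converges in L^2.\<close>

lemma L2_fourier_exists:
  assumes f: "Lp 2 f"
  obtains g where "is_fourier f g" "Lp 2 g" "(N2 g)\<^sup>2 \<le> 2 * pi * (N2 f)\<^sup>2"
proof -
  define fn where "fn n x = indicator {- real n..real n} x * f x" for n x
  note T = Lp2_truncation[OF f, folded fn_def]
  define Fn where "Fn n = fourier_integral (fn n)" for n
  have Fn2: "Lp 2 (Fn n)" for n unfolding Fn_def by (rule Plancherel_L1[OF T(2,1)])
  have FnF: "is_fourier (fn n) (Fn n)" for n unfolding Fn_def by (rule is_fourier_L1[OF T(2,1)])
  note [measurable] = Lp_measurable[OF Fn2]
  have Fd: "fourier_integral (\<lambda>x. fn n x - fn m x) = (\<lambda>x. Fn n x - Fn m x)" for n m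
    unfolding Fn_def fourier_integral_def using integrable_cis_mult'(1)[OF T(2)]
    by (auto simp: right_diff_distrib fun_eq_iff)
  have dd: "(N2 (\<lambda>x. Fn n x - Fn m x))\<^sup>2 \<le> 2 * pi * (N2 (\<lambda>x. f x - fn m x))\<^sup>2" if "m \<le> n" for m n
  proof -
    have "(N2 (\<lambda>x. Fn n x - Fn m x))\<^sup>2 \<le> 2 * pi * (N2 (\<lambda>x. fn n x - fn m x))\<^sup>2"
      using Plancherel_L1(2)[of "\<lambda>x. fn n x - fn m x"] T(1,2) Lp_diff[OF T(1) T(1)] unfolding Fd by auto
    also have "... \<le> 2 * pi * (N2 (\<lambda>x. f x - fn m x))\<^sup>2"
      using T(4)[OF that] by (intro mult_left_mono power_mono) auto
    finally show ?thesis .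
  qed
  have dd': "N2 (\<lambda>x. Fn n x - Fn m x) \<le> sqrt (2 * pi) * N2 (\<lambda>x. f x - fn m x)" if "m \<le> n" for m n
    using real_le_rsqrt[OF dd[OF that]] by (simp add: real_sqrt_mult)
  \<comment> \<open>A square integrable weight without zeros turns the Cauchy sequence in L^2 into
    one in L^1, which has a subsequence converging almost everywhere; afterwards the weight can be
    divided out.\<close>
  let ?w = "\<lambda>x::real. cr (exp (- x\<^sup>2 / 2))"
  have w: "Lp 2 ?w" using schwartz_facts(3)[OF schwartz_gauss[of 0 0]] by (simp add: gauss_def[abs_def])
  define s where "s n x = Fn n x * ?w x" for n x
  have si: "integ (s n)" for n unfolding s_def by (rule CS_integrable[OF Fn2 w])
  have cau: "\<exists>N. \<forall>i\<ge>N. \<forall>j\<ge>N. (LI x. norm (s i x - s j x)) < e" if e: "e > 0" for e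
  proof -
    define W where "W = N2 ?w"
    have W: "W \<ge> 0" by (simp add: W_def)
    have "(\<lambda>n. sqrt (2 * pi) * N2 (\<lambda>x. f x - fn n x) * W) \<longlonglongrightarrow> sqrt (2 * pi) * 0 * W"
      by (intro tendsto_intros T(3))
    then have "\<forall>\<^sub>F n in sequentially. sqrt (2 * pi) * N2 (\<lambda>x. f x - fn n x) * W < e"
      using e by (intro order_tendstoD) auto
    then obtain N where N: "\<And>n. n \<ge> N \<Longrightarrow> sqrt (2 * pi) * N2 (\<lambda>x. f x - fn n x) * W < e"
      by (auto simp: eventually_sequentially)
    have lt: "(LI x. norm (s i x - s j x)) < e" if "i \<ge> j" "j \<ge> N" for i j
    proof -
      have "(LI x. norm (s i x - s j x)) = (LI x. cmod (Fn i x - Fn j x) * cmod (?w x))"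
        by (simp add: s_def norm_mult[symmetric] left_diff_distrib del: norm_of_real)
      also have "... \<le> N2 (\<lambda>x. Fn i x - Fn j x) * W"
        unfolding W_def by (rule CS_norm[OF Lp_diff[OF Fn2 Fn2] w]) simp
      also have "... \<le> sqrt (2 * pi) * N2 (\<lambda>x. f x - fn j x) * W"
        using dd'[OF that(1)] W by (rule mult_right_mono)
      also have "... < e" by (rule N[OF that(2)])
      finally show ?thesis .
    qed
    show ?thesis
    proof (intro exI[of _ N] allI impI)
      fix i j assume "N \<le> i" "N \<le> j"
      then show "(LI x. norm (s i x - s j x)) < e"
        using lt[of i j] lt[of j i] by (cases "i \<ge> j") (auto simp: norm_minus_commute)
    qed
  qed
  obtain r where r: "strict_mono r" and rc: "AEL x. Cauchy (\<lambda>i. s (r i) x)"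
    using cauchy_L1_AE_cauchy_subseq[OF si cau] by blast
  define g where "g x = lim (\<lambda>i. Fn (r i) x)" for x
  have gl: "AEL x. (\<lambda>i. Fn (r i) x) \<longlonglongrightarrow> g x"
    using rc
  proof eventually_elim
    case (elim x)
    then obtain l where l: "(\<lambda>i. s (r i) x) \<longlonglongrightarrow> l"
      using Cauchy_convergent convergent_def by blast
    then have "(\<lambda>i. s (r i) x / ?w x) \<longlonglongrightarrow> l / ?w x"
      by (intro tendsto_intros) auto
    then have "(\<lambda>i. Fn (r i) x) \<longlonglongrightarrow> l / ?w x" by (simp add: s_def)
    then show ?case unfolding g_def by (rule convergent_LIMSEQ_iff[THEN iffD1, OF convergentI])
  qed
  have [measurable]: "g \<in> lmeas"
    unfolding g_def by measurable
  have near: "Lp 2 (\<lambda>x. g x - Fn n x)" "(N2 (\<lambda>x. g x - Fn n x))\<^sup>2 \<le> 2 * pi * (N2 (\<lambda>x. f x - fn n x))\<^sup>2" for n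
  proof -
    have l: "AEL x. (\<lambda>i. Fn (r (i + n)) x - Fn n x) \<longlonglongrightarrow> g x - Fn n x"
      using gl by eventually_elim (intro tendsto_diff tendsto_const LIMSEQ_ignore_initial_segment)
    have ge: "r (i + n) \<ge> n" for i
      using seq_suble[OF r, of "i + n"] by simp
    show "Lp 2 (\<lambda>x. g x - Fn n x)"
      by (rule L2_Fatou(1)[OF Lp_diff[OF Fn2 Fn2] l _ dd[OF ge]]) auto
    show "(N2 (\<lambda>x. g x - Fn n x))\<^sup>2 \<le> 2 * pi * (N2 (\<lambda>x. f x - fn n x))\<^sup>2"
      by (rule L2_Fatou(2)[OF Lp_diff[OF Fn2 Fn2] l _ dd[OF ge]]) auto
  qed
  have g2: "Lp 2 g"
    using Lp_add[OF near(1)[of 0] Fn2[of 0]] by simp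
  have tn: "(\<lambda>n. N2 (\<lambda>x. g x - Fn n x)) \<longlonglongrightarrow> 0"
  proof (rule Lim_null_comparison)
    show "\<forall>\<^sub>F n in sequentially. norm (N2 (\<lambda>x. g x - Fn n x)) \<le> sqrt (2 * pi) * N2 (\<lambda>x. f x - fn n x)"
      using real_le_rsqrt[OF near(2)] by (auto simp: real_sqrt_mult)
    show "(\<lambda>n. sqrt (2 * pi) * N2 (\<lambda>x. f x - fn n x)) \<longlonglongrightarrow> 0"
      using tendsto_mult_left[OF T(3), of "sqrt (2 * pi)"] by simp
  qed
  have "is_fourier f g"
    unfolding is_fourier_def
  proof (intro conjI allI impI)
    show "f \<in> lmeas" "g \<in> lmeas" using f by (auto simp: Lp_def)
    fix \<phi> assume \<phi>: "schwartz \<phi>"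
    note S = schwartz_facts[OF \<phi>]
    show "integ (\<lambda>x. f x * fourier_integral \<phi> x)" by (rule CS_integrable[OF f S(5)])
    show "integ (\<lambda>x. g x * \<phi> x)" by (rule CS_integrable[OF g2 S(3)])
    have e: "(LI x. Fn n x * \<phi> x) = (LI x. fn n x * fourier_integral \<phi> x)" for n
      using FnF[of n] \<phi> by (auto simp: is_fourier_def)
    show "(LI xi. g xi * \<phi> xi) = (LI x. f x * fourier_integral \<phi> x)"
      using integral_L2_tendsto[OF Fn2 g2 S(3) tn] integral_L2_tendsto[OF T(1) f S(5) T(3)]
      unfolding e by (rule LIMSEQ_unique)
  qed
  moreover have "(N2 g)\<^sup>2 \<le> 2 * pi * (N2 f)\<^sup>2"
  proof (rule L2_Fatou(2)[of "\<lambda>i. Fn (r i)", OF Fn2 gl])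
    fix i
    have "(N2 (Fn (r i)))\<^sup>2 \<le> 2 * pi * (N2 (fn (r i)))\<^sup>2"
      unfolding Fn_def by (rule Plancherel_L1[OF T(2,1)])
    also have "... \<le> 2 * pi * (N2 f)\<^sup>2"
    proof (intro mult_left_mono power_mono)
      have "N2 (fn (r i)) \<le> 1 * N2 f"
        by (rule Lp_norm_bound[OF Lp_measurable[OF T(1)] f]) (auto simp: fn_def indicator_def)
      then show "N2 (fn (r i)) \<le> N2 f" by simp
    qed auto
    finally show "(N2 (Fn (r i)))\<^sup>2 \<le> 2 * pi * (N2 f)\<^sup>2" .
  qed measurable
  ultimately show thesis using g2 that by blast
qed

text \<open>Some transform of f exists in L^2 and is determined by its pairings with modulated
  Gaussians. So an identity checked on these holds for all Schwartz functions.\<close>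

lemma gauss_test_is_fourier:
  assumes f: "Lp 2 f" and g: "Lp 2 g"
    and eq: "\<And>t. (LI x. g x * gauss 0 t x) = (LI x. f x * fourier_integral (gauss 0 t) x)"
  shows "is_fourier f g"
proof -
  obtain h where h: "is_fourier f h" "Lp 2 h" using L2_fourier_exists[OF f] by blast
  have "AEL x. h x - g x = 0"
  proof (rule gauss_test_unique)
    show "(\<lambda>x. h x - g x) \<in> lmeas" using Lp_diff[OF h(2) g] by (simp add: Lp_def)
    fix t
    note i = CS_integrable[OF h(2) schwartz_facts(3)[OF schwartz_gauss[of 0 t]]]
      CS_integrable[OF g schwartz_facts(3)[OF schwartz_gauss[of 0 t]]]
    show "integ (\<lambda>x. (h x - g x) * gauss 0 t x)" using i by (simp add: left_diff_distrib)
    have "(LI x. h x * gauss 0 t x) = (LI x. f x * fourier_integral (gauss 0 t) x)"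
      using h(1) schwartz_gauss[of 0 t] by (auto simp: is_fourier_def)
    then show "(LI x. (h x - g x) * gauss 0 t x) = 0"
      using i eq[of t] by (simp add: left_diff_distrib)
  qed
  then have "AEL x. h x = g x" by eventually_elim simp
  then show ?thesis by (rule is_fourier_cong_AE[OF h(1) AE_I2[OF refl]])
qed

lemma is_fourierD:
  "is_fourier f g \<Longrightarrow> schwartz \<phi> \<Longrightarrow> (LI xi. g xi * \<phi> xi) = (LI x. f x * fourier_integral \<phi> x)"
  by (auto simp: is_fourier_def)

lemma Lp_reflect0: "Lp q f \<Longrightarrow> Lp q (\<lambda>x. f (- x))"
  using Lp_reflect[of q f 0] by simp

lemma Lp_norm_reflect0: "Lp_norm q (\<lambda>x. f (- x)) = Lp_norm q f"
  using Lp_norm_reflect[of q f 0] by simp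

text \<open>On Gaussians the inversion formula is explicit, the two factors sqrt (2 pi) cancelling
  the constant 1 / (2 pi), and Gaussians are enough.\<close>

lemma L2_fourier_inverse:
  assumes g: "Lp 2 g" and G: "is_fourier g G" "Lp 2 G"
  shows "is_fourier (\<lambda>x. cr (1 / (2 * pi)) * G (- x)) g"
proof (rule gauss_test_is_fourier)
  show f: "Lp 2 (\<lambda>x. cr (1 / (2 * pi)) * G (- x))"
    by (intro Lp_scale Lp_reflect0 G) simp
  show "Lp 2 g" by fact
  fix t
  define c where "c = cr (1 / (2 * pi)) * cr (sqrt (2 * pi))"
  have c: "c * cr (sqrt (2 * pi)) = 1"
  proof -
    have "1 / (2 * pi) * sqrt (2 * pi) * sqrt (2 * pi) = 1" by (simp add: mult.assoc)
    then show ?thesis unfolding c_def by (metis of_real_1 of_real_mult)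
  qed
  have "(LI x. cr (1 / (2 * pi)) * G (- x) * fourier_integral (gauss 0 t) x)
    = (LI x. c * (G (- x) * gauss t 0 x))"
    by (simp add: fourier_integral_gauss c_def mult_ac)
  also have "... = (LI x. c * (G (0 - x) * gauss (- t) 0 (0 - x)))"
    by (simp add: gauss_def power2_commute[of "- _" "- _"] algebra_simps minus_diff_commute power2_eq_square)
  also have "... = c * (LI x. G x * gauss (- t) 0 x)"
    unfolding integral_mult_right_zero integral_reflect[of "\<lambda>x. G x * gauss (- t) 0 x" 0] ..
  also have "(LI x. G x * gauss (- t) 0 x) = (LI x. g x * fourier_integral (gauss (- t) 0) x)"
    by (rule is_fourierD[OF G(1) schwartz_gauss])
  also have "... = cr (sqrt (2 * pi)) * (LI x. g x * gauss 0 t x)"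
    by (simp add: fourier_integral_gauss mult.left_commute[of _ "cr (sqrt (2*pi))"])
  finally show "(LI x. g x * gauss 0 t x) = (LI x. cr (1 / (2 * pi)) * G (- x) * fourier_integral (gauss 0 t) x)"
    using c by (simp add: mult.assoc[symmetric])
qed

text \<open>For the converse direction, a function with square integrable transform g coincides with
  the inverse transform of g, which is in L^2 by construction.\<close>

lemma is_fourier_Lp2:
  assumes "is_fourier f g"
  shows "Lp 2 f \<longleftrightarrow> Lp 2 g"
proof
  assume "Lp 2 f"
  then obtain h where "is_fourier f h" "Lp 2 h" by (rule L2_fourier_exists)
  then show "Lp 2 g" using is_fourier_unique[OF _ assms] Lp_cong_AE by blast
next
  assume g: "Lp 2 g"
  obtain G where G: "is_fourier g G" "Lp 2 G" using L2_fourier_exists[OF g] by blast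
  have "is_fourier (\<lambda>x. cr (1 / (2 * pi)) * G (- x)) g" by (rule L2_fourier_inverse[OF g G])
  from is_fourier_inj[OF this assms] show "Lp 2 f"
    by (rule Lp_cong_AE) (intro Lp_scale Lp_reflect0 G, simp)
qed

lemma L2_inverse_exists:
  assumes g: "Lp 2 g"
  obtains f where "is_fourier f g" "Lp 2 f"
proof -
  obtain G where G: "is_fourier g G" "Lp 2 G" using L2_fourier_exists[OF g] by blast
  show thesis by (rule that[OF L2_fourier_inverse[OF g G]]) (intro Lp_scale Lp_reflect0 G, simp)
qed

text \<open>Transforming twice gives 2 pi times the reflection. The inequality applied to f, and
  then to its transform, therefore bounds the norms in both directions.\<close>

lemma Plancherel:
  assumes fg: "is_fourier f g" and f: "Lp 2 f"
  shows "(N2 g)\<^sup>2 = 2 * pi * (N2 f)\<^sup>2"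
proof -
  have le: "(N2 g)\<^sup>2 \<le> 2 * pi * (N2 f)\<^sup>2" if "is_fourier f g" "Lp 2 f" for f g
  proof -
    obtain h where h: "is_fourier f h" "Lp 2 h" "(N2 h)\<^sup>2 \<le> 2 * pi * (N2 f)\<^sup>2"
      using L2_fourier_exists[OF \<open>Lp 2 f\<close>] by blast
    then show ?thesis
      using Lp_norm_cong_AE[OF is_fourier_unique[OF h(1) \<open>is_fourier f g\<close>] Lp_measurable[OF h(2)]] by simp
  qed
  have g: "Lp 2 g" using is_fourier_Lp2[OF fg] f by simp
  obtain G where G: "is_fourier g G" "Lp 2 G" using L2_fourier_exists[OF g] by blast
  define k where "k x = cr (1 / (2 * pi)) * G (- x)" for x
  have k: "is_fourier k g" unfolding k_def by (rule L2_fourier_inverse[OF g G])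
  have "N2 f = N2 k"
    by (rule Lp_norm_cong_AE[OF is_fourier_inj[OF fg k] Lp_measurable[OF f]])
  also have "... = 1 / (2 * pi) * N2 G"
    unfolding k_def by (subst Lp_norm_scale) (auto simp: Lp_norm_reflect0 norm_divide norm_mult)
  finally have "2 * pi * (N2 f)\<^sup>2 = 1 / (2 * pi) * (N2 G)\<^sup>2"
    by (simp add: power2_eq_square)
  also have "... \<le> 1 / (2 * pi) * (2 * pi * (N2 g)\<^sup>2)"
    by (intro mult_left_mono le[OF G(1) g]) auto
  also have "... = (N2 g)\<^sup>2" by simp
  finally show ?thesis using le[OF fg f] by simp
qed

lemma Lp_norm2_polarization:
  assumes f: "Lp 2 f" and g: "Lp 2 g"
  shows "4 * (LI x. f x * cnj (g x)) =
     cr ((N2 (\<lambda>x. f x + g x))\<^sup>2) - cr ((N2 (\<lambda>x. f x + (- 1) * g x))\<^sup>2)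
     + \<i> * cr ((N2 (\<lambda>x. f x + \<i> * g x))\<^sup>2) - \<i> * cr ((N2 (\<lambda>x. f x + (- \<i>) * g x))\<^sup>2)"
proof -
  have i: "integ (\<lambda>x. (cmod (f x + c * g x))\<^sup>2)" for c
    using Lp_add[OF f Lp_scale[OF g, of c]] by (simp add: Lp2_iff)
  have i': "integ (\<lambda>x. cr ((cmod (f x + c * g x))\<^sup>2))" for c
    using i[of c] by (rule complex_of_real_integrable_eq[THEN iffD2])
  have N: "cr ((N2 (\<lambda>x. f x + c * g x))\<^sup>2) = (LI x. cr ((cmod (f x + c * g x))\<^sup>2))" for c
    unfolding Lp_norm2_sq by (rule integral_complex_of_real[symmetric])
  have "4 * (LI x. f x * cnj (g x)) = (LI x. 4 * (f x * cnj (g x)))" by simp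
  also have "... = (LI x. cr ((cmod (f x + 1 * g x))\<^sup>2) - cr ((cmod (f x + (- 1) * g x))\<^sup>2)
     + \<i> * cr ((cmod (f x + \<i> * g x))\<^sup>2) - \<i> * cr ((cmod (f x + (- \<i>) * g x))\<^sup>2))"
  proof (rule B_integral_cong[OF refl])
    fix x
    show "4 * (f x * cnj (g x)) = cr ((cmod (f x + 1 * g x))\<^sup>2) - cr ((cmod (f x + (- 1) * g x))\<^sup>2)
     + \<i> * cr ((cmod (f x + \<i> * g x))\<^sup>2) - \<i> * cr ((cmod (f x + (- \<i>) * g x))\<^sup>2)"
      unfolding complex_norm_square by (simp add: algebra_simps)
  qed
  also have "... = (LI x. cr ((cmod (f x + 1 * g x))\<^sup>2)) - (LI x. cr ((cmod (f x + (- 1) * g x))\<^sup>2))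
     + \<i> * (LI x. cr ((cmod (f x + \<i> * g x))\<^sup>2)) - \<i> * (LI x. cr ((cmod (f x + (- \<i>) * g x))\<^sup>2))"
    by (simp only: B_integral_diff B_integral_add integral_mult_right_zero
        B_integrable_diff B_integrable_add Bochner_Integration.integrable_mult_right i')
  finally show ?thesis using N[of 1] N[of "- 1"] N[of \<i>] N[of "- \<i>"] by simp
qed

text \<open>By polarisation the pairing is a combination of four squared norms, each of which is
  multiplied by 2 pi.\<close>

lemma Parseval:
  assumes fg: "is_fourier f g" "Lp 2 f" and hk: "is_fourier h k" "Lp 2 h"
  shows "(LI x. g x * cnj (k x)) = cr (2 * pi) * (LI x. f x * cnj (h x))"
proof -
  have g: "Lp 2 g" and k: "Lp 2 k" using assms is_fourier_Lp2 by blast+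
  have P: "(N2 (\<lambda>x. g x + c * k x))\<^sup>2 = 2 * pi * (N2 (\<lambda>x. f x + c * h x))\<^sup>2" for c
    by (rule Plancherel[OF is_fourier_add[OF fg(1) is_fourier_scale[OF hk(1)]]])
      (intro Lp_add fg Lp_scale hk, auto)
  have "4 * (LI x. g x * cnj (k x)) = cr (2 * pi) * (4 * (LI x. f x * cnj (h x)))"
    unfolding Lp_norm2_polarization[OF g k] Lp_norm2_polarization[OF fg(2) hk(2)] P P[of 1, simplified]
    by (simp add: algebra_simps)
  then show ?thesis by simp
qed

text \<open>Checked on Gaussians: translating the argument of a Gaussian moves its centre and
  produces the matching phase.\<close>

lemma is_fourier_modulation:
  assumes fg: "is_fourier f g" and f: "Lp 2 f"
  shows "is_fourier (\<lambda>x. cis (eta * x) * f x) (\<lambda>xi. g (xi - eta))"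
proof (rule gauss_test_is_fourier)
  note [measurable] = Lp_measurable[OF f]
  have g: "Lp 2 g" using is_fourier_Lp2[OF fg] f by simp
  have [measurable]: "(\<lambda>x. cis (eta * x)) \<in> lmeas" by (rule borel_imp_lebesgue) measurable
  show "Lp 2 (\<lambda>x. cis (eta * x) * f x)"
    by (rule Lp_bound[OF _ f, where c = 1]) (auto simp: norm_mult)
  show "Lp 2 (\<lambda>xi. g (xi - eta))" by (rule Lp_shift[OF g])
  fix t
  have ge: "gauss 0 t (xi + eta) = cis (t * eta) * gauss (- eta) t xi" for xi
    by (simp add: gauss_def cis_mult distrib_left add.commute)
  have "(LI xi. g (xi - eta) * gauss 0 t xi) = (LI xi. g (xi - eta) * gauss 0 t ((xi - eta) + eta))" by simp
  also have "... = (LI xi. g xi * gauss 0 t (xi + eta))"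
    by (rule integral_shift[of "\<lambda>xi. g xi * gauss 0 t (xi + eta)" eta])
  also have "... = cis (t * eta) * (LI xi. g xi * gauss (- eta) t xi)"
    by (simp add: ge mult.left_commute[of _ "cis (t * eta)"])
  also have "(LI xi. g xi * gauss (- eta) t xi) = (LI x. f x * fourier_integral (gauss (- eta) t) x)"
    by (rule is_fourierD[OF fg schwartz_gauss])
  also have "cis (t * eta) * ... = (LI x. cis (t * eta) * (f x * fourier_integral (gauss (- eta) t) x))" by simp
  also have "... = (LI x. cis (eta * x) * f x * fourier_integral (gauss 0 t) x)"
  proof (rule B_integral_cong[OF refl])
    fix x
    have "cis (t * eta) * gauss t eta x * cis (- eta * t) = cis (eta * x) * gauss t 0 x"
    proof -
      have "cis (t * eta) * cis (- eta * t) = 1" by (simp add: cis_mult mult.commute)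
      then have "cis (t * eta) * gauss t eta x * cis (- eta * t) = gauss t eta x"
        by (metis mult.commute mult.left_commute mult.right_neutral)
      then show ?thesis by (simp add: gauss_def mult.commute)
    qed
    then show "cis (t * eta) * (f x * fourier_integral (gauss (- eta) t) x) = cis (eta * x) * f x * fourier_integral (gauss 0 t) x"
      unfolding fourier_integral_gauss by (simp add: mult_ac)
  qed
  finally show "(LI x. g (x - eta) * gauss 0 t x) = (LI x. cis (eta * x) * f x * fourier_integral (gauss 0 t) x)" .
qed

section \<open>Differentiable symbols\<close>

text \<open>
  Only bounds on \<open>S\<close> are recorded, not the derivatives themselves: bounds for products and, uniformly in
  the parameter, for the Bessel weights then follow by induction on \<open>n\<close>.
\<close>

primrec Cn :: "nat \<Rightarrow> real set \<Rightarrow> real \<Rightarrow> (real \<Rightarrow> real) \<Rightarrow> bool" where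
  "Cn 0 S B f \<longleftrightarrow> continuous_on UNIV f \<and> (\<forall>x\<in>S. \<bar>f x\<bar> \<le> B)"
| "Cn (Suc n) S B f \<longleftrightarrow> (\<forall>x\<in>S. \<bar>f x\<bar> \<le> B) \<and> (\<exists>f'. (\<forall>x. (f has_real_derivative f' x) (at x)) \<and> Cn n S B f')"

lemma Cn_continuous: "Cn n S B f \<Longrightarrow> continuous_on UNIV f"
  by (cases n) (auto intro!: continuous_at_imp_continuous_on intro: DERIV_isCont)

lemma Cn_bound: "Cn n S B f \<Longrightarrow> x \<in> S \<Longrightarrow> \<bar>f x\<bar> \<le> B"
  by (cases n) auto

lemma Cn_SucI:
  "(\<And>x. x \<in> S \<Longrightarrow> \<bar>f x\<bar> \<le> B) \<Longrightarrow> (\<And>x. (f has_real_derivative f' x) (at x)) \<Longrightarrow> Cn n S B f' \<Longrightarrow> Cn (Suc n) S B f"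
  by auto

lemma Cn_mono: "Cn n S B f \<Longrightarrow> B \<le> B' \<Longrightarrow> T \<subseteq> S \<Longrightarrow> Cn n T B' f"
proof (induction n arbitrary: f)
  have b: "\<bar>f x\<bar> \<le> B'" if "Cn n S B f" "B \<le> B'" "T \<subseteq> S" "x \<in> T" for n f x
    by (rule order_trans[OF Cn_bound[OF that(1) subsetD[OF that(3,4)]] that(2)])
  {
    case 0
    then show ?case using b[OF 0] by auto
  next
    case (Suc n)
    then obtain f' where d: "\<And>x. (f has_real_derivative f' x) (at x)" "Cn n S B f'" by auto
    show ?case by (rule Cn_SucI[OF b[OF Suc.prems] d(1) Suc.IH[OF d(2) Suc.prems(2,3)]])
  }
qed

lemma Cn_Suc: "Cn (Suc n) S B f \<Longrightarrow> Cn n S B f"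
proof (induction n arbitrary: f)
  case 0
  then show ?case using Cn_continuous[OF 0] by simp
next
  case (Suc n)
  then obtain f' where "\<forall>x. (f has_real_derivative f' x) (at x)" "Cn (Suc n) S B f'" by auto
  then show ?case using Suc.IH[of f'] Suc.prems by auto
qed

lemma Cn_const: "Cn n S \<bar>c\<bar> (\<lambda>x. c)"
proof (induction n arbitrary: c)
  case (Suc n)
  show ?case using Cn_mono[OF Suc[of 0], of "\<bar>c\<bar>" S] by (auto intro!: exI[of _ "\<lambda>x. 0"])
qed simp

lemma Cn_id:
  assumes "K \<ge> 1" "\<And>x. x \<in> S \<Longrightarrow> \<bar>x\<bar> \<le> K"
  shows "Cn n S K (\<lambda>x. x)"
proof (cases n)
  case (Suc k)
  then show ?thesis using Cn_mono[OF Cn_const[of k S 1], of K S] assms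
    by (auto intro!: exI[of _ "\<lambda>x. 1"] derivative_eq_intros)
qed (use assms in auto)

lemma Cn_add: "Cn n S A f \<Longrightarrow> Cn n S B g \<Longrightarrow> Cn n S (A + B) (\<lambda>x. f x + g x)"
proof (induction n arbitrary: f g)
  case 0
  then show ?case by (auto intro!: continuous_intros order_trans[OF abs_triangle_ineq add_mono])
next
  case (Suc n)
  then obtain f' g' where d: "\<forall>x. (f has_real_derivative f' x) (at x)" "Cn n S A f'"
    "\<forall>x. (g has_real_derivative g' x) (at x)" "Cn n S B g'" by auto
  have "\<forall>x. ((\<lambda>x. f x + g x) has_real_derivative f' x + g' x) (at x)" using d by (auto intro!: derivative_intros)
  then show ?case using Suc.IH[OF d(2,4)] Suc.prems by (auto intro!: order_trans[OF abs_triangle_ineq add_mono])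
qed

text \<open>By Leibniz' rule each differentiation doubles the number of products, whence the factor
  \<open>2 ^ n\<close>.\<close>

lemma Cn_mult:
  assumes "0 \<le> A" "0 \<le> B"
  shows "Cn n S A f \<Longrightarrow> Cn n S B g \<Longrightarrow> Cn n S (2 ^ n * A * B) (\<lambda>x. f x * g x)"
proof (induction n arbitrary: f g)
  case 0
  then show ?case using assms by (auto intro!: continuous_intros mult_mono simp: abs_mult)
next
  case (Suc n)
  then obtain f' g' where d: "\<forall>x. (f has_real_derivative f' x) (at x)" "Cn n S A f'"
    "\<forall>x. (g has_real_derivative g' x) (at x)" "Cn n S B g'" by auto
  have "\<forall>x. ((\<lambda>x. f x * g x) has_real_derivative f' x * g x + f x * g' x) (at x)"
    using d by (auto intro!: derivative_eq_intros)
  moreover have "Cn n S (2 ^ Suc n * A * B) (\<lambda>x. f' x * g x + f x * g' x)"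
    using Cn_add[OF Suc.IH[OF d(2) Cn_Suc[OF Suc.prems(2)]] Suc.IH[OF Cn_Suc[OF Suc.prems(1)] d(4)]] by (simp add: mult_ac)
  moreover have "\<bar>f x * g x\<bar> \<le> 2 ^ Suc n * A * B" if "x \<in> S" for x
  proof -
    have "\<bar>f x * g x\<bar> \<le> A * B" unfolding abs_mult using Suc.prems that assms by (intro mult_mono) auto
    also have "... \<le> 2 ^ Suc n * (A * B)" using mult_right_mono[OF one_le_power[of 2 "Suc n"], of "A * B"] assms by simp
    finally show ?thesis by (simp add: mult.assoc)
  qed
  ultimately show ?case by (intro Cn_SucI[where f' = "\<lambda>x. f' x * g x + f x * g' x"]) auto
qed

lemma Cn_cmult: "0 \<le> A \<Longrightarrow> Cn n S A f \<Longrightarrow> Cn n S (2 ^ n * \<bar>c\<bar> * A) (\<lambda>x. c * f x)"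
  using Cn_mult[OF abs_ge_zero _ Cn_const] by blast

text \<open>With S empty, \<open>Cn\<close> expresses differentiability alone; bounds come back from
  the continuity of the derivatives on a compact set.\<close>

lemma Cn_compact:
  assumes "compact S"
  shows "Cn n {} 0 f \<Longrightarrow> \<exists>B\<ge>0. Cn n S B f"
proof (induction n arbitrary: f)
  have b: "\<exists>B\<ge>0. \<forall>x\<in>S. \<bar>f x\<bar> \<le> B" if "continuous_on UNIV f" for f :: "real \<Rightarrow> real"
  proof -
    have "bounded (f ` S)" using that assms by (meson compact_continuous_image compact_imp_bounded continuous_on_subset subset_UNIV)
    then obtain B where "\<forall>x\<in>S. \<bar>f x\<bar> \<le> B" by (auto simp: bounded_iff)
    then show ?thesis by (intro exI[of _ "max B 0"]) (auto intro: max.coboundedI1)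
  qed
  {
    case 0
    then show ?case using b[of f] by auto
  next
    case (Suc n)
    then obtain f' where d: "\<forall>x. (f has_real_derivative f' x) (at x)" "Cn n {} 0 f'" by auto
    obtain B1 B2 where B: "B1 \<ge> 0" "Cn n S B1 f'" "B2 \<ge> 0" "\<forall>x\<in>S. \<bar>f x\<bar> \<le> B2"
      using Suc.IH[OF d(2)] b[OF Cn_continuous[OF Suc.prems]] by blast
    have "Cn (Suc n) S (max B1 B2) f"
      using d(1) Cn_mono[OF B(2), of "max B1 B2" S] B(4) by (auto intro: max.coboundedI2)
    then show ?case using B(1) by (intro exI[of _ "max B1 B2"]) auto
  }
qed

lemma Cn_inverse:
  assumes nz: "\<And>x. f x \<noteq> 0"
  shows "Cn n {} 0 f \<Longrightarrow> Cn n {} 0 (\<lambda>x. 1 / f x)"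
proof (induction n)
  case 0
  then show ?case using nz by (auto intro!: continuous_intros)
next
  case (Suc n)
  then obtain f' where d: "\<forall>x. (f has_real_derivative f' x) (at x)" "Cn n {} 0 f'" by auto
  note i = Suc.IH[OF Cn_Suc[OF Suc.prems]]
  have "Cn n {} 0 (\<lambda>x. (- 1) * (f' x * (1 / f x * (1 / f x))))"
    using Cn_cmult[OF _ Cn_mult[OF _ _ d(2) Cn_mult[OF _ _ i i]], of "- 1"] by simp
  moreover have "((\<lambda>x. 1 / f x) has_real_derivative (- 1) * (f' x * (1 / f x * (1 / f x)))) (at x)" for x
    using d(1) nz[of x] by (auto intro!: derivative_eq_intros)
  ultimately show ?case by (intro Cn_SucI[where f' = "\<lambda>x. (- 1) * (f' x * (1 / f x * (1 / f x)))"]) auto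
qed

lemma Cn_dilate: "Cn n {} 0 f \<Longrightarrow> Cn n {} 0 (\<lambda>x. f (2 * x))"
proof (induction n arbitrary: f)
  case 0
  then show ?case by (auto intro!: continuous_on_compose2[of UNIV f] continuous_intros)
next
  case (Suc n)
  then obtain f' where d: "\<forall>x. (f has_real_derivative f' x) (at x)" "Cn n {} 0 f'" by auto
  have "((\<lambda>x. f (2 * x)) has_real_derivative 2 * f' (2 * x)) (at x)" for x
  proof -
    have "((\<lambda>x. 2 * x) has_real_derivative 2) (at x)" by (auto intro!: derivative_eq_intros)
    from DERIV_chain2[of f _ "\<lambda>x. 2 * x", OF d(1)[rule_format] this] show ?thesis by (simp add: mult.commute)
  qed
  then show ?case using Cn_cmult[OF _ Suc.IH[OF d(2)], of 2] by (intro Cn_SucI[where f' = "\<lambda>x. 2 * f' (2 * x)"]) auto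
qed

text \<open>Away from 0 the function is a monomial or 0; at 0 the difference quotient is at most
  |h|^(n+1). Powers of the positive part thus give functions of compact support with any prescribed
  number of derivatives.\<close>

lemma pos_power_derivative:
  fixes x :: real
  shows "((\<lambda>t. max 0 t ^ Suc (Suc n)) has_real_derivative real (Suc (Suc n)) * max 0 x ^ Suc n) (at x)"
proof (cases "x = 0")
  case True
  have "((\<lambda>h. (max 0 (0 + h) ^ Suc (Suc n) - max 0 0 ^ Suc (Suc n)) / h) \<longlongrightarrow> (0::real)) (at 0)"
  proof (rule Lim_null_comparison)
    show "\<forall>\<^sub>F h in at 0. norm ((max 0 (0 + h) ^ Suc (Suc n) - max 0 0 ^ Suc (Suc n)) / h) \<le> \<bar>h\<bar> ^ Suc n"
    proof (rule always_eventually, rule allI)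
      fix h :: real
      show "norm ((max 0 (0 + h) ^ Suc (Suc n) - max 0 0 ^ Suc (Suc n)) / h) \<le> \<bar>h\<bar> ^ Suc n"
      proof (cases "h > 0")
        case False
        then have "norm ((max 0 (0 + h) ^ Suc (Suc n) - max 0 0 ^ Suc (Suc n)) / h) = 0" by (simp add: max_def)
        also have "0 \<le> \<bar>h\<bar> ^ Suc n" by (rule zero_le_power) simp
        finally show ?thesis .
      qed (simp add: max_def abs_mult)
    qed
    have "((\<lambda>h::real. \<bar>h\<bar> ^ Suc n) \<longlongrightarrow> \<bar>0\<bar> ^ Suc n) (at 0)" by (intro tendsto_intros)
    then show "((\<lambda>h::real. \<bar>h\<bar> ^ Suc n) \<longlongrightarrow> 0) (at 0)" by simp
  qed
  then show ?thesis using True by (simp add: DERIV_def del: power_Suc)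
next
  case False
  then consider "x > 0" | "x < 0" by linarith
  then show ?thesis
  proof cases
    case 1
    have e: "\<forall>\<^sub>F t in nhds x. max 0 t ^ Suc (Suc n) = t ^ Suc (Suc n)"
      using eventually_nhds_in_open[of "{0<..}" x] 1 by (auto elim!: eventually_mono)
    have "((\<lambda>t. t ^ Suc (Suc n)) has_real_derivative real (Suc (Suc n)) * x ^ Suc n) (at x)"
      using DERIV_pow[of "Suc (Suc n)" x UNIV] by simp
    then show ?thesis using DERIV_cong_ev[OF refl e refl] 1 by simp
  next
    case 2
    have e: "\<forall>\<^sub>F t in nhds x. max 0 t ^ Suc (Suc n) = 0"
      using eventually_nhds_in_open[of "{..<0}" x] 2 by (auto elim!: eventually_mono)
    show ?thesis using DERIV_cong_ev[OF refl e refl] 2 by simp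
  qed
qed

lemma Cn_pos_power:
  fixes s c :: real
  shows "Cn n {} 0 (\<lambda>x. max 0 (c + s * x\<^sup>2) ^ Suc n)"
proof (induction n)
  case (Suc n)
  let ?d = "\<lambda>x. (real (Suc (Suc n)) * (2 * s)) * (max 0 (c + s * x\<^sup>2) ^ Suc n * x)"
  have "((\<lambda>x. c + s * x\<^sup>2) has_real_derivative 2 * s * x) (at x)" for x by (auto intro!: derivative_eq_intros)
  from DERIV_chain2[OF pos_power_derivative this]
  have "((\<lambda>x. max 0 (c + s * x\<^sup>2) ^ Suc (Suc n)) has_real_derivative ?d x) (at x)" for x
    by (rule DERIV_cong) (simp only: mult_ac)
  moreover have "Cn n {} 0 ?d"
    using Cn_cmult[OF _ Cn_mono[OF Cn_mult[OF _ _ Suc Cn_id[of 1 "{}"]], of 0 "{}"]] by simp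
  ultimately show ?case by (intro Cn_SucI[where f' = ?d]) auto
qed (auto intro!: continuous_intros)

section \<open>The Littlewood-Paley cut-offs\<close>

text \<open>A quotient a / (a + b) with a supported in |x| \<le> 2 and b in |x| \<ge> 1, hence 1 on
  [-1, 1] and 0 beyond 2. The exponent 4 makes it three times continuously differentiable.\<close>

definition phi :: "real \<Rightarrow> real" where
  "phi x = max 0 (4 + (- 1) * x\<^sup>2) ^ 4 * (1 / (max 0 (4 + (- 1) * x\<^sup>2) ^ 4 + max 0 (- 1 + 1 * x\<^sup>2) ^ 4))"

lemma phi_denominator: "max 0 (4 + (- 1) * x\<^sup>2) ^ 4 + max 0 (- 1 + 1 * x\<^sup>2) ^ 4 > (0::real)"
proof (cases "x\<^sup>2 < 4")
  case True
  then have "max 0 (4 + (- 1) * x\<^sup>2) ^ 4 > 0" by (intro zero_less_power) auto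
  then show ?thesis by (intro add_pos_nonneg) auto
next
  case False
  then have "max 0 (- 1 + 1 * x\<^sup>2) ^ 4 > 0" by (intro zero_less_power) auto
  then show ?thesis by (intro add_nonneg_pos) auto
qed

lemma phi_0: "\<bar>x\<bar> \<ge> 2 \<Longrightarrow> phi x = 0"
proof -
  assume "\<bar>x\<bar> \<ge> 2"
  then have "x\<^sup>2 \<ge> 4" using power_mono[of 2 "\<bar>x\<bar>" 2] by simp
  then show ?thesis by (simp add: phi_def)
qed

lemma phi_1: "\<bar>x\<bar> \<le> 1 \<Longrightarrow> phi x = 1"
proof -
  assume "\<bar>x\<bar> \<le> 1"
  then have "x\<^sup>2 \<le> 1" by (simp add: abs_square_le_1)
  then show ?thesis by (simp add: phi_def)
qed

lemma phi_range: "0 \<le> phi x" "phi x \<le> 1"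
proof -
  have a: "max 0 (4 + (- 1) * x\<^sup>2) ^ 4 \<ge> 0" "max 0 (- 1 + 1 * x\<^sup>2) ^ 4 \<ge> 0" by auto
  show "0 \<le> phi x" unfolding phi_def using phi_denominator[of x] a by (intro mult_nonneg_nonneg) auto
  show "phi x \<le> 1" unfolding phi_def using phi_denominator[of x] a by (simp add: divide_le_eq_1)
qed

lemma phi_even: "phi (- x) = phi x" by (simp add: phi_def)

lemma phi_Cn: "Cn 3 {} 0 phi"
proof -
  have p4: "Cn 3 {} 0 (\<lambda>x. max 0 (c + s * x\<^sup>2) ^ 4)" for c s :: real
    using Cn_pos_power[of 3 c s] by simp
  have nz: "max 0 (4 + (- 1) * x\<^sup>2) ^ 4 + max 0 (- 1 + 1 * x\<^sup>2) ^ 4 \<noteq> (0::real)" for x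
    using phi_denominator[of x] by simp
  have "Cn 3 {} 0 (\<lambda>x. max 0 (4 + (- 1) * x\<^sup>2) ^ 4 + max 0 (- 1 + 1 * x\<^sup>2) ^ 4)"
    using Cn_add[OF p4[of 4 "- 1"] p4[of "- 1" 1]] by simp
  from Cn_mult[OF _ _ p4[of 4 "- 1"] Cn_inverse[OF nz this]]
  show ?thesis unfolding phi_def[abs_def] by simp
qed

text \<open>Three derivatives, because the kernel is to be bounded by a multiple of 1/(1 + z^2) even
  after multiplication by z. Since S is closed, the derivatives vanish off S as well.\<close>

definition cutoff :: "real set \<Rightarrow> real \<Rightarrow> (real \<Rightarrow> real) \<Rightarrow> bool" where
  "cutoff S B f \<longleftrightarrow> closed S \<and> 0 \<le> B \<and> Cn 3 S B f \<and> (\<forall>x. x \<notin> S \<longrightarrow> f x = 0)"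

lemma cutoff_mult:
  assumes "cutoff S B f" "Cn 3 S G g" "0 \<le> G"
  shows "cutoff S (8 * B * G) (\<lambda>x. f x * g x)"
  using assms Cn_mult[of B G 3 S f g] unfolding cutoff_def by simp

definition psi :: "real \<Rightarrow> real" where "psi x = phi x - phi (2 * x)"

lemma phi_cutoff: "\<exists>B. cutoff {-2..2} B phi"
  using Cn_compact[OF _ phi_Cn, of "{-2..2}"] phi_0 unfolding cutoff_def by (fastforce simp: abs_if split: if_splits)

lemma psi_0: "\<bar>x\<bar> \<ge> 2 \<or> \<bar>x\<bar> \<le> 1/2 \<Longrightarrow> psi x = 0"
  unfolding psi_def by (auto simp: phi_0 phi_1)

lemma psi_cutoff: "\<exists>B. cutoff ({-2..-1/2} \<union> {1/2..2}) B psi"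
proof -
  let ?S = "{-2..-1/2} \<union> {1/2..2::real}"
  have "Cn 3 {} 0 (\<lambda>x. phi x + (- 1) * phi (2 * x))"
    using Cn_add[OF phi_Cn Cn_cmult[OF _ Cn_dilate[OF phi_Cn], of "- 1"]] by simp
  then have "Cn 3 {} 0 psi" by (simp add: psi_def[abs_def])
  then obtain B where "B \<ge> 0" "Cn 3 ?S B psi" using Cn_compact[of ?S 3 psi] by (auto simp: compact_Un)
  moreover have "psi x = 0" if "x \<notin> ?S" for x using that by (intro psi_0) (simp, arith)
  ultimately show ?thesis unfolding cutoff_def by (intro exI[of _ B]) (auto intro!: closed_Un)
qed

lemma powr_bound_5:
  assumes "1 / 5 \<le> x" "x \<le> (5::real)" "\<bar>c\<bar> \<le> d"
  shows "x powr c \<le> 5 powr d"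
proof -
  have x0: "x > 0" using assms by linarith
  have l: "\<bar>ln x\<bar> \<le> ln 5"
  proof -
    have "ln x \<le> ln 5" using assms x0 by simp
    moreover have "ln (1 / 5) \<le> ln x" using assms x0 by (subst ln_le_cancel_iff) auto
    ultimately show ?thesis by (simp add: ln_div)
  qed
  have "c * ln x \<le> \<bar>c\<bar> * \<bar>ln x\<bar>" by (metis abs_ge_self abs_mult)
  also have "... \<le> d * ln 5" using assms l by (intro mult_mono) auto
  finally show ?thesis using x0 by (simp add: powr_def)
qed

text \<open>Rescaling the k-th annulus to unit size turns 1 + xi^2 into a multiple of l + x^2 with l
  = 4^(-k), and the bounds must not depend on k. On the rescaled supports l + x^2 lies between 1/5
  and 5, which is the origin of the set. Each derivative lowers b by one, so b is arbitrary in the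
  induction.\<close>

lemma Cn_bessel:
  "\<exists>G\<ge>0. \<forall>l>0. Cn n {x. 1 / 5 \<le> l + x\<^sup>2 \<and> l + x\<^sup>2 \<le> 5 \<and> \<bar>x\<bar> \<le> 2} G (\<lambda>x. (l + x\<^sup>2) powr b)"
proof (induction n arbitrary: b)
  have pos: "l + x\<^sup>2 > 0" if "l > 0" for l x :: real using that by (simp add: add_pos_nonneg)
  {
    case 0
    have "continuous_on UNIV (\<lambda>x. (l + x\<^sup>2) powr b)" if "l > 0" for l
      using pos[OF that] by (intro continuous_intros) (auto simp: less_imp_neq[symmetric])
    then show ?case by (intro exI[of _ "5 powr \<bar>b\<bar>"]) (auto intro!: powr_bound_5)
  next
    case (Suc n)
    obtain G where G: "G \<ge> 0" "\<And>l. l > 0 \<Longrightarrow> Cn n {x. 1 / 5 \<le> l + x\<^sup>2 \<and> l + x\<^sup>2 \<le> 5 \<and> \<bar>x\<bar> \<le> 2} G (\<lambda>x. (l + x\<^sup>2) powr (b - 1))"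
      using Suc[of "b - 1"] by blast
    define H where "H = 2 ^ n * \<bar>2 * b\<bar> * (2 ^ n * 2 * G) + 5 powr \<bar>b\<bar>"
    have H: "0 \<le> H" using G(1) by (simp add: H_def)
    show ?case
    proof (intro exI[of _ H] conjI H allI impI)
      fix l :: real assume l: "l > 0"
      let ?S = "{x. 1 / 5 \<le> l + x\<^sup>2 \<and> l + x\<^sup>2 \<le> 5 \<and> \<bar>x\<bar> \<le> 2}" and ?d = "\<lambda>x. (2 * b) * (x * (l + x\<^sup>2) powr (b - 1))"
      have "((\<lambda>x. l + x\<^sup>2) has_real_derivative 2 * x) (at x)" for x by (auto intro!: derivative_eq_intros)
      from DERIV_chain2[OF has_real_derivative_powr[OF pos[OF l]] this]
      have d: "((\<lambda>x. (l + x\<^sup>2) powr b) has_real_derivative ?d x) (at x)" for x by (rule DERIV_cong) (simp add: mult_ac)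
      have "Cn n ?S (2 ^ n * 2 * G) (\<lambda>x. x * (l + x\<^sup>2) powr (b - 1))"
        by (rule Cn_mult[OF _ G(1) Cn_id G(2)[OF l]]) auto
      from Cn_mono[OF Cn_cmult[OF _ this, of "2 * b"], of H ?S] have "Cn n ?S H ?d" using G(1) by (simp add: H_def)
      moreover have "\<bar>(l + x\<^sup>2) powr b\<bar> \<le> H" if "x \<in> ?S" for x
        using powr_bound_5[of "l + x\<^sup>2" b "\<bar>b\<bar>"] that G(1) by (auto simp: H_def intro: add_increasing)
      ultimately show "Cn (Suc n) ?S H (\<lambda>x. (l + x\<^sup>2) powr b)" using d by (intro Cn_SucI[where f' = ?d]) auto
    qed
  }
qed

text \<open>The second function carries the factor x of a spatial derivative, which is bounded by 2
  on the rescaled support.\<close>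

lemma cutoff_bessel:
  assumes f: "cutoff S B f" and S: "S \<subseteq> {-2..2}"
  shows "\<exists>B'\<ge>0. \<forall>l. 0 < l \<longrightarrow> (\<forall>x\<in>S. 1 / 5 \<le> l + x\<^sup>2 \<and> l + x\<^sup>2 \<le> 5) \<longrightarrow>
     cutoff S B' (\<lambda>x. f x * (l + x\<^sup>2) powr b) \<and> cutoff S B' (\<lambda>x. x * (f x * (l + x\<^sup>2) powr b))"
proof -
  obtain G where G: "G \<ge> 0" "\<And>l. l > 0 \<Longrightarrow> Cn 3 {x. 1 / 5 \<le> l + x\<^sup>2 \<and> l + x\<^sup>2 \<le> 5 \<and> \<bar>x\<bar> \<le> 2} G (\<lambda>x. (l + x\<^sup>2) powr b)"
    using Cn_bessel by blast
  have B0: "B \<ge> 0" using f by (simp add: cutoff_def)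
  have x2: "Cn 3 S 2 (\<lambda>x. x)" by (rule Cn_id) (use S in \<open>auto simp: abs_le_iff\<close>)
  have mono: "cutoff S B2 h" if "cutoff S B1 h" "B1 \<le> B2" for B1 B2 h
    using that Cn_mono[of 3 S B1 h B2 S] unfolding cutoff_def by auto
  show ?thesis
  proof (intro exI[of _ "8 * (8 * B * G) * 2"] conjI allI impI)
    show "0 \<le> 8 * (8 * B * G) * 2" using B0 G by simp
    fix l :: real assume l: "0 < l" and S5: "\<forall>x\<in>S. 1 / 5 \<le> l + x\<^sup>2 \<and> l + x\<^sup>2 \<le> 5"
    have c1: "cutoff S (8 * B * G) (\<lambda>x. f x * (l + x\<^sup>2) powr b)"
      by (rule cutoff_mult[OF f Cn_mono[OF G(2)[OF l] order_refl] G(1)]) (use S5 S in \<open>auto simp: abs_le_iff\<close>)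
    show "cutoff S (8 * (8 * B * G) * 2) (\<lambda>x. f x * (l + x\<^sup>2) powr b)"
      by (rule mono[OF c1]) (use B0 G in simp)
    show "cutoff S (8 * (8 * B * G) * 2) (\<lambda>x. x * (f x * (l + x\<^sup>2) powr b))"
      using cutoff_mult[OF c1 x2] by (simp add: mult_ac)
  qed
qed

section \<open>Fourier multipliers with compactly supported symbols\<close>

lemma fourier_is_fourier: "is_fourier f g \<Longrightarrow> is_fourier f (fourier f)"
  unfolding fourier_def using someI[of "is_fourier f" g] by simp

lemma fourier_L2:
  assumes "Lp 2 f"
  shows "is_fourier f (fourier f)" "Lp 2 (fourier f)"
proof -
  obtain g where "is_fourier f g" using L2_fourier_exists[OF assms] by blast
  then show "is_fourier f (fourier f)" by (rule fourier_is_fourier)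
  then show "Lp 2 (fourier f)" using is_fourier_Lp2 assms by blast
qed

lemma fourier_AE_eq: "is_fourier f g \<Longrightarrow> AEL x. fourier f x = g x"
  using is_fourier_unique fourier_is_fourier by blast

lemma fourier_cong_AE:
  assumes "AEL x. f x = g x"
  shows "fourier f = fourier g"
proof -
  have "AEL x. g x = f x" using assms by eventually_elim simp
  then have "is_fourier f h = is_fourier g h" for h
    using is_fourier_cong_AE[of f h g h] is_fourier_cong_AE[of g h f h] assms by auto
  then show ?thesis by (simp add: fourier_def)
qed

definition symbol :: "(real \<Rightarrow> complex) \<Rightarrow> bool" where
  "symbol a \<longleftrightarrow> a \<in> borel_measurable borel \<and> (\<exists>B. \<forall>xi. cmod (a xi) \<le> B) \<and> (\<exists>R. \<forall>xi. \<bar>xi\<bar> > R \<longrightarrow> a xi = 0)"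

definition inv_kernel :: "(real \<Rightarrow> complex) \<Rightarrow> real \<Rightarrow> complex" where
  "inv_kernel a x = cr (1 / (2 * pi)) * (LI eta. a eta * cis (x * eta))"

text \<open>For a \<open>symbol\<close> and f in L^2 the integral converges absolutely at every x.
  Values are thus determined pointwise and not only up to null sets, and composition and linearity
  are equalities of functions.\<close>

definition mult_op :: "(real \<Rightarrow> complex) \<Rightarrow> (real \<Rightarrow> complex) \<Rightarrow> real \<Rightarrow> complex" where
  "mult_op a f x = cr (1 / (2 * pi)) * (LI eta. a eta * fourier f eta * cis (x * eta))"

lemma symbol_measurable: "symbol a \<Longrightarrow> a \<in> borel_measurable borel"
  by (simp add: symbol_def)

lemma symbol_bound:
  assumes "symbol a"
  obtains B where "B \<ge> 0" "\<And>xi. cmod (a xi) \<le> B"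
proof -
  obtain B where B: "\<And>xi. cmod (a xi) \<le> B" using assms by (auto simp: symbol_def)
  show thesis by (rule that[OF order_trans[OF norm_ge_zero B[of 0]] B])
qed

lemma Lp2_indicator: "Lp 2 (indicator {a..b::real} :: real \<Rightarrow> complex)"
proof -
  have "(\<lambda>x. (cmod (indicator {a..b} x))\<^sup>2) = (indicator {a..b} :: real \<Rightarrow> real)"
    by (auto simp: indicator_def)
  then show ?thesis by (cases "a \<le> b") (simp_all add: Lp2_iff)
qed

lemma symbol_kernel:
  assumes "symbol a"
  shows "conv_kernel a"
proof -
  obtain B where B: "\<And>xi. cmod (a xi) \<le> B" using assms by (auto simp: symbol_def)
  obtain R where R: "\<And>xi. \<bar>xi\<bar> > R \<Longrightarrow> a xi = 0" using assms by (auto simp: symbol_def)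
  have "integ a"
  proof (rule B_integrable_bound)
    show "integ (\<lambda>x. B * indicator {-R..R} x :: real)" by (cases "- R \<le> R") simp_all
    show "a \<in> lmeas" using symbol_measurable[OF assms] by simp
    show "AEL x. norm (a x) \<le> norm (B * indicator {-R..R} x)"
    proof (rule AE_I2)
      fix x
      show "norm (a x) \<le> norm (B * indicator {-R..R} x)"
        using R[of x] order_trans[OF B abs_ge_self] by (cases "\<bar>x\<bar> > R") (auto simp: indicator_def abs_le_iff)
    qed
  qed
  then show ?thesis unfolding conv_kernel_def using symbol_measurable[OF assms] B by blast
qed

lemma symbol_mult_L2:
  assumes "symbol a" "Lp 2 g"
  shows "Lp 2 (\<lambda>xi. a xi * g xi)" "integ (\<lambda>xi. a xi * g xi)"
proof -
  obtain B where B: "B \<ge> 0" "\<And>xi. cmod (a xi) \<le> B" using symbol_bound[OF assms(1)] by blast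
  have m: "a \<in> lmeas" using symbol_measurable[OF assms(1)] by simp
  show "Lp 2 (\<lambda>xi. a xi * g xi)"
    by (rule Lp_bound[OF _ assms(2), where c = B])
      (use m B Lp_measurable[OF assms(2)] in \<open>auto simp: norm_mult intro!: AE_I2 mult_right_mono\<close>)
  show "integ (\<lambda>xi. a xi * g xi)"
    by (rule CS_integrable[OF kernel_Lp[OF symbol_kernel[OF assms(1)]] assms(2)]) simp
qed

lemma mult_op_fourier:
  assumes a: "symbol a" and f: "Lp 2 f"
  shows "is_fourier (mult_op a f) (\<lambda>xi. a xi * fourier f xi)" "Lp 2 (mult_op a f)"
proof -
  let ?g = "\<lambda>xi. a xi * fourier f xi"
  note g = symbol_mult_L2[OF a fourier_L2(2)[OF f]]
  have "is_fourier (\<lambda>x. cr (1 / (2 * pi)) * fourier_integral ?g (- x)) ?g"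
    by (rule L2_fourier_inverse[OF g(1) is_fourier_L1[OF g(2,1)] Plancherel_L1(1)[OF g(2,1)]])
  moreover have "(\<lambda>x. cr (1 / (2 * pi)) * fourier_integral ?g (- x)) = mult_op a f"
    unfolding mult_op_def fourier_integral_def by (simp add: fun_eq_iff mult_ac)
  ultimately show "is_fourier (mult_op a f) ?g" by simp
  then show "Lp 2 (mult_op a f)" using is_fourier_Lp2 g(1) by blast
qed

lemma fourier_mult_op:
  assumes "symbol a" "Lp 2 f"
  shows "AEL xi. fourier (mult_op a f) xi = a xi * fourier f xi"
  by (rule fourier_AE_eq[OF mult_op_fourier(1)[OF assms]])

lemma mult_op_AE_symbol:
  assumes "AEL eta. a eta * fourier f eta = b eta * fourier g eta"
  shows "mult_op a f = mult_op b g"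
proof
  fix x
  have "AEL eta. a eta * fourier f eta * cis (x * eta) = b eta * fourier g eta * cis (x * eta)"
    using assms by eventually_elim simp
  from integral_cong_AE_gen[OF this] show "mult_op a f x = mult_op b g x"
    unfolding mult_op_def by simp
qed

lemma mult_op_compose:
  assumes "symbol b" "Lp 2 f"
  shows "mult_op a (mult_op b f) = mult_op (\<lambda>xi. a xi * b xi) f"
  by (rule mult_op_AE_symbol) (use fourier_mult_op[OF assms] in eventually_elim, simp)

lemma mult_op_integrable:
  assumes "symbol a" "Lp 2 f"
  shows "integ (\<lambda>eta. a eta * fourier f eta * cis (x * eta))"
  using integrable_cis_mult'(3)[OF symbol_mult_L2(2)[OF assms(1) fourier_L2(2)[OF assms(2)]], of x]
  by (simp add: mult.commute)

text \<open>Parseval's identity for f and the function whose transform is the conjugated symbol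
  modulated by x; that function is the conjugate of the kernel reflected and translated to
  x.\<close>

lemma mult_op_conv:
  assumes a: "symbol a" and f: "Lp 2 f"
  shows "mult_op a f x = conv (inv_kernel a) f x"
proof -
  define b where "b eta = cnj (a eta) * cis (- (x * eta))" for eta
  have b: "symbol b"
  proof -
    have "b \<in> borel_measurable borel" using symbol_measurable[OF a] unfolding b_def by measurable
    then show ?thesis using a unfolding symbol_def b_def by (auto simp: norm_mult)
  qed
  note bL = kernel_integrable[OF symbol_kernel[OF b]] kernel_Lp[OF symbol_kernel[OF b], of 2, simplified]
  have k: "is_fourier (\<lambda>y. cr (1 / (2 * pi)) * fourier_integral b (- y)) b"
    by (rule L2_fourier_inverse[OF bL(2) is_fourier_L1[OF bL] Plancherel_L1(1)[OF bL]])
  have ke: "cr (1 / (2 * pi)) * fourier_integral b (- y) = cnj (inv_kernel a (x - y))" for y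
  proof -
    have "fourier_integral b (- y) = (LI eta. cnj (a eta * cis ((x - y) * eta)))"
      unfolding fourier_integral_def b_def by (simp add: cis_cnj cis_mult mult_ac left_diff_distrib right_diff_distrib)
    also have "... = cnj (LI eta. a eta * cis ((x - y) * eta))" by (simp del: complex_cnj_mult)
    finally show ?thesis unfolding inv_kernel_def by simp
  qed
  have kL: "Lp 2 (\<lambda>y. cnj (inv_kernel a (x - y)))" using is_fourier_Lp2[OF k] bL(2) unfolding ke by simp
  have "(LI eta. fourier f eta * cnj (b eta)) = cr (2 * pi) * (LI y. f y * cnj (cnj (inv_kernel a (x - y))))"
    using Parseval[OF fourier_L2(1)[OF f] f k[unfolded ke] kL] .
  then show ?thesis unfolding mult_op_def conv_def b_def
    by (simp add: cis_cnj mult_ac)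
qed

lemma mult_op_zero:
  assumes "AEL eta. a eta * fourier f eta = 0"
  shows "mult_op a f x = 0"
proof -
  have "(LI eta. a eta * fourier f eta * cis (x * eta)) = (LINT eta|(lebesgue::real measure). 0)"
    by (rule integral_cong_AE_gen) (use assms in eventually_elim, simp)
  then show ?thesis by (simp add: mult_op_def)
qed

lemma fourier_diff_AE:
  assumes "Lp 2 f" "Lp 2 g"
  shows "AEL xi. fourier (\<lambda>x. f x - g x) xi = fourier f xi - fourier g xi"
  by (rule fourier_AE_eq[OF is_fourier_diff[OF fourier_L2(1)[OF assms(1)] fourier_L2(1)[OF assms(2)]]])

lemma mult_op_diff:
  assumes a: "symbol a" and f: "Lp 2 f" "Lp 2 g"
  shows "mult_op a (\<lambda>x. f x - g x) x = mult_op a f x - mult_op a g x"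
proof -
  have "(LI eta. a eta * fourier (\<lambda>x. f x - g x) eta * cis (x * eta)) =
    (LI eta. a eta * fourier f eta * cis (x * eta) - a eta * fourier g eta * cis (x * eta))"
    by (rule integral_cong_AE_gen) (use fourier_diff_AE[OF f] in eventually_elim, simp add: left_diff_distrib right_diff_distrib)
  then show ?thesis unfolding mult_op_def
    using mult_op_integrable[OF a f(1)] mult_op_integrable[OF a f(2)] by (simp add: right_diff_distrib)
qed

lemma mult_op_sum:
  assumes "\<And>i. i \<in> I \<Longrightarrow> symbol (a i)" and f: "Lp 2 f"
  shows "mult_op (\<lambda>xi. \<Sum>i\<in>I. a i xi) f x = (\<Sum>i\<in>I. mult_op (a i) f x)"
  unfolding mult_op_def using mult_op_integrable[OF assms(1) f]
  by (simp add: sum_distrib_left sum_distrib_right)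

lemma inv_kernel_measurable: "a \<in> lmeas \<Longrightarrow> inv_kernel a \<in> borel_measurable borel"
proof -
  assume a: "a \<in> lmeas"
  have "(\<lambda>x. LI eta. cis (x * eta) * a eta) \<in> borel_measurable borel"
    by (rule kernel_integral_measurable[OF a]) measurable
  then show ?thesis unfolding inv_kernel_def[abs_def] by (simp add: mult.commute)
qed

lemma inv_kernel_real:
  assumes "\<And>xi. a (- xi) = cnj (a xi)"
  shows "cnj (inv_kernel a z) = inv_kernel a z"
proof -
  have "cnj (LI eta. a eta * cis (z * eta)) = (LI eta. cnj (a eta * cis (z * eta)))" by (simp del: complex_cnj_mult)
  also have "... = (LI eta. a (0 - eta) * cis (z * (0 - eta)))" by (simp add: assms cis_cnj)
  also have "... = (LI eta. a eta * cis (z * eta))" by (rule integral_reflect)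
  finally show ?thesis by (simp add: inv_kernel_def)
qed

lemma inv_kernel_odd:
  assumes "\<And>xi. a (- xi) = - a xi"
  shows "inv_kernel a (- z) = - inv_kernel a z"
proof -
  have "(LI eta. a eta * cis (- z * eta)) = (LI eta. a (0 - eta) * cis (- z * (0 - eta)))"
    by (rule integral_reflect[symmetric])
  also have "... = - (LI eta. a eta * cis (z * eta))" by (simp add: assms)
  finally show ?thesis by (simp add: inv_kernel_def)
qed

text \<open>The symmetry of the symbol makes its kernel real. Frequency pieces of real functions
  have to be real, because the dispersive estimate is assumed for real data.\<close>

lemma mult_op_real:
  assumes a: "symbol a" "\<And>xi. a (- xi) = cnj (a xi)" and f: "Lp 2 (cplx w)"
  shows "mult_op a (cplx w) x = cr (Re (mult_op a (cplx w) x))"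
proof -
  have "cnj (mult_op a (cplx w) x) = (LI y. cnj (inv_kernel a (x - y) * cr (w y)))"
    unfolding mult_op_conv[OF a(1) f] conv_def by (simp del: complex_cnj_mult)
  also have "... = mult_op a (cplx w) x"
    unfolding mult_op_conv[OF a(1) f] conv_def by (simp add: inv_kernel_real[of a, OF a(2)])
  finally show ?thesis by (simp add: complex_eq_iff)
qed

section \<open>Kernel bounds\<close>

text \<open>A Poisson kernel up to normalisation, dilated so that its mass pi is the same at all
  scales.\<close>

definition cauchy :: "real \<Rightarrow> real \<Rightarrow> real" where
  "cauchy rho z = rho * inverse (1 + (rho * z)\<^sup>2)"

lemma integral_cauchy1: "(LI x. inverse (1 + x\<^sup>2)) = (pi::real)"
proof -
  have "(LINT x|lborel. inverse (1 + x\<^sup>2)) = pi"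
    using LBINT_inverse_1_plus_square by (simp add: interval_lebesgue_integral_def set_lebesgue_integral_def)
  then show ?thesis by (subst integral_lebesgue_lborel) auto
qed

lemma cauchy_integral:
  assumes "rho > 0"
  shows "integ (cauchy rho)" "(LI z. cauchy rho z) = pi"
proof -
  have "integ (\<lambda>z. inverse (1 + (0 + rho * z)\<^sup>2))"
    by (rule lebesgue_integrable_real_affine[OF integrable_cauchy]) (use assms in simp)
  then show "integ (cauchy rho)" by (simp add: cauchy_def[abs_def])
  have "pi = rho * (LI z. inverse (1 + (0 + rho * z)\<^sup>2))"
    using lebesgue_integral_real_affine[of rho "\<lambda>x::real. inverse (1 + x\<^sup>2)" 0] assms by (simp add: integral_cauchy1)
  then show "(LI z. cauchy rho z) = pi" by (simp add: cauchy_def)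
qed

lemma cauchy_bounds:
  assumes "rho > 0"
  shows "0 < cauchy rho z" "cauchy rho z \<le> rho"
proof -
  have p: "1 + (rho * z)\<^sup>2 \<ge> 1" by simp
  then have "inverse (1 + (rho * z)\<^sup>2) \<le> 1" by (simp add: inverse_le_1_iff)
  then show "cauchy rho z \<le> rho" using assms unfolding cauchy_def by (intro mult_left_le) auto
  have "0 < 1 + (rho * z)\<^sup>2" using p by linarith
  then show "0 < cauchy rho z" using assms by (simp add: cauchy_def)
qed

text \<open>Interpolation between the height \<open>A * rho\<close> and the mass
  \<open>A * pi\<close> of the majorant. The resulting power of rho is the loss in Bernstein's
  inequality.\<close>

lemma cauchy_kernel:
  assumes K: "K \<in> borel_measurable borel" and b: "\<And>z. cmod (K z) \<le> A * cauchy rho z" and r: "rho > 0" and A: "A \<ge> 0"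
  shows "conv_kernel K" "(LI z. cmod (K z)) \<le> A * pi"
    and "q \<ge> 1 \<Longrightarrow> Lp_norm q K \<le> A * pi * rho powr (1 - 1 / q)"
proof -
  have iA: "integ (\<lambda>z. A * cauchy rho z)" using cauchy_integral[OF r] by simp
  have Km: "K \<in> lmeas" using K by simp
  have i: "integ K"
    by (rule B_integrable_bound[OF iA Km]) (use b in \<open>auto intro!: order_trans[OF _ abs_ge_self]\<close>)
  have bd: "cmod (K z) \<le> A * rho" for z
    using order_trans[OF b mult_left_mono[OF cauchy_bounds(2)[OF r] A]] .
  show ck: "conv_kernel K" unfolding conv_kernel_def using K i bd by blast
  have "(LI z. cmod (K z)) \<le> (LI z. A * cauchy rho z)"
    by (rule integral_mono[OF integrable_norm[OF i] iA b])
  then show "(LI z. cmod (K z)) \<le> A * pi" using cauchy_integral[OF r] by simp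
  assume q: "q \<ge> 1"
  have "(LI z. cmod (K z) powr q) \<le> (LI z. A powr q * rho powr (q - 1) * cauchy rho z)"
  proof (rule integral_mono)
    show "integ (\<lambda>z. cmod (K z) powr q)" using kernel_Lp[OF ck q] by (simp add: Lp_def)
    show "integ (\<lambda>z. A powr q * rho powr (q - 1) * cauchy rho z)" using cauchy_integral[OF r] by simp
    fix z
    have "cmod (K z) powr q \<le> (A * cauchy rho z) powr q" using b q by (intro powr_mono2) auto
    also have "... = A powr q * (cauchy rho z powr (q - 1) * cauchy rho z)"
      using A cauchy_bounds(1)[OF r, of z] powr_add[of "cauchy rho z" "q - 1" 1] by (simp add: powr_mult)
    also have "... \<le> A powr q * (rho powr (q - 1) * cauchy rho z)"
      using cauchy_bounds[OF r, of z] q by (intro mult_left_mono mult_right_mono powr_mono2) auto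
    finally show "cmod (K z) powr q \<le> A powr q * rho powr (q - 1) * cauchy rho z" by (simp add: mult_ac)
  qed
  also have "... = A powr q * rho powr (q - 1) * pi" using cauchy_integral[OF r] by simp
  finally have "Lp_norm q K \<le> (A powr q * rho powr (q - 1) * pi) powr (1 / q)"
    unfolding Lp_norm_def using q by (intro powr_mono2) auto
  also have "... = A * rho powr (1 - 1 / q) * pi powr (1 / q)"
  proof -
    have "(q - 1) * (1 / q) = 1 - 1 / q" using q by (simp add: field_simps)
    then have "(rho powr (q - 1)) powr (1 / q) = rho powr (1 - 1 / q)" by (simp only: powr_powr)
    moreover have "(A powr q) powr (1 / q) = A" using A q by (simp add: powr_powr)
    ultimately show ?thesis by (simp only: powr_mult)
  qed
  also have "... \<le> A * rho powr (1 - 1 / q) * pi powr 1"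
    using q pi_ge_two A by (intro mult_left_mono powr_mono) auto
  finally show "Lp_norm q K \<le> A * pi * rho powr (1 - 1 / q)"
    by (simp add: mult_ac)
qed

text \<open>Integration by parts n times: the derivatives vanish outside S because the complement of
  S is open, and the last integral is at most B times the length 4 of [-2, 2].\<close>

lemma cutoff_fourier_decay_power:
  assumes S: "closed S" "S \<subseteq> {-2..2}" and B: "0 \<le> B"
  shows "Cn n S B f \<Longrightarrow> (\<And>x. x \<notin> S \<Longrightarrow> f x = 0) \<Longrightarrow>
    \<bar>z\<bar> ^ n * cmod (LI eta. cr (f eta) * cis (z * eta)) \<le> 4 * B"
proof (induction n arbitrary: f)
  have le: "cmod (cr (h eta) * cis (z * eta)) \<le> B * indicator {-2..2} eta"
    if "Cn n S B h" "\<And>x. x \<notin> S \<Longrightarrow> h x = 0" for n h eta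
    using Cn_bound[OF that(1), of eta] that(2)[of eta] S(2) B by (cases "eta \<in> S") (auto simp: norm_mult)
  have i: "integ (\<lambda>eta::real. B * indicator {-2..2} eta :: real)" by simp
  have int: "integ (\<lambda>eta. cr (h eta) * cis (z * eta))"
    if h: "Cn n S B h" "\<And>x. x \<notin> S \<Longrightarrow> h x = 0" for n h
  proof (rule B_integrable_bound[OF i])
    have [measurable]: "h \<in> borel_measurable borel" by (rule borel_measurable_continuous_onI[OF Cn_continuous[OF h(1)]])
    show "(\<lambda>eta. cr (h eta) * cis (z * eta)) \<in> lmeas" by (rule borel_imp_lebesgue) measurable
    show "AEL eta. norm (cr (h eta) * cis (z * eta)) \<le> norm (B * indicator {-2..2} eta)"
      by (intro AE_I2 order_trans[OF le[OF h]]) auto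
  qed
  {
    case 0
    have "cmod (LI eta. cr (f eta) * cis (z * eta)) \<le> (LI eta. B * indicator {-2..2::real} eta)"
      using integrable_norm[OF int[OF 0]] by (intro order_trans[OF integral_norm_bound] integral_mono[OF _ i le[OF 0]])
    then show ?case by simp
  next
    case (Suc n)
    then obtain f' where d: "\<And>x. (f has_real_derivative f' x) (at x)" and f': "Cn n S B f'" by auto
    have z: "f' x = 0" if "x \<notin> S" for x
    proof -
      have e: "\<forall>\<^sub>F t in nhds x. f t = 0"
        by (rule eventually_mono[OF eventually_nhds_in_open[of "- S" x]]) (use S(1) that Suc.prems(2) in auto)
      then have "(f has_real_derivative 0) (at x)" using DERIV_cong_ev[OF refl e refl] by simp
      then show ?thesis using d DERIV_unique by blast
    qed
    let ?g = "\<lambda>eta. cr (f eta) * cis (z * eta)" and ?g' = "\<lambda>eta. cr (f' eta) * cis (z * eta)"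
    note i1 = int[OF Suc.prems] and i2 = int[OF f' z]
    have "(LI eta. ?g' eta + \<i> * cr z * ?g eta) = 0"
    proof (rule integral_vector_derivative_zero)
      fix x
      have "((\<lambda>w. exp (\<i> * of_real z * w)) has_field_derivative \<i> * of_real z * exp (\<i> * of_real z * of_real x)) (at (of_real x))"
        by (auto intro!: derivative_eq_intros)
      from has_vector_derivative_real_field[OF this, of UNIV]
      have "((\<lambda>y. cis (z * y)) has_vector_derivative \<i> * z * cis (z * x)) (at x)" by (simp add: cis_conv_exp mult_ac)
      from has_vector_derivative_mult[OF has_vector_derivative_of_real[OF d] this]
      show "(?g has_vector_derivative ?g' x + \<i> * cr z * ?g x) (at x)"
        by (rule has_vector_derivative_eq_rhs) (simp add: algebra_simps)
    next
      show "continuous_on UNIV (\<lambda>eta. ?g' eta + \<i> * cr z * ?g eta)"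
        by (intro continuous_intros Cn_continuous[OF f'] Cn_continuous[OF Suc.prems(1)])
      show "integ (\<lambda>eta. ?g' eta + \<i> * cr z * ?g eta)" using i1 i2 by auto
      have g0: "?g eta = 0" if "\<bar>eta\<bar> > 2" for eta
        using that S(2) Suc.prems(2)[of eta] by fastforce
      show "(?g \<longlongrightarrow> 0) at_top"
        by (rule tendsto_eventually, rule eventually_mono[OF eventually_gt_at_top[of 2]]) (rule g0, simp)
      show "(?g \<longlongrightarrow> 0) at_bot"
        by (rule tendsto_eventually, rule eventually_mono[OF eventually_gt_at_bot[of "-2"]]) (rule g0, simp)
    qed
    then have "(LI eta. ?g' eta) = - (\<i> * cr z) * (LI eta. ?g eta)"
      using i1 i2 by (subst (asm) B_integral_add) (auto simp: add_eq_0_iff2)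
    then have "cmod (LI eta. ?g' eta) = \<bar>z\<bar> * cmod (LI eta. ?g eta)" by (simp add: norm_mult)
    then show ?case using Suc.IH[OF f' z] by (simp add: mult_ac)
  }
qed

text \<open>Adding the estimates for the powers 0 and 2 of z gives the first bound, adding those for
  1 and 3 the second; each contributes 4 B.\<close>

lemma cutoff_fourier_decay:
  assumes f: "cutoff S B f" and S: "S \<subseteq> {-2..2}"
  shows "cmod (LI eta. cr (f eta) * cis (z * eta)) \<le> 8 * B * inverse (1 + z\<^sup>2)" (is "?I \<le> _")
    and "\<bar>z\<bar> * cmod (LI eta. cr (f eta) * cis (z * eta)) \<le> 8 * B * inverse (1 + z\<^sup>2)"
proof -
  have c3: "Cn (Suc (Suc (Suc 0))) S B f" using f by (simp add: cutoff_def numeral_3_eq_3)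
  have cs: "closed S" "0 \<le> B" "\<And>x. x \<notin> S \<Longrightarrow> f x = 0" using f by (auto simp: cutoff_def)
  note d = cutoff_fourier_decay_power[OF cs(1) S cs(2) _ cs(3), where z = z]
  note c = c3 Cn_Suc[OF c3] Cn_Suc[OF Cn_Suc[OF c3]] Cn_Suc[OF Cn_Suc[OF Cn_Suc[OF c3]]]
  have p: "0 < 1 + z\<^sup>2" by (simp add: add_pos_nonneg)
  have z2: "z\<^sup>2 = \<bar>z\<bar> * \<bar>z\<bar>" by (simp add: power2_eq_square)
  have "?I * (1 + z\<^sup>2) \<le> 8 * B" using d[OF c(4)] d[OF c(2)] unfolding z2 by (simp add: algebra_simps)
  then show "?I \<le> 8 * B * inverse (1 + z\<^sup>2)" using p by (simp add: inverse_eq_divide pos_le_divide_eq)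
  have "(\<bar>z\<bar> * ?I) * (1 + z\<^sup>2) \<le> 8 * B" using d[OF c(3)] d[OF c(1)] unfolding z2 by (simp add: algebra_simps)
  then show "\<bar>z\<bar> * ?I \<le> 8 * B * inverse (1 + z\<^sup>2)" using p by (simp add: inverse_eq_divide pos_le_divide_eq)
qed

text \<open>Dilation by rho. Multiplying the kernel by z gains 1 / rho, and this gain pays for a
  derivative in the commutator estimate.\<close>

lemma scaled_symbol:
  assumes f: "cutoff S B f" and S: "S \<subseteq> {-2..2}" and r: "rho > 0" and a: "\<And>xi. a xi = c * cr (f (xi / rho))"
  shows "symbol a" "inv_kernel a \<in> borel_measurable borel"
    and "cmod (inv_kernel a z) \<le> 8 * B * cmod c * cauchy rho z"
    and "cmod (cr z * inv_kernel a z) \<le> 8 * B * cmod c / rho * cauchy rho z"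
proof -
  have c: "Cn 3 S B f" and B0: "B \<ge> 0" and zero: "\<And>x. x \<notin> S \<Longrightarrow> f x = 0" using f by (auto simp: cutoff_def)
  have B: "\<bar>f x\<bar> \<le> B" for x using Cn_bound[OF c, of x] zero[of x] B0 by (cases "x \<in> S") auto
  have [measurable]: "f \<in> borel_measurable borel" by (rule borel_measurable_continuous_onI[OF Cn_continuous[OF c]])
  have am: "a \<in> borel_measurable borel"
    unfolding a[abs_def] by measurable
  show "symbol a" unfolding symbol_def
  proof (intro conjI exI allI impI)
    show "cmod (a xi) \<le> cmod c * B" for xi using B by (simp add: a norm_mult mult_left_mono)
    fix xi assume "\<bar>xi\<bar> > 2 * rho"
    then have "xi / rho \<notin> {-2..2}" using r by (auto simp: divide_le_eq le_divide_eq)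
    then have "xi / rho \<notin> S" using S by blast
    then show "a xi = 0" using zero by (simp add: a)
  qed (rule am)
  show "inv_kernel a \<in> borel_measurable borel"
    by (rule inv_kernel_measurable) (use am in simp)
  let ?I = "\<lambda>z. LI eta. cr (f eta) * cis (z * eta)"
  have "(LI eta. a eta * cis (z * eta)) = rho *\<^sub>R (LI eta. a (0 + rho * eta) * cis (z * (0 + rho * eta)))"
    using lebesgue_integral_real_affine[of rho "\<lambda>eta. a eta * cis (z * eta)" 0] r by simp
  also have "(LI eta. a (0 + rho * eta) * cis (z * (0 + rho * eta))) = (LI eta. c * (cr (f eta) * cis (rho * z * eta)))"
    using r by (simp add: a mult_ac)
  also have "... = c * ?I (rho * z)" by simp
  finally have e: "cmod (inv_kernel a z) = 1 / (2 * pi) * rho * cmod c * cmod (?I (rho * z))"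
    using r by (simp add: inv_kernel_def norm_mult norm_divide)
  have p: "1 / (2 * pi) \<le> 1" using pi_ge_two by simp
  have "cmod (inv_kernel a z) \<le> 1 * rho * cmod c * cmod (?I (rho * z))"
    unfolding e using r p by (intro mult_right_mono) auto
  also have "... \<le> 1 * rho * cmod c * (8 * B * inverse (1 + (rho * z)\<^sup>2))"
    using r by (intro mult_left_mono cutoff_fourier_decay(1)[OF f S]) auto
  finally show "cmod (inv_kernel a z) \<le> 8 * B * cmod c * cauchy rho z"
    by (simp add: cauchy_def mult_ac)
  have "cmod (cr z * inv_kernel a z) \<le> \<bar>z\<bar> * (1 * rho * cmod c * cmod (?I (rho * z)))"
    unfolding norm_mult e using r p by (intro mult_mono mult_right_mono) auto
  also have "... = cmod c * (\<bar>rho * z\<bar> * cmod (?I (rho * z)))" using r by (simp add: abs_mult)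
  also have "... \<le> cmod c * (8 * B * inverse (1 + (rho * z)\<^sup>2))"
    by (intro mult_left_mono cutoff_fourier_decay(2)[OF f S]) auto
  finally show "cmod (cr z * inv_kernel a z) \<le> 8 * B * cmod c / rho * cauchy rho z"
    using r by (simp add: cauchy_def mult_ac)
qed

definition psik :: "nat \<Rightarrow> real \<Rightarrow> real" where
  "psik k xi = (if k = 0 then phi xi else psi (xi / 2 ^ k))"

text \<open>The symbol of the i-th derivative composed with the Bessel potential (1 -
  d^2/dx^2)^(b/2), localised to the k-th Littlewood-Paley block.\<close>

definition ann :: "nat \<Rightarrow> real \<Rightarrow> nat \<Rightarrow> real \<Rightarrow> complex" where
  "ann i b k xi = (\<i> * cr xi) ^ i * bessel_symbol b xi * cr (psik k xi)"

definition low :: "nat \<Rightarrow> real \<Rightarrow> real \<Rightarrow> complex" where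
  "low i R xi = (\<i> * cr xi) ^ i * cr (phi (xi / R))"

text \<open>The bound on the kernel itself serves Young's and Bernstein's inequalities, the bound on
  z times the kernel serves commutators.\<close>

definition kernel_bound :: "real \<Rightarrow> real \<Rightarrow> (real \<Rightarrow> complex) \<Rightarrow> bool" where
  "kernel_bound A rho a \<longleftrightarrow> symbol a \<and> inv_kernel a \<in> borel_measurable borel \<and> (\<forall>z. cmod (inv_kernel a z) \<le> A * cauchy rho z)
     \<and> (\<forall>z. cmod (cr z * inv_kernel a z) \<le> A / rho * cauchy rho z)"

lemma scaled_kernel_bound:
  assumes f: "cutoff S B f" and S: "S \<subseteq> {-2..2}" and r: "rho > 0" and a: "\<And>xi. a xi = c * cr (f (xi / rho))"
    and A: "8 * B * cmod c \<le> A"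
  shows "kernel_bound A rho a"
proof -
  note s = scaled_symbol[OF f S r a]
  have "0 \<le> cauchy rho z" for z using cauchy_bounds(1)[OF r, of z] by simp
  then have "8 * B * cmod c * cauchy rho z \<le> A * cauchy rho z" "8 * B * cmod c / rho * cauchy rho z \<le> A / rho * cauchy rho z" for z
    using A r by (auto intro!: mult_right_mono divide_right_mono)
  then show ?thesis unfolding kernel_bound_def using s by (meson order_trans)
qed

text \<open>Dilation by 2^k reduces each annulus to a fixed cut-off times a power of l + x^2, whose
  bounds are uniform in l; the factor pulled out is 2^(k(b + i)). The ball k = 0 is treated apart:
  its cut-off does not vanish near 0, and there l = 1 keeps the weight away from 0.\<close>

lemma ann_kernel:
  "\<exists>C\<ge>0. \<forall>k. \<forall>i\<in>{0,1}. kernel_bound (C * (2 ^ k) powr (b + real i)) (2 ^ k) (ann i b k)"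
proof -
  obtain B1 where B1: "cutoff {-2..2} B1 phi" using phi_cutoff by blast
  obtain B2 where B2: "cutoff ({-2..-1/2} \<union> {1/2..2}) B2 psi" using psi_cutoff by blast
  obtain C1 where C1: "C1 \<ge> 0" and CC1: "\<And>l. 0 < l \<Longrightarrow> (\<forall>x\<in>{-2..2}. 1 / 5 \<le> l + x\<^sup>2 \<and> l + x\<^sup>2 \<le> 5) \<Longrightarrow>
     cutoff {-2..2} C1 (\<lambda>x. phi x * (l + x\<^sup>2) powr (b/2)) \<and> cutoff {-2..2} C1 (\<lambda>x. x * (phi x * (l + x\<^sup>2) powr (b/2)))"
    using cutoff_bessel[OF B1 order_refl, of "b/2"] by blast
  have S2: "{-2..-1/2} \<union> {1/2..2} \<subseteq> {-2..2::real}" by auto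
  obtain C2 where C2: "C2 \<ge> 0" and CC2: "\<And>l. 0 < l \<Longrightarrow> (\<forall>x\<in>{-2..-1/2} \<union> {1/2..2}. 1 / 5 \<le> l + x\<^sup>2 \<and> l + x\<^sup>2 \<le> 5) \<Longrightarrow>
     cutoff ({-2..-1/2} \<union> {1/2..2}) C2 (\<lambda>x. psi x * (l + x\<^sup>2) powr (b/2)) \<and> cutoff ({-2..-1/2} \<union> {1/2..2}) C2 (\<lambda>x. x * (psi x * (l + x\<^sup>2) powr (b/2)))"
    using cutoff_bessel[OF B2 S2, of "b/2"] by blast
  show ?thesis
  proof (intro exI[of _ "8 * C1 + 8 * C2"] conjI allI ballI)
    show "0 \<le> 8 * C1 + 8 * C2" using C1 C2 by simp
    fix k i :: nat assume "i \<in> {0,1}"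
    then consider "i = 0" | "i = 1" by auto
    note i01 = this
    show "kernel_bound ((8 * C1 + 8 * C2) * (2 ^ k) powr (b + real i)) (2 ^ k) (ann i b k)"
    proof (cases "k = 0")
      case True
      have x5: "\<forall>x\<in>{-2..2}. 1 / 5 \<le> 1 + x\<^sup>2 \<and> 1 + x\<^sup>2 \<le> (5::real)"
      proof
        fix x :: real assume "x \<in> {-2..2}"
        then have "\<bar>x\<bar> \<le> 2" by auto
        from power_mono[OF this, of 2] have "x\<^sup>2 \<le> 4" by simp
        then show "1 / 5 \<le> 1 + x\<^sup>2 \<and> 1 + x\<^sup>2 \<le> 5" by (auto intro: order_trans[of _ 1])
      qed
      note c = CC1[OF zero_less_one x5]
      show ?thesis
      proof (rule i01)
        assume i: "i = 0"
        show ?thesis unfolding True i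
          by (rule scaled_kernel_bound[OF conjunct1[OF c], where c = 1]) (use C2 in \<open>auto simp: ann_def bessel_symbol_def psik_def\<close>)
      next
        assume i: "i = 1"
        show ?thesis unfolding True i
          by (rule scaled_kernel_bound[OF conjunct2[OF c], where c = \<i>]) (use C2 in \<open>auto simp: ann_def bessel_symbol_def psik_def\<close>)
      qed
    next
      case False
      define rho where "rho = (2::real) ^ k"
      have r0: "rho > 0" by (simp add: rho_def)
      define l where "l = 1 / rho\<^sup>2"
      have l0: "l > 0" using r0 by (simp add: l_def)
      have "rho \<ge> 2 ^ 1" unfolding rho_def using False by (intro power_increasing) auto
      then have "rho\<^sup>2 \<ge> 4" using power_mono[of 2 rho 2] by simp
      then have l4: "l \<le> 1 / 4" unfolding l_def by (intro divide_left_mono) (auto simp: r0)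
      have x5: "\<forall>x\<in>{-2..-1/2} \<union> {1/2..2}. 1 / 5 \<le> l + x\<^sup>2 \<and> l + x\<^sup>2 \<le> 5"
      proof
        fix x :: real assume "x \<in> {-2..-1/2} \<union> {1/2..2}"
        then have x: "\<bar>x\<bar> \<le> 2" "1/2 \<le> \<bar>x\<bar>" by auto
        from power_mono[OF x(1), of 2] have "x\<^sup>2 \<le> 4" by simp
        moreover from power_mono[OF x(2), of 2] have "1/4 \<le> x\<^sup>2" by (simp add: power2_eq_square)
        ultimately show "1 / 5 \<le> l + x\<^sup>2 \<and> l + x\<^sup>2 \<le> 5" using l0 l4 by linarith
      qed
      note c = CC2[OF l0 x5]
      have be: "(1 + xi\<^sup>2) powr (b / 2) = rho powr b * (l + (xi / rho)\<^sup>2) powr (b / 2)" for xi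
      proof -
        have "1 + xi\<^sup>2 = rho\<^sup>2 * (l + (xi / rho)\<^sup>2)" using r0 by (simp add: l_def power_divide field_simps)
        moreover have "(rho\<^sup>2) powr (b / 2) = rho powr b"
          using r0 powr_powr[of rho 2 "b / 2"] by simp
        ultimately show ?thesis by (simp add: powr_mult)
      qed
      have r1: "rho powr (b + 1) = rho powr b * rho" using r0 by (simp add: powr_add)
      show ?thesis
      proof (rule i01)
        assume i: "i = 0"
        have e: "ann 0 b k xi = cr (rho powr b) * cr (psi (xi / rho) * (l + (xi / rho)\<^sup>2) powr (b / 2))" for xi
          using False by (simp add: ann_def bessel_symbol_def psik_def be rho_def[symmetric])
        have A: "8 * C2 * cmod (cr (rho powr b)) \<le> (8 * C1 + 8 * C2) * rho powr (b + real 0)"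
          using C1 by (simp add: algebra_simps)
        from scaled_kernel_bound[OF conjunct1[OF c] S2 r0 e A] show ?thesis unfolding i rho_def[symmetric] .
      next
        assume i: "i = 1"
        have e: "ann 1 b k xi = (\<i> * cr (rho powr (b + 1))) * cr (xi / rho * (psi (xi / rho) * (l + (xi / rho)\<^sup>2) powr (b / 2)))" for xi
          using False r0 by (simp add: ann_def bessel_symbol_def psik_def be rho_def[symmetric] r1)
        have A: "8 * C2 * cmod (\<i> * cr (rho powr (b + 1))) \<le> (8 * C1 + 8 * C2) * rho powr (b + real 1)"
          using C1 by (simp add: norm_mult algebra_simps)
        from scaled_kernel_bound[OF conjunct2[OF c] S2 r0 e A] show ?thesis unfolding i rho_def[symmetric] .
      qed
    qed
  qed
qed

lemma low_kernel:
  "\<exists>C\<ge>0. \<forall>R>0. \<forall>i\<in>{0,1}. kernel_bound (C * R ^ i) R (low i R)"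
proof -
  obtain B where B: "cutoff {-2..2} B phi" using phi_cutoff by blast
  have B0: "B \<ge> 0" using B by (simp add: cutoff_def)
  have "Cn 3 {-2..2} 2 (\<lambda>x. x)" by (rule Cn_id) auto
  then have B': "cutoff {-2..2} (8 * B * 2) (\<lambda>x. phi x * x)" by (rule cutoff_mult[OF B]) simp
  show ?thesis
  proof (intro exI[of _ "128 * B"] conjI allI ballI impI)
    show "0 \<le> 128 * B" using B0 by simp
    fix R :: real and i :: nat assume R: "R > 0" "i \<in> {0,1}"
    then consider "i = 0" | "i = 1" by auto
    then show "kernel_bound (128 * B * R ^ i) R (low i R)"
    proof cases
      case 1
      show ?thesis unfolding 1
        by (rule scaled_kernel_bound[OF B _ R(1), where c = 1]) (use B0 in \<open>auto simp: low_def\<close>)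
    next
      case 2
      show ?thesis unfolding 2
      proof (rule scaled_kernel_bound[OF B' _ R(1), where c = "\<i> * cr R"])
        show "low 1 R xi = (\<i> * cr R) * cr (phi (xi / R) * (xi / R))" for xi
          using R by (simp add: low_def)
      qed (use R in \<open>auto simp: norm_mult\<close>)
    qed
  qed
qed

section \<open>Sobolev norms\<close>

lemma is_multiplier_iff:
  assumes "is_fourier f (fourier f)"
  shows "is_multiplier a f h \<longleftrightarrow> is_fourier h (\<lambda>xi. a xi * fourier f xi)"
proof
  assume "is_multiplier a f h"
  then obtain g where g: "is_fourier f g" "is_fourier h (\<lambda>xi. a xi * g xi)" by (auto simp: is_multiplier_def)
  have "AEL xi. a xi * g xi = a xi * fourier f xi"
    using fourier_AE_eq[OF g(1)] by eventually_elim simp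
  from is_fourier_cong_AE[OF g(2) AE_I2[OF refl] this] show "is_fourier h (\<lambda>xi. a xi * fourier f xi)" .
qed (use assms in \<open>auto simp: is_multiplier_def\<close>)

lemma multiplier_AE_eq:
  assumes h: "is_multiplier a f h"
  shows "AEL x. multiplier a f x = h x"
proof -
  have f: "is_fourier f (fourier f)" using h fourier_is_fourier by (auto simp: is_multiplier_def)
  have "is_multiplier a f (multiplier a f)" unfolding multiplier_def by (rule someI[of "is_multiplier a f", OF h])
  with h show ?thesis unfolding is_multiplier_iff[OF f] using is_fourier_inj by blast
qed

lemma bessel_measurable [measurable]: "bessel_symbol s \<in> borel_measurable borel"
  unfolding bessel_symbol_def by measurable

lemma cmod_bessel: "cmod (bessel_symbol s xi) = (1 + xi\<^sup>2) powr (s / 2)"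
  by (simp add: bessel_symbol_def)

lemma bessel_add: "bessel_symbol s xi * bessel_symbol t xi = bessel_symbol (s + t) xi"
proof -
  have "1 + xi\<^sup>2 > 0" by (simp add: add_pos_nonneg)
  then show ?thesis by (simp add: bessel_symbol_def powr_add[symmetric] add_divide_distrib flip: of_real_mult)
qed

lemma bessel_0 [simp]: "bessel_symbol 0 xi = 1"
proof -
  have "1 + xi\<^sup>2 > 0" by (simp add: add_pos_nonneg)
  then show ?thesis by (simp add: bessel_symbol_def)
qed

text \<open>The H^s norm on the Fourier side, larger than \<open>sobolev_norm s 2\<close> by the
  factor sqrt (2 pi); no inverse transform has to be chosen.\<close>

definition Xn :: "real \<Rightarrow> (real \<Rightarrow> complex) \<Rightarrow> real" where
  "Xn s f = N2 (\<lambda>xi. bessel_symbol s xi * fourier f xi)"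

lemma Xn_nonneg [simp]: "Xn s f \<ge> 0" by (simp add: Xn_def)

lemma cmod_bessel_ge1: "s \<ge> 0 \<Longrightarrow> 1 \<le> cmod (bessel_symbol s xi)"
  unfolding cmod_bessel by (rule ge_one_powr_ge_zero) auto

text \<open>For s \<ge> 0 the weight is at least 1, so the transform of f is square integrable; this
  brings f into L^2 and makes Plancherel's theorem applicable.\<close>

lemma sobolev2D:
  assumes "sobolev s 2 f" "s \<ge> 0"
  shows "Lp 2 f" "Lp 2 (\<lambda>xi. bessel_symbol s xi * fourier f xi)" "sobolev_norm s 2 f = Xn s f / sqrt (2 * pi)"
    "N2 (fourier f) \<le> Xn s f"
proof -
  obtain h where h: "is_multiplier (bessel_symbol s) f h" "Lp 2 h" using assms by (auto simp: sobolev_def)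
  have f: "is_fourier f (fourier f)" using h fourier_is_fourier by (auto simp: is_multiplier_def)
  have hf: "is_fourier h (\<lambda>xi. bessel_symbol s xi * fourier f xi)" using h(1) is_multiplier_iff[OF f] by blast
  show W: "Lp 2 (\<lambda>xi. bessel_symbol s xi * fourier f xi)" using is_fourier_Lp2[OF hf] h(2) by simp
  have fm: "fourier f \<in> lmeas" using f by (simp add: is_fourier_def)
  have le: "AEL xi. cmod (fourier f xi) \<le> 1 * cmod (bessel_symbol s xi * fourier f xi)"
  proof (rule AE_I2)
    fix xi
    show "cmod (fourier f xi) \<le> 1 * cmod (bessel_symbol s xi * fourier f xi)"
      using mult_right_mono[OF cmod_bessel_ge1[OF assms(2), of xi], of "cmod (fourier f xi)"] by (simp add: norm_mult)
  qed
  have "Lp 2 (fourier f)" by (rule Lp_bound[OF fm W _ _ le]) auto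
  then show "Lp 2 f" using is_fourier_Lp2[OF f] by simp
  show "N2 (fourier f) \<le> Xn s f"
    using Lp_norm_bound[OF fm W _ _ le] by (simp add: Xn_def)
  have "sobolev_norm s 2 f = N2 h"
    unfolding sobolev_norm_def
  proof (rule Lp_norm_cong_AE[symmetric])
    show "h \<in> lmeas" using h(2) by (simp add: Lp_def)
    show "AEL x. h x = multiplier (bessel_symbol s) f x"
      using multiplier_AE_eq[OF h(1)] by eventually_elim simp
  qed
  also have "... = Xn s f / sqrt (2 * pi)"
  proof -
    have "(Xn s f)\<^sup>2 = (sqrt (2 * pi) * N2 h)\<^sup>2"
      using Plancherel[OF hf h(2)] by (simp add: Xn_def power_mult_distrib)
    then have "Xn s f = sqrt (2 * pi) * N2 h" by (rule power2_eq_imp_eq) auto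
    then show ?thesis by simp
  qed
  finally show "sobolev_norm s 2 f = Xn s f / sqrt (2 * pi)" .
qed

lemma sobolev2I:
  assumes "Lp 2 f" "Lp 2 (\<lambda>xi. bessel_symbol s xi * fourier f xi)"
  shows "sobolev s 2 f"
proof -
  obtain h where "is_fourier h (\<lambda>xi. bessel_symbol s xi * fourier f xi)" "Lp 2 h"
    using L2_inverse_exists[OF assms(2)] by blast
  then show ?thesis unfolding sobolev_def using is_multiplier_iff[OF fourier_L2(1)[OF assms(1)]] by blast
qed

lemma sobolev2_diff:
  assumes "sobolev s 2 f" "sobolev s 2 g" "s \<ge> 0"
  shows "sobolev s 2 (\<lambda>x. f x - g x)" "Xn s f \<le> Xn s g + Xn s (\<lambda>x. f x - g x)"
proof -
  note F = sobolev2D[OF assms(1,3)] and G = sobolev2D[OF assms(2,3)]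
  have e: "AEL xi. bessel_symbol s xi * fourier f xi - bessel_symbol s xi * fourier g xi = bessel_symbol s xi * fourier (\<lambda>x. f x - g x) xi"
    using fourier_diff_AE[OF F(1) G(1)] by eventually_elim (simp add: right_diff_distrib)
  have L: "Lp 2 (\<lambda>xi. bessel_symbol s xi * fourier f xi - bessel_symbol s xi * fourier g xi)"
    by (rule Lp_diff[OF F(2) G(2)]) simp
  show "sobolev s 2 (\<lambda>x. f x - g x)"
    by (rule sobolev2I[OF Lp_diff[OF F(1) G(1)] Lp_cong_AE[OF e L]]) simp
  have "Xn s f = N2 (\<lambda>xi. bessel_symbol s xi * fourier g xi + (bessel_symbol s xi * fourier f xi - bessel_symbol s xi * fourier g xi))"
    by (simp add: Xn_def)
  also have "... \<le> Xn s g + N2 (\<lambda>xi. bessel_symbol s xi * fourier f xi - bessel_symbol s xi * fourier g xi)"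
    unfolding Xn_def by (rule Lp_norm2_triangle[OF G(2) L])
  also have "N2 (\<lambda>xi. bessel_symbol s xi * fourier f xi - bessel_symbol s xi * fourier g xi) = Xn s (\<lambda>x. f x - g x)"
    unfolding Xn_def by (rule Lp_norm_cong_AE[OF e Lp_measurable[OF L]])
  finally show "Xn s f \<le> Xn s g + Xn s (\<lambda>x. f x - g x)" .
qed

section \<open>Littlewood-Paley pieces\<close>

lemma psi_psik_zero: "psik k xi \<noteq> 0 \<Longrightarrow> \<bar>xi\<bar> \<le> 2 * 2 ^ k"
proof (cases "k = 0")
  case True
  assume "psik k xi \<noteq> 0"
  then show ?thesis using phi_0[of xi] True by (cases "\<bar>xi\<bar> \<ge> 2") (auto simp: psik_def)
next
  case False
  assume "psik k xi \<noteq> 0"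
  then have "\<not> \<bar>xi / 2 ^ k\<bar> \<ge> 2" using psi_0[of "xi / 2 ^ k"] False by (auto simp: psik_def)
  then show ?thesis by (simp add: abs_divide not_le pos_divide_less_eq)
qed

lemma psik_low: "k > 0 \<Longrightarrow> psik k xi \<noteq> 0 \<Longrightarrow> 2 ^ k / 2 < \<bar>xi\<bar>"
proof -
  assume k: "k > 0" and "psik k xi \<noteq> 0"
  then have "\<not> \<bar>xi / 2 ^ k\<bar> \<le> 1/2" using psi_0[of "xi / 2 ^ k"] by (auto simp: psik_def)
  then show ?thesis by (simp add: abs_divide not_le pos_less_divide_eq)
qed

lemma psik_range: "\<bar>psik k xi\<bar> \<le> 1"
  using phi_range[of xi] phi_range[of "xi / 2 ^ k"] phi_range[of "2 * (xi / 2 ^ k)"]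
  by (auto simp: psik_def psi_def abs_le_iff)

lemma psik_even: "psik k (- xi) = psik k xi"
  using phi_even[of xi] phi_even[of "xi / 2 ^ k"] phi_even[of "2 * (xi / 2 ^ k)"] by (simp add: psik_def psi_def)

lemma phi_telescope: "phi (xi / 2 ^ n) = (\<Sum>j\<le>n. psik j xi)"
proof (induction n)
  case (Suc n)
  have "psik (Suc n) xi = phi (xi / 2 ^ Suc n) - phi (xi / 2 ^ n)"
    by (simp add: psik_def psi_def)
  then show ?case using Suc by simp
qed (simp add: psik_def)

lemma low_sum: "low i (2 ^ n) = (\<lambda>xi. \<Sum>j\<le>n. ann i 0 j xi)"
  by (rule ext) (simp add: low_def ann_def phi_telescope sum_distrib_left)

text \<open>The low-frequency cut-off at twice the scale is 1 on the annulus. Each piece is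
  therefore reproduced by a convolution with a dilated fixed kernel, which is how its sup norm and
  its derivative are reached.\<close>

lemma low_ann: "low i (2 ^ Suc k) xi * ann j b k xi = ann (i + j) b k xi"
proof (cases "psik k xi = 0")
  case False
  then have "\<bar>xi / 2 ^ Suc k\<bar> \<le> 1" using psi_psik_zero[of k xi] by (simp add: abs_divide)
  then have "phi (xi / 2 ^ Suc k) = 1" by (rule phi_1)
  then show ?thesis by (simp add: low_def ann_def power_add del: power_Suc)
qed (simp add: ann_def)

lemma symbol_ann: "i \<in> {0,1} \<Longrightarrow> symbol (ann i b k)"
  using ann_kernel[of b] unfolding kernel_bound_def by blast

lemma symbol_low: "i \<in> {0,1} \<Longrightarrow> R > 0 \<Longrightarrow> symbol (low i R)"
  using low_kernel unfolding kernel_bound_def by blast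

lemma kernel_boundD:
  assumes "kernel_bound A rho a" "rho > 0" "A \<ge> 0"
  shows "symbol a" "conv_kernel (inv_kernel a)" "(LI z. cmod (inv_kernel a z)) \<le> A * pi"
    "q \<ge> 1 \<Longrightarrow> Lp_norm q (inv_kernel a) \<le> A * pi * rho powr (1 - 1 / q)"
    "conv_kernel (\<lambda>z. cr z * inv_kernel a z)"
    "(LI z. cmod (cr z * inv_kernel a z)) \<le> A / rho * pi"
proof -
  have b: "\<And>z. cmod (inv_kernel a z) \<le> A * cauchy rho z" "\<And>z. cmod (cr z * inv_kernel a z) \<le> A / rho * cauchy rho z"
    and m: "inv_kernel a \<in> borel_measurable borel" and "symbol a"
    using assms(1) unfolding kernel_bound_def by auto
  then show "symbol a" by simp
  note c = cauchy_kernel[OF m b(1) assms(2,3)]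
  show "conv_kernel (inv_kernel a)" "(LI z. cmod (inv_kernel a z)) \<le> A * pi" by (rule c(1), rule c(2))
  show "q \<ge> 1 \<Longrightarrow> Lp_norm q (inv_kernel a) \<le> A * pi * rho powr (1 - 1 / q)" by (rule c(3))
  have m2: "(\<lambda>z. cr z * inv_kernel a z) \<in> borel_measurable borel" using m by measurable
  have A2: "A / rho \<ge> 0" using assms by simp
  note c2 = cauchy_kernel[OF m2 b(2) assms(2) A2]
  show "conv_kernel (\<lambda>z. cr z * inv_kernel a z)"
    "(LI z. cmod (cr z * inv_kernel a z)) \<le> A / rho * pi" by (rule c2(1), rule c2(2))
qed

lemma mult_op_Young:
  assumes "kernel_bound A rho a" "rho > 0" "A \<ge> 0" "Lp 2 f" "Lp q f" "q \<ge> 1"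
  shows "Lp q (mult_op a f)" "Lp_norm q (mult_op a f) \<le> A * pi * Lp_norm q f"
proof -
  note k = kernel_boundD[OF assms(1,2,3)]
  have e: "mult_op a f = conv (inv_kernel a) f"
    by (rule ext, rule mult_op_conv[OF k(1) assms(4)])
  show "Lp q (mult_op a f)" unfolding e by (rule Young(1)[OF k(2) assms(5,6)])
  have "Lp_norm q (mult_op a f) \<le> (LI z. cmod (inv_kernel a z)) * Lp_norm q f"
    unfolding e by (rule Young(2)[OF k(2) assms(5,6)])
  also have "... \<le> A * pi * Lp_norm q f" using k(3) by (intro mult_right_mono) auto
  finally show "Lp_norm q (mult_op a f) \<le> A * pi * Lp_norm q f" .
qed

lemma geometric_bound:
  assumes "a > (0::real)"
  shows "\<exists>C\<ge>0. \<forall>n. (\<Sum>j\<le>n. (2 ^ j) powr (- a)) \<le> (C::real)"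
proof -
  have e: "((2::real) ^ j) powr (- a) = (2 powr (- a)) ^ j" for j
    by (simp add: powr_realpow[symmetric] powr_powr mult.commute)
  have lt: "(2::real) powr (- a) < 1" using assms by (simp add: powr_less_one)
  then have s: "summable (\<lambda>j. ((2::real) powr (- a)) ^ j)" by (intro summable_geometric) auto
  have "(\<Sum>j\<le>n. (2 ^ j) powr (- a)) \<le> (\<Sum>j. ((2::real) powr (- a)) ^ j)" for n
    unfolding e by (rule sum_le_suminf[OF s]) auto
  moreover have "0 \<le> (\<Sum>j. ((2::real) powr (- a)) ^ j)" by (rule suminf_nonneg[OF s]) simp
  ultimately show ?thesis by blast
qed

text \<open>Where |h| exceeds B the excess is at most |h - hn|, so its L^2 norm tends to 0.\<close>

lemma L2_limit_bound:
  assumes h: "Lp 2 h" and hn: "\<And>n. Lp 2 (hn n)" and lim: "(\<lambda>n. N2 (\<lambda>x. h x - hn n x)) \<longlonglongrightarrow> 0"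
    and b: "\<And>n x. cmod (hn n x) \<le> B"
  shows "AEL x. cmod (h x) \<le> B"
proof -
  note [measurable] = Lp_measurable[OF h]
  define m where "m x = cr (max 0 (cmod (h x) - B))" for x
  have mm: "m \<in> lmeas" unfolding m_def by measurable
  have le: "cmod (m x) \<le> 1 * cmod (h x - hn n x)" for n x
    using b[of n x] norm_triangle_ineq2[of "h x" "hn n x"] by (simp add: m_def max_def)
  have "N2 m \<le> N2 (\<lambda>x. h x - hn n x)" for n
    using Lp_norm_bound[OF mm Lp_diff[OF h hn] _ _ AE_I2[OF le]] by simp
  then have "N2 m \<le> 0" by (intro LIMSEQ_le_const[OF lim]) auto
  then have "N2 m = 0" using Lp_norm_nonneg[of 2 m] by linarith
  moreover have "Lp 2 m"
    by (rule Lp_bound[OF mm Lp_diff[OF h hn[of 0]] _ _ AE_I2[OF le]]) auto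
  ultimately have "AEL x. m x = 0" using Lp_norm_eq_0 by blast
  then show ?thesis by eventually_elim (auto simp: m_def max_def split: if_splits)
qed

lemma cis_diff_bound: "cmod (cis a - cis b) \<le> \<bar>a - b\<bar>"
proof -
  have "cmod (cis (a - b) - 1) \<le> \<bar>a - b\<bar>"
    using iexp_approx1[of "a - b" 0] by (simp add: cis_conv_exp)
  moreover have "cis a - cis b = cis b * (cis (a - b) - 1)"
    by (simp add: right_diff_distrib cis_mult)
  ultimately show ?thesis by (simp add: norm_mult)
qed

lemma cis_taylor_bound: "cmod (cis a - cis b - \<i> * cr (a - b) * cis b) \<le> (a - b)\<^sup>2"
proof -
  have "cmod (cis (a - b) - 1 - \<i> * cr (a - b)) \<le> (a - b)\<^sup>2 / 2"
    using iexp_approx1[of "a - b" 1] by (simp add: cis_conv_exp power2_eq_square diff_diff_eq abs_mult_self_eq fact_numeral)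
  moreover have "cis a - cis b - \<i> * cr (a - b) * cis b = cis b * (cis (a - b) - 1 - \<i> * cr (a - b))"
    by (simp add: right_diff_distrib cis_mult mult_ac)
  moreover have "(a - b)\<^sup>2 / 2 \<le> (a - b)\<^sup>2" by simp
  ultimately show ?thesis by (simp only: norm_mult norm_cis mult_1_left)
qed

text \<open>The compact support of the symbol allows a Taylor expansion of the exponential under the
  integral with a quadratic remainder uniform in x. So the function is differentiable with the
  expected derivative, and the mean value inequality applies.\<close>

lemma mult_op_lipschitz:
  assumes a: "symbol a" and a': "symbol (\<lambda>xi. \<i> * cr xi * a xi)" and f: "Lp 2 f"
    and L: "\<And>x. cmod (mult_op (\<lambda>xi. \<i> * cr xi * a xi) f x) \<le> L"
  shows "cmod (mult_op a f x - mult_op a f y) \<le> L * \<bar>x - y\<bar>"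
proof -
  let ?b = "\<lambda>xi. \<i> * cr xi * a xi"
  let ?F = "\<lambda>x eta. a eta * fourier f eta * cis (x * eta)"
  let ?D = "\<lambda>x eta. ?b eta * fourier f eta * cis (x * eta)"
  obtain R where R: "\<And>eta. \<bar>eta\<bar> > R \<Longrightarrow> a eta = 0" using a by (auto simp: symbol_def)
  have iF: "integ (?F x)" for x by (rule mult_op_integrable[OF a f])
  have iD: "integ (?D x)" for x by (rule mult_op_integrable[OF a' f])
  define M where "M = R\<^sup>2 * (LI eta. cmod (?F 0 eta)) / (2 * pi)"
  have key: "cmod (mult_op a f x - mult_op a f y - (x - y) *\<^sub>R mult_op ?b f y) \<le> M * (x - y)\<^sup>2" for x y
  proof -
    have 1: "mult_op a f x - mult_op a f y - (x - y) *\<^sub>R mult_op ?b f y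
      = cr (1 / (2 * pi)) * (LI eta. ?F x eta - ?F y eta - cr (x - y) * ?D y eta)"
    proof -
      have "(LI eta. ?F x eta - ?F y eta - cr (x - y) * ?D y eta) = (LI eta. ?F x eta) - (LI eta. ?F y eta) - cr (x - y) * (LI eta. ?D y eta)"
        by (simp only: B_integral_diff B_integrable_diff integral_mult_right_zero integrable_mult_right iF iD)
      then show ?thesis unfolding mult_op_def scaleR_conv_of_real by (simp only: right_diff_distrib mult.left_commute)
    qed
    have 2: "cmod (LI eta. ?F x eta - ?F y eta - cr (x - y) * ?D y eta) \<le> (LI eta. (R\<^sup>2 * (x - y)\<^sup>2) * cmod (?F 0 eta))"
    proof (rule order_trans[OF integral_norm_bound integral_mono'])
      show "integ (\<lambda>eta. (R\<^sup>2 * (x - y)\<^sup>2) * cmod (?F 0 eta))" using iF[of 0] by (intro integrable_mult_right integrable_norm)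
      fix eta
      show "cmod (?F x eta - ?F y eta - cr (x - y) * ?D y eta) \<le> (R\<^sup>2 * (x - y)\<^sup>2) * cmod (?F 0 eta)"
      proof (cases "\<bar>eta\<bar> > R")
        case False
        have "cmod (cis (x * eta) - cis (y * eta) - \<i> * cr (x * eta - y * eta) * cis (y * eta)) \<le> (x * eta - y * eta)\<^sup>2"
          by (rule cis_taylor_bound)
        also have "... = \<bar>eta\<bar>\<^sup>2 * (x - y)\<^sup>2" by (simp add: left_diff_distrib[symmetric] power_mult_distrib)
        also have "... \<le> R\<^sup>2 * (x - y)\<^sup>2" using False by (intro mult_right_mono power_mono) auto
        finally have "cmod (?F 0 eta) * cmod (cis (x * eta) - cis (y * eta) - \<i> * cr (x * eta - y * eta) * cis (y * eta)) \<le> cmod (?F 0 eta) * (R\<^sup>2 * (x - y)\<^sup>2)"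
          by (rule mult_left_mono) simp
        moreover have "?F x eta - ?F y eta - cr (x - y) * ?D y eta = ?F 0 eta * (cis (x * eta) - cis (y * eta) - \<i> * cr (x * eta - y * eta) * cis (y * eta))"
          by (simp add: algebra_simps)
        ultimately show ?thesis by (simp only: norm_mult mult.commute)
      qed (simp add: R)
    qed simp
    have "(R\<^sup>2 * (x - y)\<^sup>2 * N) / (2 * pi) = R\<^sup>2 * N / (2 * pi) * (x - y)\<^sup>2" for N by simp
    then show ?thesis using divide_right_mono[OF 2, of "2 * pi"] unfolding 1 norm_mult M_def integral_mult_right_zero
      by (simp add: norm_divide mult_ac del: of_real_diff)
  qed
  have D: "(mult_op a f has_derivative (\<lambda>t. t *\<^sub>R mult_op ?b f y)) (at y within UNIV)" for y
    unfolding has_derivative_iff_norm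
  proof (intro conjI bounded_linear_scaleR_left)
    have "((\<lambda>x. M * \<bar>x - y\<bar>) \<longlongrightarrow> M * \<bar>y - y\<bar>) (at y)" by (intro tendsto_intros)
    then have "((\<lambda>x. M * \<bar>x - y\<bar>) \<longlongrightarrow> 0) (at y)" by simp
    then show "((\<lambda>x. norm (mult_op a f x - mult_op a f y - (x - y) *\<^sub>R mult_op ?b f y) / norm (x - y)) \<longlongrightarrow> 0) (at y)"
      by (rule Lim_null_comparison[rotated])
        (use key in \<open>auto simp: eventually_at_filter pos_divide_le_eq power2_eq_square mult.assoc abs_mult_self_eq intro!: always_eventually\<close>)
  qed
  have "norm (mult_op a f x - mult_op a f y) \<le> L * norm (x - y)"
  proof (rule differentiable_bound[OF convex_UNIV D])
    show "onorm (\<lambda>t. t *\<^sub>R mult_op ?b f x) \<le> L" for x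
      using L[of x] by (simp add: onorm_scaleR_left[OF bounded_linear_ident] onorm_id)
  qed auto
  then show ?thesis by simp
qed

locale LPS =
  fixes p :: nat and \<sigma> :: real
  assumes p3: "p \<ge> 3" and sg3: "\<sigma> \<ge> 3"
begin

definition r :: real where "r = 2 * real p"
definition rc :: real where "rc = r / (r - 1)"

lemma r_facts: "r \<ge> 6" "r > 2" "rc > 1" "1 - 1 / rc = 1 / r" "1 / r + 1 / rc = 1" "rc \<le> 2" "1 / r \<le> 1 / 6"
proof -
  show r: "r \<ge> 6" using p3 by (simp add: r_def)
  then show "r > 2" "rc > 1" "1 - 1 / rc = 1 / r" "1 / r + 1 / rc = 1" "rc \<le> 2"
    by (auto simp: rc_def field_simps)
  show "1 / r \<le> 1 / 6" using r by (intro divide_left_mono) auto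
qed

abbreviation P :: "nat \<Rightarrow> (real \<Rightarrow> complex) \<Rightarrow> real \<Rightarrow> complex" where
  "P k f \<equiv> mult_op (ann 0 0 k) f"

text \<open>
  The decaying norm is the Besov norm with exponents \<open>(3/2, r, \<infinity>)\<close>; the \<open>L\<^sup>r\<close> norms in it are
  used in dual form.
\<close>

definition Nb :: "real \<Rightarrow> (real \<Rightarrow> complex) \<Rightarrow> bool" where
  "Nb A f \<longleftrightarrow> (\<forall>k G. Lp 2 G \<longrightarrow> Lp rc G \<longrightarrow>
     cmod (LI x. P k f x * G x) \<le> A * (2 ^ k) powr (- 3 / 2) * Lp_norm rc G)"

lemma NbD: "Nb A f \<Longrightarrow> Lp 2 G \<Longrightarrow> Lp rc G \<Longrightarrow>
  cmod (LI x. P k f x * G x) \<le> A * (2 ^ k) powr (- 3 / 2) * Lp_norm rc G"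
  by (auto simp: Nb_def)

text \<open>Bernstein's inequality by duality: the reproducing kernel, reflected and translated to
  x, is itself a test function for \<open>Nb\<close>. Apart from the derivative its L^rc norm is of
  order 2^(k/r), at most 2^(k/6) since r \<ge> 6, and -3/2 + 1/6 = -4/3.\<close>

lemma P_sup: "\<exists>C\<ge>0. \<forall>f A k i x. Lp 2 f \<longrightarrow> A \<ge> 0 \<longrightarrow> Nb A f \<longrightarrow> i \<in> {0,1} \<longrightarrow>
    cmod (mult_op (ann i 0 k) f x) \<le> C * A * (2 ^ k) powr (- 4 / 3 + real i)"
proof -
  obtain C0 where C0: "C0 \<ge> 0" and K: "\<And>R i. R > 0 \<Longrightarrow> i \<in> {0,1} \<Longrightarrow> kernel_bound (C0 * R ^ i) R (low i R)"
    using low_kernel by blast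
  show ?thesis
  proof (intro exI[of _ "4 * C0 * pi"] conjI allI impI)
    show "0 \<le> 4 * C0 * pi" using C0 by simp
    fix f A and k i :: nat and x
    assume f: "Lp 2 f" and A: "A \<ge> 0" and N: "Nb A f" and i: "i \<in> {0,1}"
    define rho where "rho = (2::real) ^ Suc k"
    have r0: "rho \<ge> 1" unfolding rho_def by (rule one_le_power) simp
    then have r0': "rho > 0" by linarith
    note k = kernel_boundD[OF K[OF r0' i] r0']
    have c0: "0 \<le> C0 * rho ^ i" using C0 r0' by simp
    have e: "mult_op (low i rho) (P k f) = mult_op (ann i 0 k) f"
      unfolding mult_op_compose[OF symbol_ann f] using low_ann[of i k _ 0 0] mult_op_compose[of "ann 0 0 k" f]
      by (subst mult_op_compose) (auto simp: symbol_ann f rho_def simp del: power_Suc)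
    have Pf: "Lp 2 (P k f)" by (rule mult_op_fourier(2)[OF symbol_ann f]) simp
    let ?G = "\<lambda>y. inv_kernel (low i rho) (x - y)"
    have rc1: "rc \<ge> 1" using r_facts by simp
    have G: "Lp 2 ?G" "Lp rc ?G"
      using Lp_reflect[OF kernel_Lp[OF k(2)[OF c0]]] rc1 by auto
    have "mult_op (ann i 0 k) f x = conv (inv_kernel (low i rho)) (P k f) x"
      unfolding e[symmetric] by (rule mult_op_conv[OF k(1)[OF c0] Pf])
    also have "... = (LI y. P k f y * ?G y)" by (simp add: conv_def mult.commute)
    finally have "cmod (mult_op (ann i 0 k) f x) \<le> A * (2 ^ k) powr (- 3 / 2) * Lp_norm rc ?G"
      using NbD[OF N G, of k] by simp
    also have "... \<le> A * (2 ^ k) powr (- 3 / 2) * (C0 * rho ^ i * pi * rho powr (1 / 6))"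
    proof (intro mult_left_mono)
      have "Lp_norm rc ?G \<le> C0 * rho ^ i * pi * rho powr (1 - 1 / rc)"
        unfolding Lp_norm_reflect by (rule k(4)[OF c0 rc1])
      also have "... \<le> C0 * rho ^ i * pi * rho powr (1 / 6)"
        unfolding r_facts(4) using r_facts(7) r0 C0 by (intro mult_left_mono powr_mono) auto
      finally show "Lp_norm rc ?G \<le> C0 * rho ^ i * pi * rho powr (1 / 6)" .
    qed (use A in auto)
    also have "... = C0 * pi * A * ((2 ^ k) powr (- 3 / 2) * rho powr (real i + 1 / 6))"
      using r0' by (simp add: powr_add powr_realpow mult_ac)
    also have "... \<le> C0 * pi * A * (4 * (2 ^ k) powr (- 4 / 3 + real i))"
    proof (rule mult_left_mono)
      have "rho powr (real i + 1 / 6) = 2 powr (real i + 1/6) * (2 ^ k) powr (real i + 1 / 6)"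
        unfolding rho_def by (simp add: powr_mult)
      moreover have "(2::real) powr (real i + 1/6) \<le> 2 powr 2" using i by (intro powr_mono) auto
      ultimately have "(2 ^ k) powr (- 3 / 2) * rho powr (real i + 1 / 6) \<le> (2 ^ k) powr (- 3 / 2) * (4 * (2 ^ k) powr (real i + 1 / 6))"
        by (intro mult_left_mono) (auto intro!: mult_right_mono)
      also have "... = 4 * (2 ^ k) powr (- 4 / 3 + real i)"
        by (simp add: mult.left_commute powr_add[symmetric])
      finally show "(2 ^ k) powr (- 3 / 2) * rho powr (real i + 1 / 6) \<le> 4 * (2 ^ k) powr (- 4 / 3 + real i)" .
    qed (use C0 A in simp)
    finally show "cmod (mult_op (ann i 0 k) f x) \<le> 4 * C0 * pi * A * (2 ^ k) powr (- 4 / 3 + real i)" by (simp add: mult_ac)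
  qed
qed

abbreviation S :: "nat \<Rightarrow> (real \<Rightarrow> complex) \<Rightarrow> real \<Rightarrow> complex" where
  "S n f \<equiv> mult_op (low 0 (2 ^ n)) f"

lemma S_sum:
  assumes f: "Lp 2 f"
  shows "S n f x = (\<Sum>j\<le>n. P j f x)" "mult_op (low 1 (2 ^ n)) f x = (\<Sum>j\<le>n. mult_op (ann 1 0 j) f x)"
  unfolding low_sum by (rule mult_op_sum[OF _ f]; simp add: symbol_ann)+

lemma low_derivative: "(\<lambda>xi. \<i> * cr xi * low 0 R xi) = low 1 R"
  by (rule ext) (simp add: low_def)

lemma S_L2: "Lp 2 f \<Longrightarrow> Lp 2 (S n f)"
  by (rule mult_op_fourier(2)[OF symbol_low]) auto

text \<open>Even after one derivative the pieces decay like 2^(-j/3), so the sums over j converge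
  geometrically; without a derivative the tail from m on gains a further factor 2^(-m). The last
  bound stays in dual form, as the L^r norms are not yet known to be finite.\<close>

lemma S_bounds: "\<exists>C\<ge>0. \<forall>f A. Lp 2 f \<longrightarrow> A \<ge> 0 \<longrightarrow> Nb A f \<longrightarrow>
   (\<forall>n x. cmod (S n f x) \<le> C * A) \<and>
   (\<forall>n x y. cmod (S n f x - S n f y) \<le> C * A * \<bar>x - y\<bar>) \<and>
   (\<forall>m n x. m \<le> n \<longrightarrow> cmod (S n f x - S m f x) \<le> C * A * (1 / 2 ^ m)) \<and>
   (\<forall>n G. Lp 2 G \<longrightarrow> Lp rc G \<longrightarrow> cmod (LI x. S n f x * G x) \<le> C * A * Lp_norm rc G)"
proof -
  obtain C0 where C0: "C0 \<ge> 0" and K: "\<And>f A k i x. Lp 2 f \<Longrightarrow> A \<ge> 0 \<Longrightarrow> Nb A f \<Longrightarrow> i \<in> {0,1} \<Longrightarrow>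
    cmod (mult_op (ann i 0 k) f x) \<le> C0 * A * (2 ^ k) powr (- 4 / 3 + real i)"
    using P_sup by blast
  obtain C1 where C1: "C1 \<ge> 0" and g1: "\<And>n. (\<Sum>j\<le>n. (2 ^ j) powr (- (1/3))) \<le> (C1::real)" using geometric_bound[of "1/3"] by auto
  have mono: "(2 ^ j) powr (- c) \<le> (2 ^ j) powr (- (1/3::real))" if "c \<ge> 1/3" for j c
    using that by (intro powr_mono) auto
  show ?thesis
  proof (intro exI[of _ "C0 * C1 + C1"] conjI allI impI)
    show "0 \<le> C0 * C1 + C1" using C0 C1 by simp
    fix f A assume f: "Lp 2 f" and A: "A \<ge> 0" and N: "Nb A f"
    have le: "C0 * A * (\<Sum>j\<in>J. (2 ^ j) powr (- (1/3))) \<le> (C0 * C1 + C1) * A" if "J \<subseteq> {..n}" for J n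
    proof -
      have "(\<Sum>j\<in>J. (2 ^ j) powr (- (1/3))) \<le> (\<Sum>j\<le>n. (2 ^ j) powr (- (1/3::real)))"
        by (rule sum_mono2) (use that in auto)
      then have "(\<Sum>j\<in>J. (2 ^ j) powr (- (1/3))) \<le> C1" using g1[of n] by linarith
      then have "C0 * A * (\<Sum>j\<in>J. (2 ^ j) powr (- (1/3))) \<le> C0 * A * C1" using C0 A by (intro mult_left_mono) auto
      also have "... \<le> (C0 * C1 + C1) * A" using C1 A by (simp add: algebra_simps)
      finally show ?thesis .
    qed
    have P0: "cmod (P j f x) \<le> C0 * A * (2 ^ j) powr (- (1/3)) * (1 / 2 ^ j)" for j x
    proof -
      have "- 4 / 3 + real 0 = - (1/3) + - 1" by simp
      then have "(2 ^ j) powr (- 4 / 3 + real 0) = (2 ^ j) powr (- (1/3)) * (2 ^ j) powr (- 1 :: real)"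
        by (simp only: powr_add)
      also have "(2 ^ j) powr (- 1 :: real) = 1 / 2 ^ j" by (simp add: powr_minus divide_inverse)
      finally show ?thesis using K[OF f A N, of 0 j x] by simp
    qed
    have P0': "cmod (P j f x) \<le> C0 * A * (2 ^ j) powr (- (1/3)) * (1 / 2 ^ m)" if "m \<le> j" for j m x
      using C0 A by (intro order_trans[OF P0[of j x]] mult_left_mono) (auto intro!: divide_left_mono power_increasing that)
    have S0: "cmod (\<Sum>j\<in>J. P j f x) \<le> (C0 * C1 + C1) * A * (1 / 2 ^ m)" if "J \<subseteq> {m..n}" for J n m x
    proof -
      have "cmod (\<Sum>j\<in>J. P j f x) \<le> (\<Sum>j\<in>J. C0 * A * (2 ^ j) powr (- (1/3)) * (1 / 2 ^ m))"
        by (rule order_trans[OF norm_sum sum_mono], rule P0') (use that in auto)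
      also have "... = C0 * A * (\<Sum>j\<in>J. (2 ^ j) powr (- (1/3))) * (1 / 2 ^ m)"
        unfolding sum_distrib_left sum_distrib_right ..
      also have "... \<le> (C0 * C1 + C1) * A * (1 / 2 ^ m)" by (rule mult_right_mono[OF le[of J n]]) (use that in auto)
      finally show ?thesis .
    qed
    show "cmod (S n f x) \<le> (C0 * C1 + C1) * A" for n x
    proof -
      have "{..n} \<subseteq> {0..n}" by (simp add: atLeast0AtMost)
      from S0[OF this, of x] show ?thesis by (simp add: S_sum[OF f])
    qed
    show "cmod (S n f x - S m f x) \<le> (C0 * C1 + C1) * A * (1 / 2 ^ m)" if "m \<le> n" for m n x
    proof -
      have "(\<Sum>j\<le>n. P j f x) = (\<Sum>j\<le>m. P j f x) + (\<Sum>j\<in>{m<..n}. P j f x)"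
        using that by (subst sum.union_disjoint[symmetric]) (auto intro!: sum.cong)
      then have "S n f x - S m f x = (\<Sum>j\<in>{m<..n}. P j f x)" by (simp add: S_sum[OF f])
      moreover have "{m<..n} \<subseteq> {m..n}" by (simp add: subset_iff)
      ultimately show ?thesis using S0[of "{m<..n}" m n x] by simp
    qed
    show "cmod (S n f x - S n f y) \<le> (C0 * C1 + C1) * A * \<bar>x - y\<bar>" for n x y
    proof (rule mult_op_lipschitz[OF symbol_low _ f], unfold low_derivative)
      fix x
      have "cmod (mult_op (low 1 (2 ^ n)) f x) \<le> (\<Sum>j\<le>n. C0 * A * (2 ^ j) powr (- (1/3)))"
        unfolding S_sum(2)[OF f]
        by (rule order_trans[OF norm_sum sum_mono]) (use K[OF f A N, of 1] in simp)
      also have "... = C0 * A * (\<Sum>j\<le>n. (2 ^ j) powr (- (1/3)))" by (simp add: sum_distrib_left)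
      also have "... \<le> (C0 * C1 + C1) * A" by (rule le[of _ n]) auto
      finally show "cmod (mult_op (low 1 (2 ^ n)) f x) \<le> (C0 * C1 + C1) * A" .
    qed (auto intro: symbol_low)
    show "cmod (LI x. S n f x * G x) \<le> (C0 * C1 + C1) * A * Lp_norm rc G" if G: "Lp 2 G" "Lp rc G" for n G
    proof -
      have i: "integ (\<lambda>x. P j f x * G x)" for j
        by (rule CS_integrable[OF mult_op_fourier(2)[OF symbol_ann f] G(1)]) simp
      have "(LI x. S n f x * G x) = (\<Sum>j\<le>n. LI x. P j f x * G x)"
        using i by (simp add: S_sum[OF f] sum_distrib_right)
      then have "cmod (LI x. S n f x * G x) \<le> (\<Sum>j\<le>n. A * (2 ^ j) powr (- 3 / 2) * Lp_norm rc G)"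
        by (simp only:) (rule order_trans[OF norm_sum sum_mono], rule NbD[OF N G])
      also have "... \<le> (\<Sum>j\<le>n. A * (2 ^ j) powr (- (1/3)) * Lp_norm rc G)"
        using A by (intro sum_mono mult_right_mono mult_left_mono powr_mono) auto
      also have "... = A * Lp_norm rc G * (\<Sum>j\<le>n. (2 ^ j) powr (- (1/3)))" by (simp add: sum_distrib_left mult_ac)
      also have "... \<le> A * Lp_norm rc G * C1" using g1 A by (intro mult_left_mono) auto
      also have "... \<le> (C0 * C1 + C1) * A * Lp_norm rc G" using C0 C1 A by (simp add: algebra_simps)
      finally show ?thesis .
    qed
  qed
qed

section \<open>Splitting at a frequency well below \<open>2\<^sup>k\<close>\<close>

text \<open>With this \<open>c\<close> the \<open>p\<close>-th power of \<open>Lo k f\<close> has no frequency in the \<open>k\<close>-th annulus.\<close>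

definition c :: nat where "c = 4 * p"

lemma c_facts: "c > 0" "4 * real p \<le> 2 ^ c"
proof -
  show "c > 0" using p3 by (simp add: c_def)
  have "real c < 2 ^ c" by (rule of_nat_less_two_power)
  then show "4 * real p \<le> 2 ^ c" by (simp add: c_def)
qed

text \<open>For k < c the cut-off frequency would lie below 1. The low part is then 0 and all of f
  counts as high, which also disposes of the ball k = 0.\<close>

definition Lo :: "nat \<Rightarrow> (real \<Rightarrow> complex) \<Rightarrow> real \<Rightarrow> complex" where
  "Lo k f = (if k < c then (\<lambda>_. 0) else S (k - c) f)"

definition losym :: "nat \<Rightarrow> real \<Rightarrow> complex" where
  "losym k xi = (if k < c then 0 else low 0 (2 ^ (k - c)) xi)"

lemma losym_real: "losym k xi = cr (if k < c then 0 else phi (xi / 2 ^ (k - c)))"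
  by (simp add: losym_def low_def)

lemma Lo_fourier:
  assumes f: "Lp 2 f"
  shows "Lp 2 (Lo k f)" "AEL xi. fourier (Lo k f) xi = losym k xi * fourier f xi"
proof -
  have z: "is_fourier (\<lambda>x. 0) (\<lambda>x. 0)" by (simp add: is_fourier_def)
  show "Lp 2 (Lo k f)" using S_L2[OF f] by (simp add: Lo_def)
  show "AEL xi. fourier (Lo k f) xi = losym k xi * fourier f xi"
  proof (cases "k < c")
    case True
    then show ?thesis using fourier_AE_eq[OF z] by (simp add: Lo_def losym_def)
  next
    case False
    then show ?thesis using fourier_mult_op[OF symbol_low f, of 0 "2 ^ (k - c)"] by (simp add: Lo_def losym_def)
  qed
qed

lemma Lo_support:
  assumes f: "Lp 2 f"
  shows "AEL xi. 2 * 2 ^ k / 2 ^ c \<le> \<bar>xi\<bar> \<longrightarrow> fourier (Lo k f) xi = 0"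
  using Lo_fourier(2)[OF f, of k]
proof eventually_elim
  case (elim xi)
  show ?case
  proof
    assume a: "2 * 2 ^ k / 2 ^ c \<le> \<bar>xi\<bar>"
    have "losym k xi = 0"
    proof (cases "k < c")
      case False
      then have "(2::real) ^ (k - c) = 2 ^ k / 2 ^ c" by (simp add: power_diff)
      then have "2 * 2 ^ (k - c) \<le> \<bar>xi\<bar>" using a by simp
      then have "\<bar>xi / 2 ^ (k - c)\<bar> \<ge> 2" by (simp add: abs_divide pos_le_divide_eq)
      then show ?thesis using phi_0 by (simp add: losym_real)
    qed (simp add: losym_def)
    then show "fourier (Lo k f) xi = 0" using elim by simp
  qed
qed

definition Hi :: "nat \<Rightarrow> (real \<Rightarrow> complex) \<Rightarrow> real \<Rightarrow> complex" where
  "Hi k f x = f x - Lo k f x"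

lemma Hi_fourier:
  assumes f: "Lp 2 f"
  shows "Lp 2 (Hi k f)" "AEL xi. fourier (Hi k f) xi = (1 - losym k xi) * fourier f xi"
proof -
  show "Lp 2 (Hi k f)" unfolding Hi_def by (rule Lp_diff[OF f Lo_fourier(1)[OF f]]) simp
  show "AEL xi. fourier (Hi k f) xi = (1 - losym k xi) * fourier f xi"
    using fourier_diff_AE[OF f Lo_fourier(1)[OF f, of k]] Lo_fourier(2)[OF f, of k] unfolding Hi_def[abs_def]
    by eventually_elim (simp add: left_diff_distrib)
qed

text \<open>The maximum with 1 absorbs the blocks k < c, from which nothing is cut away.\<close>

lemma hisym:
  "cmod (1 - losym k xi) \<le> 1" "1 - losym k xi \<noteq> 0 \<Longrightarrow> 2 ^ k < 2 ^ c * max 1 \<bar>xi\<bar>"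
proof -
  have "1 - losym k xi = cr (1 - (if k < c then 0 else phi (xi / 2 ^ (k - c))))"
    by (simp add: losym_real)
  then show "cmod (1 - losym k xi) \<le> 1"
    using phi_range[of "xi / 2 ^ (k - c)"] by (simp only: norm_of_real) auto
  assume nz: "1 - losym k xi \<noteq> 0"
  show "2 ^ k < 2 ^ c * max 1 \<bar>xi\<bar>"
  proof (cases "k < c")
    case True
    then have "(2::real) ^ k < 2 ^ c" by simp
    also have "... \<le> 2 ^ c * max 1 \<bar>xi\<bar>" by (simp add: max_def)
    finally show ?thesis .
  next
    case False
    then have "\<not> \<bar>xi / 2 ^ (k - c)\<bar> \<le> 1" using nz phi_1[of "xi / 2 ^ (k - c)"] by (auto simp: losym_real)
    then have "2 ^ (k - c) < \<bar>xi\<bar>" by (simp add: abs_divide not_le pos_less_divide_eq)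
    then have "2 ^ c * 2 ^ (k - c) < 2 ^ c * \<bar>xi\<bar>" by simp
    also have "(2::real) ^ c * 2 ^ (k - c) = 2 ^ k" using False by (simp flip: power_add)
    also have "2 ^ c * \<bar>xi\<bar> \<le> 2 ^ c * max 1 \<bar>xi\<bar>" by simp
    finally show ?thesis .
  qed
qed

lemma max_powr_bessel:
  assumes "a \<ge> 0"
  shows "max 1 \<bar>xi\<bar> powr a \<le> cmod (bessel_symbol a xi)"
proof -
  have "(max 1 \<bar>xi\<bar>)\<^sup>2 \<le> 1 + xi\<^sup>2" by (auto simp: max_def)
  then have "((max 1 \<bar>xi\<bar>)\<^sup>2) powr (a / 2) \<le> (1 + xi\<^sup>2) powr (a / 2)" using assms by (intro powr_mono2) auto
  moreover have "((max 1 \<bar>xi\<bar>)\<^sup>2) powr (a / 2) = max 1 \<bar>xi\<bar> powr a"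
    using powr_powr[of "max 1 \<bar>xi\<bar>" 2 "a / 2"] by simp
  ultimately show ?thesis by (simp add: cmod_bessel)
qed

text \<open>On the support of the symbol 2^k is below 2^c max(1, |xi|), so the factor 2^(\<sigma> k)
  is bought with the Bessel weight.\<close>

lemma Hi_L2:
  assumes f: "sobolev \<sigma> 2 f"
  shows "N2 (Hi k f) \<le> (2 ^ c) powr \<sigma> * (2 ^ k) powr (- \<sigma>) * Xn \<sigma> f"
proof -
  have s0: "\<sigma> \<ge> 0" using sg3 by simp
  note s = sobolev2D[OF f s0]
  note h = Hi_fourier[OF s(1), of k]
  have "AEL xi. cmod (fourier (Hi k f) xi) \<le> ((2 ^ c) powr \<sigma> * (2 ^ k) powr (- \<sigma>)) * cmod (bessel_symbol \<sigma> xi * fourier f xi)"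
    using h(2)
  proof eventually_elim
    case (elim xi)
    have "cmod (1 - losym k xi) \<le> ((2 ^ c) powr \<sigma> * (2 ^ k) powr (- \<sigma>)) * cmod (bessel_symbol \<sigma> xi)"
    proof (cases "1 - losym k xi = 0")
      case False
      have "(2 ^ k) powr \<sigma> \<le> (2 ^ c * max 1 \<bar>xi\<bar>) powr \<sigma>" using hisym(2)[OF False] s0 by (intro powr_mono2) auto
      also have "... = (2 ^ c) powr \<sigma> * max 1 \<bar>xi\<bar> powr \<sigma>" by (simp add: powr_mult)
      also have "... \<le> (2 ^ c) powr \<sigma> * cmod (bessel_symbol \<sigma> xi)" by (intro mult_left_mono max_powr_bessel s0) auto
      finally have "(2 ^ k) powr \<sigma> * (2 ^ k) powr (- \<sigma>) \<le> (2 ^ c) powr \<sigma> * cmod (bessel_symbol \<sigma> xi) * (2 ^ k) powr (- \<sigma>)"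
        by (intro mult_right_mono) auto
      then have "1 \<le> (2 ^ c) powr \<sigma> * cmod (bessel_symbol \<sigma> xi) * (2 ^ k) powr (- \<sigma>)" by (simp add: powr_minus)
      then show ?thesis using hisym(1)[of k xi] by (simp add: mult_ac)
    qed simp
    then show ?case unfolding elim norm_mult by (simp add: mult_right_mono flip: mult.assoc)
  qed
  then have "N2 (fourier (Hi k f)) \<le> ((2 ^ c) powr \<sigma> * (2 ^ k) powr (- \<sigma>)) * Xn \<sigma> f"
    unfolding Xn_def by (intro Lp_norm_bound s(2) Lp_measurable[OF fourier_L2(2)[OF h(1)]]) auto
  moreover have "N2 (Hi k f) \<le> N2 (fourier (Hi k f))"
  proof (rule power2_le_imp_le)
    have "(N2 (Hi k f))\<^sup>2 \<le> 2 * pi * (N2 (Hi k f))\<^sup>2"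
      using pi_ge_two by (simp add: mult_le_cancel_right1)
    then show "(N2 (Hi k f))\<^sup>2 \<le> (N2 (fourier (Hi k f)))\<^sup>2"
      using Plancherel[OF fourier_L2(1)[OF h(1)] h(1)] by simp
  qed simp
  ultimately show ?thesis by linarith
qed

text \<open>As s \<ge> 1 the ratios are at least 2, and the geometric sum is at most twice its last
  term.\<close>

lemma dyadic_sum:
  assumes s: "s \<ge> (1::real)" and Y: "Y > 0"
  shows "(\<Sum>k\<le>K. if 2 ^ k < Y then (2 ^ k) powr s else 0) \<le> 2 * Y powr s"
proof -
  have full: "(\<Sum>k\<le>K. (2 ^ k) powr s) \<le> 2 * (2 ^ K) powr s" for K
  proof (induction K)
    case (Suc K)
    have "(2::real) powr 1 \<le> 2 powr s" using s by (intro powr_mono) auto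
    then have "2 * (2 ^ K) powr s \<le> 2 powr s * (2 ^ K) powr s" by (intro mult_right_mono) auto
    also have "... = (2 ^ Suc K) powr s" by (simp add: powr_mult)
    finally show ?case using Suc by simp
  qed simp
  show ?thesis
  proof (induction K)
    case 0
    have "1 \<le> Y powr s" if "1 < Y" using that s by (intro ge_one_powr_ge_zero) auto
    moreover have "0 \<le> Y powr s" by simp
    ultimately show ?case by (cases "1 < Y") auto
  next
    case (Suc K)
    show ?case
    proof (cases "2 ^ Suc K < Y")
      case True
      have "(\<Sum>k\<le>Suc K. if 2 ^ k < Y then (2 ^ k) powr s else 0) \<le> (\<Sum>k\<le>Suc K. (2 ^ k) powr s)"
        by (rule sum_mono) auto
      also have "... \<le> 2 * (2 ^ Suc K) powr s" by (rule full)
      also have "... \<le> 2 * Y powr s" using True s by (intro mult_left_mono powr_mono2) auto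
      finally show ?thesis .
    qed (use Suc in simp)
  qed
qed

text \<open>\<open>Hi k\<close> keeps all high frequencies and not just an annulus, so these parts
  overlap heavily. But a frequency xi occurs only in those with 2^k < 2^c max(1, |xi|), and over
  these k the weights 2^(2 \<sigma> k) add up to the size of the last one.\<close>

lemma Hi_sum:
  assumes f: "sobolev \<sigma> 2 f"
  shows "(\<Sum>k\<le>K. (2 ^ k) powr (2 * \<sigma>) * (N2 (Hi k f))\<^sup>2) \<le> 2 * (2 ^ c) powr (2 * \<sigma>) * (Xn \<sigma> f)\<^sup>2"
proof -
  have s0: "\<sigma> \<ge> 0" "2 * \<sigma> \<ge> 1" using sg3 by auto
  note s = sobolev2D[OF f s0(1)]
  let ?F = "\<lambda>k xi. (cmod ((1 - losym k xi) * fourier f xi))\<^sup>2"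
  have L: "Lp 2 (\<lambda>xi. (1 - losym k xi) * fourier f xi)" for k
    by (rule Lp_cong_AE[OF Hi_fourier(2)[OF s(1)] fourier_L2(2)[OF Hi_fourier(1)[OF s(1)]]])
  have iF: "integ (?F k)" for k using Lp2_integrable[OF L] .
  have e: "(N2 (Hi k f))\<^sup>2 \<le> (LI xi. ?F k xi)" for k
  proof -
    note h = Hi_fourier[OF s(1), of k]
    have "(N2 (fourier (Hi k f)))\<^sup>2 = (LI xi. ?F k xi)"
      unfolding Lp_norm_cong_AE[OF h(2) Lp_measurable[OF fourier_L2(2)[OF h(1)]]] Lp_norm2_sq ..
    moreover have "(N2 (Hi k f))\<^sup>2 \<le> 2 * pi * (N2 (Hi k f))\<^sup>2"
      using pi_ge_two by (simp add: mult_le_cancel_right1)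
    ultimately show ?thesis using Plancherel[OF fourier_L2(1)[OF h(1)] h(1)] by simp
  qed
  have "(\<Sum>k\<le>K. (2 ^ k) powr (2 * \<sigma>) * (N2 (Hi k f))\<^sup>2) \<le> (\<Sum>k\<le>K. (2 ^ k) powr (2 * \<sigma>) * (LI xi. ?F k xi))"
    by (intro sum_mono mult_left_mono e) auto
  also have "... = (LI xi. (\<Sum>k\<le>K. (2 ^ k) powr (2 * \<sigma>) * ?F k xi))"
    using iF by simp
  also have "... \<le> (LI xi. 2 * (2 ^ c) powr (2 * \<sigma>) * (cmod (bessel_symbol \<sigma> xi * fourier f xi))\<^sup>2)"
  proof (rule integral_mono)
    show "integ (\<lambda>xi. \<Sum>k\<le>K. (2 ^ k) powr (2 * \<sigma>) * ?F k xi)" using iF by simp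
    show "integ (\<lambda>xi. 2 * (2 ^ c) powr (2 * \<sigma>) * (cmod (bessel_symbol \<sigma> xi * fourier f xi))\<^sup>2)"
      using Lp2_integrable[OF s(2)] by simp
    fix xi :: real
    let ?Y = "2 ^ c * max 1 \<bar>xi\<bar>"
    have Y: "?Y > 0" by (simp add: max_def)
    have "(\<Sum>k\<le>K. (2 ^ k) powr (2 * \<sigma>) * ?F k xi) \<le> (\<Sum>k\<le>K. (if 2 ^ k < ?Y then (2 ^ k) powr (2 * \<sigma>) else 0) * (cmod (fourier f xi))\<^sup>2)"
    proof (rule sum_mono)
      fix k
      show "(2 ^ k) powr (2 * \<sigma>) * ?F k xi \<le> (if 2 ^ k < ?Y then (2 ^ k) powr (2 * \<sigma>) else 0) * (cmod (fourier f xi))\<^sup>2"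
      proof (cases "1 - losym k xi = 0")
        case False
        have "(cmod (1 - losym k xi))\<^sup>2 \<le> 1" using hisym(1)[of k xi] by (simp add: abs_square_le_1)
        then have "(cmod (1 - losym k xi))\<^sup>2 * (cmod (fourier f xi))\<^sup>2 \<le> 1 * (cmod (fourier f xi))\<^sup>2" by (rule mult_right_mono) simp
        then show ?thesis using hisym(2)[OF False] by (simp add: norm_mult power_mult_distrib mult_left_mono)
      qed (simp only: mult_zero_left norm_zero, simp)
    qed
    also have "... = (\<Sum>k\<le>K. if 2 ^ k < ?Y then (2 ^ k) powr (2 * \<sigma>) else 0) * (cmod (fourier f xi))\<^sup>2"
      by (rule sum_distrib_right[symmetric])
    also have "... \<le> (2 * ?Y powr (2 * \<sigma>)) * (cmod (fourier f xi))\<^sup>2"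
      by (intro mult_right_mono dyadic_sum s0 Y) auto
    also have "?Y powr (2 * \<sigma>) = (2 ^ c) powr (2 * \<sigma>) * (max 1 \<bar>xi\<bar>) powr (2 * \<sigma>)" by (simp add: powr_mult)
    also have "2 * ((2 ^ c) powr (2 * \<sigma>) * (max 1 \<bar>xi\<bar>) powr (2 * \<sigma>)) * (cmod (fourier f xi))\<^sup>2
       \<le> 2 * ((2 ^ c) powr (2 * \<sigma>) * (cmod (bessel_symbol \<sigma> xi))\<^sup>2) * (cmod (fourier f xi))\<^sup>2"
    proof (intro mult_right_mono mult_left_mono)
      have "(max 1 \<bar>xi\<bar>) powr (2 * \<sigma>) = ((max 1 \<bar>xi\<bar>) powr \<sigma>)\<^sup>2"
        by (simp add: power2_eq_square powr_add[symmetric])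
      also have "... \<le> (cmod (bessel_symbol \<sigma> xi))\<^sup>2" by (intro power_mono max_powr_bessel s0) auto
      finally show "(max 1 \<bar>xi\<bar>) powr (2 * \<sigma>) \<le> (cmod (bessel_symbol \<sigma> xi))\<^sup>2" .
    qed auto
    finally show "(\<Sum>k\<le>K. (2 ^ k) powr (2 * \<sigma>) * ?F k xi) \<le> 2 * (2 ^ c) powr (2 * \<sigma>) * (cmod (bessel_symbol \<sigma> xi * fourier f xi))\<^sup>2"
      by (simp add: norm_mult power_mult_distrib mult_ac)
  qed
  also have "... = 2 * (2 ^ c) powr (2 * \<sigma>) * (Xn \<sigma> f)\<^sup>2"
    unfolding Xn_def Lp_norm2_sq by simp
  finally show ?thesis .
qed

text \<open>The remainder is \<open>Hi (n + c) f\<close>, whose norm decays like 2^(-\<sigma>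
  n).\<close>

lemma S_tendsto:
  assumes f: "sobolev \<sigma> 2 f"
  shows "(\<lambda>n. N2 (\<lambda>x. f x - S n f x)) \<longlonglongrightarrow> 0"
proof (rule Lim_null_comparison)
  have e: "(\<lambda>x. f x - S n f x) = Hi (n + c) f" for n
    by (simp add: Hi_def[abs_def] Lo_def)
  show "\<forall>\<^sub>F n in sequentially. norm (N2 (\<lambda>x. f x - S n f x)) \<le> (2 ^ c) powr \<sigma> * (2 ^ (n + c)) powr (- \<sigma>) * Xn \<sigma> f"
    unfolding e using Hi_L2[OF f] by simp
  have "(\<lambda>n. ((2::real) powr (- \<sigma>)) ^ n) \<longlonglongrightarrow> 0"
  proof (rule LIMSEQ_power_zero)
    have "(2::real) powr (- \<sigma>) < 1" using sg3 by (simp add: powr_less_one)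
    then show "norm ((2::real) powr (- \<sigma>)) < 1" by simp
  qed
  then have "(\<lambda>n. (2 ^ c) powr \<sigma> * ((2 powr (- \<sigma>)) ^ n * (2 ^ c) powr (- \<sigma>)) * Xn \<sigma> f) \<longlonglongrightarrow> (2 ^ c) powr \<sigma> * (0 * (2 ^ c) powr (- \<sigma>)) * Xn \<sigma> f"
    by (intro tendsto_mult tendsto_const)
  moreover have "((2::real) ^ (n + c)) powr (- \<sigma>) = (2 powr (- \<sigma>)) ^ n * (2 ^ c) powr (- \<sigma>)" for n
    by (simp add: power_add powr_mult powr_realpow[symmetric] powr_powr mult.commute)
  ultimately show "(\<lambda>n. (2 ^ c) powr \<sigma> * (2 ^ (n + c)) powr (- \<sigma>) * Xn \<sigma> f) \<longlonglongrightarrow> 0" by simp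
qed

text \<open>Everything the nonlinear estimates take from the decaying norm, with one constant: sup
  and Lipschitz bounds of the low part, L^r bounds, and the factor 2^(-k) in the sup norm of the
  high part.\<close>

lemma split_bounds: "\<exists>C\<ge>1. \<forall>f A k. sobolev \<sigma> 2 f \<longrightarrow> A \<ge> 0 \<longrightarrow> Nb A f \<longrightarrow>
   (\<forall>x. cmod (Lo k f x) \<le> C * A) \<and> (\<forall>x y. cmod (Lo k f x - Lo k f y) \<le> C * A * \<bar>x - y\<bar>) \<and>
   Lp r (Lo k f) \<and> Lp_norm r (Lo k f) \<le> C * A \<and> (AEL x. cmod (f x) \<le> C * A) \<and>
   Lp r f \<and> Lp_norm r f \<le> C * A \<and> (AEL x. cmod (Hi k f x) \<le> C * A / 2 ^ k)"
proof -
  obtain C where C: "C \<ge> 0" and K: "\<And>f A. Lp 2 f \<Longrightarrow> A \<ge> 0 \<Longrightarrow> Nb A f \<Longrightarrow>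
   (\<forall>n x. cmod (S n f x) \<le> C * A) \<and>
   (\<forall>n x y. cmod (S n f x - S n f y) \<le> C * A * \<bar>x - y\<bar>) \<and>
   (\<forall>m n x. m \<le> n \<longrightarrow> cmod (S n f x - S m f x) \<le> C * A * (1 / 2 ^ m)) \<and>
   (\<forall>n G. Lp 2 G \<longrightarrow> Lp rc G \<longrightarrow> cmod (LI x. S n f x * G x) \<le> C * A * Lp_norm rc G)"
    using S_bounds by blast
  \<comment> \<open>The tail beyond 2^(k - c) is measured against 2^(-k), which costs 2^c; adding 1
    to C makes the constant at least 1.\<close>
  define D where "D = (C + 1) * 2 ^ c"
  have c1: "(2::real) ^ c \<ge> 1" by simp
  have DC: "C \<le> D" "D \<ge> 1"
  proof -
    have "(C + 1) * 1 \<le> D" unfolding D_def using C c1 by (intro mult_left_mono) auto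
    then show "C \<le> D" "D \<ge> 1" using C by auto
  qed
  show ?thesis
  proof (intro exI[of _ D] conjI allI impI DC(2))
    fix f A k assume f: "sobolev \<sigma> 2 f" and A: "A \<ge> 0" and N: "Nb A f"
    have f2: "Lp 2 f" using sobolev2D(1)[OF f] sg3 by simp
    have CD: "C * A \<le> D * A" using DC A by (intro mult_right_mono) auto
    have D0: "0 \<le> D * A" using DC A by simp
    note k1 = K[OF f2 A N, THEN conjunct1, rule_format]
    note k2 = K[OF f2 A N, THEN conjunct2, THEN conjunct1, rule_format]
    note k3 = K[OF f2 A N, THEN conjunct2, THEN conjunct2, THEN conjunct1, rule_format]
    note k4 = K[OF f2 A N, THEN conjunct2, THEN conjunct2, THEN conjunct2, rule_format]
    show "cmod (Lo k f x) \<le> D * A" for x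
      using order_trans[OF k1 CD] D0 by (simp add: Lo_def)
    show "cmod (Lo k f x - Lo k f y) \<le> D * A * \<bar>x - y\<bar>" for x y
      using order_trans[OF k2 mult_right_mono[OF CD]] D0 by (simp add: Lo_def)
    have d1: "cmod (LI x. Lo k f x * G x) \<le> D * A * Lp_norm rc G" if "Lp 2 G" "Lp rc G" for G
      using order_trans[OF k4[OF that] mult_right_mono[OF CD]] D0 by (simp add: Lo_def)
    show "Lp r (Lo k f)" "Lp_norm r (Lo k f) \<le> D * A"
      using Lp_by_duality[OF r_facts(2) Lo_fourier(1)[OF f2] D0 d1[unfolded rc_def]] by auto
    show "AEL x. cmod (f x) \<le> D * A"
      by (rule L2_limit_bound[OF f2 S_L2[OF f2] S_tendsto[OF f] order_trans[OF k1 CD]])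
    \<comment> \<open>The dual bounds of the partial sums pass to the limit in L^2; only then does
      duality bring f itself into L^r.\<close>
    have d2: "cmod (LI x. f x * G x) \<le> D * A * Lp_norm rc G" if "Lp 2 G" "Lp rc G" for G
    proof -
      have "(\<lambda>n. LI x. S n f x * G x) \<longlonglongrightarrow> (LI x. f x * G x)"
        by (rule integral_L2_tendsto[OF S_L2[OF f2] f2 that(1) S_tendsto[OF f]])
      from tendsto_norm[OF this] show ?thesis
        by (rule LIMSEQ_le_const2) (use order_trans[OF k4[OF that] mult_right_mono[OF CD]] in auto)
    qed
    show "Lp r f" "Lp_norm r f \<le> D * A"
      using Lp_by_duality[OF r_facts(2) f2 D0 d2[unfolded rc_def]] by auto
    have CD2: "C * A * 2 ^ c \<le> D * A" unfolding D_def using A by (simp add: algebra_simps)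
    show "AEL x. cmod (Hi k f x) \<le> D * A / 2 ^ k"
    proof (cases "k < c")
      case True
      have "C * A \<le> D * A / 2 ^ k"
      proof -
        have "C * A * 2 ^ k \<le> C * A * 2 ^ c" using True C A by (intro mult_left_mono power_increasing) auto
        then show ?thesis using CD2 by (simp add: pos_le_divide_eq)
      qed
      then have "AEL x. cmod (f x) \<le> D * A / 2 ^ k"
        by (intro L2_limit_bound[OF f2 S_L2[OF f2] S_tendsto[OF f]] order_trans[OF k1])
      then show ?thesis using True by (simp add: Hi_def Lo_def)
    next
      case False
      have e: "C * A * (1 / 2 ^ (k - c)) \<le> D * A / 2 ^ k"
      proof -
        have "(2::real) ^ k = 2 ^ c * 2 ^ (k - c)" using False by (simp flip: power_add)
        then show ?thesis using CD2 by (simp add: field_simps)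
      qed
      let ?h = "\<lambda>n x. S (n + (k - c)) f x - S (k - c) f x"
      have "AEL x. cmod (Hi k f x) \<le> D * A / 2 ^ k"
      proof (rule L2_limit_bound)
        show "Lp 2 (Hi k f)" by (rule Hi_fourier(1)[OF f2])
        show "Lp 2 (?h n)" for n by (intro Lp_diff S_L2 f2) simp
        have "(\<lambda>x. Hi k f x - ?h n x) = (\<lambda>x. f x - S (n + (k - c)) f x)" for n
          using False by (auto simp: Hi_def Lo_def)
        then show "(\<lambda>n. N2 (\<lambda>x. Hi k f x - ?h n x)) \<longlonglongrightarrow> 0"
          using LIMSEQ_ignore_initial_segment[OF S_tendsto[OF f], of "k - c"] by simp
        show "cmod (?h n x) \<le> D * A / 2 ^ k" for n x
          by (rule order_trans[OF k3 e]) simp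
      qed
      then show ?thesis .
    qed
  qed
qed

end

section \<open>Products of band-limited functions\<close>

lemma band_representation:
  assumes U: "Lp 2 U" and a: "AEL xi. a < \<bar>xi\<bar> \<longrightarrow> fourier U xi = 0"
  shows "AEL x. U x = mult_op (indicator {-a..a}) U x"
proof -
  have s: "symbol (indicator {-a..a})"
    unfolding symbol_def
  proof (intro conjI exI allI impI)
    show "cmod (indicator {-a..a} xi) \<le> 1" for xi :: real by (simp add: indicator_def)
    show "indicator {-a..a} xi = (0::complex)" if "a < \<bar>xi\<bar>" for xi :: real using that by (auto simp: indicator_def)
  qed measurable
  have "AEL xi. fourier U xi = indicator {-a..a} xi * fourier U xi"
    using a
  proof eventually_elim
    case (elim xi)
    then show ?case by (cases "a < \<bar>xi\<bar>") (auto simp: indicator_def)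
  qed
  from is_fourier_cong_AE[OF fourier_L2(1)[OF U] AE_I2[OF refl] this]
  have "is_fourier U (\<lambda>xi. indicator {-a..a} xi * fourier U xi)" .
  from is_fourier_inj[OF this mult_op_fourier(1)[OF s U]] show ?thesis .
qed

lemma Lp2_mult_bounded:
  assumes "Lp 2 U" "V \<in> lmeas" "\<And>x. cmod (V x) \<le> B"
  shows "Lp 2 (\<lambda>x. U x * V x)"
proof (rule Lp_bound[OF _ assms(1), where c = B])
  show "(\<lambda>x. U x * V x) \<in> lmeas" using assms(2) Lp_measurable[OF assms(1)] by measurable
  show "0 \<le> B" using order_trans[OF norm_ge_zero assms(3)] .
  show "AEL x. cmod (U x * V x) \<le> B * cmod (U x)"
  proof (rule AE_I2)
    fix x
    show "cmod (U x * V x) \<le> B * cmod (U x)"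
      using mult_right_mono[OF assms(3)[of x], of "cmod (U x)"] by (simp add: norm_mult mult.commute)
  qed
qed simp

text \<open>U is a superposition of exponentials of frequency at most a, and multiplication by one
  of these shifts the spectrum of V by at most a, so it stays in |xi| \<le> a + b. Pairing U V with
  the function whose transform is the part beyond a + b therefore gives 0, while by Parseval this
  pairing is a multiple of the squared norm of that part.\<close>

lemma band_product:
  assumes U: "Lp 2 U" and V: "Lp 2 V" "\<And>x. cmod (V x) \<le> B"
    and a: "AEL xi. a < \<bar>xi\<bar> \<longrightarrow> fourier U xi = 0"
    and b: "AEL xi. b < \<bar>xi\<bar> \<longrightarrow> fourier V xi = 0"
  shows "AEL xi. a + b < \<bar>xi\<bar> \<longrightarrow> fourier (\<lambda>x. U x * V x) xi = 0"
proof -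
  let ?W = "\<lambda>x. U x * V x"
  have W: "Lp 2 ?W" by (rule Lp2_mult_bounded[OF U Lp_measurable[OF V(1)] V(2)])
  define H where "H xi = (if a + b < \<bar>xi\<bar> then fourier ?W xi else 0)" for xi
  note Wm = Lp_measurable[OF fourier_L2(2)[OF W]]
  have [measurable]: "fourier ?W \<in> lmeas" by (rule Wm)
  have Hm: "H \<in> lmeas" unfolding H_def by measurable
  have H: "Lp 2 H"
    by (rule Lp_bound[OF Hm fourier_L2(2)[OF W], where c = 1]) (auto simp: H_def)
  obtain h where h: "is_fourier h H" "Lp 2 h" using L2_inverse_exists[OF H] by blast
  define V' where "V' xi = (if b < \<bar>xi\<bar> then 0 else fourier V xi)" for xi
  have V': "is_fourier V V'"
    by (rule is_fourier_cong_AE[OF fourier_L2(1)[OF V(1)] AE_I2[OF refl]])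
      (use b in eventually_elim, auto simp: V'_def)
  let ?i = "indicator {-a..a} :: real \<Rightarrow> complex"
  define q where "q eta = ?i eta * fourier U eta" for eta
  have qi: "integ q"
    unfolding q_def by (rule CS_integrable[OF Lp2_indicator fourier_L2(2)[OF U]])
  define f where "f x = V x * cnj (h x)" for x
  have fi: "integ f"
    unfolding f_def by (rule CS_integrable[OF V(1) Lp_cnj[OF h(2)]])
  have km: "case_prod (\<lambda>x eta. cis (x * eta)) \<in> borel_measurable (borel \<Otimes>\<^sub>M borel)" by measurable
  have inner: "q eta * (LI x. cis (x * eta) * f x) = 0" for eta
  proof (cases "\<bar>eta\<bar> \<le> a")
    case True
    have "cr (2 * pi) * (LI x. (cis (eta * x) * V x) * cnj (h x)) = (LI xi. V' (xi - eta) * cnj (H xi))"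
    proof (rule Parseval[OF is_fourier_modulation[OF V' V(1)] _ h, symmetric])
      have [measurable]: "(\<lambda>x. cis (eta * x)) \<in> lmeas" by (rule borel_imp_lebesgue) measurable
      show "Lp 2 (\<lambda>x. cis (eta * x) * V x)"
        using Lp2_mult_bounded[OF V(1), of "\<lambda>x. cis (eta * x)" 1] by (simp add: mult.commute)
    qed
    also have "... = 0"
    proof -
      have "V' (xi - eta) * cnj (H xi) = 0" for xi
        using True by (auto simp: V'_def H_def)
      then have "(\<lambda>xi. V' (xi - eta) * cnj (H xi)) = (\<lambda>xi. 0)" by (rule ext)
      then show ?thesis by (simp only: integral_zero)
    qed
    finally show ?thesis by (simp add: f_def mult_ac)
  next
    case False
    then have "q eta = 0" by (auto simp: q_def indicator_def)
    then show ?thesis by simp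
  qed
  have "(LI x. f x * (LI eta. cis (x * eta) * q eta)) = (LI eta. q eta * (LI x. cis (x * eta) * f x))"
  proof (rule Fubini_kernel(1)[OF _ _ km])
    show "integ (\<lambda>eta. cis (x * eta) * q eta)" for x by (rule integrable_cis_mult'[OF qi])
    show "integ (\<lambda>x. cmod (f x) * (LI eta. cmod (cis (x * eta)) * cmod (q eta)))"
      using fi by simp
  qed (use fi qi in auto)
  also have "... = 0" unfolding inner by simp
  finally have z: "(LI x. f x * (LI eta. cis (x * eta) * q eta)) = 0" .
  have "(LI x. ?W x * cnj (h x)) = (LI x. cr (1 / (2 * pi)) * (f x * (LI eta. cis (x * eta) * q eta)))"
  proof (rule integral_cong_AE_gen)
    show "AEL x. ?W x * cnj (h x) = cr (1 / (2 * pi)) * (f x * (LI eta. cis (x * eta) * q eta))"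
      using band_representation[OF U a]
    proof eventually_elim
      case (elim x)
      have "U x = cr (1 / (2 * pi)) * (LI eta. cis (x * eta) * q eta)"
        unfolding elim mult_op_def q_def by (simp add: mult.commute)
      then show ?case by (simp add: f_def)
    qed
  qed
  also have "... = 0" using z by simp
  finally have "(LI xi. fourier ?W xi * cnj (H xi)) = 0"
    using Parseval[OF fourier_L2(1)[OF W] W h] by simp
  moreover have "fourier ?W xi * cnj (H xi) = cr ((cmod (H xi))\<^sup>2)" for xi
    unfolding complex_norm_square by (simp add: H_def)
  ultimately have "(LI xi. cr ((cmod (H xi))\<^sup>2)) = 0" by simp
  then have "(N2 H)\<^sup>2 = 0" unfolding Lp_norm2_sq integral_complex_of_real by simp
  then have "AEL xi. H xi = 0" using Lp_norm_eq_0[OF H] by simp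
  then show ?thesis by eventually_elim (auto simp: H_def split: if_splits)
qed

lemma band_power:
  assumes U: "Lp 2 U" "\<And>x. cmod (U x) \<le> B"
    and a: "AEL xi. a < \<bar>xi\<bar> \<longrightarrow> fourier U xi = 0"
  shows "Lp 2 (\<lambda>x. U x ^ Suc n) \<and> (AEL xi. real (Suc n) * a < \<bar>xi\<bar> \<longrightarrow> fourier (\<lambda>x. U x ^ Suc n) xi = 0)"
proof (induction n)
  case 0
  show ?case using U a by simp
next
  case (Suc n)
  have B: "B \<ge> 0" using order_trans[OF norm_ge_zero U(2)] .
  have e: "(\<lambda>x. U x ^ Suc n * U x) = (\<lambda>x. U x ^ Suc (Suc n))" by (simp add: mult.commute)
  have "AEL xi. real (Suc n) * a + a < \<bar>xi\<bar> \<longrightarrow> fourier (\<lambda>x. U x ^ Suc n * U x) xi = 0"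
    using band_product[OF conjunct1[OF Suc] U conjunct2[OF Suc] a] .
  moreover have "real (Suc n) * a + a = real (Suc (Suc n)) * a" by (simp add: algebra_simps)
  moreover have "Lp 2 (\<lambda>x. U x ^ Suc n * U x)"
    by (rule Lp2_mult_bounded[OF conjunct1[OF Suc] Lp_measurable[OF U(1)] U(2)])
  ultimately show ?case unfolding e by simp
qed

section \<open>Pointwise expansion of powers\<close>

lemma power_diff_bound:
  fixes x y :: complex
  assumes "cmod x \<le> M" "cmod y \<le> M"
  shows "cmod (x ^ Suc n - y ^ Suc n) \<le> real (Suc n) * M ^ n * cmod (x - y)"
proof -
  have M: "M \<ge> 0" using assms(1) norm_ge_zero order_trans by blast
  have "x ^ Suc n - y ^ Suc n = (x - y) * (\<Sum>i<Suc n. x ^ i * y ^ (n - i))"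
    using diff_power_eq_sum[of x n y] by simp
  moreover have "cmod (\<Sum>i<Suc n. x ^ i * y ^ (n - i)) \<le> (\<Sum>i<Suc n. M ^ n)"
  proof (rule order_trans[OF norm_sum sum_mono])
    fix i assume "i \<in> {..<Suc n}"
    then have "M ^ i * M ^ (n - i) = M ^ n" by (simp flip: power_add)
    moreover have "cmod (x ^ i * y ^ (n - i)) \<le> M ^ i * M ^ (n - i)"
      unfolding norm_mult norm_power using assms M by (intro mult_mono power_mono) auto
    ultimately show "cmod (x ^ i * y ^ (n - i)) \<le> M ^ n" by simp
  qed
  ultimately have "cmod (x ^ Suc n - y ^ Suc n) \<le> cmod (x - y) * (\<Sum>i<Suc n. M ^ n)"
    by (simp only: norm_mult mult_left_mono norm_ge_zero)
  then show ?thesis by (simp add: mult_ac)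
qed

text \<open>Once x - y is factored out, what remains is a sum of differences of powers, each of
  which contributes x - y a second time.\<close>

lemma power_taylor_bound:
  fixes x y :: complex
  assumes "cmod x \<le> M" "cmod y \<le> M"
  shows "cmod (x ^ Suc (Suc n) - y ^ Suc (Suc n) - of_nat (Suc (Suc n)) * y ^ Suc n * (x - y))
     \<le> (real (Suc (Suc n)))\<^sup>2 * M ^ n * (cmod (x - y))\<^sup>2"
proof -
  have M: "M \<ge> 0" using assms(1) norm_ge_zero order_trans by blast
  let ?m = "Suc n"
  have e: "x ^ Suc ?m - y ^ Suc ?m - of_nat (Suc ?m) * y ^ ?m * (x - y) = (x - y) * (\<Sum>i<Suc ?m. y ^ (?m - i) * (x ^ i - y ^ i))"
  proof -
    have "(\<Sum>i<Suc ?m. y ^ (?m - i) * (x ^ i - y ^ i)) = (\<Sum>i<Suc ?m. x ^ i * y ^ (?m - i)) - (\<Sum>i<Suc ?m. y ^ ?m)"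
      unfolding sum_subtractf[symmetric]
    proof (rule sum.cong[OF refl])
      fix i assume "i \<in> {..<Suc ?m}"
      then have "y ^ (?m - i) * y ^ i = y ^ ?m" by (simp flip: power_add)
      then show "y ^ (?m - i) * (x ^ i - y ^ i) = x ^ i * y ^ (?m - i) - y ^ ?m" by (simp add: algebra_simps)
    qed
    also have "(\<Sum>i<Suc ?m. y ^ ?m) = of_nat (Suc ?m) * y ^ ?m" by simp
    finally have s: "(\<Sum>i<Suc ?m. y ^ (?m - i) * (x ^ i - y ^ i)) = (\<Sum>i<Suc ?m. x ^ i * y ^ (?m - i)) - of_nat (Suc ?m) * y ^ ?m" .
    define A where "A = (\<Sum>i<Suc ?m. x ^ i * y ^ (?m - i))"
    have d: "x ^ Suc ?m - y ^ Suc ?m = (x - y) * A" unfolding A_def by (rule diff_power_eq_sum)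
    show ?thesis unfolding s A_def[symmetric] d by (simp only: right_diff_distrib left_diff_distrib mult_ac)
  qed
  have "cmod (\<Sum>i<Suc ?m. y ^ (?m - i) * (x ^ i - y ^ i)) \<le> (\<Sum>i<Suc ?m. real (Suc ?m) * M ^ n * cmod (x - y))"
  proof (rule order_trans[OF norm_sum sum_mono])
    fix i assume i: "i \<in> {..<Suc ?m}"
    show "cmod (y ^ (?m - i) * (x ^ i - y ^ i)) \<le> real (Suc ?m) * M ^ n * cmod (x - y)"
    proof (cases i)
      case 0
      then show ?thesis using M by simp
    next
      case (Suc j)
      have "cmod (y ^ (?m - i) * (x ^ i - y ^ i)) \<le> M ^ (?m - i) * (real (Suc j) * M ^ j * cmod (x - y))"
        unfolding norm_mult norm_power Suc using assms M
        by (intro mult_mono power_mono power_diff_bound) auto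
      also have "... = real (Suc j) * (M ^ n * cmod (x - y))"
      proof -
        have "M ^ (?m - i) * M ^ j = M ^ n" using i Suc by (simp flip: power_add)
        then show ?thesis by (metis mult.assoc mult.left_commute)
      qed
      also have "... \<le> real (Suc ?m) * (M ^ n * cmod (x - y))"
        using i Suc M by (intro mult_right_mono) auto
      finally show ?thesis by (simp add: mult.assoc)
    qed
  qed
  also have "... = (real (Suc ?m))\<^sup>2 * M ^ n * cmod (x - y)" by (simp add: power2_eq_square mult_ac)
  finally have "cmod (\<Sum>i<Suc ?m. y ^ (?m - i) * (x ^ i - y ^ i)) \<le> (real (Suc ?m))\<^sup>2 * M ^ n * cmod (x - y)" .
  from mult_left_mono[OF this, of "cmod (x - y)"] show ?thesis unfolding e norm_mult
    by (simp only: norm_ge_zero power2_eq_square mult_ac simp_thms)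
qed

section \<open>The nonlinearity in the dual norm\<close>

context LPS
begin

text \<open>1/rc = 1/2 + (p - 1)/r because r = 2p. Hoelder's inequality is applied to the rc-th
  powers, with exponents 2/rc and r/((p - 1) rc).\<close>

lemma Holder_mixed:
  assumes g: "Lp 2 g" and w: "Lp r w"
  shows "Lp rc (\<lambda>x. g x * w x ^ (p - 1))" "Lp_norm rc (\<lambda>x. g x * w x ^ (p - 1)) \<le> N2 g * Lp_norm r w ^ (p - 1)"
proof -
  note [measurable] = Lp_measurable[OF g] Lp_measurable[OF w]
  define a where "a = 2 / rc"
  define b where "b = r / (real (p - 1) * rc)"
  have p: "real p \<ge> 3" "real (p - 1) = real p - 1" using p3 by auto
  have rce: "rc = 2 * real p / (2 * real p - 1)" by (simp add: rc_def r_def)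
  have rc0: "rc > 0" "rc > 1" using r_facts by auto
  have ae: "a = (2 * real p - 1) / real p" using p by (simp add: a_def rce field_simps)
  have be: "b = (2 * real p - 1) / (real p - 1)" using p by (simp add: b_def rce r_def field_simps)
  have ab: "a > 1" "b > 1" using p unfolding ae be by (auto simp: field_simps)
  have ab1: "1 / a + 1 / b = 1"
  proof -
    have "1 / a = real p / (2 * real p - 1)" "1 / b = (real p - 1) / (2 * real p - 1)" by (simp_all add: ae be)
    then have "1 / a + 1 / b = (real p + (real p - 1)) / (2 * real p - 1)"
      by (simp only: add_divide_distrib)
    then show ?thesis using p by simp
  qed
  let ?F = "\<lambda>x. cr (cmod (g x) powr rc)"
  let ?G = "\<lambda>x. cr (cmod (w x) powr (real (p - 1) * rc))"
  have pF: "cmod (?F x) powr a = cmod (g x) powr 2" for x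
    using rc0 by (simp add: powr_powr a_def)
  have pG: "cmod (?G x) powr b = cmod (w x) powr r" for x
    using rc0 p by (simp add: powr_powr b_def)
  have F: "Lp a ?F" unfolding Lp_def pF using g by (auto simp: Lp_def)
  have G: "Lp b ?G" unfolding Lp_def pG using w by (auto simp: Lp_def)
  have e: "cmod (g x * w x ^ (p - 1)) powr rc = cmod (?F x) * cmod (?G x)" for x
  proof -
    have "(cmod (w x) ^ (p - 1)) powr rc = cmod (w x) powr (real (p - 1) * rc)"
    proof (cases "w x = 0")
      case True
      then show ?thesis using p3 rc0 by simp
    next
      case False
      then show ?thesis by (simp add: powr_realpow[symmetric] powr_powr)
    qed
    then show ?thesis by (simp add: norm_mult norm_power powr_mult)
  qed
  have "integ (\<lambda>x. cmod (?F x * ?G x))"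
    by (rule integrable_norm[OF Holder_aux(1)[OF ab ab1 F G]])
  then have "integ (\<lambda>x. cmod (?F x) * cmod (?G x))" by (simp only: norm_mult)
  then have i: "integ (\<lambda>x. cmod (g x * w x ^ (p - 1)) powr rc)"
    unfolding e .
  then show "Lp rc (\<lambda>x. g x * w x ^ (p - 1))" unfolding Lp_def by simp
  have "(LI x. cmod (g x * w x ^ (p - 1)) powr rc) \<le> Lp_norm a ?F * Lp_norm b ?G"
    unfolding e by (rule Holder_aux(2)[OF ab ab1 F G])
  then have "Lp_norm rc (\<lambda>x. g x * w x ^ (p - 1)) \<le> (Lp_norm a ?F * Lp_norm b ?G) powr (1 / rc)"
    unfolding Lp_norm_def[of rc] using rc0 by (intro powr_mono2) auto
  also have "... = Lp_norm a ?F powr (1 / rc) * Lp_norm b ?G powr (1 / rc)"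
    by (simp add: powr_mult)
  also have "Lp_norm a ?F powr (1 / rc) = N2 g"
    unfolding Lp_norm_def pF powr_powr using rc0 by (simp add: a_def)
  also have "Lp_norm b ?G powr (1 / rc) = Lp_norm r w ^ (p - 1)"
  proof -
    let ?I = "LI x. cmod (w x) powr r"
    have "1 / b * (1 / rc) = 1 / r * real (p - 1)" using rc0 p r_facts by (simp add: b_def)
    then have "Lp_norm b ?G powr (1 / rc) = (?I powr (1 / r)) powr real (p - 1)"
      unfolding Lp_norm_def pG powr_powr by simp
    also have "... = (?I powr (1 / r)) ^ (p - 1)"
    proof (cases "?I powr (1 / r) = 0")
      case True
      then show ?thesis unfolding True using p3 by simp
    next
      case False
      moreover have "0 \<le> ?I powr (1 / r)" by simp
      ultimately have "0 < ?I powr (1 / r)" by linarith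
      then show ?thesis by (rule powr_realpow)
    qed
    finally show ?thesis by (simp add: Lp_norm_def)
  qed
  finally show "Lp_norm rc (\<lambda>x. g x * w x ^ (p - 1)) \<le> N2 g * Lp_norm r w ^ (p - 1)" .
qed

lemma Lp_power:
  assumes "Lp 2 f" "AEL x. cmod (f x) \<le> B"
  shows "Lp 2 (\<lambda>x. f x ^ Suc n)"
proof (rule Lp_bound[OF _ assms(1), where c = "max B 0 ^ n"])
  show "(\<lambda>x. f x ^ Suc n) \<in> lmeas" using Lp_measurable[OF assms(1)] by measurable
  show "AEL x. cmod (f x ^ Suc n) \<le> max B 0 ^ n * cmod (f x)"
    using assms(2)
  proof eventually_elim
    case (elim x)
    then have "cmod (f x) ^ n \<le> max B 0 ^ n" by (intro power_mono) auto
    then show ?case by (simp add: norm_mult norm_power mult.commute mult_left_mono)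
  qed
qed auto

text \<open>Powers up to p of \<open>Lo k f\<close> have frequencies at most p 2^(k + 1 - c), which
  by the choice of c does not exceed the inner edge 2^(k - 1) of the annulus. The first power is
  included: it shows that the annulus sees only the high part of f itself.\<close>

lemma Lo_power_killed:
  assumes f: "Lp 2 f" and B: "\<And>x. cmod (Lo k f x) \<le> B" and q: "Suc q \<le> p"
  shows "Lp 2 (\<lambda>x. Lo k f x ^ Suc q)" "AEL xi. ann i b k xi * fourier (\<lambda>x. Lo k f x ^ Suc q) xi = 0"
proof -
  let ?U = "Lo k f"
  have U: "Lp 2 ?U" by (rule Lo_fourier(1)[OF f])
  have "AEL xi. 2 * 2 ^ k / 2 ^ c < \<bar>xi\<bar> \<longrightarrow> fourier ?U xi = 0"
    using Lo_support[OF f, of k] by eventually_elim auto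
  note bp = band_power[OF U B this, of q]
  show "Lp 2 (\<lambda>x. ?U x ^ Suc q)" using bp by simp
  show "AEL xi. ann i b k xi * fourier (\<lambda>x. ?U x ^ Suc q) xi = 0"
  proof (cases "k = 0")
    case True
    have z: "is_fourier (\<lambda>x. 0) (\<lambda>x. 0)" by (simp add: is_fourier_def)
    have "(\<lambda>x. ?U x ^ Suc q) = (\<lambda>x. 0)" using True c_facts(1) by (simp add: Lo_def)
    show ?thesis unfolding \<open>(\<lambda>x. ?U x ^ Suc q) = (\<lambda>x. 0)\<close>
      using fourier_AE_eq[OF z] by eventually_elim simp
  next
    case False
    have le: "real (Suc q) * (2 * 2 ^ k / 2 ^ c) \<le> 2 ^ k / 2"
    proof -
      have "real (Suc q) \<le> real p" using q by simp
      then have "4 * real (Suc q) \<le> 4 * real p" by simp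
      also note c_facts(2)
      finally have "4 * real (Suc q) \<le> 2 ^ c" .
      then have "4 * real (Suc q) * 2 ^ k \<le> 2 ^ c * 2 ^ k" by (intro mult_right_mono) auto
      then show ?thesis by (simp add: field_simps)
    qed
    show ?thesis using conjunct2[OF bp]
    proof eventually_elim
      case (elim xi)
      show ?case
      proof (cases "psik k xi = 0")
        case nz: False
        have "2 ^ k / 2 < \<bar>xi\<bar>" using psik_low[OF _ nz] False by simp
        then have "fourier (\<lambda>x. ?U x ^ Suc q) xi = 0" using elim le by auto
        then show ?thesis by simp
      qed (simp add: ann_def)
    qed
  qed
qed

text \<open>The annulus does not see U^p for U = \<open>Lo k f\<close>, so f^p may be replaced by
  f^p - U^p, which is at most p |f - U| (|f| + |U|)^(p - 1). The factor f - U is in L^2 with norm of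
  order 2^(-\<sigma> k) X, the others are in L^r: one factor takes all derivatives and the others
  supply the decay.\<close>

lemma nonlinear_decay:
  "\<exists>C\<ge>0. \<forall>f A k. sobolev \<sigma> 2 f \<longrightarrow> A \<ge> 0 \<longrightarrow> Nb A f \<longrightarrow>
     Lp rc (mult_op (ann 1 g k) (\<lambda>x. f x ^ p)) \<and>
     Lp_norm rc (mult_op (ann 1 g k) (\<lambda>x. f x ^ p)) \<le> C * (2 ^ k) powr (g + 1 - \<sigma>) * Xn \<sigma> f * A ^ (p - 1)"
proof -
  obtain C where C1: "C \<ge> 1" and K: "\<And>f A k. sobolev \<sigma> 2 f \<Longrightarrow> A \<ge> 0 \<Longrightarrow> Nb A f \<Longrightarrow>
   (\<forall>x. cmod (Lo k f x) \<le> C * A) \<and> (\<forall>x y. cmod (Lo k f x - Lo k f y) \<le> C * A * \<bar>x - y\<bar>) \<and>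
   Lp r (Lo k f) \<and> Lp_norm r (Lo k f) \<le> C * A \<and> (AEL x. cmod (f x) \<le> C * A) \<and>
   Lp r f \<and> Lp_norm r f \<le> C * A \<and> (AEL x. cmod (Hi k f x) \<le> C * A / 2 ^ k)"
    using split_bounds by blast
  obtain C0 where C0: "C0 \<ge> 0" and Kb: "\<And>k. kernel_bound (C0 * (2 ^ k) powr (g + real 1)) (2 ^ k) (ann 1 g k)"
    using ann_kernel[of g] by blast
  have C: "C \<ge> 0" using C1 by simp
  define D where "D = C0 * pi * (real p * (2 ^ c) powr \<sigma>) * (4 * C) ^ (p - 1)"
  show ?thesis
  proof (intro exI[of _ D] conjI allI impI)
    show "0 \<le> D" unfolding D_def using C0 C by simp
    fix f A k assume f: "sobolev \<sigma> 2 f" and A: "A \<ge> 0" and N: "Nb A f"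
    have f2: "Lp 2 f" using sobolev2D(1)[OF f] sg3 by simp
    note KK = K[OF f A N, of k]
    let ?U = "Lo k f"
    have U: "Lp 2 ?U" by (rule Lo_fourier(1)[OF f2])
    note [measurable] = Lp_measurable[OF f2] Lp_measurable[OF U]
    have CA: "C * A \<ge> 0" using C A by simp
    define q where "q = p - 1"
    have q: "Suc q = p" "p - 1 = q" using p3 by (auto simp: q_def)
    have fp: "Lp 2 (\<lambda>x. f x ^ p)" unfolding q(1)[symmetric] using Lp_power[OF f2] KK by blast
    have Up: "Lp 2 (\<lambda>x. ?U x ^ p)" "AEL xi. ann 1 g k xi * fourier (\<lambda>x. ?U x ^ p) xi = 0"
      using Lo_power_killed(1)[OF f2, of k "C * A" q] Lo_power_killed(2)[OF f2, of k "C * A" q 1 g] KK q by auto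
    have sa: "symbol (ann 1 g k)" by (rule symbol_ann) simp
    define d where "d x = f x ^ p - ?U x ^ p" for x
    have d2: "Lp 2 d" unfolding d_def by (rule Lp_diff[OF fp Up(1)]) simp
    have e: "mult_op (ann 1 g k) (\<lambda>x. f x ^ p) = mult_op (ann 1 g k) d"
      unfolding d_def by (rule ext) (simp only: mult_op_diff[OF sa fp Up(1)] mult_op_zero[OF Up(2)] diff_zero)
    define w where "w x = cr (cmod (f x)) + cr (cmod (?U x))" for x
    have absr: "Lp r (\<lambda>x. cr (cmod (h x)))" "Lp_norm r (\<lambda>x. cr (cmod (h x))) = Lp_norm r h"
      if "Lp r h" for h
    proof -
      note [measurable] = Lp_measurable[OF that]
      have "(\<lambda>x. cr (cmod (h x))) \<in> lmeas" by measurable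
      then show "Lp r (\<lambda>x. cr (cmod (h x)))" using that by (simp add: Lp_def)
      show "Lp_norm r (\<lambda>x. cr (cmod (h x))) = Lp_norm r h" by (simp add: Lp_norm_def)
    qed
    have r0: "r > 0" "r \<ge> 0" "r \<ge> 1" using r_facts by auto
    have w: "Lp r w" unfolding w_def by (intro Lp_add absr r0) (use KK in auto)
    \<comment> \<open>Bounding the sum by twice the maximum costs a factor 2, and adding two equal
      r-th powers at most another 2; hence 4.\<close>
    have wn: "Lp_norm r w \<le> 4 * C * A"
    proof -
      define M where "M x = cr (max (cmod (f x)) (cmod (?U x)))" for x
      have I1: "integ (\<lambda>x. cmod (f x) powr r)" "integ (\<lambda>x. cmod (?U x) powr r)"
        using KK by (auto simp: Lp_def)
      have wb: "cmod (w x) powr r \<le> 2 powr r * (cmod (f x) powr r + cmod (?U x) powr r)" for x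
      proof -
        have "cmod (w x) = cmod (f x) + cmod (?U x)"
          unfolding w_def of_real_add[symmetric] norm_of_real by simp
        also have "... \<le> 2 * max (cmod (f x)) (cmod (?U x))" by linarith
        finally have "cmod (w x) powr r \<le> (2 * max (cmod (f x)) (cmod (?U x))) powr r"
          using r0 by (intro powr_mono2) auto
        also have "... = 2 powr r * (max (cmod (f x)) (cmod (?U x))) powr r" by (simp add: powr_mult max_def)
        also have "... \<le> 2 powr r * (cmod (f x) powr r + cmod (?U x) powr r)" by (auto simp: max_def)
        finally show ?thesis .
      qed
      have "(LI x. cmod (w x) powr r) \<le> (LI x. 2 powr r * (cmod (f x) powr r + cmod (?U x) powr r))"
        by (rule integral_mono[OF Lp_integrable[OF w] _ wb]) (use I1 in simp)
      also have "... = 2 powr r * (Lp_norm r f powr r + Lp_norm r ?U powr r)"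
        using I1 by (simp add: Lp_norm_powr r0)
      also have "... \<le> 2 powr r * ((C * A) powr r + (C * A) powr r)"
        using KK r0 by (intro mult_left_mono add_mono powr_mono2) auto
      also have "... \<le> 2 powr r * (2 powr r * (C * A) powr r)"
      proof (rule mult_left_mono)
        have "(2::real) powr 1 \<le> 2 powr r" using r0 by (intro powr_mono) auto
        then have "2 * (C * A) powr r \<le> 2 powr r * (C * A) powr r" by (intro mult_right_mono) auto
        then show "(C * A) powr r + (C * A) powr r \<le> 2 powr r * (C * A) powr r" by simp
      qed simp
      also have "... = (4 * (C * A)) powr r"
      proof -
        have "(4::real) powr r = 2 powr r * 2 powr r" by (simp flip: powr_mult)
        then show ?thesis by (simp add: powr_mult)
      qed
      finally have "Lp_norm r w \<le> ((4 * (C * A)) powr r) powr (1 / r)"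
        unfolding Lp_norm_def using r0 by (intro powr_mono2) auto
      then show ?thesis using r0 CA by (simp add: powr_powr)
    qed
    have H: "Lp 2 (Hi k f)" by (rule Hi_fourier(1)[OF f2])
    note HM = Holder_mixed[OF H w]
    have dm: "d \<in> lmeas" using d2 by (simp add: Lp_def)
    have rc1: "rc \<ge> 1" "rc > 0" "rc \<ge> 0" using r_facts by auto
    have db: "cmod (d x) \<le> real p * cmod (Hi k f x * w x ^ (p - 1))" for x
    proof -
      have n: "cmod (w x) = cmod (f x) + cmod (?U x)"
        unfolding w_def of_real_add[symmetric] norm_of_real by simp
      have "cmod (f x ^ Suc q - ?U x ^ Suc q) \<le> real (Suc q) * cmod (w x) ^ q * cmod (f x - ?U x)"
        by (rule power_diff_bound) (auto simp: n)
      then show ?thesis unfolding q(1) by (simp only: d_def q(2) Hi_def norm_mult norm_power mult_ac)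
    qed
    have drc: "Lp rc d" by (rule Lp_bound[OF dm HM(1) _ rc1(3) AE_I2[OF db]]) simp
    have "Lp_norm rc d \<le> real p * (N2 (Hi k f) * Lp_norm r w ^ (p - 1))"
      using Lp_norm_bound[OF dm HM(1) _ rc1(2) AE_I2[OF db]] HM(2)
      by (meson mult_left_mono of_nat_0_le_iff order_trans)
    also have "... \<le> real p * (((2 ^ c) powr \<sigma> * (2 ^ k) powr (- \<sigma>) * Xn \<sigma> f) * (4 * C * A) ^ (p - 1))"
      using Hi_L2[OF f, of k] wn by (intro mult_left_mono mult_mono power_mono) auto
    finally have dn: "Lp_norm rc d \<le> real p * (((2 ^ c) powr \<sigma> * (2 ^ k) powr (- \<sigma>) * Xn \<sigma> f) * (4 * C * A) ^ (p - 1))" .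
    have c00: "0 \<le> C0 * (2 ^ k) powr (g + real 1)" using C0 by simp
    have k2: "(2::real) ^ k > 0" by simp
    note Y = mult_op_Young[OF Kb k2 c00 d2 drc rc1(1)]
    show "Lp rc (mult_op (ann 1 g k) (\<lambda>x. f x ^ p))" unfolding e by (rule Y(1))
    have "Lp_norm rc (mult_op (ann 1 g k) (\<lambda>x. f x ^ p)) \<le> C0 * (2 ^ k) powr (g + real 1) * pi *
       (real p * (((2 ^ c) powr \<sigma> * (2 ^ k) powr (- \<sigma>) * Xn \<sigma> f) * (4 * C * A) ^ (p - 1)))"
      unfolding e using Y(2) mult_left_mono[OF dn, of "C0 * (2 ^ k) powr (g + real 1) * pi"] C0 by simp
    also have "... = D * ((2 ^ k) powr (g + real 1) * (2 ^ k) powr (- \<sigma>)) * Xn \<sigma> f * A ^ (p - 1)"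
      unfolding D_def power_mult_distrib by (simp only: mult_ac)
    also have "(2 ^ k) powr (g + real 1) * (2 ^ k) powr (- \<sigma>) = (2 ^ k) powr (g + 1 - \<sigma>)"
      by (simp add: powr_add[symmetric])
    finally show "Lp_norm rc (mult_op (ann 1 g k) (\<lambda>x. f x ^ p)) \<le> D * (2 ^ k) powr (g + 1 - \<sigma>) * Xn \<sigma> f * A ^ (p - 1)" .
  qed
qed

end

section \<open>Symmetries of the symbols and the commutator estimate\<close>

lemma bessel_even: "bessel_symbol s (- xi) = bessel_symbol s xi" by (simp add: bessel_symbol_def)

lemma ann_hermitian: "ann i b k (- xi) = cnj (ann i b k xi)"
proof -
  have "(- (\<i> * cr xi)) ^ i = cnj ((\<i> * cr xi) ^ i)" by simp
  moreover have "cnj (bessel_symbol b xi) = bessel_symbol b xi" by (simp add: bessel_symbol_def)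
  ultimately show ?thesis by (simp add: ann_def psik_even bessel_even)
qed

lemma ann_odd: "ann 1 b k (- xi) = - ann 1 b k xi"
  by (simp add: ann_def psik_even bessel_even)

text \<open>Transposing an odd kernel changes the sign, so 2J is the pairing of g with the
  commutator of multiplication by F and convolution with K, applied to g. The kernel of the
  commutator is K(x - y)(F x - F y), at most L |x - y| |K(x - y)|, and Schur's test applies: the
  Lipschitz norm of F replaces the derivative hidden in K.\<close>

lemma commutator_estimate:
  assumes K: "conv_kernel K" "\<And>z. K (- z) = - K z" "conv_kernel (\<lambda>z. cr z * K z)"
    and g: "Lp 2 g" and F: "F \<in> lmeas" "\<And>x. cmod (F x) \<le> B" "\<And>x y. cmod (F x - F y) \<le> L * \<bar>x - y\<bar>"
  shows "cmod (LI x. F x * g x * conv K g x) \<le> L * (LI z. cmod (cr z * K z)) * (N2 g)\<^sup>2"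
proof -
  have L0: "L \<ge> 0" using order_trans[OF norm_ge_zero F(3)[of 1 0]] by simp
  have Fg: "Lp 2 (\<lambda>x. F x * g x)"
    using Lp2_mult_bounded[OF g F(1,2)] by (simp add: mult.commute)
  note [measurable] = Lp_measurable[OF g] Lp_measurable[OF Fg] F(1)
  have km: "case_prod (\<lambda>x y. K (x - y)) \<in> borel_measurable (borel \<Otimes>\<^sub>M borel)"
    by (rule kernel_shift_measurable(1)[OF K(1)])
  have c1: "Lp 2 (conv K g)" by (rule Young(1)[OF K(1) g]) simp
  have c2: "Lp 2 (conv K (\<lambda>x. F x * g x))" by (rule Young(1)[OF K(1) Fg]) simp
  define J where "J = (LI x. F x * g x * conv K g x)"
  have "J = (LI x. F x * g x * (LI y. K (x - y) * g y))"
    by (simp add: J_def conv_def)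
  also have "... = (LI y. g y * (LI x. K (x - y) * (F x * g x)))"
  proof (rule Fubini_kernel(1)[OF _ _ km])
    show "integ (\<lambda>y. K (x - y) * g y)" for x by (rule conv_integrable[OF K(1) g])
    show "integ (\<lambda>x. cmod (F x * g x) * (LI y. cmod (K (x - y)) * cmod (g y)))"
      by (rule Schur(1)[OF K(1) Fg g])
  qed measurable
  also have "... = (LI y. - (g y * conv K (\<lambda>x. F x * g x) y))"
  proof -
    have e: "K (x - y) * (F x * g x) = - (K (y - x) * (F x * g x))" for x y
      using K(2)[of "y - x"] by simp
    show ?thesis unfolding e conv_def by simp
  qed
  also have "... = - (LI y. g y * conv K (\<lambda>x. F x * g x) y)" by simp
  finally have J2: "(LI y. g y * conv K (\<lambda>x. F x * g x) y) = - J" by simp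
  let ?zK = "\<lambda>z. cr z * K z"
  have "2 * J = J - (LI y. g y * conv K (\<lambda>x. F x * g x) y)" by (simp add: J2)
  also have "... = (LI x. F x * g x * conv K g x - g x * conv K (\<lambda>x. F x * g x) x)"
    unfolding J_def
    by (rule B_integral_diff[symmetric]) (intro CS_integrable Fg c1 g c2)+
  also have "... = (LI x. g x * (LI y. K (x - y) * ((F x - F y) * g y)))"
  proof (rule B_integral_cong[OF refl])
    fix x
    have "(LI y. K (x - y) * ((F x - F y) * g y)) = (LI y. F x * (K (x - y) * g y) - K (x - y) * (F y * g y))"
      by (simp add: algebra_simps)
    also have "... = F x * conv K g x - conv K (\<lambda>x. F x * g x) x"
      unfolding conv_def using conv_integrable[OF K(1) g, of x] conv_integrable[OF K(1) Fg, of x] by simp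
    finally have q: "(LI y. K (x - y) * ((F x - F y) * g y)) = F x * conv K g x - conv K (\<lambda>x. F x * g x) x" .
    show "F x * g x * conv K g x - g x * conv K (\<lambda>x. F x * g x) x = g x * (LI y. K (x - y) * ((F x - F y) * g y))"
      unfolding q by (simp add: algebra_simps)
  qed
  finally have "cmod (2 * J) \<le> (LI x. cmod (g x * (LI y. K (x - y) * ((F x - F y) * g y))))"
    using integral_norm_bound[of lebesgue "\<lambda>x. g x * (LI y. K (x - y) * ((F x - F y) * g y))"] by simp
  also have "... \<le> (LI x. L * (cmod (g x) * (LI y. cmod (?zK (x - y)) * cmod (g y))))"
  proof (rule integral_mono')
    show "integ (\<lambda>x. L * (cmod (g x) * (LI y. cmod (?zK (x - y)) * cmod (g y))))"
      using Schur(1)[OF K(3) g g] by simp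
    fix x
    have i: "integ (\<lambda>y. cmod (?zK (x - y)) * cmod (g y))"
      using integrable_norm[OF conv_integrable[OF K(3) g, of x]] by (simp only: norm_mult)
    have "cmod (LI y. K (x - y) * ((F x - F y) * g y)) \<le> (LI y. cmod (K (x - y) * ((F x - F y) * g y)))"
      by (rule integral_norm_bound)
    also have "... \<le> (LI y. L * (cmod (?zK (x - y)) * cmod (g y)))"
    proof (rule integral_mono')
      show "integ (\<lambda>y. L * (cmod (?zK (x - y)) * cmod (g y)))" using i by simp
      fix y
      have "cmod (K (x - y)) * (cmod (F x - F y) * cmod (g y)) \<le> cmod (K (x - y)) * ((L * \<bar>x - y\<bar>) * cmod (g y))"
        by (intro mult_left_mono mult_right_mono F(3)) auto
      also have "... = L * (cmod (?zK (x - y)) * cmod (g y))"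
      proof -
        have "cmod (cr (x - y)) = \<bar>x - y\<bar>" by (rule norm_of_real)
        then show ?thesis by (simp only: norm_mult mult_ac)
      qed
      finally show "cmod (K (x - y) * ((F x - F y) * g y)) \<le> L * (cmod (?zK (x - y)) * cmod (g y))"
        by (simp only: norm_mult)
    qed (use L0 in simp)
    finally have "cmod (LI y. K (x - y) * ((F x - F y) * g y)) \<le> L * (LI y. cmod (?zK (x - y)) * cmod (g y))"
      by simp
    from mult_left_mono[OF this, of "cmod (g x)"]
    show "cmod (g x * (LI y. K (x - y) * ((F x - F y) * g y))) \<le> L * (cmod (g x) * (LI y. cmod (?zK (x - y)) * cmod (g y)))"
      by (simp only: norm_mult mult_ac norm_ge_zero simp_thms)
  qed (use L0 in \<open>auto intro!: mult_nonneg_nonneg integral_nonneg_AE\<close>)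
  also have "... = L * (LI x. cmod (g x) * (LI y. cmod (?zK (x - y)) * cmod (g y)))" by simp
  also have "... \<le> L * ((LI z. cmod (?zK z)) * N2 g * N2 g)"
    using L0 by (intro mult_left_mono Schur(2)[OF K(3) g g]) auto
  finally have "2 * cmod J \<le> L * (LI z. cmod (?zK z)) * (N2 g)\<^sup>2"
    by (simp add: norm_mult power2_eq_square mult_ac)
  moreover have "cmod J \<ge> 0" by simp
  ultimately show ?thesis unfolding J_def by linarith
qed

text \<open>a^q \<le> a + a^2 for 1 \<le> q \<le> 2, applied to a = |v| / B; the constant 2 stands
  for the two terms.\<close>

lemma Lp_interpolate:
  assumes v: "Lp 1 v" "Lp 2 v" and B: "Lp_norm 1 v \<le> B" "N2 v \<le> B" and q: "1 \<le> q" "q \<le> 2"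
  shows "Lp q v" "Lp_norm q v \<le> 2 * B"
proof -
  have i1: "integ (\<lambda>x. cmod (v x))" using v(1) by (simp add: Lp_def)
  have i2: "integ (\<lambda>x. (cmod (v x))\<^sup>2)" using v(2) by (simp add: Lp2_iff)
  note [measurable] = Lp_measurable[OF v(1)]
  have b: "a powr q \<le> a + a\<^sup>2" if "a \<ge> 0" for a :: real
  proof (cases "a \<le> 1")
    case True
    have "a powr q \<le> a powr 1"
      by (rule powr_mono') (use that True q in auto)
    then have "a powr q \<le> a" using that by simp
    then show ?thesis using zero_le_power2[of a] by linarith
  next
    case False
    then have "a powr q \<le> a powr 2" using q by (intro powr_mono) auto
    also have "... = a\<^sup>2" using False by simp
    finally show ?thesis using that by linarith
  qed
  have iq: "integ (\<lambda>x. cmod (v x) powr q)"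
    by (rule B_integrable_bound[OF B_integrable_add[OF i1 i2]])
      (use b in \<open>auto intro!: order_trans[OF _ abs_ge_self]\<close>)
  then show "Lp q v" by (simp add: Lp_def)
  have B0: "B \<ge> 0" using B(1) Lp_norm_nonneg[of 1 v] by linarith
  show "Lp_norm q v \<le> 2 * B"
  proof (cases "B = 0")
    case True
    then have "AEL x. v x = 0" using Lp_norm_eq_0[OF v(1)] B(1) Lp_norm_nonneg[of 1 v] by simp
    then have "Lp_norm q v = Lp_norm q (\<lambda>x. 0)" by (rule Lp_norm_cong_AE) measurable
    then show ?thesis using True by simp
  next
    case False
    then have Bp: "B > 0" using B0 by simp
    have "(LI x. cmod (v x) powr q) = (LI x. B powr q * (cmod (v x) / B) powr q)"
      using Bp by (simp add: powr_divide)
    also have "... = B powr q * (LI x. (cmod (v x) / B) powr q)" by simp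
    also have "... \<le> B powr q * (LI x. cmod (v x) / B + (cmod (v x) / B)\<^sup>2)"
    proof (rule mult_left_mono[OF integral_mono])
      show "integ (\<lambda>x. (cmod (v x) / B) powr q)" using iq Bp by (simp add: powr_divide)
      show "integ (\<lambda>x. cmod (v x) / B + (cmod (v x) / B)\<^sup>2)"
        using i1 i2 by (simp add: power_divide)
      show "(cmod (v x) / B) powr q \<le> cmod (v x) / B + (cmod (v x) / B)\<^sup>2" for x
        using b[of "cmod (v x) / B"] Bp by simp
    qed simp
    also have "(LI x. cmod (v x) / B + (cmod (v x) / B)\<^sup>2) = Lp_norm 1 v / B + (N2 v / B)\<^sup>2"
    proof -
      have "Lp_norm 1 v = (LI x. cmod (v x))" by (simp add: Lp_norm_def)
      then show ?thesis using i1 i2 by (simp add: power_divide Lp_norm2_sq)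
    qed
    also have "B powr q * (Lp_norm 1 v / B + (N2 v / B)\<^sup>2) \<le> B powr q * (1 + 1\<^sup>2)"
      using B Bp by (intro mult_left_mono add_mono power_mono) (auto simp: divide_le_eq)
    also have "... \<le> B powr q * 2 powr q"
      using q powr_mono[of 1 q 2] by (intro mult_left_mono) auto
    also have "... = (2 * B) powr q" by (simp add: powr_mult)
    finally have "Lp_norm q v \<le> ((2 * B) powr q) powr (1 / q)"
      unfolding Lp_norm_def using q by (intro powr_mono2) auto
    then show ?thesis using q B0 by (simp add: powr_powr)
  qed
qed

section \<open>The energy estimate for the nonlinearity\<close>

context LPS
begin

text \<open>
  In \<open>U\<^sup>p + p U\<^sup>p\<^sup>-\<^sup>1 g + O(g\<^sup>2)\<close> the first term does not meet the annulus; the second is a commutator because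
  the kernel of the multiplier is odd.
\<close>

lemma energy_piece:
  "\<exists>C\<ge>0. \<forall>u A k. sobolev \<sigma> 2 (cplx u) \<longrightarrow> A \<ge> 0 \<longrightarrow> Nb A (cplx u) \<longrightarrow>
     cmod (LI x. cplx u x ^ p * mult_op (ann 1 (2 * \<sigma>) k) (cplx u) x)
      \<le> C * A ^ (p - 1) * ((2 ^ k) powr (2 * \<sigma>) * (N2 (Hi k (cplx u)))\<^sup>2)"
proof -
  obtain C where C1: "C \<ge> 1" and K: "\<And>f A k. sobolev \<sigma> 2 f \<Longrightarrow> A \<ge> 0 \<Longrightarrow> Nb A f \<Longrightarrow>
   (\<forall>x. cmod (Lo k f x) \<le> C * A) \<and> (\<forall>x y. cmod (Lo k f x - Lo k f y) \<le> C * A * \<bar>x - y\<bar>) \<and>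
   Lp r (Lo k f) \<and> Lp_norm r (Lo k f) \<le> C * A \<and> (AEL x. cmod (f x) \<le> C * A) \<and>
   Lp r f \<and> Lp_norm r f \<le> C * A \<and> (AEL x. cmod (Hi k f x) \<le> C * A / 2 ^ k)"
    using split_bounds by blast
  obtain C0 where C0: "C0 \<ge> 0" and Kb: "\<And>k. kernel_bound (C0 * (2 ^ k) powr (2 * \<sigma> + real 1)) (2 ^ k) (ann 1 (2 * \<sigma>) k)"
    using ann_kernel[of "2 * \<sigma>"] by blast
  define q where "q = p - 2"
  have q: "Suc (Suc q) = p" "p - 1 = Suc q" using p3 by (auto simp: q_def)
  define D where "D = (real p)\<^sup>2 * C ^ Suc q * (C0 * pi) + real p * (real p * C ^ Suc q) * (C0 * pi)"
  have C: "C \<ge> 0" using C1 by simp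
  show ?thesis
  proof (intro exI[of _ D] conjI allI impI)
    show "0 \<le> D" unfolding D_def using C C0 by simp
    fix u A k
    let ?f = "cplx u"
    assume f: "sobolev \<sigma> 2 ?f" and A: "A \<ge> 0" and N: "Nb A ?f"
    let ?a = "ann 1 (2 * \<sigma>) k"
    have f2: "Lp 2 ?f" using sobolev2D(1)[OF f] sg3 by simp
    note KK = K[OF f A N, of k]
    define U where "U = Lo k ?f"
    define g where "g = Hi k ?f"
    have gU: "g x = ?f x - U x" for x by (simp add: g_def U_def Hi_def)
    have U2: "Lp 2 U" unfolding U_def by (rule Lo_fourier(1)[OF f2])
    have g2: "Lp 2 g" unfolding g_def by (rule Hi_fourier(1)[OF f2])
    note [measurable] = Lp_measurable[OF f2] Lp_measurable[OF U2] Lp_measurable[OF g2]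
    define M where "M = C * A"
    have M: "M \<ge> 0" using C A by (simp add: M_def)
    have Ub: "\<And>x. cmod (U x) \<le> M" and Ul: "\<And>x y. cmod (U x - U y) \<le> M * \<bar>x - y\<bar>"
      and fb: "AEL x. cmod (?f x) \<le> M" and gb: "AEL x. cmod (g x) \<le> M / 2 ^ k"
      using KK by (auto simp: U_def g_def M_def)
    have fp: "Lp 2 (\<lambda>x. ?f x ^ p)" unfolding q(1)[symmetric] by (rule Lp_power[OF f2 fb])
    have Up: "Lp 2 (\<lambda>x. U x ^ p)" and Up0: "AEL xi. ?a xi * fourier (\<lambda>x. U x ^ p) xi = 0"
      using Lo_power_killed(1)[OF f2, of k M "Suc q"] Lo_power_killed(2)[OF f2, of k M "Suc q" 1 "2 * \<sigma>"] Ub q(1) unfolding U_def by auto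
    have U1: "AEL xi. ?a xi * fourier U xi = 0"
      using Lo_power_killed(2)[OF f2, of k M 0 1 "2 * \<sigma>"] Ub p3 unfolding U_def by auto
    have sa: "symbol ?a" by (rule symbol_ann) simp
    define Af where "Af = mult_op ?a ?f"
    have Af2: "Lp 2 Af" unfolding Af_def by (rule mult_op_fourier(2)[OF sa f2])
    \<comment> \<open>U itself has no frequency in the annulus, so only the high part g enters
      \<open>Af\<close>.\<close>
    have Af_g: "Af = mult_op ?a g"
    proof
      fix x
      have "mult_op ?a (\<lambda>x. ?f x - U x) x = Af x - 0"
        unfolding Af_def mult_op_diff[OF sa f2 U2] mult_op_zero[OF U1] ..
      moreover have "(\<lambda>x. ?f x - U x) = g" by (rule ext) (simp add: gU)
      ultimately show "Af x = mult_op ?a g x" by simp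
    qed
    \<comment> \<open>Parseval's identity contains a conjugate; since \<open>Af\<close> is real it
      evaluates the plain product too.\<close>
    have Af_real: "cnj (Af x) = Af x" for x
      using mult_op_real[OF sa ann_hermitian f2, of x] unfolding Af_def by (metis complex_cnj_complex_of_real)
    have z: "(LI x. U x ^ p * Af x) = 0"
    proof -
      have "cr (2 * pi) * (LI x. U x ^ p * cnj (Af x)) = (LI xi. fourier (\<lambda>x. U x ^ p) xi * cnj (?a xi * fourier ?f xi))"
        unfolding Af_def
        by (rule Parseval[OF fourier_L2(1)[OF Up] Up mult_op_fourier[OF sa f2], symmetric])
      also have "... = (LINT xi|(lebesgue::real measure). 0)"
      proof (rule integral_cong_AE_gen)
        show "AEL xi. fourier (\<lambda>x. U x ^ p) xi * cnj (?a xi * fourier ?f xi) = 0"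
          using Up0 by eventually_elim auto
      qed
      finally show ?thesis by (simp add: Af_real)
    qed
    define R where "R x = ?f x ^ p - U x ^ p - of_nat p * U x ^ Suc q * g x" for x
    have Ug: "Lp 2 (\<lambda>x. U x ^ Suc q * g x)"
    proof -
      have "cmod (U x ^ Suc q) \<le> M ^ Suc q" for x unfolding norm_power by (intro power_mono Ub) auto
      from Lp2_mult_bounded[OF g2 _ this] show ?thesis by (simp add: mult.commute)
    qed
    have Ug': "Lp 2 (\<lambda>x. of_nat p * U x ^ Suc q * g x)" using Lp_scale[OF Ug, of "of_nat p"] by (simp add: mult.assoc)
    have R2: "Lp 2 R" unfolding R_def by (intro Lp_diff fp Up Ug') auto
    have "(LI x. ?f x ^ p * Af x) = (LI x. R x * Af x + U x ^ p * Af x + of_nat p * (U x ^ Suc q * g x * Af x))"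
      by (rule B_integral_cong[OF refl]) (simp add: R_def algebra_simps)
    also have "... = (LI x. R x * Af x) + (LI x. U x ^ p * Af x) + of_nat p * (LI x. U x ^ Suc q * g x * Af x)"
      using CS_integrable[OF R2 Af2] CS_integrable[OF Up Af2] CS_integrable[OF Ug Af2] by simp
    finally have split: "(LI x. ?f x ^ p * Af x) = (LI x. R x * Af x) + of_nat p * (LI x. U x ^ Suc q * g x * Af x)"
      by (simp add: z)
    define rho where "rho = (2::real) ^ k"
    have r0: "rho > 0" by (simp add: rho_def)
    define E where "E = C0 * rho powr (2 * \<sigma> + real 1)"
    have E0: "E \<ge> 0" using C0 by (simp add: E_def)
    note kb = Kb[of k, folded rho_def, folded E_def]
    note kbd = kernel_boundD[OF kb r0 E0]
    have AfY: "N2 Af \<le> E * pi * N2 g"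
      unfolding Af_g by (rule mult_op_Young(2)[OF kb r0 E0 g2 g2]) simp
    have Rm: "R \<in> lmeas" using R2 by (simp add: Lp_def)
    have Rn: "N2 R \<le> (real p)\<^sup>2 * M ^ q * (M / rho) * N2 g"
    proof (rule Lp_norm_bound[OF Rm g2])
      show "AEL x. cmod (R x) \<le> (real p)\<^sup>2 * M ^ q * (M / rho) * cmod (g x)"
        using fb gb
      proof eventually_elim
        case (elim x)
        have "cmod (R x) \<le> (real p)\<^sup>2 * M ^ q * (cmod (g x))\<^sup>2"
          using power_taylor_bound[OF elim(1) Ub[of x], of q] unfolding R_def gU q(1) .
        also have "... = (real p)\<^sup>2 * M ^ q * (cmod (g x) * cmod (g x))" by (simp add: power2_eq_square)
        also have "... \<le> (real p)\<^sup>2 * M ^ q * (M / rho * cmod (g x))"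
          using elim(2) M unfolding rho_def by (intro mult_left_mono mult_right_mono) auto
        finally show ?case by (simp add: mult.assoc)
      qed
    qed (use M r0 in auto)
    \<comment> \<open>The quadratic remainder contains one factor g in the sup norm, of size M /
      2^k, and this compensates the derivative in \<open>Af\<close>.\<close>
    have part1: "cmod (LI x. R x * Af x) \<le> (real p)\<^sup>2 * M ^ q * (M / rho) * (E * pi) * (N2 g)\<^sup>2"
    proof -
      have "cmod (LI x. R x * Af x) \<le> N2 R * N2 Af" by (rule CS[OF R2 Af2])
      also have "... \<le> ((real p)\<^sup>2 * M ^ q * (M / rho) * N2 g) * (E * pi * N2 g)"
        using M r0 by (intro mult_mono Rn AfY) auto
      finally show ?thesis by (simp add: power2_eq_square mult_ac)
    qed
    have conv_e: "Af = conv (inv_kernel ?a) g"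
      unfolding Af_g by (rule ext) (rule mult_op_conv[OF sa g2])
    \<comment> \<open>In the linear term the derivative is compensated by the commutator: U^(p - 1)
      is bounded and Lipschitz, and z times the kernel gains 1 / rho.\<close>
    have "cmod (LI x. U x ^ Suc q * g x * conv (inv_kernel ?a) g x) \<le>
      (real (Suc q) * M ^ q * M) * (LI z. cmod (cr z * inv_kernel ?a z)) * (N2 g)\<^sup>2"
    proof (rule commutator_estimate[OF kbd(2) _ kbd(5) g2])
      show "inv_kernel ?a (- z) = - inv_kernel ?a z" for z by (rule inv_kernel_odd[of ?a, OF ann_odd])
      show "cmod (U x ^ Suc q) \<le> M ^ Suc q" for x unfolding norm_power by (intro power_mono Ub) auto
      show "cmod (U x ^ Suc q - U y ^ Suc q) \<le> real (Suc q) * M ^ q * M * \<bar>x - y\<bar>" for x y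
      proof -
        have "cmod (U x ^ Suc q - U y ^ Suc q) \<le> real (Suc q) * M ^ q * cmod (U x - U y)"
          by (rule power_diff_bound[OF Ub Ub])
        also have "... \<le> real (Suc q) * M ^ q * (M * \<bar>x - y\<bar>)" using M by (intro mult_left_mono Ul) auto
        finally show ?thesis by (simp add: mult.assoc)
      qed
    qed measurable
    also have "... \<le> (real p * M ^ q * M) * (E / rho * pi) * (N2 g)\<^sup>2"
    proof -
      have "real (Suc q) \<le> real p" using q(1) by simp
      then show ?thesis using M kbd(6) E0 r0
        by (intro mult_right_mono mult_mono) (auto intro!: integral_nonneg_AE)
    qed
    finally have part2: "cmod (LI x. U x ^ Suc q * g x * Af x) \<le> (real p * M ^ q * M) * (E / rho * pi) * (N2 g)\<^sup>2"
      unfolding conv_e .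
    have Er: "E / rho = C0 * rho powr (2 * \<sigma>)" using r0 by (simp add: E_def powr_add)
    have MM: "M ^ q * M = C ^ Suc q * A ^ Suc q" by (simp add: M_def power_mult_distrib mult_ac)
    have "cmod (LI x. ?f x ^ p * Af x) \<le> cmod (LI x. R x * Af x) + real p * cmod (LI x. U x ^ Suc q * g x * Af x)"
      unfolding split using norm_triangle_ineq[of "LI x. R x * Af x" "of_nat p * (LI x. U x ^ Suc q * g x * Af x)"]
      by (simp add: norm_mult)
    also have "... \<le> (real p)\<^sup>2 * M ^ q * (M / rho) * (E * pi) * (N2 g)\<^sup>2 + real p * ((real p * M ^ q * M) * (E / rho * pi) * (N2 g)\<^sup>2)"
      by (intro add_mono part1 mult_left_mono part2) auto
    also have "... = (real p)\<^sup>2 * (M ^ q * M) * (E / rho * pi) * (N2 g)\<^sup>2 + real p * ((real p * (M ^ q * M)) * (E / rho * pi) * (N2 g)\<^sup>2)"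
      by (simp add: mult_ac)
    also have "... = D * A ^ Suc q * (rho powr (2 * \<sigma>) * (N2 g)\<^sup>2)"
      unfolding MM Er D_def by (simp add: algebra_simps)
    finally show "cmod (LI x. ?f x ^ p * mult_op ?a ?f x) \<le> D * A ^ (p - 1) * ((2 ^ k) powr (2 * \<sigma>) * (N2 (Hi k ?f))\<^sup>2)"
      unfolding q(2) Af_def rho_def g_def .
  qed
qed

text \<open>Uniformity in K is the point: it holds because the squared norms of the high parts are
  summable with the weights 2^(2 \<sigma> k).\<close>

lemma energy_estimate:
  "\<exists>C\<ge>0. \<forall>u A K. sobolev \<sigma> 2 (cplx u) \<longrightarrow> A \<ge> 0 \<longrightarrow> Nb A (cplx u) \<longrightarrow>
     cmod (LI x. cplx u x ^ p * mult_op (\<lambda>xi. \<Sum>k\<le>K. ann 1 (2 * \<sigma>) k xi) (cplx u) x)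
      \<le> C * A ^ (p - 1) * (Xn \<sigma> (cplx u))\<^sup>2"
proof -
  obtain C where C: "C \<ge> 0" and E: "\<And>u A k. sobolev \<sigma> 2 (cplx u) \<Longrightarrow> A \<ge> 0 \<Longrightarrow> Nb A (cplx u) \<Longrightarrow>
     cmod (LI x. cplx u x ^ p * mult_op (ann 1 (2 * \<sigma>) k) (cplx u) x)
      \<le> C * A ^ (p - 1) * ((2 ^ k) powr (2 * \<sigma>) * (N2 (Hi k (cplx u)))\<^sup>2)"
    using energy_piece by blast
  obtain C1 where C1: "C1 \<ge> 1" and Kb: "\<And>f A k. sobolev \<sigma> 2 f \<Longrightarrow> A \<ge> 0 \<Longrightarrow> Nb A f \<Longrightarrow>
    (AEL x. cmod (f x) \<le> C1 * A)"
    using split_bounds by blast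
  show ?thesis
  proof (intro exI[of _ "C * (2 * (2 ^ c) powr (2 * \<sigma>))"] conjI allI impI)
    show "0 \<le> C * (2 * (2 ^ c) powr (2 * \<sigma>))" using C by simp
    fix u A K
    let ?f = "cplx u"
    assume f: "sobolev \<sigma> 2 ?f" and A: "A \<ge> 0" and N: "Nb A ?f"
    have f2: "Lp 2 ?f" using sobolev2D(1)[OF f] sg3 by simp
    have p1: "Suc (p - 1) = p" using p3 by simp
    have fp: "Lp 2 (\<lambda>x. ?f x ^ p)" using Lp_power[OF f2 Kb[OF f A N], of "p - 1"] unfolding p1 .
    have i: "integ (\<lambda>x. ?f x ^ p * mult_op (ann 1 (2 * \<sigma>) k) ?f x)" for k
      by (rule CS_integrable[OF fp mult_op_fourier(2)[OF symbol_ann f2]]) simp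
    have "(LI x. ?f x ^ p * mult_op (\<lambda>xi. \<Sum>k\<le>K. ann 1 (2 * \<sigma>) k xi) ?f x)
      = (LI x. (\<Sum>k\<le>K. ?f x ^ p * mult_op (ann 1 (2 * \<sigma>) k) ?f x))"
      by (subst mult_op_sum[OF symbol_ann f2]) (simp_all add: sum_distrib_left)
    also have "... = (\<Sum>k\<le>K. LI x. ?f x ^ p * mult_op (ann 1 (2 * \<sigma>) k) ?f x)"
      by (rule Bochner_Integration.integral_sum) (rule i)
    finally have "cmod (LI x. ?f x ^ p * mult_op (\<lambda>xi. \<Sum>k\<le>K. ann 1 (2 * \<sigma>) k xi) ?f x)
       \<le> (\<Sum>k\<le>K. C * A ^ (p - 1) * ((2 ^ k) powr (2 * \<sigma>) * (N2 (Hi k ?f))\<^sup>2))"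
      by (simp only:) (rule order_trans[OF norm_sum sum_mono], rule E[OF f A N])
    also have "... = C * A ^ (p - 1) * (\<Sum>k\<le>K. (2 ^ k) powr (2 * \<sigma>) * (N2 (Hi k ?f))\<^sup>2)"
      by (rule sum_distrib_left[symmetric])
    also have "... \<le> C * A ^ (p - 1) * (2 * (2 ^ c) powr (2 * \<sigma>) * (Xn \<sigma> ?f)\<^sup>2)"
      using C A by (intro mult_left_mono Hi_sum f) auto
    finally show "cmod (LI x. ?f x ^ p * mult_op (\<lambda>xi. \<Sum>k\<le>K. ann 1 (2 * \<sigma>) k xi) ?f x)
      \<le> C * (2 * (2 ^ c) powr (2 * \<sigma>)) * A ^ (p - 1) * (Xn \<sigma> ?f)\<^sup>2" by (simp add: mult_ac)
  qed
qed

text \<open>Bernstein's inequality from L^2 to the sup norm loses 2^(k/2), the intermediate L^r norm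
  no more than that, and 1/2 - \<sigma> \<le> -3/2. The decaying norm is thereby finite and
  continuous along a solution, and under control while t \<le> 1.\<close>

lemma Nb_of_Xn: "\<exists>C\<ge>0. \<forall>f. sobolev \<sigma> 2 f \<longrightarrow> Nb (C * Xn \<sigma> f) f"
proof -
  obtain C0 where C0: "C0 \<ge> 0" and K: "\<And>R i. R > 0 \<Longrightarrow> i \<in> {0,1} \<Longrightarrow> kernel_bound (C0 * R ^ i) R (low i R)"
    using low_kernel by blast
  define D where "D = (C0 * pi * 2 + 1) * 2 powr \<sigma>"
  show ?thesis
  proof (intro exI[of _ "2 * D"] conjI allI impI)
    show "0 \<le> 2 * D" using C0 by (simp add: D_def)
    fix f assume f: "sobolev \<sigma> 2 f"
    have s0: "\<sigma> \<ge> 0" using sg3 by simp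
    note s = sobolev2D[OF f s0]
    have P2: "Lp 2 (P k f)" for k by (rule mult_op_fourier(2)[OF symbol_ann s(1)]) simp
    have Pn: "N2 (P k f) \<le> 2 powr \<sigma> * (2 ^ k) powr (- \<sigma>) * Xn \<sigma> f" for k
    proof -
      have sa: "symbol (ann 0 0 k)" by (rule symbol_ann) simp
      have b: "cmod (ann 0 0 k xi * fourier f xi) \<le> (2 powr \<sigma> * (2 ^ k) powr (- \<sigma>)) * cmod (bessel_symbol \<sigma> xi * fourier f xi)" for xi
      proof (cases "psik k xi = 0")
        case False
        have "2 ^ k \<le> 2 * max 1 \<bar>xi\<bar>"
        proof (cases "k = 0")
          case False
          from psik_low[OF _ \<open>psik k xi \<noteq> 0\<close>] False show ?thesis by (simp add: max_def)
        qed simp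
        then have "(2 ^ k) powr \<sigma> \<le> (2 * max 1 \<bar>xi\<bar>) powr \<sigma>" using s0 by (intro powr_mono2) auto
        also have "... = 2 powr \<sigma> * max 1 \<bar>xi\<bar> powr \<sigma>" by (simp add: powr_mult)
        also have "... \<le> 2 powr \<sigma> * cmod (bessel_symbol \<sigma> xi)" by (intro mult_left_mono max_powr_bessel s0) auto
        finally have "(2 ^ k) powr \<sigma> * (2 ^ k) powr (- \<sigma>) \<le> 2 powr \<sigma> * cmod (bessel_symbol \<sigma> xi) * (2 ^ k) powr (- \<sigma>)"
          by (intro mult_right_mono) auto
        then have "1 \<le> 2 powr \<sigma> * (2 ^ k) powr (- \<sigma>) * cmod (bessel_symbol \<sigma> xi)" by (simp add: powr_minus mult_ac)
        moreover have "cmod (ann 0 0 k xi) \<le> 1" using psik_range[of k xi] by (simp add: ann_def)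
        ultimately have "cmod (ann 0 0 k xi) \<le> 2 powr \<sigma> * (2 ^ k) powr (- \<sigma>) * cmod (bessel_symbol \<sigma> xi)" by linarith
        from mult_right_mono[OF this, of "cmod (fourier f xi)"] show ?thesis by (simp add: norm_mult mult_ac)
      qed (simp add: ann_def)
      have "N2 (\<lambda>xi. ann 0 0 k xi * fourier f xi) \<le> (2 powr \<sigma> * (2 ^ k) powr (- \<sigma>)) * Xn \<sigma> f"
        unfolding Xn_def
        by (rule Lp_norm_bound[OF Lp_measurable[OF symbol_mult_L2(1)[OF sa fourier_L2(2)[OF s(1)]]] s(2) _ _ AE_I2[OF b]]) auto
      moreover have "N2 (P k f) \<le> N2 (\<lambda>xi. ann 0 0 k xi * fourier f xi)"
      proof (rule power2_le_imp_le)
        have "(N2 (P k f))\<^sup>2 \<le> 2 * pi * (N2 (P k f))\<^sup>2"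
          using pi_ge_two by (simp add: mult_le_cancel_right1)
        then show "(N2 (P k f))\<^sup>2 \<le> (N2 (\<lambda>xi. ann 0 0 k xi * fourier f xi))\<^sup>2"
          using Plancherel[OF mult_op_fourier[OF sa s(1)]] by simp
      qed simp
      ultimately show ?thesis by linarith
    qed
    show "Nb (2 * D * Xn \<sigma> f) f" unfolding Nb_def
    proof (intro allI impI)
      fix k G assume G: "Lp 2 G" "Lp rc G"
      define rho where "rho = (2::real) ^ Suc k"
      have r0: "rho \<ge> 1" unfolding rho_def by (rule one_le_power) simp
      then have r0': "rho > 0" by linarith
      have c0: "0 \<le> C0 * rho ^ 0" using C0 by simp
      note kk = kernel_boundD[OF K[OF r0', of 0, simplified] r0', simplified, OF C0]
      have sa: "symbol (ann 0 0 k)" by (rule symbol_ann) simp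
      have e: "mult_op (low 0 rho) (P k f) = P k f"
        unfolding mult_op_compose[OF sa s(1)] rho_def low_ann by simp
      define B where "B = (C0 * pi * 2 + 1) * rho powr (1 / 2) * N2 (P k f)"
      have sup: "cmod (P k f x) \<le> B" for x
      proof -
        have "P k f x = conv (inv_kernel (low 0 rho)) (P k f) x"
          using mult_op_conv[OF kk(1) P2[of k], of x] unfolding e .
        also have "cmod ... \<le> N2 (\<lambda>y. inv_kernel (low 0 rho) (x - y)) * N2 (P k f)"
          unfolding conv_def by (rule CS[OF Lp_reflect[OF kernel_Lp[OF kk(2)]] P2]) simp
        also have "... \<le> (C0 * pi * rho powr (1 - 1 / 2)) * N2 (P k f)"
          unfolding Lp_norm_reflect by (intro mult_right_mono kk(4)) auto
        also have "... \<le> B"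
        proof -
          have "C0 * pi \<le> C0 * pi * 2 + 1" using C0 by simp
          from mult_right_mono[OF mult_right_mono[OF this]] show ?thesis unfolding B_def by simp
        qed
        finally show ?thesis .
      qed
      have B0: "B \<ge> 0" using C0 by (simp add: B_def)
      have rr: "r > 2" "rc > 1" "1 / r + 1 / rc = 1" using r_facts by auto
      have "Lp r (P k f) \<and> Lp_norm r (P k f) \<le> (C0 * pi * 2 + 1) * rho powr (1 / 2) * N2 (P k f)"
      proof -
        have pw: "cmod (P k f x) powr r \<le> B powr (r - 2) * (cmod (P k f x))\<^sup>2" for x
        proof -
          have "cmod (P k f x) powr r = cmod (P k f x) powr ((r - 2) + 2)" by simp
          also have "... = cmod (P k f x) powr (r - 2) * cmod (P k f x) powr 2" by (rule powr_add)
          also have "... \<le> B powr (r - 2) * cmod (P k f x) powr 2"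
            using sup rr by (intro mult_right_mono powr_mono2) auto
          finally show ?thesis by simp
        qed
        have i2: "integ (\<lambda>x. B powr (r - 2) * (cmod (P k f x))\<^sup>2)" using Lp2_integrable[OF P2[of k]] by simp
        note [measurable] = Lp_measurable[OF P2[of k]]
        have i: "integ (\<lambda>x. cmod (P k f x) powr r)"
          by (rule B_integrable_bound[OF i2]) (use pw in \<open>auto intro!: order_trans[OF _ abs_ge_self]\<close>)
        have "(LI x. cmod (P k f x) powr r) \<le> (LI x. B powr (r - 2) * (cmod (P k f x))\<^sup>2)"
          by (rule integral_mono[OF i i2 pw])
        also have "... = B powr (r - 2) * (N2 (P k f))\<^sup>2" by (simp add: Lp_norm2_sq)
        also have "... \<le> B powr (r - 2) * B\<^sup>2"
        proof (intro mult_left_mono power_mono)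
          have "1 * 1 * N2 (P k f) \<le> (C0 * pi * 2 + 1) * rho powr (1 / 2) * N2 (P k f)"
            using C0 r0 by (intro mult_right_mono mult_mono) (auto intro: ge_one_powr_ge_zero)
          then show "N2 (P k f) \<le> B" by (simp add: B_def)
        qed auto
        also have "... = B powr r"
        proof -
          have "B powr r = B powr ((r - 2) + 2)" by simp
          also have "... = B powr (r - 2) * B powr 2" by (rule powr_add)
          finally show ?thesis using B0 by simp
        qed
        finally have "Lp_norm r (P k f) \<le> (B powr r) powr (1 / r)"
          unfolding Lp_norm_def using rr by (intro powr_mono2) (auto intro: integral_nonneg_AE)
        then have "Lp_norm r (P k f) \<le> B" using rr B0 by (simp add: powr_powr)
        then show ?thesis using i P2[of k] unfolding B_def by (auto simp: Lp_def)
      qed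
      then have Lr: "Lp r (P k f)" and nr: "Lp_norm r (P k f) \<le> (C0 * pi * 2 + 1) * rho powr (1 / 2) * N2 (P k f)" by auto
      have "cmod (LI x. P k f x * G x) \<le> Lp_norm r (P k f) * Lp_norm rc G"
        by (rule Holder[OF _ rr(2,3) Lr G(2)]) (use rr in simp)
      also have "... \<le> (C0 * pi * 2 + 1) * rho powr (1 / 2) * (2 powr \<sigma> * (2 ^ k) powr (- \<sigma>) * Xn \<sigma> f) * Lp_norm rc G"
        using C0 by (intro mult_right_mono order_trans[OF nr] mult_left_mono Pn) auto
      also have "... = D * Xn \<sigma> f * (rho powr (1 / 2) * (2 ^ k) powr (- \<sigma>)) * Lp_norm rc G"
        by (simp add: D_def mult_ac)
      also have "... \<le> D * Xn \<sigma> f * ((2 ^ k) powr (- 3 / 2) * 2) * Lp_norm rc G"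
      proof (intro mult_right_mono mult_left_mono)
        have "rho powr (1 / 2) = 2 powr (1 / 2) * (2 ^ k) powr (1 / 2)" unfolding rho_def by (simp add: powr_mult)
        also have "... \<le> 2 powr 1 * (2 ^ k) powr (1 / 2)" by (intro mult_right_mono powr_mono) auto
        finally have "rho powr (1 / 2) * (2 ^ k) powr (- \<sigma>) \<le> 2 powr 1 * (2 ^ k) powr (1 / 2) * (2 ^ k) powr (- \<sigma>)"
          by (intro mult_right_mono) auto
        also have "... = 2 * (2 ^ k) powr (1 / 2 - \<sigma>)" by (simp add: mult.assoc powr_add[symmetric])
        also have "... \<le> 2 * (2 ^ k) powr (- 3 / 2)" using sg3 by (intro mult_left_mono powr_mono) auto
        finally show "rho powr (1 / 2) * (2 ^ k) powr (- \<sigma>) \<le> (2 ^ k) powr (- 3 / 2) * 2" by simp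
      qed (use C0 in \<open>auto simp: D_def\<close>)
      finally show "cmod (LI x. P k f x * G x) \<le> 2 * D * Xn \<sigma> f * (2 ^ k) powr (- 3 / 2) * Lp_norm rc G"
        by (simp only: mult_ac)
    qed
  qed
qed

end

section \<open>The propagator\<close>

text \<open>
  If the multiplier had no value at a Gaussian \<open>w\<close>, it would have none at \<open>2w\<close> either, and
  \<open>propagator\<close> would return the same arbitrary function for both, against the conservation of the norm.
\<close>

lemma m_measurable:
  assumes cons: "\<And>t u0. t > 0 \<Longrightarrow> Lp 2 (cplx u0) \<Longrightarrow>
          Lp 2 (propagator m t (cplx u0)) \<and> N2 (propagator m t (cplx u0)) = N2 (cplx u0)"
  shows "m \<in> lmeas"
proof -
  define w where "w x = exp (- x\<^sup>2 / 2)" for x :: real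
  have g0: "gauss 0 0 = cplx w" by (rule ext) (simp add: gauss_def w_def)
  have w2: "Lp 2 (cplx w)" using schwartz_facts(3)[OF schwartz_gauss[of 0 0]] unfolding g0 .
  have w2': "Lp 2 (cplx (\<lambda>x. 2 * w x))" using Lp_scale[OF w2, of 2] by simp
  have wn: "N2 (cplx w) \<noteq> 0"
  proof
    assume "N2 (cplx w) = 0"
    then have "AEL x. cplx w x = 0" by (rule Lp_norm_eq_0[OF w2])
    then have "AEL x. False" by eventually_elim (simp add: w_def)
    then show False by (simp add: trivial_limit_def[symmetric] ae_filter_eq_bot_iff)
  qed
  have cis_m: "(\<lambda>xi. cis (- (t * m xi))) \<in> lmeas" if t: "t > 0" for t
  proof -
    let ?a = "\<lambda>xi. cis (- (t * m xi))"
    have "\<exists>h. is_multiplier ?a (cplx w) h"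
    proof (rule ccontr)
      assume no: "\<nexists>h. is_multiplier ?a (cplx w) h"
      have no2: "\<nexists>h. is_multiplier ?a (cplx (\<lambda>x. 2 * w x)) h"
      proof
        assume "\<exists>h. is_multiplier ?a (cplx (\<lambda>x. 2 * w x)) h"
        then obtain h g where "is_fourier (cplx (\<lambda>x. 2 * w x)) g" "is_fourier h (\<lambda>xi. ?a xi * g xi)"
          by (auto simp: is_multiplier_def)
        from is_fourier_scale[OF this(1), of "1/2"] is_fourier_scale[OF this(2), of "1/2"]
        have "is_fourier (cplx w) (\<lambda>xi. 1 / 2 * g xi)" "is_fourier (\<lambda>x. 1 / 2 * h x) (\<lambda>xi. ?a xi * (1 / 2 * g xi))"
          by (simp_all add: mult_ac)
        then have "is_multiplier ?a (cplx w) (\<lambda>x. 1 / 2 * h x)" unfolding is_multiplier_def by blast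
        with no show False by blast
      qed
      have "is_multiplier ?a (cplx w) = is_multiplier ?a (cplx (\<lambda>x. 2 * w x))"
        by (rule ext) (use no no2 in blast)
      then have e: "propagator m t (cplx w) = propagator m t (cplx (\<lambda>x. 2 * w x))"
        unfolding propagator_def multiplier_def by simp
      have "N2 (cplx w) = N2 (cplx (\<lambda>x. 2 * w x))"
        using cons[OF t w2] cons[OF t w2'] e by simp
      also have "... = 2 * N2 (cplx w)" using Lp_norm_scale[of 2 2 "cplx w"] by simp
      finally show False using wn by simp
    qed
    then obtain h g where g: "is_fourier (gauss 0 0) g" and h: "is_fourier h (\<lambda>xi. ?a xi * g xi)"
      unfolding g0[symmetric] by (auto simp: is_multiplier_def)
    have "is_fourier (gauss 0 0) (fourier_integral (gauss 0 0))"
      by (rule is_fourier_L1[OF integrable_gauss schwartz_facts(3)[OF schwartz_gauss]])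
    from is_fourier_unique[OF g this] have ge: "AEL xi. g xi = cr (sqrt (2 * pi)) * gauss 0 0 xi"
      by eventually_elim (simp add: fourier_integral_gauss)
    have hm: "(\<lambda>xi. ?a xi * g xi) \<in> lmeas" using h by (simp add: is_fourier_def)
    let ?G = "\<lambda>xi. cr (sqrt (2 * pi)) * gauss 0 0 xi"
    have Gm: "?G \<in> lmeas" by (rule borel_imp_lebesgue) measurable
    \<comment> \<open>The transform of the Gaussian has no zeros, so measurability of the product
      passes to the phase.\<close>
    have "(\<lambda>xi. ?a xi * g xi / ?G xi) \<in> lmeas"
      using hm Gm by (intro borel_measurable_divide)
    moreover have "AEL xi. ?a xi * g xi / ?G xi = ?a xi"
      using ge by eventually_elim (simp add: gauss_def)
    ultimately show ?thesis by (rule AE_measurable_lebesgue)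
  qed
  show ?thesis
  proof (rule borel_measurable_LIMSEQ_real)
    fix xi
    \<comment> \<open>The phases at the times 1 / (n + 1) recover m in the limit, without a branch
      of the logarithm being chosen.\<close>
    have "(\<lambda>n. real (Suc n) * sin (1 / real (Suc n) * m xi)) \<longlonglongrightarrow> m xi"
    proof (cases "m xi = 0")
      case False
      have l: "(\<lambda>n. 1 / real (Suc n) * m xi) \<longlonglongrightarrow> 0"
        using tendsto_mult[OF LIMSEQ_Suc[OF lim_1_over_n] tendsto_const[of "m xi"]] by simp
      have "filterlim (\<lambda>n. 1 / real (Suc n) * m xi) (at 0) sequentially"
        unfolding filterlim_at using l False by simp
      from filterlim_compose[OF sinc_at_0 this] False l
      have "(\<lambda>n. sin (1 / real (Suc n) * m xi) / (1 / real (Suc n) * m xi)) \<longlonglongrightarrow> 1"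
        by simp
      from tendsto_mult[OF this tendsto_const[of "m xi"]] show ?thesis using False by (simp add: mult.commute del: of_nat_Suc)
    qed simp
    then show "(\<lambda>n. - real (Suc n) * Im (cis (- (1 / real (Suc n) * m xi)))) \<longlonglongrightarrow> m xi" by (simp del: of_nat_Suc)
  next
    fix n :: nat
    note [measurable] = cis_m[of "1 / real (Suc n)", simplified]
    show "(\<lambda>xi. - real (Suc n) * Im (cis (- (1 / real (Suc n) * m xi)))) \<in> lmeas"
      by (intro borel_measurable_times borel_measurable_const measurable_compose[OF cis_m borel_measurable_Im]) auto
  qed
qed

lemma propagator_fourier:
  assumes m: "m \<in> lmeas" and f: "Lp 2 f"
  shows "is_fourier (propagator m t f) (\<lambda>xi. cis (- (t * m xi)) * fourier f xi)" "Lp 2 (propagator m t f)"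
proof -
  let ?a = "\<lambda>xi. cis (- (t * m xi))"
  note [measurable] = m Lp_measurable[OF fourier_L2(2)[OF f]]
  have "(\<lambda>xi. - (t * m xi)) \<in> lmeas" by measurable
  from measurable_compose[OF this measurable_cis] have [measurable]: "?a \<in> lmeas" .
  have L: "Lp 2 (\<lambda>xi. ?a xi * fourier f xi)"
    by (rule Lp_bound[OF _ fourier_L2(2)[OF f], where c = 1]) (auto simp: norm_mult)
  obtain h where h: "is_fourier h (\<lambda>xi. ?a xi * fourier f xi)" using L2_inverse_exists[OF L] by blast
  then have "is_multiplier ?a f h" using is_multiplier_iff[OF fourier_L2(1)[OF f]] by blast
  then have "AEL x. multiplier ?a f x = h x" by (rule multiplier_AE_eq)
  then have "AEL x. h x = propagator m t f x" unfolding propagator_def by eventually_elim simp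
  from is_fourier_cong_AE[OF h this AE_I2[OF refl]]
  show F: "is_fourier (propagator m t f) (\<lambda>xi. ?a xi * fourier f xi)" .
  show "Lp 2 (propagator m t f)" using is_fourier_Lp2[OF F] L by simp
qed

locale DP = LPS +
  fixes m :: "real \<Rightarrow> real" and \<gamma> C d :: real
  assumes mm [measurable]: "m \<in> lmeas"
    and gam: "\<gamma> > 0" and sgam: "\<sigma> \<ge> 5 / 2 + \<gamma>"
    and d01: "0 < d" "d < 1" and dp: "d * real (p - 1) > 1"
    and disp: "\<And>t u0. t > 0 \<Longrightarrow> Lp 2 (cplx u0) \<Longrightarrow> sobolev (\<gamma> * (1 - 2 / r)) rc (cplx u0) \<Longrightarrow>
          Lp r (propagator m t (cplx u0)) \<and>
          Lp_norm r (propagator m t (cplx u0)) \<le> C * t powr (- d) * sobolev_norm (\<gamma> * (1 - 2 / r)) rc (cplx u0)"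
begin

definition g :: real where "g = \<gamma> * (1 - 2 / r)"

lemma g_facts: "0 \<le> g" "g \<le> \<gamma>"
proof -
  have "2 / r \<le> 1" "2 / r \<ge> 0" using r_facts by auto
  then have "0 \<le> 1 - 2 / r" "1 - 2 / r \<le> 1" by auto
  then show "0 \<le> g" "g \<le> \<gamma>" unfolding g_def using gam by (auto simp: mult_left_le)
qed

lemma sobolev_rc:
  assumes i: "i \<in> {0,1}" and w: "Lp 2 (cplx w)" and L: "Lp rc (mult_op (ann i g k) (cplx w))"
  defines "v \<equiv> \<lambda>x. Re (mult_op (ann i 0 k) (cplx w) x)"
  shows "cplx v = mult_op (ann i 0 k) (cplx w)" "sobolev g rc (cplx v)"
    "sobolev_norm g rc (cplx v) = Lp_norm rc (mult_op (ann i g k) (cplx w))"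
proof -
  have sa: "symbol (ann i b k)" for b by (rule symbol_ann[OF i])
  show v: "cplx v = mult_op (ann i 0 k) (cplx w)"
    unfolding v_def by (rule ext) (rule mult_op_real[OF sa ann_hermitian w, symmetric])
  have v2: "Lp 2 (cplx v)" unfolding v by (rule mult_op_fourier(2)[OF sa w])
  have "AEL xi. ann i g k xi * fourier (cplx w) xi = bessel_symbol g xi * fourier (cplx v) xi"
    using fourier_mult_op[OF sa[of 0] w] unfolding v
    by eventually_elim (simp add: ann_def mult_ac)
  from is_fourier_cong_AE[OF mult_op_fourier(1)[OF sa[of g] w] AE_I2[OF refl] this]
  have mu: "is_multiplier (bessel_symbol g) (cplx v) (mult_op (ann i g k) (cplx w))"
    unfolding is_multiplier_iff[OF fourier_L2(1)[OF v2]] .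
  then show "sobolev g rc (cplx v)" unfolding sobolev_def using L by blast
  show "sobolev_norm g rc (cplx v) = Lp_norm rc (mult_op (ann i g k) (cplx w))"
    unfolding sobolev_norm_def
  proof (rule Lp_norm_cong_AE[symmetric])
    show "AEL x. mult_op (ann i g k) (cplx w) x = multiplier (bessel_symbol g) (cplx v) x"
      using multiplier_AE_eq[OF mu] by eventually_elim simp
    show "mult_op (ann i g k) (cplx w) \<in> lmeas" using L by (simp add: Lp_def)
  qed
qed

text \<open>The dispersive estimate paired with a test function and moved to the Fourier side by
  Parseval, where Duhamel's formula is available. The Bessel weight of the norm on the data is part
  of the symbol \<open>ann i g k\<close>.\<close>

lemma linear_decay:
  assumes i: "i \<in> {0,1}" and w: "Lp 2 (cplx w)" and L: "Lp rc (mult_op (ann i g k) (cplx w))"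
    and G: "Lp 2 G" "Lp rc G" and t: "t > 0"
  shows "cmod (LI xi. cis (- (t * m xi)) * (ann i 0 k xi * fourier (cplx w) xi) * cnj (fourier G xi))
     \<le> 2 * pi * (\<bar>C\<bar> * t powr (- d) * Lp_norm rc (mult_op (ann i g k) (cplx w)) * Lp_norm rc G)"
proof -
  define v where "v x = Re (mult_op (ann i 0 k) (cplx w) x)" for x
  note S = sobolev_rc[OF i w L, folded v_def]
  have sa: "symbol (ann i 0 k)" by (rule symbol_ann[OF i])
  have v2: "Lp 2 (cplx v)" unfolding S(1) by (rule mult_op_fourier(2)[OF sa w])
  note D = disp[OF t v2, folded g_def, OF S(2)]
  note PF = propagator_fourier[OF mm v2, of t]
  have "(LI xi. cis (- (t * m xi)) * (ann i 0 k xi * fourier (cplx w) xi) * cnj (fourier G xi))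
    = (LI xi. (cis (- (t * m xi)) * fourier (cplx v) xi) * cnj (fourier G xi))"
  proof (rule integral_cong_AE_gen)
    show "AEL xi. cis (- (t * m xi)) * (ann i 0 k xi * fourier (cplx w) xi) * cnj (fourier G xi)
       = cis (- (t * m xi)) * fourier (cplx v) xi * cnj (fourier G xi)"
      using fourier_mult_op[OF sa w] unfolding S(1) by eventually_elim simp
  qed
  also have "... = cr (2 * pi) * (LI x. propagator m t (cplx v) x * cnj (G x))"
    by (rule Parseval[OF PF fourier_L2(1)[OF G(1)] G(1)])
  finally have e: "cmod (LI xi. cis (- (t * m xi)) * (ann i 0 k xi * fourier (cplx w) xi) * cnj (fourier G xi))
     = 2 * pi * cmod (LI x. propagator m t (cplx v) x * cnj (G x))"
    by (simp add: norm_mult)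
  have "cmod (LI x. propagator m t (cplx v) x * cnj (G x)) \<le> Lp_norm r (propagator m t (cplx v)) * Lp_norm rc (\<lambda>x. cnj (G x))"
    by (rule Holder[OF _ r_facts(3,5) _ Lp_cnj[OF G(2)]]) (use r_facts D in auto)
  also have "... \<le> (\<bar>C\<bar> * t powr (- d) * Lp_norm rc (mult_op (ann i g k) (cplx w))) * Lp_norm rc (\<lambda>x. cnj (G x))"
  proof (rule mult_right_mono)
    have "C * t powr (- d) * sobolev_norm g rc (cplx v) \<le> \<bar>C\<bar> * t powr (- d) * sobolev_norm g rc (cplx v)"
      unfolding S(3) by (intro mult_right_mono) auto
    then show "Lp_norm r (propagator m t (cplx v)) \<le> \<bar>C\<bar> * t powr (- d) * Lp_norm rc (mult_op (ann i g k) (cplx w))"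
      using D unfolding S(3) by linarith
  qed simp
  finally show ?thesis unfolding e by (intro mult_left_mono) auto
qed

text \<open>The data have 3/2 + \<gamma> derivatives in L^1 and, as \<sigma> is larger, also in L^2,
  hence their blocks can be interpolated to L^rc. At most \<gamma> of these derivatives are spent in
  the dispersive estimate; the others give 2^(-3k/2).\<close>

lemma initial_data:
  "\<exists>D\<ge>0. \<forall>f k. sobolev \<sigma> 2 f \<longrightarrow> sobolev (3 / 2 + \<gamma>) 1 f \<longrightarrow>
     Lp rc (mult_op (ann 0 g k) f) \<and>
     Lp_norm rc (mult_op (ann 0 g k) f) \<le> D * (2 ^ k) powr (- 3 / 2) * (Xn \<sigma> f + sobolev_norm (3 / 2 + \<gamma>) 1 f)"
proof -
  define s1 where "s1 = 3 / 2 + \<gamma>"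
  obtain C0 where C0: "C0 \<ge> 0" and Kb: "\<And>k. kernel_bound (C0 * (2 ^ k) powr ((g - s1) + real 0)) (2 ^ k) (ann 0 (g - s1) k)"
    using ann_kernel[of "g - s1"] by blast
  show ?thesis unfolding s1_def[symmetric]
  proof (intro exI[of _ "2 * (C0 * pi)"] allI impI)
    have s1: "0 \<le> s1" "s1 \<le> \<sigma>" using gam sgam by (auto simp: s1_def)
    have "Lp rc (mult_op (ann 0 g k) f) \<and>
       Lp_norm rc (mult_op (ann 0 g k) f) \<le> 2 * (C0 * pi) * (2 ^ k) powr (- 3 / 2) * (Xn \<sigma> f + sobolev_norm s1 1 f)"
      if f: "sobolev \<sigma> 2 f" and f1: "sobolev s1 1 f" for f k
    proof -
      have s0: "\<sigma> \<ge> 0" using sg3 by simp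
      note s = sobolev2D[OF f s0]
      obtain h where h: "is_multiplier (bessel_symbol s1) f h" "Lp 1 h" using f1 by (auto simp: sobolev_def)
      have hF: "is_fourier h (\<lambda>xi. bessel_symbol s1 xi * fourier f xi)"
        using h(1) is_multiplier_iff[OF fourier_L2(1)[OF s(1)]] by blast
      have n1: "sobolev_norm s1 1 f = Lp_norm 1 h"
        unfolding sobolev_norm_def
      proof (rule Lp_norm_cong_AE[symmetric])
        show "h \<in> lmeas" using h(2) by (simp add: Lp_def)
        show "AEL x. h x = multiplier (bessel_symbol s1) f x"
          using multiplier_AE_eq[OF h(1)] by eventually_elim simp
      qed
      have hm: "(\<lambda>xi. bessel_symbol s1 xi * fourier f xi) \<in> lmeas" using hF by (simp add: is_fourier_def)
      have le: "AEL xi. cmod (bessel_symbol s1 xi * fourier f xi) \<le> 1 * cmod (bessel_symbol \<sigma> xi * fourier f xi)"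
      proof (rule AE_I2)
        fix xi
        have "(1 + xi\<^sup>2) powr (s1 / 2) \<le> (1 + xi\<^sup>2) powr (\<sigma> / 2)" using s1 by (intro powr_mono) auto
        then show "cmod (bessel_symbol s1 xi * fourier f xi) \<le> 1 * cmod (bessel_symbol \<sigma> xi * fourier f xi)"
          by (simp add: norm_mult cmod_bessel mult_right_mono)
      qed
      have hL: "Lp 2 (\<lambda>xi. bessel_symbol s1 xi * fourier f xi)" by (rule Lp_bound[OF hm s(2) _ _ le]) auto
      then have h2: "Lp 2 h" using is_fourier_Lp2[OF hF] by simp
      have "N2 h \<le> N2 (\<lambda>xi. bessel_symbol s1 xi * fourier f xi)"
      proof (rule power2_le_imp_le)
        have "(N2 h)\<^sup>2 \<le> 2 * pi * (N2 h)\<^sup>2" using pi_ge_two by (simp add: mult_le_cancel_right1)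
        then show "(N2 h)\<^sup>2 \<le> (N2 (\<lambda>xi. bessel_symbol s1 xi * fourier f xi))\<^sup>2"
          using Plancherel[OF hF h2] by simp
      qed simp
      also have "... \<le> 1 * Xn \<sigma> f" unfolding Xn_def by (rule Lp_norm_bound[OF hm s(2) _ _ le]) auto
      finally have n2: "N2 h \<le> Xn \<sigma> f" by simp
      have e: "mult_op (ann 0 g k) f = mult_op (ann 0 (g - s1) k) h"
      proof (rule mult_op_AE_symbol)
        show "AEL eta. ann 0 g k eta * fourier f eta = ann 0 (g - s1) k eta * fourier h eta"
          using fourier_AE_eq[OF hF]
        proof eventually_elim
          case (elim eta)
          have "bessel_symbol (g - s1) eta * bessel_symbol s1 eta = bessel_symbol g eta" unfolding bessel_add by simp
          then show ?case unfolding elim ann_def by (simp add: mult_ac)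
        qed
      qed
      define B where "B = C0 * (2 ^ k) powr (- 3 / 2) * pi * (Xn \<sigma> f + sobolev_norm s1 1 f)"
      have k2: "(2::real) ^ k > 0" by simp
      have A0: "0 \<le> C0 * (2 ^ k) powr ((g - s1) + real 0)" using C0 by simp
      have le2: "C0 * (2 ^ k) powr ((g - s1) + real 0) * pi \<le> C0 * (2 ^ k) powr (- 3 / 2) * pi"
        using C0 g_facts by (intro mult_right_mono mult_left_mono powr_mono) (auto simp: s1_def)
      have N0: "0 \<le> sobolev_norm s1 1 f" unfolding n1 by simp
      have b: "Lp q (mult_op (ann 0 g k) f) \<and> Lp_norm q (mult_op (ann 0 g k) f) \<le> B" if "q \<ge> 1" "Lp q h" "Lp_norm q h \<le> Xn \<sigma> f + sobolev_norm s1 1 f" for q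
      proof
        note Y = mult_op_Young[OF Kb k2 A0 h2 that(2,1)]
        show "Lp q (mult_op (ann 0 g k) f)" unfolding e by (rule Y(1))
        have "Lp_norm q (mult_op (ann 0 g k) f) \<le> C0 * (2 ^ k) powr ((g - s1) + real 0) * pi * Lp_norm q h"
          unfolding e by (rule Y(2))
        also have "... \<le> C0 * (2 ^ k) powr (- 3 / 2) * pi * (Xn \<sigma> f + sobolev_norm s1 1 f)"
          by (rule mult_mono[OF le2 that(3)]) (use C0 in simp_all)
        finally show "Lp_norm q (mult_op (ann 0 g k) f) \<le> B" by (simp add: B_def)
      qed
      have b1: "Lp 1 (mult_op (ann 0 g k) f) \<and> Lp_norm 1 (mult_op (ann 0 g k) f) \<le> B"
        by (rule b) (use h(2) n1 in auto)
      have b2: "Lp 2 (mult_op (ann 0 g k) f) \<and> N2 (mult_op (ann 0 g k) f) \<le> B"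
        by (rule b) (use h2 n2 N0 in auto)
      have rc12: "1 \<le> rc" "rc \<le> 2" using r_facts by auto
      show ?thesis
        using Lp_interpolate[OF _ _ _ _ rc12, of "mult_op (ann 0 g k) f" B] b1 b2 by (auto simp: B_def mult_ac)
    qed
    then show "0 \<le> 2 * (C0 * pi) \<and> (\<forall>f k. sobolev \<sigma> 2 f \<longrightarrow> sobolev s1 1 f \<longrightarrow> Lp rc (mult_op (ann 0 g k) f) \<and>
       Lp_norm rc (mult_op (ann 0 g k) f) \<le> 2 * (C0 * pi) * (2 ^ k) powr (- 3 / 2) * (Xn \<sigma> f + sobolev_norm s1 1 f))"
      using C0 by simp
  qed
qed

end

section \<open>Time derivatives in the weighted space\<close>

text \<open>Writing V s = V t + (s - t)(V' + e) exactly, the difference quotient of the form differs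
  from the claimed derivative only by terms containing e or a factor s - t. Cauchy-Schwarz bounds
  all of them.\<close>

lemma L2_pairing_derivative:
  fixes V :: "real \<Rightarrow> real \<Rightarrow> complex" and \<theta> :: "real \<Rightarrow> real"
  assumes h: "Lp 2 h" and V: "\<And>s. s \<in> I \<Longrightarrow> Lp 2 (V s)" and V': "Lp 2 V'" and t: "t \<in> I"
    and \<theta>: "\<theta> \<in> lmeas" "\<And>xi. \<bar>\<theta> xi\<bar> \<le> B"
    and lim: "((\<lambda>s. N2 (\<lambda>xi. (V s xi - V t xi) / cr (s - t) - V' xi)) \<longlongrightarrow> 0) (at t within I)"
  shows "((\<lambda>s. LI xi. V s xi * cnj (h xi) + cr (\<theta> xi) * (V s xi * cnj (V s xi))) has_vector_derivative
     (LI xi. V' xi * cnj (h xi) + cr (\<theta> xi) * (V' xi * cnj (V t xi) + V t xi * cnj (V' xi)))) (at t within I)"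
    (is "(?Q has_vector_derivative ?Q') _")
proof -
  define e where "e s xi = (V s xi - V t xi) / cr (s - t) - V' xi" for s xi
  have B0: "0 \<le> B" using order_trans[OF abs_ge_zero \<theta>(2)] .
  have Lth: "Lp 2 (\<lambda>xi. cr (\<theta> xi) * f xi)" if "Lp 2 f" for f
    by (rule Lp_bound[OF _ that B0])
      (use \<theta> Lp_measurable[OF that] in \<open>auto simp: norm_mult intro!: mult_right_mono\<close>)
  have ith: "integ (\<lambda>xi. cr (\<theta> xi) * (f xi * cnj (g xi)))" if "Lp 2 f" "Lp 2 g" for f g
    using CS_integrable[OF Lth[OF that(1)] Lp_cnj[OF that(2)]] by (simp add: mult.assoc)
  have iq: "integ (\<lambda>xi. V s xi * cnj (h xi) + cr (\<theta> xi) * (V s xi * cnj (V s xi)))" if "s \<in> I" for s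
    using CS_integrable[OF V[OF that] Lp_cnj[OF h]] ith[OF V[OF that] V[OF that]] by (rule B_integrable_add)
  have iq': "integ (\<lambda>xi. V' xi * cnj (h xi) + cr (\<theta> xi) * (V' xi * cnj (V t xi) + V t xi * cnj (V' xi)))"
    unfolding distrib_left
    by (intro B_integrable_add CS_integrable[OF V' Lp_cnj[OF h]] ith V' V t)
  define b where "b s = N2 (e s) * (N2 h + 2 * B * N2 (V t)) + B * \<bar>s - t\<bar> * (N2 (e s) + N2 V')\<^sup>2" for s
  have bound: "cmod ((?Q s - ?Q t) - (s - t) *\<^sub>R ?Q') / norm (s - t) \<le> b s" if s: "s \<in> I" "s \<noteq> t" for s
  proof -
    have e2: "Lp 2 (e s)"
      using Lp_diff[OF Lp_scale[OF Lp_diff[OF V[OF s(1)] V[OF t]], of "1 / cr (s - t)"] V'] unfolding e_def by simp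
    have d2: "Lp 2 (\<lambda>xi. e s xi + V' xi)" using e2 V' by (rule Lp_add) simp
    define err where "err xi = e s xi * cnj (h xi) + cr (\<theta> xi) * (e s xi * cnj (V t xi) + V t xi * cnj (e s xi))
      + cr (\<theta> xi) * cr (s - t) * ((e s xi + V' xi) * cnj (e s xi + V' xi))" for xi
    have pt: "V s xi * cnj (h xi) + cr (\<theta> xi) * (V s xi * cnj (V s xi))
        - (V t xi * cnj (h xi) + cr (\<theta> xi) * (V t xi * cnj (V t xi)))
        - cr (s - t) * (V' xi * cnj (h xi) + cr (\<theta> xi) * (V' xi * cnj (V t xi) + V t xi * cnj (V' xi)))
        = cr (s - t) * err xi" for xi
    proof -
      have nz: "cr (s - t) \<noteq> 0" using s(2) by simp
      have "V s xi = V t xi + cr (s - t) * (e s xi + V' xi)" unfolding e_def using nz by simp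
      then show ?thesis unfolding err_def by (simp add: algebra_simps del: of_real_diff)
    qed
    have "(?Q s - ?Q t) - (s - t) *\<^sub>R ?Q' = (LI xi. cr (s - t) * err xi)"
      unfolding pt[symmetric] scaleR_conv_of_real using iq[OF s(1)] iq[OF t] iq' by simp
    then have "cmod ((?Q s - ?Q t) - (s - t) *\<^sub>R ?Q') / norm (s - t) = cmod (LI xi. err xi)"
      using s(2) by (simp add: norm_mult del: of_real_diff)
    also have "... \<le> (LI xi. cmod (err xi))" by (rule integral_norm_bound)
    also have "... \<le> (LI xi. cmod (e s xi) * cmod (h xi) + 2 * B * (cmod (e s xi) * cmod (V t xi))
        + B * \<bar>s - t\<bar> * (cmod (e s xi + V' xi) * cmod (e s xi + V' xi)))" (is "_ \<le> integral\<^sup>L _ ?M")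
    proof (rule integral_mono')
      have n: "integ (\<lambda>xi. cmod (f xi) * cmod (g xi))" if "Lp 2 f" "Lp 2 g" for f g
        using integrable_norm[OF CS_integrable[OF that]] by (simp add: norm_mult)
      show "integ ?M"
        by (intro B_integrable_add integrable_mult_right n e2 h V t d2)
      fix xi
      have "cmod (err xi) \<le> cmod (e s xi * cnj (h xi)) + (cmod (cr (\<theta> xi) * (e s xi * cnj (V t xi))) + cmod (cr (\<theta> xi) * (V t xi * cnj (e s xi))))
         + cmod (cr (\<theta> xi) * cr (s - t) * ((e s xi + V' xi) * cnj (e s xi + V' xi)))"
        unfolding err_def distrib_left by (intro norm_triangle_le add_mono order_refl)
      also have "... = cmod (e s xi) * cmod (h xi) + 2 * \<bar>\<theta> xi\<bar> * (cmod (e s xi) * cmod (V t xi)) + \<bar>\<theta> xi\<bar> * \<bar>s - t\<bar> * (cmod (e s xi + V' xi) * cmod (e s xi + V' xi))"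
        by (simp add: norm_mult del: of_real_diff complex_cnj_add)
      also have "... \<le> ?M xi"
        using \<theta>(2)[of xi] by (intro add_mono mult_right_mono order_refl) auto
      finally show "cmod (err xi) \<le> ?M xi" .
      show "0 \<le> ?M xi" using B0 by simp
    qed
    also have "... = (LI xi. cmod (e s xi) * cmod (h xi)) + 2 * B * (LI xi. cmod (e s xi) * cmod (V t xi))
        + B * \<bar>s - t\<bar> * (LI xi. cmod (e s xi + V' xi) * cmod (e s xi + V' xi))"
    proof -
      have n: "integ (\<lambda>xi. cmod (f xi) * cmod (g xi))" if "Lp 2 f" "Lp 2 g" for f g
        using integrable_norm[OF CS_integrable[OF that]] by (simp add: norm_mult)
      show ?thesis using n[OF e2 h] n[OF e2 V[OF t]] n[OF d2 d2] by simp
    qed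
    also have "... \<le> N2 (e s) * N2 h + 2 * B * (N2 (e s) * N2 (V t))
        + B * \<bar>s - t\<bar> * (N2 (\<lambda>xi. e s xi + V' xi) * N2 (\<lambda>xi. e s xi + V' xi))"
      using B0 by (intro add_mono mult_left_mono CS_norm e2 h V t d2) auto
    also have "... \<le> N2 (e s) * N2 h + 2 * B * (N2 (e s) * N2 (V t))
        + B * \<bar>s - t\<bar> * ((N2 (e s) + N2 V') * (N2 (e s) + N2 V'))"
      using B0 Lp_norm2_triangle[OF e2 V'] by (intro add_left_mono mult_left_mono mult_mono) auto
    also have "... = b s" unfolding b_def by (simp add: algebra_simps power2_eq_square)
    finally show ?thesis .
  qed
  have e0: "((\<lambda>s. N2 (e s)) \<longlongrightarrow> 0) (at t within I)" using lim unfolding e_def .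
  have "(b \<longlongrightarrow> 0 * (N2 h + 2 * B * N2 (V t)) + B * \<bar>t - t\<bar> * (0 + N2 V')\<^sup>2) (at t within I)"
    unfolding b_def by (intro tendsto_intros e0)
  then have b0: "(b \<longlongrightarrow> 0) (at t within I)" by simp
  have "((\<lambda>s. cmod ((?Q s - ?Q t) - (s - t) *\<^sub>R ?Q') / norm (s - t)) \<longlongrightarrow> 0) (at t within I)"
  proof (rule Lim_null_comparison[OF _ b0])
    show "\<forall>\<^sub>F s in at t within I. norm (cmod ((?Q s - ?Q t) - (s - t) *\<^sub>R ?Q') / norm (s - t)) \<le> b s"
      unfolding eventually_at_filter
    proof (intro always_eventually allI impI)
      fix s assume "s \<noteq> t" "s \<in> I"
      have "0 \<le> cmod ((?Q s - ?Q t) - (s - t) *\<^sub>R ?Q') / norm (s - t)" by (intro divide_nonneg_nonneg norm_ge_zero)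
      then show "norm (cmod ((?Q s - ?Q t) - (s - t) *\<^sub>R ?Q') / norm (s - t)) \<le> b s"
        using bound[OF \<open>s \<in> I\<close> \<open>s \<noteq> t\<close>] by (simp only: real_norm_def abs_of_nonneg)
    qed
  qed
  then show ?thesis
    unfolding has_vector_derivative_def has_derivative_iff_norm
    by (simp add: bounded_linear_scaleR_left)
qed

lemma Xn_diff_commute:
  assumes f: "sobolev s 2 f" and h: "sobolev s 2 h" and s: "s \<ge> 0"
  shows "Xn s (\<lambda>x. f x - h x) = Xn s (\<lambda>x. h x - f x)"
proof -
  have "AEL xi. bessel_symbol s xi * fourier (\<lambda>x. h x - f x) xi = - (bessel_symbol s xi * fourier (\<lambda>x. f x - h x) xi)"
    using fourier_diff_AE[OF sobolev2D(1)[OF f s] sobolev2D(1)[OF h s]] fourier_diff_AE[OF sobolev2D(1)[OF h s] sobolev2D(1)[OF f s]]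
    by eventually_elim (simp add: right_diff_distrib)
  from Lp_norm_cong_AE[OF this Lp_measurable[OF sobolev2D(2)[OF sobolev2_diff(1)[OF h f s] s]], of 2]
  show ?thesis unfolding Xn_def by simp
qed

section \<open>Solution curves on a bounded time interval\<close>

locale SOL = DP +
  fixes T :: real and u0 :: "real \<Rightarrow> real" and u :: "real \<Rightarrow> real \<Rightarrow> real"
  assumes T0: "0 \<le> T" and sol: "is_solution m p \<sigma> u0 {0..T} u"
begin

abbreviation F :: "real \<Rightarrow> real \<Rightarrow> complex" where "F t \<equiv> fourier (cplx (u t))"
abbreviation up :: "real \<Rightarrow> real \<Rightarrow> complex" where "up t \<equiv> (\<lambda>x. cplx (u t) x ^ p)"
abbreviation G :: "real \<Rightarrow> real \<Rightarrow> complex" where "G t \<equiv> fourier (up t)"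
abbreviation X :: "real \<Rightarrow> real" where "X t \<equiv> Xn \<sigma> (cplx (u t))"

text \<open>The transform of the nonlinear term, moved to the right side of the equation. Up to the
  phase it is the whole time derivative of \<open>cis (t * m xi) * F t xi\<close>, in which the
  dispersion has been undone.\<close>

definition D :: "real \<Rightarrow> real \<Rightarrow> complex" where
  "D t xi = - (1 / of_nat p) * (\<i> * cr xi * G t xi)"

lemma s0: "\<sigma> \<ge> 0" using sg3 by simp

lemma hs: "t \<in> {0..T} \<Longrightarrow> sobolev \<sigma> 2 (cplx (u t))"
  using sol by (simp add: is_solution_def)

lemma u2: "t \<in> {0..T} \<Longrightarrow> Lp 2 (cplx (u t))" "t \<in> {0..T} \<Longrightarrow> Lp 2 (F t)"
  using sobolev2D(1)[OF hs s0] fourier_L2(2) by blast+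

text \<open>Of the p factors p - 1 are bounded in the sup norm through \<open>Nb_of_Xn\<close>, and
  the last one stays in L^2.\<close>

lemma G_bound: "\<exists>C\<ge>0. \<forall>t\<in>{0..T}. Lp 2 (up t) \<and> N2 (G t) \<le> (C * X t) ^ (p - 1) * X t"
proof -
  obtain C1 where C1: "C1 \<ge> 0" and N: "\<And>f. sobolev \<sigma> 2 f \<Longrightarrow> Nb (C1 * Xn \<sigma> f) f" using Nb_of_Xn by blast
  obtain C2 where C2: "C2 \<ge> 1" and B: "\<And>f A. sobolev \<sigma> 2 f \<Longrightarrow> A \<ge> 0 \<Longrightarrow> Nb A f \<Longrightarrow> AEL x. cmod (f x) \<le> C2 * A"
    using split_bounds by blast
  show ?thesis
  proof (intro exI[of _ "C2 * C1"] conjI ballI)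
    show "0 \<le> C2 * C1" using C1 C2 by simp
    fix t assume t: "t \<in> {0..T}"
    have b: "AEL x. cmod (cplx (u t) x) \<le> C2 * C1 * X t"
      using B[OF hs[OF t] _ N[OF hs[OF t]]] C1 by (simp add: mult.assoc)
    have p: "Suc (p - 1) = p" using p3 by simp
    show L: "Lp 2 (up t)" using Lp_power[OF u2(1)[OF t] b, of "p - 1"] unfolding p .
    have c0: "0 \<le> (C2 * C1 * X t) ^ (p - 1)" using C1 C2 by simp
    have "N2 (up t) \<le> (C2 * C1 * X t) ^ (p - 1) * N2 (cplx (u t))"
    proof (rule Lp_norm_bound[OF Lp_measurable[OF L] u2(1)[OF t] c0])
      show "AEL x. cmod (cplx (u t) x ^ p) \<le> (C2 * C1 * X t) ^ (p - 1) * cmod (cplx (u t) x)"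
        using b
      proof eventually_elim
        case (elim x)
        have "cmod (cplx (u t) x) ^ p = cmod (cplx (u t) x) ^ (p - 1) * cmod (cplx (u t) x)"
          using power_Suc2[of "cmod (cplx (u t) x)" "p - 1"] unfolding p .
        then show ?case unfolding norm_power using power_mono[OF elim, of "p - 1"] by (simp add: mult_right_mono)
      qed
    qed simp
    then have "(N2 (up t))\<^sup>2 \<le> ((C2 * C1 * X t) ^ (p - 1) * N2 (cplx (u t)))\<^sup>2" by (rule power_mono) simp
    then have "(N2 (G t))\<^sup>2 \<le> ((C2 * C1 * X t) ^ (p - 1) * N2 (F t))\<^sup>2"
      using Plancherel[OF fourier_L2(1)[OF L] L] Plancherel[OF fourier_L2(1)[OF u2(1)[OF t]] u2(1)[OF t]]
      by (simp add: power_mult_distrib mult_ac)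
    then have "N2 (G t) \<le> (C2 * C1 * X t) ^ (p - 1) * N2 (F t)"
      by (rule power2_le_imp_le) (use c0 in simp)
    also have "... \<le> (C2 * C1 * X t) ^ (p - 1) * X t"
      using sobolev2D(4)[OF hs[OF t] s0] c0 by (rule mult_left_mono)
    finally show "N2 (G t) \<le> (C2 * C1 * X t) ^ (p - 1) * X t" .
  qed
qed

lemma G2: "t \<in> {0..T} \<Longrightarrow> Lp 2 (up t)" "t \<in> {0..T} \<Longrightarrow> Lp 2 (G t)"
  using G_bound fourier_L2(2) by blast+

lemma F_meas [measurable]: "t \<in> {0..T} \<Longrightarrow> F t \<in> lmeas" "t \<in> {0..T} \<Longrightarrow> G t \<in> lmeas"
  using u2(2) G2(2) Lp_measurable by blast+

lemma X_diff: "t \<in> {0..T} \<Longrightarrow> ((\<lambda>s. Xn \<sigma> (\<lambda>x. cplx (u s) x - cplx (u t) x)) \<longlongrightarrow> 0) (at t within {0..T})"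
proof -
  assume t: "t \<in> {0..T}"
  have "((\<lambda>s. H_norm \<sigma> (\<lambda>x. u s x - u t x)) \<longlongrightarrow> 0) (at t within {0..T})" using sol t by (simp add: is_solution_def)
  from tendsto_mult[OF this tendsto_const[of "sqrt (2 * pi)"]]
  have l: "((\<lambda>s. H_norm \<sigma> (\<lambda>x. u s x - u t x) * sqrt (2 * pi)) \<longlongrightarrow> 0) (at t within {0..T})" by simp
  show ?thesis
  proof (rule Lim_transform_eventually[OF l])
    show "\<forall>\<^sub>F s in at t within {0..T}. H_norm \<sigma> (\<lambda>x. u s x - u t x) * sqrt (2 * pi) = Xn \<sigma> (\<lambda>x. cplx (u s) x - cplx (u t) x)"
      unfolding eventually_at_filter
    proof (intro always_eventually allI impI)
      fix s assume "s \<in> {0..T}"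
      from sobolev2D(3)[OF sobolev2_diff(1)[OF hs[OF this] hs[OF t] s0] s0]
      show "H_norm \<sigma> (\<lambda>x. u s x - u t x) * sqrt (2 * pi) = Xn \<sigma> (\<lambda>x. cplx (u s) x - cplx (u t) x)"
        by simp
    qed
  qed
qed

lemma X_abs_diff: "s \<in> {0..T} \<Longrightarrow> t \<in> {0..T} \<Longrightarrow> \<bar>X s - X t\<bar> \<le> Xn \<sigma> (\<lambda>x. cplx (u s) x - cplx (u t) x)"
proof -
  assume s: "s \<in> {0..T}" and t: "t \<in> {0..T}"
  show ?thesis
    using Xn_diff_commute[OF hs[OF s] hs[OF t] s0] sobolev2_diff(2)[OF hs[OF s] hs[OF t] s0] sobolev2_diff(2)[OF hs[OF t] hs[OF s] s0] by linarith
qed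

lemma X_cont: "continuous_on {0..T} X"
  unfolding continuous_on_def
proof
  fix t assume t: "t \<in> {0..T}"
  show "(X \<longlongrightarrow> X t) (at t within {0..T})"
  proof (rule LIM_zero_cancel, rule Lim_null_comparison[OF _ X_diff[OF t]])
    show "\<forall>\<^sub>F s in at t within {0..T}. norm (X s - X t) \<le> Xn \<sigma> (\<lambda>x. cplx (u s) x - cplx (u t) x)"
      unfolding eventually_at_filter using X_abs_diff[OF _ t] by (intro always_eventually) auto
  qed
qed

text \<open>The bound may depend on the solution and on T; it is a majorant for removing the
  frequency truncation and does not enter the final constants.\<close>

lemma uniform_bound: "\<exists>M\<ge>0. \<forall>t\<in>{0..T}. X t \<le> M \<and> N2 (F t) \<le> M \<and> N2 (G t) \<le> M"
proof -
  obtain C where C: "C \<ge> 0" and GB: "\<And>t. t \<in> {0..T} \<Longrightarrow> N2 (G t) \<le> (C * X t) ^ (p - 1) * X t"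
    using G_bound by blast
  have "bounded (X ` {0..T})" by (rule compact_imp_bounded[OF compact_continuous_image[OF X_cont]]) simp
  then obtain M0 where M0: "\<And>t. t \<in> {0..T} \<Longrightarrow> X t \<le> M0" unfolding bounded_iff by fastforce
  define M where "M = max M0 0"
  have M: "X t \<le> M" "M \<ge> 0" if "t \<in> {0..T}" for t using M0[OF that] by (auto simp: M_def)
  show ?thesis
  proof (intro exI[of _ "M + (C * M) ^ (p - 1) * M"] conjI ballI)
    have M00: "M \<ge> 0" by (simp add: M_def)
    then have p0: "(C * M) ^ (p - 1) * M \<ge> 0" using C by simp
    show "0 \<le> M + (C * M) ^ (p - 1) * M" using M00 p0 by simp
    fix t assume t: "t \<in> {0..T}"
    show "X t \<le> M + (C * M) ^ (p - 1) * M" using M[OF t] p0 by simp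
    then show "N2 (F t) \<le> M + (C * M) ^ (p - 1) * M" using sobolev2D(4)[OF hs[OF t] s0] by linarith
    have "(C * X t) ^ (p - 1) * X t \<le> (C * M) ^ (p - 1) * M"
      using M[OF t] C by (intro mult_mono power_mono mult_left_mono) auto
    then show "N2 (G t) \<le> M + (C * M) ^ (p - 1) * M" using GB[OF t] M00 by linarith
  qed
qed

lemma D_le: "cmod (D t xi) \<le> \<bar>xi\<bar> * cmod (G t xi)"
proof -
  have "1 / real p * (\<bar>xi\<bar> * cmod (G t xi)) \<le> 1 * (\<bar>xi\<bar> * cmod (G t xi))" using p3 by (intro mult_right_mono) auto
  then show ?thesis by (simp add: D_def norm_mult norm_divide)
qed

text \<open>
  On a set of frequencies where \<open>xi\<close> and \<open>m\<close> are bounded the weight of the defining norm is harmless, and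
  the curve is differentiable in \<open>L\<^sup>2\<close>.
\<close>

lemma cut_derivative:
  assumes A: "A \<in> sets lebesgue" "\<And>xi. xi \<in> A \<Longrightarrow> \<bar>xi\<bar> \<le> N" "\<And>xi. xi \<in> A \<Longrightarrow> \<bar>m xi\<bar> \<le> N"
    and N: "N \<ge> 0" and t: "t \<in> {0..T}"
  defines "V \<equiv> \<lambda>s xi. indicator A xi * (cis (s * m xi) * F s xi)"
    and "V' \<equiv> \<lambda>xi. indicator A xi * (cis (t * m xi) * D t xi)"
  shows "\<And>s. s \<in> {0..T} \<Longrightarrow> Lp 2 (V s)" "Lp 2 V'"
    "((\<lambda>s. N2 (\<lambda>xi. (V s xi - V t xi) / cr (s - t) - V' xi)) \<longlongrightarrow> 0) (at t within {0..T})"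
proof -
  note [measurable] = A(1)
  have cm [measurable]: "(\<lambda>xi. cis (s * m xi)) \<in> lmeas" for s
    by (rule measurable_compose[OF _ measurable_cis]) measurable
  have Vm: "V s \<in> lmeas" if [measurable]: "s \<in> {0..T}" for s
    unfolding V_def by measurable
  show V2: "Lp 2 (V s)" if s: "s \<in> {0..T}" for s
    by (rule Lp_bound[OF Vm[OF s] u2(2)[OF s], where c = 1]) (auto simp: V_def norm_mult indicator_def)
  note [measurable] = t
  have [measurable]: "D t \<in> lmeas" unfolding D_def by measurable
  have V'm: "V' \<in> lmeas" unfolding V'_def by measurable
  show V'2: "Lp 2 V'"
  proof (rule Lp_bound[OF V'm G2(2)[OF t] N])
    have "cmod (V' xi) \<le> N * cmod (G t xi)" for xi
    proof (cases "xi \<in> A")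
      case True
      then show ?thesis using order_trans[OF D_le[of t xi] mult_right_mono[OF A(2)[OF True] norm_ge_zero]]
        by (simp add: V'_def norm_mult)
    qed (use N in \<open>simp add: V'_def\<close>)
    then show "AEL xi. cmod (V' xi) \<le> N * cmod (G t xi)" by simp
  qed simp
  define W where "W xi = 1 + \<bar>xi\<bar> + \<bar>m xi\<bar>" for xi
  define df where "df s xi = pde_defect m p u s t xi / cr (W xi)" for s xi
  define R where "R xi = cr (cmod (G t xi)) + cr (2 * cmod (F t xi))" for xi
  have nc: "Lp 2 (\<lambda>xi. cr (cmod (f xi)))" if "Lp 2 f" for f
  proof -
    note [measurable] = Lp_measurable[OF that]
    have "(\<lambda>xi. cr (cmod (f xi))) \<in> lmeas" by measurable
    then show ?thesis using that unfolding Lp_def by simp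
  qed
  have R2: "Lp 2 R" unfolding R_def
    using Lp_add[OF nc[OF G2(2)[OF t]] Lp_scale[OF nc[OF u2(2)[OF t]], of 2]] by simp
  have Rn: "cmod (R xi) = cmod (G t xi) + 2 * cmod (F t xi)" for xi
    unfolding R_def of_real_add[symmetric] norm_of_real by simp
  \<comment> \<open>The defect of the equation tends to 0 by the notion of solution; what the phase
    adds is of first order in s - t where m is bounded.\<close>
  have bd: "N2 (\<lambda>xi. (V s xi - V t xi) / cr (s - t) - V' xi)
     \<le> (1 + 2 * N) * N2 (df s) + \<bar>s - t\<bar> * N\<^sup>2 * N2 R" if s: "s \<in> {0..T}" "s \<noteq> t" for s
  proof -
    note [measurable] = s(1)
    have W1: "W xi \<ge> 1" "\<bar>xi\<bar> \<le> W xi" "\<bar>m xi\<bar> \<le> W xi" for xi by (auto simp: W_def)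
    have dfm: "df s \<in> lmeas" unfolding df_def pde_defect_def W_def of_real_power[symmetric]
      by (simp only: of_real_power) measurable
    \<comment> \<open>Square integrability matters for each fixed s separately, so the constant may
      blow up as s approaches t.\<close>
    have df2: "Lp 2 (df s)"
    proof (rule Lp_bound[OF dfm])
      let ?R = "\<lambda>xi. (cr (cmod (F s xi)) + cr (cmod (F t xi))) + R xi"
      show "Lp 2 ?R"
        by (intro Lp_add[of 2 "\<lambda>xi. cr (cmod (F s xi)) + cr (cmod (F t xi))"] Lp_add[of 2 "\<lambda>xi. cr (cmod (F s xi))"] R2 nc u2 s t) auto
      show "0 \<le> 1 + 1 / \<bar>s - t\<bar>" by simp
      have "cmod (df s xi) \<le> (1 + 1 / \<bar>s - t\<bar>) * cmod (?R xi)" for xi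
      proof -
        have Rn': "cmod (?R xi) = cmod (F s xi) + cmod (F t xi) + (cmod (G t xi) + 2 * cmod (F t xi))"
          unfolding R_def of_real_add[symmetric] norm_of_real by simp
        have "cmod (pde_defect m p u s t xi) \<le> cmod ((F s xi - F t xi) / cr (s - t)) + cmod (D t xi) + cmod (\<i> * cr (m xi) * F t xi)"
          unfolding pde_defect_def D_def of_real_power
          by (rule order_trans[OF norm_triangle_ineq add_right_mono[OF order_trans[OF norm_triangle_ineq]]]) simp
        also have "... \<le> (cmod (F s xi) + cmod (F t xi)) * (1 / \<bar>s - t\<bar>) * W xi + cmod (G t xi) * W xi + cmod (F t xi) * W xi"
        proof (intro add_mono)
          have "cmod ((F s xi - F t xi) / cr (s - t)) \<le> (cmod (F s xi) + cmod (F t xi)) * (1 / \<bar>s - t\<bar>)"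
            unfolding norm_divide norm_of_real using norm_triangle_ineq4[of "F s xi" "F t xi"] by (simp add: divide_right_mono)
          also have "... \<le> (cmod (F s xi) + cmod (F t xi)) * (1 / \<bar>s - t\<bar>) * W xi"
            using W1(1)[of xi] mult_left_mono[OF W1(1)[of xi], of "(cmod (F s xi) + cmod (F t xi)) * (1 / \<bar>s - t\<bar>)"] by simp
          finally show "cmod ((F s xi - F t xi) / cr (s - t)) \<le> (cmod (F s xi) + cmod (F t xi)) * (1 / \<bar>s - t\<bar>) * W xi" .
          show "cmod (D t xi) \<le> cmod (G t xi) * W xi"
            using D_le[of t xi] mult_right_mono[OF W1(2)[of xi] norm_ge_zero[of "G t xi"]] by (simp add: mult.commute)
          show "cmod (\<i> * cr (m xi) * F t xi) \<le> cmod (F t xi) * W xi"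
            using mult_right_mono[OF W1(3)[of xi] norm_ge_zero[of "F t xi"]] by (simp add: norm_mult mult.commute)
        qed
        also have "... = ((cmod (F s xi) + cmod (F t xi)) * (1 / \<bar>s - t\<bar>) + cmod (G t xi) + cmod (F t xi)) * W xi"
          by (simp add: distrib_right)
        also have "... \<le> ((1 + 1 / \<bar>s - t\<bar>) * cmod (?R xi)) * W xi"
        proof (rule mult_right_mono)
          have "a * i + g + f \<le> (1 + i) * (a + (g + 2 * f))" if "0 \<le> a" "0 \<le> i" "0 \<le> g" "0 \<le> f" for a i g f :: real
            using that by (simp add: algebra_simps add_increasing add_increasing2)
          from this[of "cmod (F s xi) + cmod (F t xi)" "1 / \<bar>s - t\<bar>" "cmod (G t xi)" "cmod (F t xi)"]
          show "(cmod (F s xi) + cmod (F t xi)) * (1 / \<bar>s - t\<bar>) + cmod (G t xi) + cmod (F t xi) \<le> (1 + 1 / \<bar>s - t\<bar>) * cmod (?R xi)"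
            unfolding Rn' by simp
        qed (use W1(1)[of xi] in simp)
        finally show ?thesis
          using W1(1)[of xi] by (simp add: df_def norm_divide pos_divide_le_eq)
      qed
      then show "AEL xi. cmod (df s xi) \<le> (1 + 1 / \<bar>s - t\<bar>) * cmod (?R xi)" by simp
    qed simp
    let ?e = "\<lambda>xi. (V s xi - V t xi) / cr (s - t) - V' xi"
    let ?H = "\<lambda>xi. cr (1 + 2 * N) * cr (cmod (df s xi)) + cr (\<bar>s - t\<bar> * N\<^sup>2) * R xi"
    have H1: "Lp 2 (\<lambda>xi. cr (1 + 2 * N) * cr (cmod (df s xi)))" by (rule Lp_scale[OF nc[OF df2]]) simp
    have H2: "Lp 2 (\<lambda>xi. cr (\<bar>s - t\<bar> * N\<^sup>2) * R xi)" by (rule Lp_scale[OF R2]) simp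
    have em: "?e \<in> lmeas" using Vm[OF s(1)] Vm[OF t] V'm by measurable
    have eH: "cmod (?e xi) \<le> 1 * cmod (?H xi)" for xi
    proof (cases "xi \<in> A")
      case False
      then show ?thesis by (simp add: V_def V'_def)
    next
      case True
      let ?a = "cis (s * m xi)" and ?b = "cis (t * m xi)" and ?d = "pde_defect m p u s t xi"
      let ?R = "(?a - ?b - \<i> * cr (s * m xi - t * m xi) * ?b) / cr (s - t)"
      have nz: "cr (s - t) \<noteq> 0" using s(2) by simp
      have gen: "(a * x - b * y) / z = a * ((x - y) / z) + y * ((a - b) / z)" for a b x y z :: complex
        by (simp add: add_divide_distrib[symmetric] algebra_simps)
      have d: "(F s xi - F t xi) / cr (s - t) = ?d + D t xi - \<i> * cr (m xi) * F t xi"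
        unfolding pde_defect_def D_def of_real_power by simp
      have "?e xi = ?a * ((F s xi - F t xi) / cr (s - t)) + F t xi * ((?a - ?b) / cr (s - t)) - ?b * D t xi"
        using True gen[of ?a "F s xi" ?b "F t xi" "cr (s - t)"] by (simp only: V_def V'_def indicator_simps mult_1_left)
      \<comment> \<open>The difference quotient of the phase is its derivative plus a Taylor
        remainder. The derivative cancels the dispersive term of the equation except for a factor
        \<open>?a - ?b\<close>, which is small.\<close>
      also have "(?a - ?b) / cr (s - t) = ?R + \<i> * cr (m xi) * ?b"
      proof -
        have "cr (s * m xi - t * m xi) = cr (s - t) * cr (m xi)"
          by (simp add: left_diff_distrib)
        then show ?thesis using nz by (simp add: divide_simps)
      qed
      finally have "?e xi = ?a * ?d + (?a - ?b) * (D t xi - \<i> * cr (m xi) * F t xi) + F t xi * ?R"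
        unfolding d by (simp add: algebra_simps)
      then have "cmod (?e xi) \<le> cmod (?a * ?d) + cmod ((?a - ?b) * (D t xi - \<i> * cr (m xi) * F t xi)) + cmod (F t xi * ?R)"
        by (simp only:) (rule order_trans[OF norm_triangle_ineq add_right_mono[OF norm_triangle_ineq]])
      also have "... \<le> (1 + 2 * N) * cmod (df s xi) + (\<bar>s - t\<bar> * N) * (N * cmod (G t xi) + N * cmod (F t xi)) + cmod (F t xi) * (\<bar>s - t\<bar> * N\<^sup>2)"
      proof (intro add_mono)
        have "cmod (?a * ?d) = W xi * cmod (df s xi)" using W1(1)[of xi] by (simp add: df_def norm_mult norm_divide)
        also have "... \<le> (1 + 2 * N) * cmod (df s xi)"
          using A(2,3)[OF True] by (intro mult_right_mono) (auto simp: W_def)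
        finally show "cmod (?a * ?d) \<le> (1 + 2 * N) * cmod (df s xi)" .
        have mt: "\<bar>s * m xi - t * m xi\<bar> \<le> \<bar>s - t\<bar> * N"
          using mult_left_mono[OF A(3)[OF True] abs_ge_zero[of "s - t"]] by (simp add: left_diff_distrib[symmetric] abs_mult)
        show "cmod ((?a - ?b) * (D t xi - \<i> * cr (m xi) * F t xi)) \<le> (\<bar>s - t\<bar> * N) * (N * cmod (G t xi) + N * cmod (F t xi))"
          unfolding norm_mult[of "?a - ?b"]
        proof (rule mult_mono)
          show "cmod (?a - ?b) \<le> \<bar>s - t\<bar> * N" using cis_diff_bound mt by (rule order_trans)
          have "cmod (D t xi) \<le> N * cmod (G t xi)"
            using order_trans[OF D_le[of t xi] mult_right_mono[OF A(2)[OF True] norm_ge_zero]] .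
          moreover have "cmod (\<i> * cr (m xi) * F t xi) \<le> N * cmod (F t xi)"
            using mult_right_mono[OF A(3)[OF True] norm_ge_zero[of "F t xi"]] by (simp add: norm_mult)
          ultimately show "cmod (D t xi - \<i> * cr (m xi) * F t xi) \<le> N * cmod (G t xi) + N * cmod (F t xi)"
            using norm_triangle_ineq4[of "D t xi" "\<i> * cr (m xi) * F t xi"] by linarith
        qed (use N in auto)
        have "cmod ?R \<le> (\<bar>s - t\<bar> * N)\<^sup>2 / \<bar>s - t\<bar>"
          unfolding norm_divide norm_of_real
        proof (rule divide_right_mono)
          have "(s * m xi - t * m xi)\<^sup>2 \<le> (\<bar>s - t\<bar> * N)\<^sup>2" using power_mono[OF mt, of 2] by simp
          then show "cmod (?a - ?b - \<i> * cr (s * m xi - t * m xi) * ?b) \<le> (\<bar>s - t\<bar> * N)\<^sup>2"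
            using cis_taylor_bound by (rule order_trans[rotated])
        qed simp
        also have "... = \<bar>s - t\<bar> * N\<^sup>2" using s(2) by (simp add: power2_eq_square field_simps)
        finally show "cmod (F t xi * ?R) \<le> cmod (F t xi) * (\<bar>s - t\<bar> * N\<^sup>2)" unfolding norm_mult by (rule mult_left_mono) simp
      qed
      also have "... = (1 + 2 * N) * cmod (df s xi) + \<bar>s - t\<bar> * N\<^sup>2 * (cmod (G t xi) + 2 * cmod (F t xi))"
        by (simp add: algebra_simps power2_eq_square)
      also have "... = cmod (?H xi)"
      proof -
        have "?H xi = cr ((1 + 2 * N) * cmod (df s xi) + \<bar>s - t\<bar> * N\<^sup>2 * (cmod (G t xi) + 2 * cmod (F t xi)))"
          by (simp add: R_def)
        moreover have "0 \<le> (1 + 2 * N) * cmod (df s xi) + \<bar>s - t\<bar> * N\<^sup>2 * (cmod (G t xi) + 2 * cmod (F t xi))"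
          using N by simp
        ultimately show ?thesis by (simp only: norm_of_real abs_of_nonneg)
      qed
      finally show ?thesis by simp
    qed
    have "N2 ?e \<le> 1 * N2 ?H"
      by (rule Lp_norm_bound[OF em Lp_add[OF H1 H2]]) (use eH in auto)
    also have "... \<le> N2 (\<lambda>xi. cr (1 + 2 * N) * cr (cmod (df s xi))) + N2 (\<lambda>xi. cr (\<bar>s - t\<bar> * N\<^sup>2) * R xi)"
      using Lp_norm2_triangle[OF H1 H2] by simp
    also have "... = (1 + 2 * N) * N2 (df s) + \<bar>s - t\<bar> * N\<^sup>2 * N2 R"
    proof -
      have "N2 (\<lambda>xi. cr (cmod (df s xi))) = N2 (df s)" by (simp add: Lp_norm_def)
      moreover have "cmod (cr (1 + 2 * N)) = 1 + 2 * N" "cmod (cr (\<bar>s - t\<bar> * N\<^sup>2)) = \<bar>s - t\<bar> * N\<^sup>2"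
        using N unfolding norm_of_real by (auto simp: abs_mult)
      ultimately show ?thesis by (simp only: Lp_norm_scale[OF zero_less_numeral])
    qed
    finally show ?thesis .
  qed
  have "((\<lambda>s. N2 (df s)) \<longlongrightarrow> 0) (at t within {0..T})"
    using sol t unfolding is_solution_def df_def W_def by blast
  then have "((\<lambda>s. (1 + 2 * N) * N2 (df s) + \<bar>s - t\<bar> * N\<^sup>2 * N2 R) \<longlongrightarrow> (1 + 2 * N) * 0 + \<bar>t - t\<bar> * N\<^sup>2 * N2 R) (at t within {0..T})"
    by (intro tendsto_intros)
  then have l: "((\<lambda>s. (1 + 2 * N) * N2 (df s) + \<bar>s - t\<bar> * N\<^sup>2 * N2 R) \<longlongrightarrow> 0) (at t within {0..T})" by simp
  show "((\<lambda>s. N2 (\<lambda>xi. (V s xi - V t xi) / cr (s - t) - V' xi)) \<longlongrightarrow> 0) (at t within {0..T})"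
  proof (rule Lim_null_comparison[OF _ l])
    show "\<forall>\<^sub>F s in at t within {0..T}. norm (N2 (\<lambda>xi. (V s xi - V t xi) / cr (s - t) - V' xi))
        \<le> (1 + 2 * N) * N2 (df s) + \<bar>s - t\<bar> * N\<^sup>2 * N2 R"
      unfolding eventually_at_filter real_norm_def abs_of_nonneg[OF Lp_norm_nonneg]
      by (intro always_eventually allI impI bd)
  qed
qed

end

context SOL
begin

text \<open>
  One pairing serves both estimates: with \<open>\<theta> = 0\<close> it is the linear functional of Duhamel's formula, with
  \<open>h = 0\<close> the weighted energy.
\<close>

definition q :: "(real \<Rightarrow> complex) \<Rightarrow> (real \<Rightarrow> real) \<Rightarrow> real \<Rightarrow> real \<Rightarrow> complex" where
  "q h \<theta> s xi = cis (s * m xi) * F s xi * cnj (h xi) + cr (\<theta> xi) * (F s xi * cnj (F s xi))"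

definition q' :: "(real \<Rightarrow> complex) \<Rightarrow> (real \<Rightarrow> real) \<Rightarrow> real \<Rightarrow> real \<Rightarrow> complex" where
  "q' h \<theta> s xi = cis (s * m xi) * D s xi * cnj (h xi) + cr (\<theta> xi) * (D s xi * cnj (F s xi) + F s xi * cnj (D s xi))"

text \<open>The weights \<open>h\<close> and \<open>\<theta>\<close> absorb the unbounded factor xi
  of the nonlinear term. So the identities on truncated frequencies have a majorant independent of
  the truncation, and dominated convergence applies first in frequency, then in time.\<close>

lemma evolution:
  assumes h: "Lp 2 h" "\<And>xi. \<bar>xi\<bar> * cmod (h xi) \<le> B * cmod (h xi)"
    and \<theta>: "\<theta> \<in> lmeas" "\<And>xi. \<bar>\<theta> xi\<bar> \<le> B" "\<And>xi. \<bar>xi\<bar> * \<bar>\<theta> xi\<bar> \<le> B"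
    and t: "t \<in> {0..T}"
  shows "((\<lambda>s. LI xi. q' h \<theta> s xi) has_integral (LI xi. q h \<theta> t xi) - (LI xi. q h \<theta> 0 xi)) {0..t}"
proof -
  define A where "A n = {xi. \<bar>xi\<bar> \<le> real n \<and> \<bar>m xi\<bar> \<le> real n}" for n
  have Am [measurable]: "A n \<in> sets lebesgue" for n
  proof -
    have "{xi \<in> space lebesgue. \<bar>xi\<bar> \<le> real n \<and> \<bar>m xi\<bar> \<le> real n} \<in> sets lebesgue" by measurable
    then show ?thesis by (simp add: A_def)
  qed
  have B0: "0 \<le> B" using order_trans[OF abs_ge_zero \<theta>(2)] .
  have cm [measurable]: "(\<lambda>xi. cis (s * m xi)) \<in> lmeas" for s
    by (rule measurable_compose[OF _ measurable_cis]) measurable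
  note [measurable] = Lp_measurable[OF h(1)] \<theta>(1)
  have sub: "s \<in> {0..T}" if "s \<in> {0..t}" for s using that t by auto
  define V where "V n s xi = indicator (A n) xi * (cis (s * m xi) * F s xi)" for n s xi
  define V' where "V' n s xi = indicator (A n) xi * (cis (s * m xi) * D s xi)" for n s xi
  have ci: "cis x * cnj (cis x) = 1" for x by (simp add: cis_cnj cis_mult)
  \<comment> \<open>The phase has modulus one and drops out of the quadratic part.\<close>
  have Vq: "V n s xi * cnj (h xi) + cr (\<theta> xi) * (V n s xi * cnj (V n s xi)) = indicator (A n) xi * q h \<theta> s xi" for n s xi
  proof -
    have "cis x * a * cnj (cis x * b) = a * cnj b" for x a b using ci[of x] by (simp add: algebra_simps)
    then show ?thesis by (cases "xi \<in> A n") (simp_all add: V_def q_def del: complex_cnj_mult)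
  qed
  have Vq': "V' n s xi * cnj (h xi) + cr (\<theta> xi) * (V' n s xi * cnj (V n s xi) + V n s xi * cnj (V' n s xi)) = indicator (A n) xi * q' h \<theta> s xi" for n s xi
  proof -
    have e: "cis x * a * cnj (cis x * b) = a * cnj b" for x a b using ci[of x] by (simp add: algebra_simps)
    show ?thesis by (cases "xi \<in> A n") (simp_all add: V_def V'_def q'_def e del: complex_cnj_mult)
  qed
  have FT: "((\<lambda>s. LI xi. indicator (A n) xi * q' h \<theta> s xi) has_integral
      (LI xi. indicator (A n) xi * q h \<theta> t xi) - (LI xi. indicator (A n) xi * q h \<theta> 0 xi)) {0..t}" for n
  proof (rule fundamental_theorem_of_calculus)
    show "0 \<le> t" using t by simp
    fix s assume s: "s \<in> {0..t}"
    have bA: "\<And>xi. xi \<in> A n \<Longrightarrow> \<bar>xi\<bar> \<le> real n" "\<And>xi. xi \<in> A n \<Longrightarrow> \<bar>m xi\<bar> \<le> real n" by (auto simp: A_def)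
    note c = cut_derivative[OF Am bA of_nat_0_le_iff sub[OF s], folded V_def V'_def]
    from L2_pairing_derivative[OF h(1) c(1) c(2) sub[OF s] \<theta>(1,2) c(3)]
    have "((\<lambda>s. LI xi. indicator (A n) xi * q h \<theta> s xi) has_vector_derivative (LI xi. indicator (A n) xi * q' h \<theta> s xi)) (at s within {0..T})"
      unfolding Vq Vq' .
    then show "((\<lambda>s. LI xi. indicator (A n) xi * q h \<theta> s xi) has_vector_derivative (LI xi. indicator (A n) xi * q' h \<theta> s xi)) (at s within {0..t})"
      by (rule has_vector_derivative_within_subset) (use t in auto)
  qed
  have ptw: "(\<lambda>n. indicator (A n) xi * z) \<longlonglongrightarrow> z" for xi and z :: complex
  proof (rule tendsto_eventually)
    obtain N where N: "max \<bar>xi\<bar> \<bar>m xi\<bar> \<le> real N" using real_arch_simple by blast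
    show "\<forall>\<^sub>F n in sequentially. indicator (A n) xi * z = z"
      using eventually_ge_at_top[of N]
    proof eventually_elim
      case (elim n)
      then have "real N \<le> real n" by simp
      then show ?case using N by (simp add: A_def)
    qed
  qed
  have lim: "(\<lambda>n. LI xi. indicator (A n) xi * f xi) \<longlonglongrightarrow> (LI xi. f xi)" if f: "integ f" for f :: "real \<Rightarrow> complex"
  proof (rule integral_dominated_convergence[where w = "\<lambda>xi. cmod (f xi)"])
    show "f \<in> lmeas" using f by simp
    show "(\<lambda>xi. indicator (A n) xi * f xi) \<in> lmeas" for n using borel_measurable_integrable[OF f] by measurable
    show "integ (\<lambda>xi. cmod (f xi))" using f by simp
    show "AEL xi. (\<lambda>n. indicator (A n) xi * f xi) \<longlonglongrightarrow> f xi" by (intro AE_I2 ptw)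
    show "AEL xi. cmod (indicator (A n) xi * f xi) \<le> cmod (f xi)" for n by (intro AE_I2) (simp add: indicator_def)
  qed
  have qi: "integ (q h \<theta> s)" if s: "s \<in> {0..T}" for s
  proof -
    note [measurable] = s
    have a: "Lp 2 (\<lambda>xi. cis (s * m xi) * F s xi)"
      by (rule Lp_bound[OF _ u2(2)[OF s], where c = 1]) (auto simp: norm_mult)
    have b: "Lp 2 (\<lambda>xi. cr (\<theta> xi) * F s xi)"
      by (rule Lp_bound[OF _ u2(2)[OF s], where c = B]) (use \<theta> B0 in \<open>auto simp: norm_mult intro!: mult_right_mono\<close>)
    show ?thesis
      using B_integrable_add[OF CS_integrable[OF a Lp_cnj[OF h(1)]] CS_integrable[OF b Lp_cnj[OF u2(2)[OF s]]]]
      unfolding q_def by (simp add: mult.assoc)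
  qed
  obtain M where M0: "M \<ge> 0" and M: "\<And>s. s \<in> {0..T} \<Longrightarrow> N2 (F s) \<le> M" "\<And>s. s \<in> {0..T} \<Longrightarrow> N2 (G s) \<le> M"
    using uniform_bound by blast
  define K where "K = B * (M * N2 h) + 2 * B * (M * M)"
  have n: "integ (\<lambda>xi. cmod (f xi) * cmod (g xi))" if "Lp 2 f" "Lp 2 g" for f g
    using integrable_norm[OF CS_integrable[OF that]] by (simp add: norm_mult)
  \<comment> \<open>A majorant of \<open>q'\<close> after absorption of xi, whose integral is at
    most \<open>K\<close> at all times.\<close>
  define mj where "mj s xi = B * (cmod (G s xi) * cmod (h xi)) + 2 * B * (cmod (G s xi) * cmod (F s xi))" for s xi
  have mji: "integ (mj s)" if s: "s \<in> {0..T}" for s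
    unfolding mj_def by (intro B_integrable_add integrable_mult_right n G2 u2 h s)
  have mjK: "(LI xi. mj s xi) \<le> K" if s: "s \<in> {0..T}" for s
  proof -
    have "(LI xi. mj s xi) = B * (LI xi. cmod (G s xi) * cmod (h xi)) + 2 * B * (LI xi. cmod (G s xi) * cmod (F s xi))"
      unfolding mj_def using n[OF G2(2)[OF s] h(1)] n[OF G2(2)[OF s] u2(2)[OF s]] by simp
    also have "... \<le> B * (N2 (G s) * N2 h) + 2 * B * (N2 (G s) * N2 (F s))"
      using B0 by (intro add_mono mult_left_mono CS_norm G2 u2 h s) auto
    also have "... \<le> K" unfolding K_def
      using B0 M0 M[OF s] by (intro add_mono mult_left_mono mult_mono) auto
    finally show ?thesis .
  qed
  have q'le: "cmod (q' h \<theta> s xi) \<le> mj s xi" for s xi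
  proof -
    have "cmod (q' h \<theta> s xi) \<le> cmod (cis (s * m xi) * D s xi * cnj (h xi)) + (cmod (cr (\<theta> xi) * (D s xi * cnj (F s xi))) + cmod (cr (\<theta> xi) * (F s xi * cnj (D s xi))))"
      unfolding q'_def distrib_left by (intro norm_triangle_le add_mono order_refl norm_triangle_ineq)
    also have "... = cmod (D s xi) * cmod (h xi) + 2 * (\<bar>\<theta> xi\<bar> * (cmod (D s xi) * cmod (F s xi)))"
      by (simp add: norm_mult)
    also have "... \<le> (\<bar>xi\<bar> * cmod (G s xi)) * cmod (h xi) + 2 * (\<bar>\<theta> xi\<bar> * ((\<bar>xi\<bar> * cmod (G s xi)) * cmod (F s xi)))"
      using D_le by (intro add_mono mult_left_mono mult_right_mono) auto
    also have "... = cmod (G s xi) * (\<bar>xi\<bar> * cmod (h xi)) + 2 * ((\<bar>xi\<bar> * \<bar>\<theta> xi\<bar>) * (cmod (G s xi) * cmod (F s xi)))"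
      by (simp add: mult_ac)
    also have "... \<le> cmod (G s xi) * (B * cmod (h xi)) + 2 * (B * (cmod (G s xi) * cmod (F s xi)))"
      by (intro add_mono mult_left_mono[OF h(2)] mult_left_mono[OF mult_right_mono[OF \<theta>(3)]]) simp_all
    also have "... = mj s xi" by (simp add: mj_def mult_ac)
    finally show ?thesis .
  qed
  have q'm: "q' h \<theta> s \<in> lmeas" if [measurable]: "s \<in> {0..T}" for s
    unfolding q'_def D_def by measurable
  have q'i: "integ (q' h \<theta> s)" if s: "s \<in> {0..T}" for s
    by (rule B_integrable_bound[OF mji[OF s] q'm[OF s]])
      (use q'le in \<open>auto intro: order_trans[OF _ abs_ge_self]\<close>)
  let ?f = "\<lambda>n s. LI xi. indicator (A n) xi * q' h \<theta> s xi"
  let ?g = "\<lambda>s. LI xi. q' h \<theta> s xi"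
  have d1: "?f n integrable_on {0..t}" for n using FT by (rule has_integral_integrable)
  have d2: "(\<lambda>_. K) integrable_on {0..t}" by (rule integrable_const_ivl)
  have d3: "norm (?f n s) \<le> K" if "s \<in> {0..t}" for n s
    proof -
      note s = sub[OF that]
      have "norm (?f n s) \<le> (LI xi. mj s xi)"
      proof (rule order_trans[OF integral_norm_bound integral_mono'[OF mji[OF s]]])
        show "cmod (indicator (A n) xi * q' h \<theta> s xi) \<le> mj s xi" for xi
          using q'le[of s xi] order_trans[OF norm_ge_zero q'le[of s xi]] by (cases "xi \<in> A n") auto
        show "0 \<le> mj s xi" for xi using order_trans[OF norm_ge_zero q'le] .
      qed
      then show ?thesis using mjK[OF s] by linarith
    qed
  have d4: "(\<lambda>n. ?f n s) \<longlonglongrightarrow> ?g s" if "s \<in> {0..t}" for s by (rule lim[OF q'i[OF sub[OF that]]])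
  note g = dominated_convergence(1)[OF d1 d2 d3 d4] and L = dominated_convergence(2)[OF d1 d2 d3 d4]
  have t0: "0 \<in> {0..T}" using t by simp
  have "(\<lambda>n. integral {0..t} (?f n)) \<longlonglongrightarrow> (LI xi. q h \<theta> t xi) - (LI xi. q h \<theta> 0 xi)"
    unfolding integral_unique[OF FT] by (intro tendsto_diff lim qi t t0)
  from LIMSEQ_unique[OF L this] integrable_integral[OF g] show ?thesis by simp
qed

end

lemma symbol_sum:
  assumes "finite I" "\<And>i. i \<in> I \<Longrightarrow> symbol (a i)"
  shows "symbol (\<lambda>xi. \<Sum>i\<in>I. a i xi)"
  using assms
proof (induction I rule: finite_induct)
  case (insert i I)
  then obtain B R B' R' where "\<And>xi. cmod (a i xi) \<le> B" "\<And>xi. \<bar>xi\<bar> > R \<Longrightarrow> a i xi = 0"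
    "\<And>xi. cmod (\<Sum>i\<in>I. a i xi) \<le> B'" "\<And>xi. \<bar>xi\<bar> > R' \<Longrightarrow> (\<Sum>i\<in>I. a i xi) = 0"
    "a i \<in> borel_measurable borel" "(\<lambda>xi. \<Sum>i\<in>I. a i xi) \<in> borel_measurable borel"
    unfolding symbol_def by (metis insertI1 insertI2)
  note * = this
  show ?case unfolding symbol_def sum.insert[OF insert.hyps]
  proof (intro conjI exI allI impI)
    show "(\<lambda>xi. a i xi + (\<Sum>i\<in>I. a i xi)) \<in> borel_measurable borel" by (rule borel_measurable_add[OF *(5,6)])
    show "cmod (a i xi + (\<Sum>i\<in>I. a i xi)) \<le> B + B'" for xi by (rule norm_triangle_le[OF add_mono[OF *(1,3)]])
    show "a i xi + (\<Sum>i\<in>I. a i xi) = 0" if "\<bar>xi\<bar> > max R R'" for xi using *(2,4) that by simp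
  qed
qed (auto simp: symbol_def)

section \<open>The energy inequality and Duhamel's formula\<close>

context SOL
begin

text \<open>The weight is cut off near frequency 2^K, so that \<open>evolution\<close> applies. The
  cut-off is the sum of the blocks 0 to K, hence the energy estimate bounds the time derivative
  uniformly in K, and K tends to infinity. In \<open>4 * pi\<close> a factor 2 comes from adding the
  conjugate and 2 pi from Parseval.\<close>

lemma energy_inequality:
  assumes E: "\<And>w A K. sobolev \<sigma> 2 (cplx w) \<Longrightarrow> A \<ge> 0 \<Longrightarrow> Nb A (cplx w) \<Longrightarrow>
     cmod (LI x. cplx w x ^ p * mult_op (\<lambda>xi. \<Sum>k\<le>K. ann 1 (2 * \<sigma>) k xi) (cplx w) x) \<le> CE * A ^ (p - 1) * (Xn \<sigma> (cplx w))\<^sup>2"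
    and t: "t \<in> {0..T}" and a: "a integrable_on {0..t}"
    and Na: "\<And>s. s \<in> {0..t} \<Longrightarrow> \<exists>A\<ge>0. Nb A (cplx (u s)) \<and> 4 * pi * CE * A ^ (p - 1) * (X s)\<^sup>2 \<le> a s"
  shows "(X t)\<^sup>2 \<le> (X 0)\<^sup>2 + integral {0..t} a"
proof -
  define \<theta> where "\<theta> K xi = (1 + xi\<^sup>2) powr \<sigma> * phi (xi / 2 ^ K)" for K xi
  have sub: "s \<in> {0..T}" if "s \<in> {0..t}" for s using that t by auto
  have phm: "phi \<in> borel_measurable borel" unfolding phi_def by measurable
  note [measurable] = phm
  have \<theta>0: "0 \<le> \<theta> K xi" "\<theta> K xi \<le> (1 + xi\<^sup>2) powr \<sigma>" for K xi
    using phi_range[of "xi / 2 ^ K"] by (auto simp: \<theta>_def mult_left_le)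
  have \<theta>m: "\<theta> K \<in> lmeas" for K
  proof -
    have "(\<lambda>xi. (1 + xi\<^sup>2) powr \<sigma> * phi (xi / 2 ^ K)) \<in> borel_measurable borel" by measurable
    then show ?thesis unfolding \<theta>_def[abs_def] by (simp add: measurable_completion)
  qed
  have X2: "(X s)\<^sup>2 = (LI xi. (cmod (bessel_symbol \<sigma> xi * F s xi))\<^sup>2)"
    and X2i: "integ (\<lambda>xi. (cmod (bessel_symbol \<sigma> xi * F s xi))\<^sup>2)" if "s \<in> {0..T}" for s
    using sobolev2D(2)[OF hs[OF that] s0] unfolding Xn_def by (auto simp: Lp_norm2_sq Lp2_iff)
  define EK where "EK K s = (LI xi. \<theta> K xi * (cmod (F s xi))\<^sup>2)" for K s
  have le: "\<theta> K xi * (cmod (F s xi))\<^sup>2 \<le> (cmod (bessel_symbol \<sigma> xi * F s xi))\<^sup>2" for K s xi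
  proof -
    have "(1 + xi\<^sup>2) powr \<sigma> = ((1 + xi\<^sup>2) powr (\<sigma> / 2))\<^sup>2" by (simp add: power2_eq_square powr_add[symmetric])
    then show ?thesis using mult_right_mono[OF \<theta>0(2)[of K xi], of "(cmod (F s xi))\<^sup>2"]
      by (simp add: norm_mult cmod_bessel power_mult_distrib)
  qed
  have EK0: "EK K 0 \<le> (X 0)\<^sup>2" for K
  proof -
    have "0 \<in> {0..T}" using t by simp
    then show ?thesis unfolding EK_def X2[OF \<open>0 \<in> {0..T}\<close>]
      by (intro integral_mono'[OF X2i le]) (use \<theta>0 in auto)
  qed
  have EKt: "(\<lambda>K. EK K t) \<longlonglongrightarrow> (X t)\<^sup>2"
    unfolding EK_def X2[OF t]
  proof (rule integral_dominated_convergence[OF _ _ X2i[OF t]])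
    note [measurable] = t \<theta>m
    show "(\<lambda>xi. \<theta> K xi * (cmod (F t xi))\<^sup>2) \<in> lmeas" for K by measurable
    show "(\<lambda>xi. (cmod (bessel_symbol \<sigma> xi * F t xi))\<^sup>2) \<in> lmeas" using X2i[OF t] by simp
    show "AEL xi. norm (\<theta> K xi * (cmod (F t xi))\<^sup>2) \<le> (cmod (bessel_symbol \<sigma> xi * F t xi))\<^sup>2" for K
      using le[of K] \<theta>0(1)[of K] by (intro AE_I2) simp
    show "AEL xi. (\<lambda>K. \<theta> K xi * (cmod (F t xi))\<^sup>2) \<longlonglongrightarrow> (cmod (bessel_symbol \<sigma> xi * F t xi))\<^sup>2"
    proof (intro AE_I2 tendsto_eventually)
      fix xi :: real
      obtain N where N: "\<bar>xi\<bar> < 2 ^ N" using real_arch_pow[of 2 "\<bar>xi\<bar>"] by auto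
      show "\<forall>\<^sub>F K in sequentially. \<theta> K xi * (cmod (F t xi))\<^sup>2 = (cmod (bessel_symbol \<sigma> xi * F t xi))\<^sup>2"
        using eventually_ge_at_top[of N]
      proof eventually_elim
        case (elim K)
        have "(2::real) ^ N \<le> 2 ^ K" using elim by (intro power_increasing) auto
        then have "\<bar>xi\<bar> \<le> 2 ^ K" using N by linarith
        then have "phi (xi / 2 ^ K) = 1" by (intro phi_1) (simp add: abs_divide)
        moreover have "(1 + xi\<^sup>2) powr \<sigma> = ((1 + xi\<^sup>2) powr (\<sigma> / 2))\<^sup>2" by (simp add: power2_eq_square powr_add[symmetric])
        ultimately show ?case by (simp add: \<theta>_def norm_mult cmod_bessel power_mult_distrib)
      qed
    qed
  qed
  have "EK K t \<le> (X 0)\<^sup>2 + integral {0..t} a" for K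
  proof -
    \<comment> \<open>R bounds the support of the cut-off weight; B bounds both the weight and xi
      times the weight.\<close>
    define R where "R = 2 * (2::real) ^ K"
    define B where "B = (1 + R) * (1 + R\<^sup>2) powr \<sigma>"
    have R0: "R \<ge> 0" by (simp add: R_def)
    have supp: "\<theta> K xi \<noteq> 0 \<Longrightarrow> \<bar>xi\<bar> \<le> R" for xi
      using phi_0[of "xi / 2 ^ K"] by (cases "\<bar>xi / 2 ^ K\<bar> \<ge> 2") (auto simp: \<theta>_def R_def abs_divide field_simps)
    have \<theta>B: "\<bar>\<theta> K xi\<bar> \<le> (1 + R\<^sup>2) powr \<sigma>" for xi
    proof (cases "\<theta> K xi = 0")
      case False
      then have "xi\<^sup>2 \<le> R\<^sup>2" using power_mono[OF supp[of xi] abs_ge_zero, of 2] by simp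
      then have "(1 + xi\<^sup>2) powr \<sigma> \<le> (1 + R\<^sup>2) powr \<sigma>" using s0 by (intro powr_mono2) auto
      then show ?thesis using \<theta>0[of K xi] by simp
    qed simp
    have B1: "\<bar>\<theta> K xi\<bar> \<le> B" for xi
      unfolding B_def using \<theta>B[of xi] R0 mult_right_mono[of 1 "1 + R" "(1 + R\<^sup>2) powr \<sigma>"] by simp
    have B2: "\<bar>xi\<bar> * \<bar>\<theta> K xi\<bar> \<le> B" for xi
    proof (cases "\<theta> K xi = 0")
      case False
      then show ?thesis unfolding B_def using supp[of xi] \<theta>B[of xi] R0 by (intro mult_mono) auto
    qed (simp add: B_def R0)
    let ?a = "\<lambda>xi. \<Sum>k\<le>K. ann 1 (2 * \<sigma>) k xi"
    have sa: "symbol ?a" by (intro symbol_sum symbol_ann) auto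
    \<comment> \<open>Telescoping identifies the multiplier of the energy estimate with i xi times
      the cut-off weight.\<close>
    have ae: "?a xi = \<i> * cr (xi * \<theta> K xi)" for xi
      unfolding \<theta>_def phi_telescope ann_def bessel_symbol_def
      by (simp add: sum_distrib_left[symmetric] mult_ac flip: sum_distrib_right)
    have nb: "norm (LI xi. q' (\<lambda>_. 0) (\<theta> K) s xi) \<le> a s" if s: "s \<in> {0..t}" for s
    proof -
      note sT = sub[OF s]
      note [measurable] = sT \<theta>m[of K]
      obtain A where A: "A \<ge> 0" "Nb A (cplx (u s))" "4 * pi * CE * A ^ (p - 1) * (X s)\<^sup>2 \<le> a s" using Na[OF s] by blast
      have Dm [measurable]: "D s \<in> lmeas" unfolding D_def by measurable
      have D2: "Lp 2 (\<lambda>xi. cr (\<theta> K xi) * D s xi)"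
      proof (rule Lp_bound[OF _ G2(2)[OF sT]])
        show "0 \<le> B" using order_trans[OF abs_ge_zero B1] .
        show "AEL xi. cmod (cr (\<theta> K xi) * D s xi) \<le> B * cmod (G s xi)"
        proof (rule AE_I2)
          fix xi
          have "cmod (cr (\<theta> K xi) * D s xi) \<le> \<bar>\<theta> K xi\<bar> * (\<bar>xi\<bar> * cmod (G s xi))"
            unfolding norm_mult norm_of_real by (intro mult_left_mono D_le) auto
          also have "... = (\<bar>xi\<bar> * \<bar>\<theta> K xi\<bar>) * cmod (G s xi)" by (simp add: mult_ac)
          also have "... \<le> B * cmod (G s xi)" by (rule mult_right_mono[OF B2]) simp
          finally show "cmod (cr (\<theta> K xi) * D s xi) \<le> B * cmod (G s xi)" .
        qed
      qed auto
      define I where "I = (LI xi. (cr (\<theta> K xi) * D s xi) * cnj (F s xi))"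
      have i1: "integ (\<lambda>xi. (cr (\<theta> K xi) * D s xi) * cnj (F s xi))"
        by (rule CS_integrable[OF D2 Lp_cnj[OF u2(2)[OF sT]]])
      have qe: "q' (\<lambda>_. 0) (\<theta> K) s = (\<lambda>xi. (cr (\<theta> K xi) * D s xi) * cnj (F s xi) + cnj ((cr (\<theta> K xi) * D s xi) * cnj (F s xi)))"
        by (rule ext) (simp add: q'_def distrib_left mult_ac)
      have "(LI xi. q' (\<lambda>_. 0) (\<theta> K) s xi) = I + cnj I"
        unfolding qe I_def Bochner_Integration.integral_cnj[symmetric] by (rule B_integral_add[OF i1]) (rule Bochner_Integration.integrable_cnj[OF i1])
      then have "norm (LI xi. q' (\<lambda>_. 0) (\<theta> K) s xi) \<le> 2 * cmod I"
        using norm_triangle_ineq[of I "cnj I"] by simp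
      also have "I = (LI xi. (1 / of_nat p) * (G s xi * cnj (fourier (mult_op ?a (cplx (u s))) xi)))"
        unfolding I_def
      proof (rule integral_cong_AE_gen)
        show "AEL xi. cr (\<theta> K xi) * D s xi * cnj (F s xi)
            = 1 / of_nat p * (G s xi * cnj (fourier (mult_op ?a (cplx (u s))) xi))"
          using fourier_mult_op[OF sa u2(1)[OF sT]]
        proof eventually_elim
          case (elim xi)
          show ?case unfolding elim unfolding ae D_def by (simp add: mult_ac)
        qed
      qed
      also have "... = (1 / of_nat p) * (LI xi. G s xi * cnj (fourier (mult_op ?a (cplx (u s))) xi))"
        by (rule integral_mult_right_zero)
      also have "(LI xi. G s xi * cnj (fourier (mult_op ?a (cplx (u s))) xi))
          = cr (2 * pi) * (LI x. up s x * cnj (mult_op ?a (cplx (u s)) x))"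
        by (rule Parseval[OF fourier_L2(1) _ fourier_L2(1)]) (use G2(1)[OF sT] mult_op_fourier(2)[OF sa u2(1)[OF sT]] in auto)
      also have "(LI x. up s x * cnj (mult_op ?a (cplx (u s)) x)) = cnj (LI x. up s x * mult_op ?a (cplx (u s)) x)"
        unfolding Bochner_Integration.integral_cnj[symmetric] by simp
      also have "2 * cmod (1 / of_nat p * (cr (2 * pi) * cnj (LI x. up s x * mult_op ?a (cplx (u s)) x)))
         = 1 / real p * (4 * pi * cmod (LI x. up s x * mult_op ?a (cplx (u s)) x))"
        by (simp add: norm_mult norm_divide)
      also have "... \<le> 1 * (4 * pi * cmod (LI x. up s x * mult_op ?a (cplx (u s)) x))"
        using p3 by (intro mult_right_mono) auto
      also have "... \<le> 1 * (4 * pi * (CE * A ^ (p - 1) * (X s)\<^sup>2))"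
        using E[OF hs[OF sT] A(1,2)] by (intro mult_left_mono) auto
      also have "... \<le> a s" using A(3) by (simp add: mult.assoc)
      finally show ?thesis .
    qed
    have qE: "(LI xi. q (\<lambda>_. 0) (\<theta> K) s xi) = cr (EK K s)" for s
      unfolding q_def EK_def integral_complex_of_real[symmetric]
      by (rule B_integral_cong) (simp_all add: complex_norm_square del: of_real_power flip: of_real_power)
    have Z: "Lp 2 (\<lambda>_. 0)" by simp
    have ev: "((\<lambda>s. LI xi. q' (\<lambda>_. 0) (\<theta> K) s xi) has_integral cr (EK K t) - cr (EK K 0)) {0..t}"
      unfolding qE[symmetric] by (rule evolution[OF Z _ \<theta>m B1 B2 t]) simp
    have "norm (cr (EK K t) - cr (EK K 0)) \<le> integral {0..t} a"
      unfolding integral_unique[OF ev, symmetric]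
      by (rule integral_norm_bound_integral[OF has_integral_integrable[OF ev] a nb])
    then have "EK K t - EK K 0 \<le> integral {0..t} a" unfolding of_real_diff[symmetric] norm_of_real by linarith
    then show ?thesis using EK0[of K] by linarith
  qed
  then show ?thesis using LIMSEQ_le_const2[OF EKt] by blast
qed

text \<open>The functional pairs the solution at time s, propagated to time t, with a fixed test
  function on one block. Its derivative in s is the nonlinear term propagated over the time t - s,
  so \<open>linear_decay\<close> bounds both this and the contribution of the data.\<close>

lemma duhamel:
  assumes t: "t \<in> {0..T}" "t > 0" and \<Gamma>: "Lp 2 \<Gamma>" "Lp rc \<Gamma>"
    and i0: "Lp rc (mult_op (ann 0 g k) (cplx (u 0)))"
    and nl: "\<And>s. s \<in> {0..<t} \<Longrightarrow> Lp rc (mult_op (ann 1 g k) (up s)) \<and> Lp_norm rc (mult_op (ann 1 g k) (up s)) \<le> b s"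
    and b: "(\<lambda>s. (t - s) powr (- d) * b s) integrable_on {0..t}"
  shows "cmod (LI x. P k (cplx (u t)) x * \<Gamma> x)
    \<le> \<bar>C\<bar> * (t powr (- d) * Lp_norm rc (mult_op (ann 0 g k) (cplx (u 0))) + integral {0..t} (\<lambda>s. (t - s) powr (- d) * b s)) * Lp_norm rc \<Gamma>"
proof -
  let ?c = "\<lambda>x. cnj (\<Gamma> x)"
  have c2: "Lp 2 ?c" "Lp rc ?c" using \<Gamma> Lp_cnj by auto
  have cn: "Lp_norm rc ?c = Lp_norm rc \<Gamma>" by (rule Lp_norm_cnj)
  \<comment> \<open>The phase at time t turns the phase at time s in \<open>q\<close> into that of
    the propagator over t - s; the block cut-off makes xi bounded on the support.\<close>
  define H where "H xi = cis (t * m xi) * (cr (psik k xi) * fourier ?c xi)" for xi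
  have sa: "symbol (ann i 0 k)" if "i \<in> {0,1}" for i using symbol_ann[OF that] .
  have a0: "ann 0 0 k = (\<lambda>xi. cr (psik k xi))" by (rule ext) (simp add: ann_def)
  have a1: "ann 1 0 k = (\<lambda>xi. \<i> * cr xi * cr (psik k xi))" by (rule ext) (simp add: ann_def)
  have cm [measurable]: "(\<lambda>xi. cis (s * m xi)) \<in> lmeas" for s
    by (rule measurable_compose[OF _ measurable_cis]) measurable
  have L: "Lp 2 (\<lambda>xi. cr (psik k xi) * fourier ?c xi)"
    using symbol_mult_L2[OF sa fourier_L2(2)[OF c2(1)], of 0] unfolding a0 by simp
  have H2: "Lp 2 H"
    unfolding H_def[abs_def]
    by (rule Lp_bound[OF borel_measurable_times[OF cm Lp_measurable[OF L]] L, where c = 1]) (auto simp: norm_mult)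
  have HB: "\<bar>xi\<bar> * cmod (H xi) \<le> (2 * 2 ^ k) * cmod (H xi)" for xi
  proof (cases "psik k xi = 0")
    case False
    then show ?thesis using psi_psik_zero[of k xi] by (intro mult_right_mono) auto
  qed (simp add: H_def)
  have z: "(\<lambda>_. 0::real) \<in> lmeas" "\<And>xi. \<bar>0::real\<bar> \<le> 2 * 2 ^ k" "\<And>xi::real. \<bar>xi\<bar> * \<bar>0\<bar> \<le> 2 * 2 ^ k" by auto
  note ev = evolution[OF H2 HB z t(1)]
  have ci: "cis (s * m xi) * cnj (cis (t * m xi)) = cis (- ((t - s) * m xi))" for s xi
    by (simp add: cis_cnj cis_mult left_diff_distrib)
  have q0: "q H (\<lambda>_. 0) s xi = cis (- ((t - s) * m xi)) * (ann 0 0 k xi * F s xi) * cnj (fourier ?c xi)" for s xi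
    unfolding q_def H_def a0 ci[symmetric] by (simp add: mult_ac)
  have q1: "q' H (\<lambda>_. 0) s xi = - (1 / of_nat p) * (cis (- ((t - s) * m xi)) * (ann 1 0 k xi * G s xi) * cnj (fourier ?c xi))" for s xi
    unfolding q'_def H_def a1 D_def ci[symmetric] by (simp add: mult_ac)
  define Q where "Q s = (LI xi. q H (\<lambda>_. 0) s xi)" for s
  \<comment> \<open>At s = t the dispersive estimate says nothing, and
    \<open>(t - s) powr (- d)\<close> is 0 by convention. So the integrand is set to 0 there; one
    point does not change the integral.\<close>
  define Q' where "Q' s = (if s = t then 0 else LI xi. q' H (\<lambda>_. 0) s xi)" for s
  have ev': "(Q' has_integral Q t - Q 0) {0..t}"
    using has_integral_spike_finite[OF _ _ ev, of "{t}" Q'] by (auto simp: Q'_def Q_def)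
  have Qt: "Q t = cr (2 * pi) * (LI x. P k (cplx (u t)) x * \<Gamma> x)"
  proof -
    have "Q t = (LI xi. (ann 0 0 k xi * F t xi) * cnj (fourier ?c xi))" unfolding Q_def q0 by simp
    also have "... = cr (2 * pi) * (LI x. P k (cplx (u t)) x * cnj (?c x))"
      by (rule Parseval[OF mult_op_fourier[OF sa u2(1)[OF t(1)]] fourier_L2(1)[OF c2(1)] c2(1)]) simp_all
    finally show ?thesis by simp
  qed
  have i: "0 \<in> {0, 1::nat}" "1 \<in> {0, 1::nat}" by auto
  have t0: "0 \<in> {0..T}" using t by simp
  have b0: "cmod (Q 0) \<le> 2 * pi * (\<bar>C\<bar> * t powr (- d) * Lp_norm rc (mult_op (ann 0 g k) (cplx (u 0))) * Lp_norm rc \<Gamma>)"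
    using linear_decay[OF i(1) u2(1)[OF t0] i0 c2 t(2)] unfolding Q_def q0 cn by simp
  have b1: "cmod (Q' s) \<le> 2 * pi * \<bar>C\<bar> * Lp_norm rc \<Gamma> * ((t - s) powr (- d) * b s)" if s: "s \<in> {0..t}" for s
  proof (cases "s = t")
    case False
    then have s': "s \<in> {0..<t}" "t - s > 0" and sT: "s \<in> {0..T}" using s t by auto
    note N = nl[OF s'(1)]
    have e: "cplx (\<lambda>x. u s x ^ p) = up s" by (rule ext) simp
    have "cmod (Q' s) = 1 / real p * cmod (LI xi. cis (- ((t - s) * m xi)) * (ann 1 0 k xi * G s xi) * cnj (fourier ?c xi))"
      unfolding Q'_def q1 integral_mult_right_zero using False by (simp add: norm_mult norm_divide)
    also have "... \<le> 1 * (2 * pi * (\<bar>C\<bar> * (t - s) powr (- d) * Lp_norm rc (mult_op (ann 1 g k) (up s)) * Lp_norm rc ?c))"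
      using linear_decay[OF i(2) _ _ c2 s'(2), of "\<lambda>x. u s x ^ p" k] G2(1)[OF sT] N p3 unfolding e
      by (intro mult_mono) auto
    also have "... \<le> 1 * (2 * pi * (\<bar>C\<bar> * (t - s) powr (- d) * b s * Lp_norm rc ?c))"
      using N by (intro mult_left_mono mult_right_mono) auto
    finally show ?thesis by (simp add: cn mult_ac)
  qed (simp add: Q'_def)
  have bi: "(\<lambda>s. 2 * pi * \<bar>C\<bar> * Lp_norm rc \<Gamma> * ((t - s) powr (- d) * b s)) integrable_on {0..t}"
    using integrable_on_mult_right[OF b] by simp
  have "cmod (Q t - Q 0) \<le> integral {0..t} (\<lambda>s. 2 * pi * \<bar>C\<bar> * Lp_norm rc \<Gamma> * ((t - s) powr (- d) * b s))"
    unfolding integral_unique[OF ev', symmetric]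
    by (rule integral_norm_bound_integral[OF has_integral_integrable[OF ev'] bi b1])
  also have "... = 2 * pi * \<bar>C\<bar> * Lp_norm rc \<Gamma> * integral {0..t} (\<lambda>s. (t - s) powr (- d) * b s)" by (rule integral_mult_right)
  finally have "cmod (Q t) \<le> cmod (Q 0) + 2 * pi * \<bar>C\<bar> * Lp_norm rc \<Gamma> * integral {0..t} (\<lambda>s. (t - s) powr (- d) * b s)"
    using norm_triangle_ineq2[of "Q t" "Q 0"] by linarith
  then have "2 * pi * cmod (LI x. P k (cplx (u t)) x * \<Gamma> x) \<le> 2 * pi *
     (\<bar>C\<bar> * (t powr (- d) * Lp_norm rc (mult_op (ann 0 g k) (cplx (u 0))) + integral {0..t} (\<lambda>s. (t - s) powr (- d) * b s)) * Lp_norm rc \<Gamma>)"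
    using b0 unfolding Qt by (simp add: norm_mult algebra_simps)
  then show ?thesis by simp
qed

end

section \<open>The continuity argument\<close>

text \<open>If the bound failed, continuity and compactness would give a first time at which \<phi>
  is 1. Up to then \<phi> \<le> 1, so the step makes the value at that time less than 1.\<close>

lemma continuity_argument:
  fixes \<phi> :: "real \<Rightarrow> real"
  assumes c: "continuous_on {0..T} \<phi>" and start: "\<phi> 0 < 1"
    and step: "\<And>t. t \<in> {0..T} \<Longrightarrow> (\<And>s. s \<in> {0..t} \<Longrightarrow> \<phi> s \<le> 1) \<Longrightarrow> \<phi> t < 1"
    and t: "t \<in> {0..T}"
  shows "\<phi> t < 1"
proof (rule ccontr)
  assume n: "\<not> \<phi> t < 1"
  define K where "K = {s \<in> {0..t}. \<phi> s = 1}"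
  have ct: "continuous_on {0..s} \<phi>" if "s \<in> {0..T}" for s using c by (rule continuous_on_subset) (use that in auto)
  have cross: "\<exists>x\<in>{0..s}. \<phi> x = 1" if "s \<in> {0..T}" "\<phi> s \<ge> 1" for s
    using IVT'[of \<phi> 0 1 s, OF _ that(2) _ ct[OF that(1)]] start that(1) by auto
  have ne: "K \<noteq> {}" using cross[OF t] n by (auto simp: K_def)
  have "closed K" unfolding K_def using continuous_closed_preimage_constant[OF ct[OF t], of 1] by simp
  moreover have "bounded K" by (rule bounded_subset[of "{0..t}"]) (auto simp: K_def)
  ultimately have "compact K" by (simp add: compact_eq_bounded_closed)
  then obtain x where x: "x \<in> K" "\<And>y. y \<in> K \<Longrightarrow> x \<le> y" using compact_attains_inf[OF _ ne] by blast
  have xT: "x \<in> {0..T}" "\<phi> x = 1" using x(1) t by (auto simp: K_def)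
  have "\<phi> s \<le> 1" if s: "s \<in> {0..x}" for s
  proof (rule ccontr)
    assume "\<not> \<phi> s \<le> 1"
    then have g: "\<phi> s \<ge> 1" "s \<noteq> x" using xT by auto
    obtain y where "y \<in> {0..s}" "\<phi> y = 1" using cross[of s] s xT g by auto
    then have "y \<in> K" "y < x" using s x(1) g by (auto simp: K_def)
    then show False using x(2) by fastforce
  qed
  then show False using step[OF xT(1)] xT(2) by simp
qed

lemma powr_decay_integral:
  assumes \<beta>: "\<beta> > 1" and t: "t \<ge> (0::real)"
  shows "(\<lambda>s. (1 + s) powr (- \<beta>)) integrable_on {0..t}" "integral {0..t} (\<lambda>s. (1 + s) powr (- \<beta>)) \<le> 1 / (\<beta> - 1)"
proof -
  let ?f = "\<lambda>s. - ((1 + s) powr (1 - \<beta>) / (\<beta> - 1))"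
  have e: "- (- (\<beta> - 1) * x / (\<beta> - 1)) = x" for x using \<beta> by (simp add: minus_mult_left[symmetric] del: minus_diff_eq)
  have "((\<lambda>s. (1 + s) powr (- \<beta>)) has_integral ?f t - ?f 0) {0..t}"
  proof (rule fundamental_theorem_of_calculus[OF t])
    fix s assume "s \<in> {0..t}"
    then have "((\<lambda>s. (1 + s) powr (1 - \<beta>)) has_real_derivative - (\<beta> - 1) * (1 + s) powr (- \<beta>)) (at s within {0..t})"
      by (auto intro!: derivative_eq_intros)
    from DERIV_minus[OF DERIV_cdivide[OF this, of "\<beta> - 1"]]
    have "(?f has_real_derivative (1 + s) powr (- \<beta>)) (at s within {0..t})" unfolding e using \<beta> by simp
    then show "(?f has_vector_derivative (1 + s) powr (- \<beta>)) (at s within {0..t})"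
      by (simp add: has_real_derivative_iff_has_vector_derivative)
  qed
  note I = this
  then show "(\<lambda>s. (1 + s) powr (- \<beta>)) integrable_on {0..t}" by (rule has_integral_integrable)
  have "0 \<le> (1 + t) powr (1 - \<beta>) / (\<beta> - 1)" using \<beta> by simp
  then show "integral {0..t} (\<lambda>s. (1 + s) powr (- \<beta>)) \<le> 1 / (\<beta> - 1)"
    using integral_unique[OF I] by simp
qed

text \<open>
  The convolution of the two decay rates, with the second factor replaced by a majorant for which
  the integral is explicit on either side of \<open>t / 2\<close>.
\<close>

lemma decay_convolution:
  assumes \<beta>: "\<beta> > 1" and d: "0 < d" "d < 1" and t: "t \<ge> (1::real)"
  shows "\<exists>w. (\<forall>s\<in>{0..<t}. (1 + s) powr (- \<beta>) \<le> w s) \<and> (\<lambda>s. (t - s) powr (- d) * w s) integrable_on {0..t} \<and>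
     integral {0..t} (\<lambda>s. (t - s) powr (- d) * w s) \<le> 4 * (1 / (\<beta> - 1) + 1 / (1 - d)) * (1 + t) powr (- d)"
proof -
  \<comment> \<open>For s \<le> t / 2 the extra factor is at least 1 and exchanges the kernel for
    the constant (t / 2)^(-d). For s > t / 2 the integrable singularity is kept and the decaying
    factor is frozen at t / 2.\<close>
  define w where "w s = (if s \<le> t / 2 then (t - s) powr d * (t / 2) powr (- d) * (1 + s) powr (- \<beta>) else (1 + t / 2) powr (- \<beta>))" for s
  have h: "0 \<le> t / 2" "t / 2 \<le> t" using t by auto
  have I1: "((\<lambda>s. (t - s) powr (- d) * w s) has_integral (t / 2) powr (- d) * integral {0..t / 2} (\<lambda>s. (1 + s) powr (- \<beta>))) {0..t / 2}"
  proof (rule has_integral_eq[OF _ has_integral_mult_right[OF integrable_integral[OF powr_decay_integral(1)[OF \<beta> h(1)]]]])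
    fix s assume "s \<in> {0..t / 2}"
    then have "s \<le> t / 2" "t - s \<noteq> 0" using t by auto
    then show "(t / 2) powr (- d) * (1 + s) powr (- \<beta>) = (t - s) powr (- d) * w s"
      by (simp add: w_def powr_minus field_simps)
  qed
  have e: "- (- (1 - d) * x / (1 - d)) = x" for x using d by (simp add: minus_mult_left[symmetric] del: minus_diff_eq)
  let ?f = "\<lambda>s. - ((1 + t / 2) powr (- \<beta>) * ((t - s) powr (1 - d) / (1 - d)))"
  have "((\<lambda>s. (1 + t / 2) powr (- \<beta>) * (t - s) powr (- d)) has_integral ?f t - ?f (t / 2)) {t / 2..t}"
  proof (rule fundamental_theorem_of_calculus_interior[OF h(2)])
    show "continuous_on {t / 2..t} ?f" using d by (intro continuous_intros continuous_on_powr') auto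
    fix s assume "s \<in> {t / 2<..<t}"
    then have "((\<lambda>s. (t - s) powr (1 - d)) has_real_derivative - (1 - d) * (t - s) powr (- d)) (at s)"
      by (auto intro!: derivative_eq_intros simp: left_diff_distrib)
    from DERIV_minus[OF DERIV_cmult[OF DERIV_cdivide[OF this, of "1 - d"], of "(1 + t / 2) powr (- \<beta>)"]]
    have "(?f has_real_derivative (1 + t / 2) powr (- \<beta>) * (t - s) powr (- d)) (at s)"
      unfolding mult_minus_right[symmetric] e using d by simp
    then show "(?f has_vector_derivative (1 + t / 2) powr (- \<beta>) * (t - s) powr (- d)) (at s)"
      by (simp add: has_real_derivative_iff_has_vector_derivative)
  qed
  then have "((\<lambda>s. (t - s) powr (- d) * w s) has_integral ?f t - ?f (t / 2)) {t / 2..t}"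
    by (rule has_integral_spike_finite[of "{t / 2}", rotated 2]) (auto simp: w_def)
  then have I2: "((\<lambda>s. (t - s) powr (- d) * w s) has_integral (1 + t / 2) powr (- \<beta>) * ((t / 2) powr (1 - d) / (1 - d))) {t / 2..t}"
    by simp
  note I = has_integral_combine[OF h I1 I2]
  show ?thesis
  proof (intro exI[of _ w] conjI ballI)
    show "(\<lambda>s. (t - s) powr (- d) * w s) integrable_on {0..t}" using I by (rule has_integral_integrable)
    fix s assume s: "s \<in> {0..<t}"
    show "(1 + s) powr (- \<beta>) \<le> w s"
    proof (cases "s \<le> t / 2")
      case True
      have "(t / 2) powr d \<le> (t - s) powr d" using True t d by (intro powr_mono2) auto
      then have "1 \<le> (t - s) powr d * (t / 2) powr (- d)" using t by (simp add: powr_minus field_simps)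
      from mult_right_mono[OF this, of "(1 + s) powr (- \<beta>)"] show ?thesis using True by (simp add: w_def)
    next
      case False
      then show ?thesis using \<beta> t by (simp add: w_def powr_mono2')
    qed
  next
    \<comment> \<open>Here t \<ge> 1 enters, in the form (1 + t) / 4 \<le> t / 2.\<close>
    have q: "(t / 2) powr (- d) \<le> 4 * (1 + t) powr (- d)"
    proof -
      have "(t / 2) powr (- d) \<le> ((1 + t) / 4) powr (- d)" using t d by (intro powr_mono2') auto
      also have "... = 4 powr d * (1 + t) powr (- d)" using t by (simp add: powr_divide powr_minus field_simps)
      also have "... \<le> 4 * (1 + t) powr (- d)" using powr_mono[of d 1 4] d by (intro mult_right_mono) auto
      finally show ?thesis .
    qed
    have "(1 + t / 2) powr (- \<beta>) * (t / 2) powr (1 - d) \<le> (t / 2) powr (- d)"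
    proof -
      have "(t / 2) powr (1 - d) = (t / 2) * (t / 2) powr (- d)" using t by (simp add: powr_diff powr_minus field_simps)
      moreover have "(1 + t / 2) powr (- \<beta>) * (t / 2) \<le> 1"
      proof -
        have "(1 + t / 2) powr (- \<beta>) \<le> (1 + t / 2) powr (- 1)" using \<beta> t by (intro powr_mono) auto
        then have "(1 + t / 2) powr (- \<beta>) * (t / 2) \<le> (1 + t / 2) powr (- 1) * (1 + t / 2)" using t by (intro mult_mono) auto
        also have "... = 1" using t by (simp add: powr_minus)
        finally show ?thesis .
      qed
      ultimately show ?thesis
        using mult_right_mono[of "(1 + t / 2) powr (- \<beta>) * (t / 2)" 1 "(t / 2) powr (- d)"] by (simp only: mult.assoc mult_1_left) simp
    qed
    then have "(1 + t / 2) powr (- \<beta>) * ((t / 2) powr (1 - d) / (1 - d)) \<le> (t / 2) powr (- d) * (1 / (1 - d))"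
      using d by (simp add: divide_right_mono)
    moreover have "(t / 2) powr (- d) * integral {0..t / 2} (\<lambda>s. (1 + s) powr (- \<beta>)) \<le> (t / 2) powr (- d) * (1 / (\<beta> - 1))"
      by (intro mult_left_mono powr_decay_integral(2)[OF \<beta> h(1)]) simp
    ultimately have "integral {0..t} (\<lambda>s. (t - s) powr (- d) * w s) \<le> (t / 2) powr (- d) * (1 / (\<beta> - 1) + 1 / (1 - d))"
      unfolding integral_unique[OF I] by (simp add: distrib_left)
    also have "... \<le> (4 * (1 + t) powr (- d)) * (1 / (\<beta> - 1) + 1 / (1 - d))"
      using \<beta> d by (intro mult_right_mono q) auto
    finally show "integral {0..t} (\<lambda>s. (t - s) powr (- d) * w s) \<le> 4 * (1 / (\<beta> - 1) + 1 / (1 - d)) * (1 + t) powr (- d)"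
      by (simp only: mult_ac)
  qed
qed

section \<open>The decaying norm as a continuous function of time\<close>

context LPS
begin

text \<open>The least admissible constant. For f in H^\<sigma> the infimum is attained, since each
  of the defining inequalities is linear in A.\<close>

definition Nn :: "(real \<Rightarrow> complex) \<Rightarrow> real" where "Nn f = Inf {A. A \<ge> 0 \<and> Nb A f}"

lemma Nb_mono: "Nb A f \<Longrightarrow> A \<le> B \<Longrightarrow> Nb B f"
  unfolding Nb_def by (fastforce intro: order_trans mult_right_mono)

lemma Nn_le: "Nb A f \<Longrightarrow> A \<ge> 0 \<Longrightarrow> Nn f \<le> A"
  unfolding Nn_def by (intro cInf_lower bdd_belowI[of _ 0]) auto

lemma Nb_Nn:
  assumes f: "sobolev \<sigma> 2 f" and A: "Nn f \<le> A"
  shows "Nb A f" "0 \<le> Nn f"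
proof -
  obtain C1 where "C1 \<ge> 0" "Nb (C1 * Xn \<sigma> f) f" using Nb_of_Xn f by blast
  then have ne: "{A. A \<ge> 0 \<and> Nb A f} \<noteq> {}" by (auto intro: exI[of _ "C1 * Xn \<sigma> f"])
  show "0 \<le> Nn f" unfolding Nn_def using ne by (intro cInf_greatest) auto
  have "Nb (Nn f) f"
    unfolding Nb_def
  proof (intro allI impI)
    fix k \<Gamma> assume \<Gamma>: "Lp 2 \<Gamma>" "Lp rc \<Gamma>"
    let ?v = "cmod (LI x. P k f x * \<Gamma> x)" and ?c = "(2 ^ k) powr (- 3 / 2) * Lp_norm rc \<Gamma>"
    have le: "?v \<le> A * ?c" if "Nb A f" for A using NbD[OF that \<Gamma>, of k] by (simp add: mult.assoc)
    have c0: "0 \<le> ?c" by simp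
    have "?v \<le> Nn f * ?c"
    proof (cases "?c = 0")
      case True
      then show ?thesis using le ne by auto
    next
      case False
      then have c: "?c > 0" using c0 by linarith
      have "?v / ?c \<le> Nn f" unfolding Nn_def
        by (rule cInf_greatest[OF ne]) (use le c in \<open>auto simp: pos_divide_le_eq\<close>)
      then show ?thesis using c by (simp add: pos_divide_le_eq)
    qed
    then show "?v \<le> Nn f * (2 ^ k) powr (- 3 / 2) * Lp_norm rc \<Gamma>" by (simp add: mult.assoc)
  qed
  then show "Nb A f" using A by (rule Nb_mono)
qed

text \<open>Admissible constants add up under sums, and \<open>Nb_of_Xn\<close> provides one for the
  difference. Continuity in time is thus inherited from the H^\<sigma> norm.\<close>

lemma Nn_diff: "\<exists>C\<ge>0. \<forall>f h. sobolev \<sigma> 2 f \<longrightarrow> sobolev \<sigma> 2 h \<longrightarrow> \<bar>Nn f - Nn h\<bar> \<le> C * Xn \<sigma> (\<lambda>x. f x - h x)"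
proof -
  obtain C1 where C1: "C1 \<ge> 0" "\<And>f. sobolev \<sigma> 2 f \<Longrightarrow> Nb (C1 * Xn \<sigma> f) f" using Nb_of_Xn by blast
  have s0: "\<sigma> \<ge> 0" using sg3 by simp
  have le: "Nn f \<le> Nn h + C1 * Xn \<sigma> (\<lambda>x. f x - h x)" if f: "sobolev \<sigma> 2 f" and h: "sobolev \<sigma> 2 h" for f h
  proof (rule Nn_le)
    show "0 \<le> Nn h + C1 * Xn \<sigma> (\<lambda>x. f x - h x)" using Nb_Nn(2)[OF h order_refl] C1(1) by simp
    note f2 = sobolev2D(1)[OF f s0] and h2 = sobolev2D(1)[OF h s0] and d = sobolev2_diff(1)[OF f h s0]
    have sa: "symbol (ann 0 0 k)" for k by (rule symbol_ann) simp
    show "Nb (Nn h + C1 * Xn \<sigma> (\<lambda>x. f x - h x)) f"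
      unfolding Nb_def
    proof (intro allI impI)
      fix k \<Gamma> assume \<Gamma>: "Lp 2 \<Gamma>" "Lp rc \<Gamma>"
      have i: "integ (\<lambda>x. P k h x * \<Gamma> x)" "integ (\<lambda>x. P k (\<lambda>x. f x - h x) x * \<Gamma> x)"
        using CS_integrable[OF mult_op_fourier(2)[OF sa h2] \<Gamma>(1)] CS_integrable[OF mult_op_fourier(2)[OF sa sobolev2D(1)[OF d s0]] \<Gamma>(1)] by auto
      have "(LI x. P k f x * \<Gamma> x) = (LI x. P k h x * \<Gamma> x + P k (\<lambda>x. f x - h x) x * \<Gamma> x)"
        unfolding mult_op_diff[OF sa f2 h2] by (simp add: algebra_simps)
      also have "... = (LI x. P k h x * \<Gamma> x) + (LI x. P k (\<lambda>x. f x - h x) x * \<Gamma> x)"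
        by (rule B_integral_add[OF i])
      finally show "cmod (LI x. P k f x * \<Gamma> x) \<le> (Nn h + C1 * Xn \<sigma> (\<lambda>x. f x - h x)) * (2 ^ k) powr (- 3 / 2) * Lp_norm rc \<Gamma>"
        using norm_triangle_le[OF add_mono[OF NbD[OF Nb_Nn(1)[OF h order_refl] \<Gamma>, of k] NbD[OF C1(2)[OF d] \<Gamma>, of k]]]
        by (simp only: distrib_right)
    qed
  qed
  show ?thesis
  proof (intro exI[of _ C1] conjI allI impI)
    fix f h assume f: "sobolev \<sigma> 2 f" "sobolev \<sigma> 2 h"
    then show "\<bar>Nn f - Nn h\<bar> \<le> C1 * Xn \<sigma> (\<lambda>x. f x - h x)"
      using le[OF f] le[OF f(2,1)] Xn_diff_commute[OF f s0] by (simp add: abs_le_iff)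
  qed (rule C1(1))
qed

end

section \<open>The bootstrap for small data\<close>

context DP
begin

text \<open>The hypotheses X \<le> 3e and N \<le> B e (1 + s)^(-d) are improved to 2e and to B / 2
  in place of B. The data alone produce less than this, and the nonlinear terms carry an additional
  factor (B e)^(p - 1), which is small with e. The bound obtained does not depend on T.\<close>

lemma small_data_bound:
  "\<exists>e0>0. \<forall>e T u0 u. 0 < e \<longrightarrow> e \<le> e0 \<longrightarrow> 0 \<le> T \<longrightarrow> is_solution m p \<sigma> u0 {0..T} u \<longrightarrow> sobolev \<sigma> 2 (cplx u0) \<longrightarrow>
     sobolev (3 / 2 + \<gamma>) 1 (cplx u0) \<longrightarrow> Xn \<sigma> (cplx u0) \<le> e \<longrightarrow> sobolev_norm (3 / 2 + \<gamma>) 1 (cplx u0) \<le> e \<longrightarrow>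
     (\<forall>t\<in>{0..T}. Xn \<sigma> (cplx (u t)) \<le> 2 * e)"
proof -
  obtain CE where CE0: "CE \<ge> 0" and CE: "\<And>w A K. sobolev \<sigma> 2 (cplx w) \<Longrightarrow> A \<ge> 0 \<Longrightarrow> Nb A (cplx w) \<Longrightarrow>
     cmod (LI x. cplx w x ^ p * mult_op (\<lambda>xi. \<Sum>k\<le>K. ann 1 (2 * \<sigma>) k xi) (cplx w) x) \<le> CE * A ^ (p - 1) * (Xn \<sigma> (cplx w))\<^sup>2"
    using energy_estimate by blast
  obtain C1 where C10: "C1 \<ge> 0" and C1: "\<And>f. sobolev \<sigma> 2 f \<Longrightarrow> Nb (C1 * Xn \<sigma> f) f" using Nb_of_Xn by blast
  obtain C2 where C20: "C2 \<ge> 0" and C2: "\<And>f h. sobolev \<sigma> 2 f \<Longrightarrow> sobolev \<sigma> 2 h \<Longrightarrow> \<bar>Nn f - Nn h\<bar> \<le> C2 * Xn \<sigma> (\<lambda>x. f x - h x)"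
    using Nn_diff by blast
  obtain CN where CN0: "CN \<ge> 0" and CN: "\<And>f A k. sobolev \<sigma> 2 f \<Longrightarrow> A \<ge> 0 \<Longrightarrow> Nb A f \<Longrightarrow>
     Lp rc (mult_op (ann 1 g k) (\<lambda>x. f x ^ p)) \<and>
     Lp_norm rc (mult_op (ann 1 g k) (\<lambda>x. f x ^ p)) \<le> CN * (2 ^ k) powr (g + 1 - \<sigma>) * Xn \<sigma> f * A ^ (p - 1)"
    using nonlinear_decay by blast
  obtain D0 where D00: "D0 \<ge> 0" and D0: "\<And>f k. sobolev \<sigma> 2 f \<Longrightarrow> sobolev (3 / 2 + \<gamma>) 1 f \<Longrightarrow>
     Lp rc (mult_op (ann 0 g k) f) \<and>
     Lp_norm rc (mult_op (ann 0 g k) f) \<le> D0 * (2 ^ k) powr (- 3 / 2) * (Xn \<sigma> f + sobolev_norm (3 / 2 + \<gamma>) 1 f)"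
    using initial_data by blast
  define \<beta> where "\<beta> = d * real (p - 1)"
  have \<beta>1: "\<beta> > 1" using dp unfolding \<beta>_def .
  define CI where "CI = 4 * (1 / (\<beta> - 1) + 1 / (1 - d))"
  have CI0: "CI \<ge> 0" using \<beta>1 d01 by (simp add: CI_def)
  \<comment> \<open>Half of B has to be at least 4 |C| D0 + 1 for t \<ge> 1, the data plus the
    nonlinear term, and at least 4 C1 for t \<le> 1.\<close>
  define B where "B = 8 * (\<bar>C\<bar> * D0 + C1) + 4"
  have B4: "B \<ge> 4" using D00 C10 by (simp add: B_def)
  \<comment> \<open>The coefficients of the nonlinear terms in the energy and in Duhamel's formula,
    plus 1; for e \<le> 1 / (K B) each of them times (B e)^(p - 1) is at most 1.\<close>
  define K where "K = 36 * pi * CE * (1 / (\<beta> - 1)) + 3 * \<bar>C\<bar> * CN * CI + 1"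
  have K_parts: "0 \<le> 36 * pi * CE * (1 / (\<beta> - 1))" "0 \<le> 3 * \<bar>C\<bar> * CN * CI" using CE0 CN0 CI0 \<beta>1 by auto
  then have K1: "K \<ge> 1" unfolding K_def by linarith
  show ?thesis
  proof (intro exI[of _ "1 / (K * B)"] conjI allI impI ballI)
    show "0 < 1 / (K * B)" using K1 B4 by simp
    fix e T u0 u t
    assume e: "0 < e" "e \<le> 1 / (K * B)" and T: "0 \<le> T" and sol: "is_solution m p \<sigma> u0 {0..T} u"
      and u0: "sobolev \<sigma> 2 (cplx u0)" "sobolev (3 / 2 + \<gamma>) 1 (cplx u0)" "Xn \<sigma> (cplx u0) \<le> e" "sobolev_norm (3 / 2 + \<gamma>) 1 (cplx u0) \<le> e"
      and t: "t \<in> {0..T}"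
    interpret SOL p \<sigma> m \<gamma> C d T u0 u by unfold_locales (use T sol in auto)
    have Be0: "0 < B * e" using B4 e by simp
    have KBe: "K * (B * e) \<le> 1" using e(2) K1 B4 by (simp add: field_simps)
    then have Be1: "B * e \<le> 1" using mult_right_mono[OF K1, of "B * e"] Be0 by linarith
    have "K * (B * e) ^ (p - 1) \<le> K * (B * e) ^ 1"
      using Be0 Be1 K1 p3 by (intro mult_left_mono power_decreasing) auto
    then have KB: "K * (B * e) ^ (p - 1) \<le> 1" using KBe by simp
    have pw0: "0 \<le> (B * e) ^ (p - 1)" using Be0 by simp
    have small1: "36 * pi * CE * (1 / (\<beta> - 1)) * (B * e) ^ (p - 1) \<le> 1"
      by (rule order_trans[OF mult_right_mono[OF _ pw0] KB]) (use K_parts K_def in linarith)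
    have small2: "3 * \<bar>C\<bar> * CN * CI * (B * e) ^ (p - 1) \<le> 1"
      by (rule order_trans[OF mult_right_mono[OF _ pw0] KB]) (use K_parts K_def in linarith)
    have "AEL x. cplx (u 0) x = cplx u0 x" using sol unfolding is_solution_def by (auto elim: eventually_mono)
    then have fe: "fourier (cplx (u 0)) = fourier (cplx u0)" by (rule fourier_cong_AE)
    have X0: "X 0 \<le> e" using u0(3) by (simp add: Xn_def fe)
    have i0: "Lp rc (mult_op (ann 0 g k) (cplx (u 0)))"
      and i0': "Lp_norm rc (mult_op (ann 0 g k) (cplx (u 0))) \<le> D0 * (2 ^ k) powr (- 3 / 2) * (2 * e)" for k
    proof -
      have m: "mult_op (ann 0 g k) (cplx (u 0)) = mult_op (ann 0 g k) (cplx u0)" unfolding mult_op_def fe ..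
      note D = D0[OF u0(1,2), of k]
      show "Lp rc (mult_op (ann 0 g k) (cplx (u 0)))" using D m by simp
      have "Lp_norm rc (mult_op (ann 0 g k) (cplx u0)) \<le> D0 * (2 ^ k) powr (- 3 / 2) * (Xn \<sigma> (cplx u0) + sobolev_norm (3 / 2 + \<gamma>) 1 (cplx u0))"
        using D by simp
      also have "... \<le> D0 * (2 ^ k) powr (- 3 / 2) * (2 * e)" using u0(3,4) D00 by (intro mult_left_mono) auto
      finally show "Lp_norm rc (mult_op (ann 0 g k) (cplx (u 0))) \<le> D0 * (2 ^ k) powr (- 3 / 2) * (2 * e)" unfolding m .
    qed
    \<comment> \<open>Both quantities divided by their bootstrap bounds, so that a single scalar
      function is kept below 1.\<close>
    define \<phi> where "\<phi> s = max (X s / (3 * e)) (Nn (cplx (u s)) * (1 + s) powr d / (B * e))" for s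
    have Ncont: "continuous_on {0..T} (\<lambda>s. Nn (cplx (u s)))"
      unfolding continuous_on_def
    proof
      fix t assume t: "t \<in> {0..T}"
      have l: "((\<lambda>s. C2 * Xn \<sigma> (\<lambda>x. cplx (u s) x - cplx (u t) x)) \<longlongrightarrow> 0) (at t within {0..T})"
        using tendsto_mult[OF tendsto_const X_diff[OF t], of C2] by simp
      show "((\<lambda>s. Nn (cplx (u s))) \<longlongrightarrow> Nn (cplx (u t))) (at t within {0..T})"
      proof (rule LIM_zero_cancel, rule Lim_null_comparison[OF _ l])
        show "\<forall>\<^sub>F s in at t within {0..T}. norm (Nn (cplx (u s)) - Nn (cplx (u t))) \<le> C2 * Xn \<sigma> (\<lambda>x. cplx (u s) x - cplx (u t) x)"
          unfolding eventually_at_filter using C2[OF hs hs[OF t]] by (intro always_eventually) auto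
      qed
    qed
    have cont: "continuous_on {0..T} \<phi>"
      unfolding \<phi>_def using e Be0
      by (intro continuous_on_max continuous_on_divide continuous_on_mult X_cont Ncont continuous_intros) auto
    have good: "X s \<le> 3 * e" "Nb (B * e * (1 + s) powr (- d)) (cplx (u s))" if "\<phi> s \<le> 1" "s \<in> {0..T}" for s
    proof -
      show "X s \<le> 3 * e" using that(1) e by (simp add: \<phi>_def)
      have "Nn (cplx (u s)) * (1 + s) powr d \<le> B * e" using that(1) Be0 by (simp add: \<phi>_def)
      then have "Nn (cplx (u s)) \<le> B * e * (1 + s) powr (- d)"
        using that(2) by (simp add: powr_minus field_simps)
      then show "Nb (B * e * (1 + s) powr (- d)) (cplx (u s))" by (rule Nb_Nn(1)[OF hs[OF that(2)]])
    qed
    have powb: "(B * e * (1 + s) powr (- d)) ^ (p - 1) = (B * e) ^ (p - 1) * (1 + s) powr (- \<beta>)" if "s \<ge> 0" for s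
      using that p3 unfolding power_mult_distrib \<beta>_def by (simp add: powr_power mult.commute)
    have crit: "\<phi> s < 1" if "X s \<le> 2 * e" "Nb (B / 2 * e * (1 + s) powr (- d)) (cplx (u s))" "s \<in> {0..T}" for s
    proof -
      have "Nn (cplx (u s)) \<le> B / 2 * e * (1 + s) powr (- d)"
        by (rule Nn_le[OF that(2)]) (use B4 e in simp)
      then have "Nn (cplx (u s)) * (1 + s) powr d \<le> B / 2 * e"
        using that(3) by (simp add: powr_minus field_simps)
      then have "Nn (cplx (u s)) * (1 + s) powr d < B * e" using Be0 by linarith
      then show ?thesis using that(1) e Be0 by (simp add: \<phi>_def)
    qed
    \<comment> \<open>Near t = 0 the factor t^(-d) of the linear estimate is singular; the Sobolev
      bound takes its place.\<close>
    have early: "Nb (B / 2 * e * (1 + s) powr (- d)) (cplx (u s))" if "s \<in> {0..T}" "s \<le> 1" "X s \<le> 2 * e" for s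
    proof (rule Nb_mono[OF C1[OF hs[OF that(1)]]])
      have "1 / 2 \<le> (1 + s) powr (- d)"
      proof -
        have "1 / 2 = (2::real) powr (- 1)" by (simp add: powr_minus)
        also have "... \<le> 2 powr (- d)" using d01 by (intro powr_mono) auto
        also have "... \<le> (1 + s) powr (- d)" using that d01 by (intro powr_mono2') auto
        finally show ?thesis .
      qed
      have "C1 * X s \<le> C1 * (2 * e)" using that(3) C10 by (rule mult_left_mono)
      also have "... \<le> B / 2 * e * (1 / 2)"
        using D00 C10 e mult_nonneg_nonneg[of "\<bar>C\<bar> * D0" e] by (simp add: B_def algebra_simps)
      also have "... \<le> B / 2 * e * (1 + s) powr (- d)"
        using \<open>1 / 2 \<le> (1 + s) powr (- d)\<close> B4 e by (intro mult_left_mono) auto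
      finally show "C1 * X s \<le> B / 2 * e * (1 + s) powr (- d)" .
    qed
    have improve: "X t \<le> 2 * e \<and> Nb (B / 2 * e * (1 + t) powr (- d)) (cplx (u t))"
      if t: "t \<in> {0..T}" and all: "\<And>s. s \<in> {0..t} \<Longrightarrow> \<phi> s \<le> 1" for t
    proof -
      have t0: "t \<ge> 0" using t by simp
      have sub: "s \<in> {0..T}" if "s \<in> {0..t}" for s using that t by auto
      \<comment> \<open>36 = 4 times 9: the 4 pi of the energy inequality and X^2 \<le>
        (3e)^2.\<close>
      define a where "a s = 36 * pi * CE * (B * e) ^ (p - 1) * e\<^sup>2 * (1 + s) powr (- \<beta>)" for s
      have ai: "a integrable_on {0..t}" unfolding a_def
        by (rule integrable_on_mult_right[OF powr_decay_integral(1)[OF \<beta>1 t0]])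
      have en: "(X t)\<^sup>2 \<le> (X 0)\<^sup>2 + integral {0..t} a"
      proof (rule energy_inequality[OF CE t ai])
        fix s assume s: "s \<in> {0..t}"
        note G = good[OF all[OF s] sub[OF s]]
        have s0': "0 \<le> s" using s by simp
        show "\<exists>A\<ge>0. Nb A (cplx (u s)) \<and> 4 * pi * CE * A ^ (p - 1) * (X s)\<^sup>2 \<le> a s"
        proof (intro exI[of _ "B * e * (1 + s) powr (- d)"] conjI G(2))
          show "0 \<le> B * e * (1 + s) powr (- d)" using Be0 by simp
          have "4 * pi * CE * ((B * e) ^ (p - 1) * (1 + s) powr (- \<beta>)) * (X s)\<^sup>2 \<le> 4 * pi * CE * ((B * e) ^ (p - 1) * (1 + s) powr (- \<beta>)) * (3 * e)\<^sup>2"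
            using CE0 pw0 G(1) by (intro mult_left_mono power_mono) auto
          then show "4 * pi * CE * (B * e * (1 + s) powr (- d)) ^ (p - 1) * (X s)\<^sup>2 \<le> a s"
            unfolding powb[OF s0'] by (simp add: a_def power_mult_distrib mult_ac)
        qed
      qed
      have "integral {0..t} a = 36 * pi * CE * (B * e) ^ (p - 1) * e\<^sup>2 * integral {0..t} (\<lambda>s. (1 + s) powr (- \<beta>))"
        unfolding a_def by (rule integral_mult_right)
      also have "... \<le> 36 * pi * CE * (B * e) ^ (p - 1) * e\<^sup>2 * (1 / (\<beta> - 1))"
        using CE0 pw0 by (intro mult_left_mono powr_decay_integral(2)[OF \<beta>1 t0]) simp
      also have "... = 36 * pi * CE * (1 / (\<beta> - 1)) * (B * e) ^ (p - 1) * e\<^sup>2" by (simp only: mult_ac)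
      also have "... \<le> 1 * e\<^sup>2" by (rule mult_right_mono[OF small1]) simp
      finally have "(X t)\<^sup>2 \<le> e\<^sup>2 + e\<^sup>2" using en power_mono[OF X0, of 2] by simp
      also have "... \<le> (2 * e)\<^sup>2" by (simp add: power2_eq_square)
      finally have Xt: "X t \<le> 2 * e" by (rule power2_le_imp_le) (use e in simp)
      moreover have "Nb (B / 2 * e * (1 + t) powr (- d)) (cplx (u t))"
      proof (cases "t \<le> 1")
        case True
        then show ?thesis by (rule early[OF t _ Xt])
      next
        case False
        then have t1: "t \<ge> 1" "t > 0" by auto
        obtain w where w: "\<And>s. s \<in> {0..<t} \<Longrightarrow> (1 + s) powr (- \<beta>) \<le> w s" "(\<lambda>s. (t - s) powr (- d) * w s) integrable_on {0..t}"
          "integral {0..t} (\<lambda>s. (t - s) powr (- d) * w s) \<le> CI * (1 + t) powr (- d)"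
          using decay_convolution[OF \<beta>1 d01 t1(1)] unfolding CI_def by blast
        show ?thesis unfolding Nb_def
        proof (intro allI impI)
          fix k \<Gamma> assume \<Gamma>: "Lp 2 \<Gamma>" "Lp rc \<Gamma>"
          define \<kappa> where "\<kappa> = (2 ^ k :: real) powr (- 3 / 2)"
          have \<kappa>0: "\<kappa> \<ge> 0" by (simp add: \<kappa>_def)
          define b where "b s = CN * \<kappa> * (3 * e) * (B * e) ^ (p - 1) * w s" for s
          have nl: "Lp rc (mult_op (ann 1 g k) (up s)) \<and> Lp_norm rc (mult_op (ann 1 g k) (up s)) \<le> b s" if s: "s \<in> {0..<t}" for s
          proof -
            have s': "s \<in> {0..t}" and s0': "0 \<le> s" using s by auto
            note G = good[OF all[OF s'] sub[OF s']]
            have A0: "0 \<le> B * e * (1 + s) powr (- d)" using Be0 by simp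
            note N = CN[OF hs[OF sub[OF s']] A0 G(2), of k]
            have "Lp_norm rc (mult_op (ann 1 g k) (up s)) \<le> CN * (2 ^ k) powr (g + 1 - \<sigma>) * X s * ((B * e) ^ (p - 1) * (1 + s) powr (- \<beta>))"
              using N unfolding powb[OF s0'] by simp
            also have "... \<le> CN * \<kappa> * (3 * e) * ((B * e) ^ (p - 1) * w s)"
            proof (intro mult_mono mult_left_mono w(1)[OF s] G(1))
              \<comment> \<open>The balance of derivatives: one in the nonlinearity and g \<le>
                \<gamma> in the dispersive estimate leave \<sigma> - 1 - g \<ge> 3/2.\<close>
              show "(2 ^ k) powr (g + 1 - \<sigma>) \<le> \<kappa>" unfolding \<kappa>_def
                using g_facts sgam by (intro powr_mono) auto
              show "0 \<le> CN * \<kappa> * (3 * e)" using CN0 \<kappa>0 e by simp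
            qed (use CN0 \<kappa>0 e pw0 in auto)
            finally show ?thesis using N by (simp add: b_def mult_ac)
          qed
          have be: "(\<lambda>s. (t - s) powr (- d) * b s) = (\<lambda>s. CN * \<kappa> * (3 * e) * (B * e) ^ (p - 1) * ((t - s) powr (- d) * w s))"
            by (rule ext) (simp add: b_def mult_ac)
          have bi: "(\<lambda>s. (t - s) powr (- d) * b s) integrable_on {0..t}"
            unfolding be by (rule integrable_on_mult_right[OF w(2)])
          have I: "integral {0..t} (\<lambda>s. (t - s) powr (- d) * b s) \<le> CN * \<kappa> * (3 * e) * (B * e) ^ (p - 1) * (CI * (1 + t) powr (- d))"
            unfolding be integral_mult_right using CN0 \<kappa>0 e pw0 by (intro mult_left_mono w(3)) auto
          have tp: "t powr (- d) \<le> 2 * (1 + t) powr (- d)"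
          proof -
            have "t powr (- d) \<le> ((1 + t) / 2) powr (- d)" using t1 d01 by (intro powr_mono2') auto
            also have "... = 2 powr d * (1 + t) powr (- d)" using t1 by (simp add: powr_divide powr_minus field_simps)
            also have "... \<le> 2 * (1 + t) powr (- d)" using powr_mono[of d 1 2] d01 by (intro mult_right_mono) auto
            finally show ?thesis .
          qed
          have "cmod (LI x. P k (cplx (u t)) x * \<Gamma> x) \<le> \<bar>C\<bar> * (t powr (- d) * Lp_norm rc (mult_op (ann 0 g k) (cplx (u 0))) + integral {0..t} (\<lambda>s. (t - s) powr (- d) * b s)) * Lp_norm rc \<Gamma>"
            by (rule duhamel[OF t t1(2) \<Gamma> i0 nl bi])
          also have "... \<le> (B / 2 * e * (1 + t) powr (- d) * \<kappa>) * Lp_norm rc \<Gamma>"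
          proof (rule mult_right_mono)
            have "\<bar>C\<bar> * (t powr (- d) * Lp_norm rc (mult_op (ann 0 g k) (cplx (u 0))) + integral {0..t} (\<lambda>s. (t - s) powr (- d) * b s))
              \<le> \<bar>C\<bar> * ((2 * (1 + t) powr (- d)) * (D0 * \<kappa> * (2 * e)) + CN * \<kappa> * (3 * e) * (B * e) ^ (p - 1) * (CI * (1 + t) powr (- d)))"
              unfolding \<kappa>_def by (intro mult_left_mono add_mono mult_mono tp i0' I[unfolded \<kappa>_def]) auto
            also have "... = (4 * (\<bar>C\<bar> * D0) + 3 * \<bar>C\<bar> * CN * CI * (B * e) ^ (p - 1)) * (e * (1 + t) powr (- d) * \<kappa>)"
              by (simp add: algebra_simps)
            also have "... \<le> (B / 2) * (e * (1 + t) powr (- d) * \<kappa>)"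
              using small2 e \<kappa>0 C10 by (intro mult_right_mono) (auto simp: B_def)
            finally show "\<bar>C\<bar> * (t powr (- d) * Lp_norm rc (mult_op (ann 0 g k) (cplx (u 0))) + integral {0..t} (\<lambda>s. (t - s) powr (- d) * b s))
              \<le> B / 2 * e * (1 + t) powr (- d) * \<kappa>" by (simp only: mult.assoc)
          qed simp
          finally show "cmod (LI x. P k (cplx (u t)) x * \<Gamma> x) \<le> B / 2 * e * (1 + t) powr (- d) * (2 ^ k) powr (- 3 / 2) * Lp_norm rc \<Gamma>"
            by (simp only: \<kappa>_def)
        qed
      qed
      ultimately show ?thesis by blast
    qed
    have start: "\<phi> 0 < 1"
    proof -
      have z: "0 \<in> {0..T}" using T by simp
      have "X 0 \<le> 2 * e" using X0 e by simp
      from crit[OF this early[OF z _ this] z] show ?thesis by simp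
    qed
    have lt: "\<phi> s < 1" if "s \<in> {0..T}" for s
      by (rule continuity_argument[OF cont start _ that]) (use improve crit in blast)
    have "\<phi> s \<le> 1" if "s \<in> {0..t}" for s using lt[of s] that t by auto
    from improve[OF t this] show "X t \<le> 2 * e" by blast
  qed
qed

end

section \<open>Continuation of solutions\<close>

lemma sobolev_cong_AE:
  assumes f: "f \<in> lmeas" and e: "AEL x. f x = h x"
  shows "sobolev_norm s q f = sobolev_norm s q h" "sobolev s q f \<longleftrightarrow> sobolev s q h"
proof -
  have e': "AEL x. h x = f x" using e by eventually_elim simp
  have "is_fourier f k = is_fourier h k" for k
    using is_fourier_cong_AE[OF _ e', of k k] is_fourier_cong_AE[OF _ e, of k k] by auto
  then have "is_multiplier a f = is_multiplier a h" for a by (auto simp: is_multiplier_def fun_eq_iff)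
  then show "sobolev_norm s q f = sobolev_norm s q h" "sobolev s q f \<longleftrightarrow> sobolev s q h"
    by (simp_all add: sobolev_norm_def multiplier_def sobolev_def)
qed

text \<open>The two limits in \<open>is_solution\<close> concern quantities that depend on the curve
  only through its values at two times and on the time difference. Restriction, translation and
  gluing are therefore the same argument for both.\<close>

definition diff_norm :: "real \<Rightarrow> (real \<Rightarrow> real \<Rightarrow> real) \<Rightarrow> real \<Rightarrow> real \<Rightarrow> real" where
  "diff_norm s u t' t = H_norm s (\<lambda>x. u t' x - u t x)"

definition defect_norm :: "(real \<Rightarrow> real) \<Rightarrow> nat \<Rightarrow> (real \<Rightarrow> real \<Rightarrow> real) \<Rightarrow> real \<Rightarrow> real \<Rightarrow> real" where
  "defect_norm m p u t' t = N2 (\<lambda>xi. pde_defect m p u t' t xi / cr (1 + \<bar>xi\<bar> + \<bar>m xi\<bar>))"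

lemma is_solution_iff:
  "is_solution m p s u0 I u \<longleftrightarrow> (\<forall>t\<in>I. H_space s (u t)) \<and> (AEL x. u 0 x = u0 x) \<and>
     (\<forall>t\<in>I. ((\<lambda>t'. diff_norm s u t' t) \<longlongrightarrow> 0) (at t within I) \<and> ((\<lambda>t'. defect_norm m p u t' t) \<longlongrightarrow> 0) (at t within I))"
  unfolding is_solution_def diff_norm_def defect_norm_def by blast

lemma norms_cong:
  assumes "u a = v b" "u a' = v b'" "a' - a = b' - b"
  shows "diff_norm s u a' a = diff_norm s v b' b" "defect_norm m p u a' a = defect_norm m p v b' b"
  using assms by (simp_all add: diff_norm_def defect_norm_def pde_defect_def flip: of_real_diff)

lemma norms_cong_AE:
  assumes "Lp 2 (cplx (u a))" "Lp 2 (cplx (u a'))" and e: "AEL x. u a x = v b x" "AEL x. u a' x = v b' x" and d: "a' - a = b' - b"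
  shows "diff_norm s u a' a = diff_norm s v b' b" "defect_norm m p u a' a = defect_norm m p v b' b"
proof -
  show "diff_norm s u a' a = diff_norm s v b' b" unfolding diff_norm_def
  proof (rule sobolev_cong_AE(1))
    show "(\<lambda>x. cr (u a' x - u a x)) \<in> lmeas"
      using Lp_measurable[OF Lp_diff[OF assms(2,1)]] by simp
    show "AEL x. cr (u a' x - u a x) = cr (v b' x - v b x)"
      using e by eventually_elim simp
  qed
  have "fourier (cplx (u a)) = fourier (cplx (v b))" "fourier (cplx (u a')) = fourier (cplx (v b'))"
    "fourier (cplx (\<lambda>x. u a x ^ p)) = fourier (cplx (\<lambda>x. v b x ^ p))"
    by (rule fourier_cong_AE; use e in eventually_elim; simp)+
  then show "defect_norm m p u a' a = defect_norm m p v b' b"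
    by (simp add: defect_norm_def pde_defect_def d flip: of_real_diff)
qed

lemma is_solution_cong:
  assumes "is_solution m p s u0 I u" "\<And>t. t \<in> I \<Longrightarrow> v t = u t" "0 \<in> I"
  shows "is_solution m p s u0 I v"
  unfolding is_solution_iff
proof (intro conjI ballI)
  note S = assms(1)[unfolded is_solution_iff]
  show "AEL x. v 0 x = u0 x" using S assms(2)[OF assms(3)] by simp
  fix t assume t: "t \<in> I"
  show "H_space s (v t)" using S t assms(2)[OF t] by simp
  have ev: "\<forall>\<^sub>F t' in at t within I. diff_norm s u t' t = diff_norm s v t' t" "\<forall>\<^sub>F t' in at t within I. defect_norm m p u t' t = defect_norm m p v t' t"
    unfolding eventually_at_filter
    by (intro always_eventually allI impI norms_cong; use assms(2) t in simp)+
  show "((\<lambda>t'. diff_norm s v t' t) \<longlongrightarrow> 0) (at t within I)" "((\<lambda>t'. defect_norm m p v t' t) \<longlongrightarrow> 0) (at t within I)"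
    using S t Lim_transform_eventually[OF _ ev(1)] Lim_transform_eventually[OF _ ev(2)] by blast+
qed

lemma is_solution_subset:
  assumes "is_solution m p s u0 I u" "J \<subseteq> I"
  shows "is_solution m p s u0 J u"
  using assms tendsto_within_subset[OF _ assms(2)] unfolding is_solution_iff by (meson subsetD)

text \<open>On a single point every limit is trivial; this is where the continuation starts.\<close>

lemma is_solution_initial: "H_space s u0 \<Longrightarrow> is_solution m p s u0 {0..0} (\<lambda>_. u0)"
proof -
  have "at 0 within {0} = (bot :: real filter)" by (simp add: at_within_eq_bot_iff)
  then show "H_space s u0 \<Longrightarrow> is_solution m p s u0 {0..0} (\<lambda>_. u0)" by (simp add: is_solution_iff)
qed

text \<open>Limits are local: near t the half-line and [0, t + 1] have the same points.\<close>

lemma is_solution_global: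
  assumes "\<And>T. T \<ge> 0 \<Longrightarrow> is_solution m p s u0 {0..T} u"
  shows "is_solution m p s u0 {0..} u"
proof -
  have e: "at t within {0..} = at t within {0..t + 1}" for t :: real
    by (rule at_within_nhd[of _ "{..<t + 1}"]) auto
  show ?thesis unfolding is_solution_iff
  proof (intro conjI ballI)
    show "AEL x. u 0 x = u0 x" using assms[of 0] by (simp add: is_solution_iff)
    fix t :: real assume "t \<in> {0..}"
    then have t: "t \<in> {0..t + 1}" "0 \<le> t + 1" by auto
    note S = assms[OF t(2), unfolded is_solution_iff]
    show "H_space s (u t)" using S t(1) by blast
    show "((\<lambda>t'. diff_norm s u t' t) \<longlongrightarrow> 0) (at t within {0..})" "((\<lambda>t'. defect_norm m p u t' t) \<longlongrightarrow> 0) (at t within {0..})"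
      unfolding e using S t(1) by blast+
  qed
qed

text \<open>A limit within a union is a limit within both parts, and at a point outside a closed
  part the corresponding filter is trivial. So the seam and the points on either side of it are
  handled alike.\<close>

lemma glue_limit:
  fixes Qu Qv Qw :: "real \<Rightarrow> real \<Rightarrow> real"
  assumes T: "0 \<le> T" "0 \<le> \<tau>"
    and u: "\<And>t. t \<in> {0..T} \<Longrightarrow> ((\<lambda>t'. Qu t' t) \<longlongrightarrow> 0) (at t within {0..T})"
    and v: "\<And>t. t \<in> {0..\<tau>} \<Longrightarrow> ((\<lambda>t'. Qv t' t) \<longlongrightarrow> 0) (at t within {0..\<tau>})"
    and wu: "\<And>t t'. t \<in> {0..T} \<Longrightarrow> t' \<in> {0..T} \<Longrightarrow> Qu t' t = Qw t' t"
    and wv: "\<And>t t'. t \<in> {T..T + \<tau>} \<Longrightarrow> t' \<in> {T..T + \<tau>} \<Longrightarrow> Qv (t' - T) (t - T) = Qw t' t"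
    and t: "t \<in> {0..T + \<tau>}"
  shows "((\<lambda>t'. Qw t' t) \<longlongrightarrow> 0) (at t within {0..T + \<tau>})"
proof -
  have "((\<lambda>t'. Qw t' t) \<longlongrightarrow> 0) (at t within {0..T})"
  proof (cases "t \<le> T")
    case True
    then have tT: "t \<in> {0..T}" using t by simp
    show ?thesis
      by (rule Lim_transform_eventually[OF u[OF tT]]) (auto simp: eventually_at_filter wu[OF tT])
  next
    case False
    then have "at t within {0..T} = bot" by (simp add: at_within_eq_bot_iff closure_closed)
    then show ?thesis by simp
  qed
  moreover have "((\<lambda>t'. Qw t' t) \<longlongrightarrow> 0) (at t within {T..T + \<tau>})"
  proof (cases "t \<ge> T")
    case True
    then have tT: "t \<in> {T..T + \<tau>}" "t - T \<in> {0..\<tau>}" using t by auto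
    have "filterlim (\<lambda>t'. t' - T) (at (t - T) within {0..\<tau>}) (at t within {T..T + \<tau>})"
      unfolding filterlim_at
      by (auto simp: eventually_at_filter intro!: tendsto_intros)
    from filterlim_compose[OF v[OF tT(2)] this]
    show ?thesis by (rule Lim_transform_eventually) (auto simp: eventually_at_filter wv[OF tT(1)])
  next
    case False
    then have "at t within {T..T + \<tau>} = bot" by (simp add: at_within_eq_bot_iff closure_closed)
    then show ?thesis by simp
  qed
  moreover have "{0..T + \<tau>} = {0..T} \<union> {T..T + \<tau>}" using T by auto
  ultimately show ?thesis by (simp add: Lim_within_Un)
qed

text \<open>At the seam the second curve starts from \<open>u T\<close> only up to a null set, so
  there its norms and defects have to be compared with those of the glued curve almost
  everywhere.\<close>

lemma is_solution_glue:
  assumes T: "0 \<le> T" "0 \<le> \<tau>" and s: "s \<ge> 0" and u: "is_solution m p s u0 {0..T} u" and v: "is_solution m p s (u T) {0..\<tau>} v"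
  shows "is_solution m p s u0 {0..T + \<tau>} (\<lambda>t. if t \<le> T then u t else v (t - T))" (is "is_solution _ _ _ _ _ ?w")
proof -
  note U = u[unfolded is_solution_iff] and V = v[unfolded is_solution_iff]
  have wv: "AEL x. v (t - T) x = ?w t x" if "t \<in> {T..T + \<tau>}" for t
  proof (cases "t = T")
    case True
    then show ?thesis using V by simp
  qed (use that in simp)
  have v2: "Lp 2 (cplx (v (t - T)))" if "t \<in> {T..T + \<tau>}" for t
    using V that s by (intro sobolev2D(1)) auto
  show ?thesis unfolding is_solution_iff
  proof (intro conjI ballI)
    show "AEL x. ?w 0 x = u0 x" using U T by simp
    fix t assume t: "t \<in> {0..T + \<tau>}"
    show "H_space s (?w t)" using U V t by auto
    note L = glue_limit[OF T _ _ _ _ t]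
    show "((\<lambda>t'. diff_norm s ?w t' t) \<longlongrightarrow> 0) (at t within {0..T + \<tau>})"
    proof (rule L[where Qu = "diff_norm s u" and Qv = "diff_norm s v"])
      fix t t' assume t: "t \<in> {0..T}" "t' \<in> {0..T}"
      show "diff_norm s u t' t = diff_norm s ?w t' t" by (rule norms_cong) (use t in auto)
    next
      fix t t' assume t: "t \<in> {T..T + \<tau>}" "t' \<in> {T..T + \<tau>}"
      show "diff_norm s v (t' - T) (t - T) = diff_norm s ?w t' t"
        by (rule norms_cong_AE[where u = v and v = ?w and a = "t - T" and a' = "t' - T" and b = t and b' = t', OF v2[OF t(1)] v2[OF t(2)] wv[OF t(1)] wv[OF t(2)]]) simp
    qed (use U V in auto)
    show "((\<lambda>t'. defect_norm m p ?w t' t) \<longlongrightarrow> 0) (at t within {0..T + \<tau>})"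
    proof (rule L[where Qu = "defect_norm m p u" and Qv = "defect_norm m p v"])
      fix t t' assume t: "t \<in> {0..T}" "t' \<in> {0..T}"
      show "defect_norm m p u t' t = defect_norm m p ?w t' t" by (rule norms_cong) (use t in auto)
    next
      fix t t' assume t: "t \<in> {T..T + \<tau>}" "t' \<in> {T..T + \<tau>}"
      show "defect_norm m p v (t' - T) (t - T) = defect_norm m p ?w t' t"
        by (rule norms_cong_AE[where u = v and v = ?w and a = "t - T" and a' = "t' - T" and b = t and b' = t', OF v2[OF t(1)] v2[OF t(2)] wv[OF t(1)] wv[OF t(2)]]) simp
    qed (use U V in auto)
  qed
qed

text \<open>A step of fixed length \<tau> can be repeated for ever. The choices are made so that
  each solution coincides with its predecessor on the interval of the latter, and the curves then
  fit together to one.\<close>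

lemma global_continuation:
  assumes u0: "H_space s u0" and s: "s \<ge> 0" and \<tau>: "\<tau> > 0"
    and ext: "\<And>T u. T \<ge> 0 \<Longrightarrow> is_solution m p s u0 {0..T} u \<Longrightarrow> \<exists>v. is_solution m p s (u T) {0..\<tau>} v"
  shows "\<exists>u. is_solution m p s u0 {0..} u"
proof -
  let ?P = "\<lambda>k u. is_solution m p s u0 {0..real k * \<tau>} u"
  let ?Q = "\<lambda>k u v. \<forall>t\<le>real k * \<tau>. v t = u t"
  have "\<exists>U. \<forall>k. ?P k (U k) \<and> ?Q k (U k) (U (Suc k))"
  proof (rule dependent_nat_choice)
    show "\<exists>u. ?P 0 u" using is_solution_initial[OF u0] by auto
    fix u k assume u: "?P k u"
    have k: "0 \<le> real k * \<tau>" using \<tau> by simp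
    obtain v where v: "is_solution m p s (u (real k * \<tau>)) {0..\<tau>} v" using ext[OF k u] by blast
    show "\<exists>w. ?P (Suc k) w \<and> ?Q k u w"
    proof (intro exI conjI)
      show "?P (Suc k) (\<lambda>t. if t \<le> real k * \<tau> then u t else v (t - real k * \<tau>))"
        using is_solution_glue[OF k less_imp_le[OF \<tau>] s u v] by (simp add: distrib_right add.commute)
    qed simp
  qed
  then obtain U where U: "\<And>k. ?P k (U k)" and nxt: "\<And>k t. t \<le> real k * \<tau> \<Longrightarrow> U (Suc k) t = U k t" by blast
  have same: "U k t = U j t" if "j \<le> k" "t \<le> real j * \<tau>" for j k t
    using that(1)
  proof (induction k rule: dec_induct)
    case (step k)
    have "real j * \<tau> \<le> real k * \<tau>" using step(1) \<tau> by (intro mult_right_mono) auto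
    with that(2) have "t \<le> real k * \<tau>" by (rule order_trans)
    then show ?case using step(3) nxt[of t k] by simp
  qed simp
  have ex: "\<exists>k. t \<le> real k * \<tau>" for t
    using real_arch_simple[of "t / \<tau>"] \<tau> by (auto simp: pos_divide_le_eq)
  \<comment> \<open>Any index whose interval contains t would give the same value.\<close>
  define N where "N t = (LEAST k. t \<le> real k * \<tau>)" for t
  have N: "t \<le> real (N t) * \<tau>" for t unfolding N_def using ex by (rule LeastI_ex)
  have uU: "U (N t) t = U k t" if "t \<le> real k * \<tau>" for k t
    using same[of "N t" k t, OF _ N] Least_le[of "\<lambda>k. t \<le> real k * \<tau>" k, OF that] unfolding N_def[symmetric] by simp
  show ?thesis
  proof (intro exI is_solution_global)
    fix T :: real assume T: "T \<ge> 0"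
    have "is_solution m p s u0 {0..T} (U (N T))" by (rule is_solution_subset[OF U[of "N T"]]) (use N[of T] in auto)
    then show "is_solution m p s u0 {0..T} (\<lambda>t. U (N t) t)"
      by (rule is_solution_cong) (use uU N[of T] T in \<open>auto intro: order_trans\<close>)
  qed
qed

section \<open>Global existence for small data\<close>

lemma p_star_ge: "p_star n \<ge> int n + 2"
proof -
  have "real n \<le> sqrt ((real n)\<^sup>2 + 4 * real n)" by (rule real_le_rsqrt) simp
  then show ?thesis unfolding p_star_def le_floor_iff by simp
qed

lemma positive_liminf:
  fixes \<tau> :: "real \<Rightarrow> real"
  assumes "0 < Liminf (at_right 0) (\<lambda>r. ereal (\<tau> r))"
  shows "\<exists>c>0. \<exists>\<delta>>0. \<forall>r. 0 < r \<longrightarrow> r < \<delta> \<longrightarrow> c < \<tau> r"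
proof -
  obtain c where c: "0 < ereal c" "ereal c < Liminf (at_right 0) (\<lambda>r. ereal (\<tau> r))" using ereal_dense2[OF assms] by blast
  from less_LiminfD[OF c(2)] have "\<forall>\<^sub>F r in at_right 0. c < \<tau> r" by simp
  then show ?thesis using c(1) unfolding eventually_at_right_field by auto
qed

theorem theorem1p4:
  fixes m :: "real \<Rightarrow> real" and n p :: nat and \<gamma> C \<sigma> :: real and \<tau> :: "real \<Rightarrow> real"
  assumes "n \<ge> 1" and "\<gamma> > 0"
    and L2_conservation: "\<And>t u0. t > 0 \<Longrightarrow> Lp 2 (cplx u0) \<Longrightarrow>
          Lp 2 (propagator m t (cplx u0)) \<and>
          Lp_norm 2 (propagator m t (cplx u0)) = Lp_norm 2 (cplx u0)"
    and dispersive: "\<And>r t u0. r > 2 \<Longrightarrow> t > 0 \<Longrightarrow> Lp 2 (cplx u0) \<Longrightarrow>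
          sobolev (\<gamma> * (1 - 2 / r)) (r / (r - 1)) (cplx u0) \<Longrightarrow>
          Lp r (propagator m t (cplx u0)) \<and>
          Lp_norm r (propagator m t (cplx u0))
            \<le> C * t powr (- (1 / real n) * (1 - 2 / r))
                * sobolev_norm (\<gamma> * (1 - 2 / r)) (r / (r - 1)) (cplx u0)"
    and "\<sigma> = 5 / 2 + max (1 / 2) \<gamma>"
    and "int p \<ge> p_star n"
    and "locally_well_posed m p \<sigma> \<tau>"
    and "0 < Liminf (at_right 0) (\<lambda>r. ereal (\<tau> r))"
  shows "\<exists>\<epsilon>>0. \<forall>u0 :: real \<Rightarrow> real.
           H_space \<sigma> u0 \<longrightarrow> sobolev (3 / 2 + \<gamma>) 1 (cplx u0) \<longrightarrow>
           H_norm \<sigma> u0 + sobolev_norm (3 / 2 + \<gamma>) 1 (cplx u0) < \<epsilon> \<longrightarrow>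
           (\<exists>u. is_solution m p \<sigma> u0 {0..} u \<and> (\<forall>t>0. H_norm \<sigma> (u t) \<le> 4 * \<epsilon>))"
proof -
  have pn: "n + 2 \<le> p" using assms(6) p_star_ge[of n] by linarith
  interpret L: LPS p \<sigma> by unfold_locales (use pn assms(1,5) in auto)
  have r: "L.r = 2 * real p" by (rule L.r_def)
  define d where "d = (1 / real n) * (1 - 2 / L.r)"
  have n1: "real n \<ge> 1" and p3: "real p \<ge> 3" and pn': "real n \<le> real p - 2" using assms(1) pn by auto
  \<comment> \<open>With r = 2p one has 1 - 2 / r = (p - 1) / p.\<close>
  have de: "d = (real p - 1) / (real n * real p)" unfolding d_def r using n1 p3 by (simp add: field_simps)
  interpret DP p \<sigma> m \<gamma> C d
  proof unfold_locales
    show "m \<in> lmeas" using L2_conservation by (rule m_measurable)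
    show "\<gamma> > 0" "\<sigma> \<ge> 5 / 2 + \<gamma>" using assms(2,5) by auto
    show "0 < d" unfolding de using n1 p3 by simp
    have "1 * real p \<le> real n * real p" using n1 by (intro mult_right_mono) auto
    then have "real p - 1 < real n * real p" by simp
    then show "d < 1" unfolding de using n1 p3 by (simp add: divide_less_eq)
    \<comment> \<open>The condition d(p - 1) > 1 reads n p < (p - 1)^2, and (p - 1)^2 = p(p - 2) + 1
      with n \<le> p - 2.\<close>
    have "real n * real p \<le> (real p - 2) * real p" using pn' by (intro mult_right_mono) auto
    also have "... < (real p - 1) * (real p - 1)" by (simp add: algebra_simps)
    finally show "d * real (p - 1) > 1" unfolding de using n1 p3 pn by (simp add: less_divide_eq of_nat_diff)
    fix t :: real and u0 :: "real \<Rightarrow> real"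
    assume t: "t > 0" "Lp 2 (cplx u0)" "sobolev (\<gamma> * (1 - 2 / L.r)) L.rc (cplx u0)"
    then show "Lp L.r (propagator m t (cplx u0)) \<and>
          Lp_norm L.r (propagator m t (cplx u0)) \<le> C * t powr (- d) * sobolev_norm (\<gamma> * (1 - 2 / L.r)) L.rc (cplx u0)"
      using dispersive[OF L.r_facts(2) t(1,2)] unfolding L.rc_def d_def by simp
  qed
  obtain e0 where e0: "e0 > 0" and bnd: "\<And>e T u0 u t. 0 < e \<Longrightarrow> e \<le> e0 \<Longrightarrow> 0 \<le> T \<Longrightarrow> is_solution m p \<sigma> u0 {0..T} u \<Longrightarrow> sobolev \<sigma> 2 (cplx u0) \<Longrightarrow>
     sobolev (3 / 2 + \<gamma>) 1 (cplx u0) \<Longrightarrow> Xn \<sigma> (cplx u0) \<le> e \<Longrightarrow> sobolev_norm (3 / 2 + \<gamma>) 1 (cplx u0) \<le> e \<Longrightarrow>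
     t \<in> {0..T} \<Longrightarrow> Xn \<sigma> (cplx (u t)) \<le> 2 * e"
    using small_data_bound by blast
  obtain c \<delta> where c: "c > 0" "\<delta> > 0" and lim: "\<And>r. 0 < r \<Longrightarrow> r < \<delta> \<Longrightarrow> c < \<tau> r" using positive_liminf[OF assms(8)] by blast
  \<comment> \<open>The ratio of \<open>Xn\<close> to \<open>H_norm\<close>.\<close>
  define q where "q = sqrt (2 * pi)"
  have q1: "q > 1" using pi_gt3 by (simp add: q_def)
  have \<sigma>0: "\<sigma> \<ge> 0" using L.sg3 by simp
  \<comment> \<open>The first bound admits the a priori estimate; with the second, norms up to 2
    \<epsilon> stay in the range of the uniform existence time.\<close>
  define \<epsilon> where "\<epsilon> = min (e0 / q) (\<delta> / 3)"
  have \<epsilon>0: "\<epsilon> > 0" using e0 c q1 by (simp add: \<epsilon>_def)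
  have q\<epsilon>: "0 < q * \<epsilon>" "q * \<epsilon> \<le> e0" "\<epsilon> \<le> q * \<epsilon>" "2 * \<epsilon> < \<delta>"
  proof -
    have "\<epsilon> \<le> e0 / q" "\<epsilon> \<le> \<delta> / 3" unfolding \<epsilon>_def by (rule min.cobounded1, rule min.cobounded2)
    then show "q * \<epsilon> \<le> e0" "2 * \<epsilon> < \<delta>" using q1 c \<epsilon>0 by (auto simp: field_simps)
    show "0 < q * \<epsilon>" "\<epsilon> \<le> q * \<epsilon>" using \<epsilon>0 q1 by auto
  qed
  \<comment> \<open>The limit inferior concerns positive norms only; data of norm 0 have the
    existence time \<open>\<tau> 0\<close>.\<close>
  define \<tau>1 where "\<tau>1 = min c (\<tau> 0)"
  have lwp: "\<And>r. r \<ge> 0 \<Longrightarrow> 0 < \<tau> r" "\<And>u0. H_space \<sigma> u0 \<Longrightarrow> \<exists>u. is_solution m p \<sigma> u0 {0..\<tau> (H_norm \<sigma> u0)} u"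
    using assms(7) unfolding locally_well_posed_def by blast+
  have \<tau>1: "\<tau>1 > 0" using c lwp(1)[of 0] by (simp add: \<tau>1_def)
  have \<tau>_ge: "\<tau>1 \<le> \<tau> r" if "0 \<le> r" "r \<le> 2 * \<epsilon>" for r
    using lim[of r] that q\<epsilon>(4) by (cases "r = 0") (auto simp: \<tau>1_def)
  show ?thesis
  proof (intro exI[of _ \<epsilon>] conjI \<epsilon>0 allI impI)
    fix u0 :: "real \<Rightarrow> real"
    assume u0: "H_space \<sigma> u0" "sobolev (3 / 2 + \<gamma>) 1 (cplx u0)" "H_norm \<sigma> u0 + sobolev_norm (3 / 2 + \<gamma>) 1 (cplx u0) < \<epsilon>"
    have Hn: "H_norm \<sigma> w = Xn \<sigma> (cplx w) / q" if "H_space \<sigma> w" for w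
      unfolding q_def by (rule sobolev2D(3)[OF that \<sigma>0])
    have nn: "0 \<le> H_norm \<sigma> w" "0 \<le> sobolev_norm (3 / 2 + \<gamma>) 1 (cplx w)" for w by (simp_all add: sobolev_norm_def)
    have "Xn \<sigma> (cplx u0) = q * H_norm \<sigma> u0" unfolding Hn[OF u0(1)] using q1 by simp
    also have "... \<le> q * \<epsilon>" using u0(3) nn[of u0] q1 by (intro mult_left_mono) auto
    finally have X0: "Xn \<sigma> (cplx u0) \<le> q * \<epsilon>" .
    have S0: "sobolev_norm (3 / 2 + \<gamma>) 1 (cplx u0) \<le> q * \<epsilon>" using u0(3) nn[of u0] q\<epsilon>(3) by linarith
    have small: "H_norm \<sigma> (u T) \<le> 2 * \<epsilon>" if T: "T \<ge> 0" and u: "is_solution m p \<sigma> u0 {0..T} u" for u T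
    proof -
      have "H_space \<sigma> (u T)" using u T by (simp add: is_solution_def)
      moreover have "Xn \<sigma> (cplx (u T)) \<le> 2 * (q * \<epsilon>)"
        by (rule bnd[OF q\<epsilon>(1,2) T u u0(1,2) X0 S0]) (use T in simp)
      ultimately show ?thesis using q1 by (simp add: Hn pos_divide_le_eq mult_ac)
    qed
    have "\<exists>u. is_solution m p \<sigma> u0 {0..} u"
    proof (rule global_continuation[OF u0(1) \<sigma>0 \<tau>1])
      fix T u assume T: "0 \<le> T" and u: "is_solution m p \<sigma> u0 {0..T} u"
      have "H_space \<sigma> (u T)" using u T by (simp add: is_solution_def)
      then obtain v where v: "is_solution m p \<sigma> (u T) {0..\<tau> (H_norm \<sigma> (u T))} v" using lwp(2) by blast
      have "\<tau>1 \<le> \<tau> (H_norm \<sigma> (u T))" using \<tau>_ge small[OF T u] nn(1) by blast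
      then show "\<exists>v. is_solution m p \<sigma> (u T) {0..\<tau>1} v" using is_solution_subset[OF v, of "{0..\<tau>1}"] by auto
    qed
    then obtain u where u: "is_solution m p \<sigma> u0 {0..} u" by blast
    have "H_norm \<sigma> (u t) \<le> 4 * \<epsilon>" if "t > 0" for t
      using small[of t u] is_solution_subset[OF u, of "{0..t}"] that \<epsilon>0 by fastforce
    then show "\<exists>u. is_solution m p \<sigma> u0 {0..} u \<and> (\<forall>t>0. H_norm \<sigma> (u t) \<le> 4 * \<epsilon>)" using u by blast
  qed
qed

end
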